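(* Let $X^\theta$ be the Gaussian Ornstein-Uhlenbeck process with drift parameter $\theta>0$ driven by $G$, with associated continuous centered stationary Gaussian process $Z^\theta$, function $g_{Z^\theta}$ and estimator $\widehat\theta_T$, as defined in the context. Let $\rho(t)=\rho(-t):=\mathbb{E}[Z_0^\theta Z_t^\theta]$, $t\ge 0$. Assume that $\int_{\mathbb{R}}\rho^2(r)\,dr<\infty$ and that $g_{Z^\theta}$ is a diffeomorphism and is twice continuously differentiable. Let $\mathcal{N}\sim\mathcal{N}(0,1)$. Then for every $\gamma>1$ and $p\ge1$, for $T>0$, $$d_W\left(\frac{\widehat\theta_T-\theta-\mathbb{E}[\widehat\theta_T-\theta]}{g_{Z^\theta}'(f_{X^\theta})\sqrt{\mathrm{Var}(\widehat f_T(X^\theta)-f_{X^\theta})}},\mathcal{N}\right)\le C\,\frac{\left(\mathbb{E}|g_{Z^\theta}''(\zeta_T)|^p\right)^{1/p}}{\sqrt T}+\varphi_T(Z^\theta)+CT^{-1/2},$$ for some absolute constant $C>0$, where $\zeta_T$ is a random variable with values in the closed interval with endpoints $\widehat f_T(X^\theta)$ and $f_{X^\theta}$, and $$\varphi_T(Z^\theta)=C\max\left\{\frac{8}{\sqrt T}\left(\int_{-T}^T|\rho(t)|^{3/2}dt\right)^2,\ \frac{48}{T}\left(\int_{-T}^T|\rho(t)|^{4/3}dt\right)^3\right\}.$$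
   Context: $G$ is a mean-zero Gaussian process such that $Z_t^\theta:=\int_{-\infty}^te^{-\theta(t-s)}dG_s$, $t\ge0$, is a (continuous, centered) stationary Gaussian process with $\mathbb{E}[(Z_0^\theta)^2]>0$. The process $X^\theta$ solves $dX_t^\theta=-\theta X_t^\theta dt+dG_t$, $X_0^\theta=0$, i.e. $X_t^\theta=e^{-\theta t}\int_0^te^{\theta s}dG_s$ (Wiener integral), so $X_t^\theta=Z_t^\theta-e^{-\theta t}Z_0^\theta$. The function $g_{Z^\theta}:(0,\infty)\to(0,\infty)$ is invertible with $g_{Z^\theta}^{-1}(\theta)=\mathbb{E}[(Z_0^\theta)^2]$, i.e. $\theta=g_{Z^\theta}(\mathbb{E}[(Z_0^\theta)^2])$. Further, $f_{X^\theta}:=\lim_{T\to\infty}\mathbb{E}[(X_T^\theta)^2]=\mathbb{E}[(Z_0^\theta)^2]$, $\widehat f_T(X^\theta):=\frac1T\int_0^T(X_t^\theta)^2dt$, and $\widehat\theta_T:=g_{Z^\theta}(\widehat f_T(X^\theta))$. The Wasserstein distance is $d_W(U,V)=\sup_f|\mathbb{E}[f(U)]-\mathbb{E}[f(V)]|$, supremum over functions $f:\mathbb{R}\to\mathbb{R}$ with Lipschitz constant at most $1$.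
   Formalization: The constant C does not depend on T, p or γ but may depend on G, θ and g; no absolute constant serves all processes (Brownian OU, θ=1/L, stationary variance L^(-0.6), T=L→∞). The random variable ζ_T is asserted to exist and is not tied to a Taylor expansion. *)

theory Defs
  imports "HOL-Probability.Probability"
begin

text \<open>A centered Gaussian law on the real line may be degenerate (variance zero).\<close>

definition centered_gaussian_rv :: "'a measure \<Rightarrow> ('a \<Rightarrow> real) \<Rightarrow> bool" where
  "centered_gaussian_rv M Y \<longleftrightarrow>
     Y \<in> borel_measurable M \<and>
     (\<exists>\<sigma>\<ge>0. distr M borel Y =
        (if \<sigma> = 0 then return borel 0 else density lborel (\<lambda>x. ennreal (normal_density 0 \<sigma> x))))"

definition centered_gaussian_process ::
  "'a measure \<Rightarrow> real set \<Rightarrow> (real \<Rightarrow> 'a \<Rightarrow> real) \<Rightarrow> bool" where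
  "centered_gaussian_process M I Y \<longleftrightarrow>
     (\<forall>J a. finite J \<and> J \<subseteq> I \<longrightarrow> centered_gaussian_rv M (\<lambda>\<omega>. \<Sum>t\<in>J. a t * Y t \<omega>))"

text \<open>Strict stationarity: all finite-dimensional laws are invariant under time shifts.\<close>

definition stationary_process :: "'a measure \<Rightarrow> (real \<Rightarrow> 'a \<Rightarrow> real) \<Rightarrow> bool" where
  "stationary_process M Y \<longleftrightarrow>
     (\<forall>J h. finite J \<and> J \<subseteq> {0..} \<and> 0 \<le> h \<longrightarrow>
        distr M (Pi\<^sub>M J (\<lambda>_. borel)) (\<lambda>\<omega>. \<lambda>t\<in>J. Y (t + h) \<omega>) =
        distr M (Pi\<^sub>M J (\<lambda>_. borel)) (\<lambda>\<omega>. \<lambda>t\<in>J. Y t \<omega>))"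

text \<open>
  Wiener integral of a continuous deterministic function \<open>f\<close> over the interval from \<open>a\<close> to \<open>b\<close>
  with respect to the process \<open>G\<close>: the limit in \<open>L\<^sup>2\<close> of the Riemann-Stieltjes sums as the mesh
  tends to zero.  It is determined up to null sets only, hence a predicate on \<open>Y\<close>.
  The \<open>L\<^sup>2\<close> distances are \<open>nn_integral\<close>s, so that they are infinite, and not \<open>0\<close>, when the
  difference is not square integrable.
\<close>

definition has_wiener_integral ::
  "'a measure \<Rightarrow> (real \<Rightarrow> 'a \<Rightarrow> real) \<Rightarrow> (real \<Rightarrow> real) \<Rightarrow> real \<Rightarrow> real \<Rightarrow> ('a \<Rightarrow> real) \<Rightarrow> bool" where
  "has_wiener_integral M G f a b Y \<longleftrightarrow>
     Y \<in> borel_measurable M \<and>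
     (\<forall>e>0. \<exists>d>0. \<forall>D. D tagged_division_of {a..b} \<and> (\<lambda>x. ball x d) fine D \<longrightarrow>
        (\<integral>\<^sup>+\<omega>. ennreal ((Y \<omega> - (\<Sum>(x, K)\<in>D. f x * (G (Sup K) \<omega> - G (Inf K) \<omega>)))\<^sup>2) \<partial>M) < ennreal e)"

text \<open>The same over the half-line from minus infinity to \<open>b\<close>, as an improper integral in \<open>L\<^sup>2\<close>.\<close>

definition has_wiener_integral_at_bot ::
  "'a measure \<Rightarrow> (real \<Rightarrow> 'a \<Rightarrow> real) \<Rightarrow> (real \<Rightarrow> real) \<Rightarrow> real \<Rightarrow> ('a \<Rightarrow> real) \<Rightarrow> bool" where
  "has_wiener_integral_at_bot M G f b Y \<longleftrightarrow>
     Y \<in> borel_measurable M \<and>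
     (\<exists>I. (\<forall>a\<le>b. has_wiener_integral M G f a b (I a)) \<and>
          ((\<lambda>a. \<integral>\<^sup>+\<omega>. ennreal ((Y \<omega> - I a \<omega>)\<^sup>2) \<partial>M) \<longlongrightarrow> 0) at_bot)"

text \<open>
  \<open>Z\<close> is the continuous centered stationary Gaussian process
  \<open>Z t = \<integral>\<^bsub>-\<infinity>..t\<^esub> exp (- \<theta> (t - s)) dG s\<close>, \<open>t \<ge> 0\<close>.
\<close>

definition stationary_gaussian_OU ::
  "'a measure \<Rightarrow> (real \<Rightarrow> 'a \<Rightarrow> real) \<Rightarrow> real \<Rightarrow> (real \<Rightarrow> 'a \<Rightarrow> real) \<Rightarrow> bool" where
  "stationary_gaussian_OU M G \<theta> Z \<longleftrightarrow>
     (\<forall>t\<ge>0. has_wiener_integral_at_bot M G (\<lambda>s. exp (- \<theta> * (t - s))) t (Z t)) \<and>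
     centered_gaussian_process M {0..} Z \<and>
     stationary_process M Z \<and>
     (\<forall>\<omega>\<in>space M. continuous_on {0..} (\<lambda>t. Z t \<omega>)) \<and>
     prob_space.expectation M (\<lambda>\<omega>. (Z 0 \<omega>)\<^sup>2) > 0"

text \<open>
  \<open>X\<close> is the solution of \<open>dX t = - \<theta> X t dt + dG t\<close>, \<open>X 0 = 0\<close>, that is
  \<open>X t = exp (- \<theta> t) \<integral>\<^bsub>0..t\<^esub> exp (\<theta> s) dG s\<close>.  The Wiener integrals fix each \<open>X t\<close> only up to a null
  set; path continuity selects the version whose paths are integrated in the estimator.
\<close>

definition gaussian_OU ::
  "'a measure \<Rightarrow> (real \<Rightarrow> 'a \<Rightarrow> real) \<Rightarrow> real \<Rightarrow> (real \<Rightarrow> 'a \<Rightarrow> real) \<Rightarrow> bool" where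
  "gaussian_OU M G \<theta> X \<longleftrightarrow>
     (\<forall>t\<ge>0. \<exists>I. has_wiener_integral M G (\<lambda>s. exp (\<theta> * s)) 0 t I \<and>
                (\<forall>\<omega>\<in>space M. X t \<omega> = exp (- \<theta> * t) * I \<omega>)) \<and>
     (\<forall>\<omega>\<in>space M. continuous_on {0..} (\<lambda>t. X t \<omega>))"

definition autocov :: "'a measure \<Rightarrow> (real \<Rightarrow> 'a \<Rightarrow> real) \<Rightarrow> real \<Rightarrow> real" where
  "autocov M Z t = prob_space.expectation M (\<lambda>\<omega>. Z 0 \<omega> * Z \<bar>t\<bar> \<omega>)"

definition f_lim :: "'a measure \<Rightarrow> (real \<Rightarrow> 'a \<Rightarrow> real) \<Rightarrow> real" where
  "f_lim M X = Lim at_top (\<lambda>T. prob_space.expectation M (\<lambda>\<omega>. (X T \<omega>)\<^sup>2))"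

definition f_hat :: "(real \<Rightarrow> 'a \<Rightarrow> real) \<Rightarrow> real \<Rightarrow> 'a \<Rightarrow> real" where
  "f_hat X T \<omega> = 1 / T * integral {0..T} (\<lambda>t. (X t \<omega>)\<^sup>2)"

definition theta_hat :: "(real \<Rightarrow> real) \<Rightarrow> (real \<Rightarrow> 'a \<Rightarrow> real) \<Rightarrow> real \<Rightarrow> 'a \<Rightarrow> real" where
  "theta_hat g X T \<omega> = g (f_hat X T \<omega>)"

definition C1_diffeomorphism :: "real set \<Rightarrow> real set \<Rightarrow> (real \<Rightarrow> real) \<Rightarrow> bool" where
  "C1_diffeomorphism S T g \<longleftrightarrow>
     bij_betw g S T \<and> g C1_differentiable_on S \<and> inv_into S g C1_differentiable_on T"

definition twice_continuously_differentiable_on :: "(real \<Rightarrow> real) \<Rightarrow> real set \<Rightarrow> bool" where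
  "twice_continuously_differentiable_on g S \<longleftrightarrow>
     g C1_differentiable_on S \<and> deriv g C1_differentiable_on S"

text \<open>
  If \<open>U\<close> is not integrable, bounded Lipschitz functions already force the supremum to be infinite
  (for integrable \<open>V\<close>), so the value \<open>0\<close> of a non-existing Bochner integral does no harm.
\<close>

definition wasserstein_dist ::
  "'a measure \<Rightarrow> ('a \<Rightarrow> real) \<Rightarrow> 'b measure \<Rightarrow> ('b \<Rightarrow> real) \<Rightarrow> ennreal" where
  "wasserstein_dist M U P V =
     (SUP f\<in>{f :: real \<Rightarrow> real. 1-lipschitz_on UNIV f}.
        ennreal \<bar>prob_space.expectation M (\<lambda>\<omega>. f (U \<omega>)) - prob_space.expectation P (\<lambda>\<omega>. f (V \<omega>))\<bar>)"

text \<open>\<open>(E |Y|\<^sup>p)\<^bsup>1/p\<^esup>\<close>, infinite when the moment is infinite.\<close>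

definition Lp_norm :: "'a measure \<Rightarrow> real \<Rightarrow> ('a \<Rightarrow> real) \<Rightarrow> ennreal" where
  "Lp_norm M p Y =
     (let I = (\<integral>\<^sup>+\<omega>. ennreal (\<bar>Y \<omega>\<bar> powr p) \<partial>M)
      in if I = \<infinity> then \<infinity> else ennreal (enn2real I powr (1 / p)))"

definition phi_bound :: "real \<Rightarrow> (real \<Rightarrow> real) \<Rightarrow> real \<Rightarrow> real" where
  "phi_bound C \<rho> T =
     C * max (8 / sqrt T * (integral {-T..T} (\<lambda>t. \<bar>\<rho> t\<bar> powr (3/2)))\<^sup>2)
             (48 / T * (integral {-T..T} (\<lambda>t. \<bar>\<rho> t\<bar> powr (4/3))) ^ 3)"

end

theory Submission
  imports Defs "HOL-Real_Asymp.Real_Asymp"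
begin

text \<open>
  Let \<open>V\<close> be the time average of \<open>X\<^sup>2\<close> up to time \<open>T\<close>, with mean \<open>e\<close> and standard deviation \<open>\<sigma>\<close>, and
  \<open>f\<close> its limit.  The estimator is \<open>g V\<close>, and the theorem is a quantitative delta method: writing
  \<open>g V = g f + g' f * (V - f) + R\<close>, the normalised estimator equals the normalised time average
  \<open>(V - e) / \<sigma>\<close> plus the centred remainder divided by \<open>g' f * \<sigma>\<close>.  As \<open>\<rho>\<close> is square integrable and
  continuous with positive value at 0, \<open>\<sigma>\<close> is of exact order \<open>1 / sqrt T\<close> (\<open>s2_upper\<close>, \<open>s2_lower\<close>).  It
  remains to prove a central limit theorem for \<open>V\<close> and to show that \<open>R\<close> has first absolute moment of
  order \<open>\<sigma>\<^sup>2\<close>.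

  Both follow from Gaussian integration by parts.  On a grid, \<open>V\<close> becomes a quadratic form \<open>F\<close> in a Gaussian
  vector, and for smooth \<open>\<psi>\<close> the mean of \<open>(F - mean) * \<psi> F\<close> is twice the mean of \<open>Q * \<psi>' F\<close> for another
  quadratic form \<open>Q\<close> (\<open>gaussian_ibp\<close>, \<open>centered_F_ibp\<close>).  Two consequences are drawn.

  First, inserting the solution of Stein's equation and integrating by parts a second time bounds the
  Wasserstein distance of the normalised form to the normal law by the trace of the cube of the
  covariance matrix over \<open>\<sigma>\<^sup>3\<close> (\<open>quadratic_form_clt\<close>).  By the inequality of arithmetic and geometric mean
  that trace is at most the square of a row sum of the entries to the power \<open>3/2\<close> (\<open>tn_le_row\<close>), and in the
  limit the first of the two terms of \<open>phi_bound\<close> appears; thus the maximum of both is a valid bound as well.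

  Secondly, \<open>\<bar>Q\<bar> \<le> \<sigma> * F\<close> up to a constant, so the mean of \<open>(V - e) * \<psi> V\<close> is at most
  \<open>2 * \<sigma>\<close> times the mean of \<open>V * \<bar>\<psi>' V\<bar>\<close> (\<open>V_poincare\<close>).  If \<open>H\<close> is supported away from \<open>e\<close>, this bounds the mean
  of \<open>H V\<close> by \<open>\<sigma>\<close> times that of \<open>\<bar>H' V\<bar>\<close>, and after two steps by \<open>\<sigma>\<^sup>2\<close> times that of \<open>\<bar>H'' V\<bar>\<close>.  With \<open>H\<close>
  the second antiderivative of \<open>\<bar>g''\<bar>\<close> outside a compact set, the remainder \<open>R\<close> costs no more than the first
  moment of \<open>\<bar>g'' V\<bar>\<close> (\<open>delta_remainder_bound\<close>), for which every exponent \<open>p \<ge> 1\<close> suffices.  Holder's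
  inequality, which would need higher moments of \<open>g''\<close>, is avoided.

  The random point \<open>\<zeta>\<close> may be chosen: it is a maximiser of \<open>\<bar>g''\<bar>\<close> on the segment between \<open>V\<close> and \<open>f\<close> if
  \<open>V\<close> is below \<open>f\<close>, and \<open>V\<close> itself otherwise (\<open>monotone_argmax_selection\<close>).  Then \<open>\<bar>g'' \<zeta>\<bar>\<close> dominates
  \<open>\<bar>g'' V\<bar>\<close>.  Maximality on the segment is used only for short times, when \<open>e\<close> may be far from \<open>f\<close>; there a cruder
  bound for \<open>g V\<close> minus a constant, of order \<open>\<sigma>\<close>, is enough (\<open>lipschitz_image_bound\<close>).
\<close>

section \<open>Stein's equation\<close>

abbreviation normal_mean :: "(real \<Rightarrow> real) \<Rightarrow> real" where
  "normal_mean h \<equiv> (\<integral>x. std_normal_density x * h x \<partial>lborel)"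

text \<open>
  An antiderivative of an integrable function has limits at both ends of the line, whatever its
  additive constant.  Stein's equation below is solved with such an antiderivative.
\<close>

lemma antiderivative_tendsto_at_top:
  fixes F f :: "real \<Rightarrow> real"
  assumes F: "\<And>x. (F has_real_derivative f x) (at x)"
    and cont: "continuous_on UNIV f" and int: "integrable lborel f"
  shows "\<exists>A. (F \<longlongrightarrow> A) at_top"
proof -
  define u where "u x = indicator {0..} x * f x" for x
  have u: "integrable lborel u"
    unfolding u_def using integrable_mult_indicator[OF _ int, of "{0..}"] by simp
  have "((\<lambda>y. \<integral>x. indicator {..y} x *\<^sub>R u x \<partial>lborel) \<longlongrightarrow> (\<integral>x. u x \<partial>lborel)) at_top"
    by (rule tendsto_integral_at_top[OF _ u]) auto
  then have "((\<lambda>y. F 0 + (\<integral>x. indicator {..y} x *\<^sub>R u x \<partial>lborel)) \<longlongrightarrow> F 0 + (\<integral>x. u x \<partial>lborel)) at_top"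
    by (intro tendsto_intros)
  moreover have "\<forall>\<^sub>F y in at_top. F 0 + (\<integral>x. indicator {..y} x *\<^sub>R u x \<partial>lborel) = F y"
    using eventually_ge_at_top[of 0]
  proof eventually_elim
    case (elim y)
    have "(\<integral>x. indicator {..y} x *\<^sub>R u x \<partial>lborel) = (\<integral>x. indicator {0..y} x *\<^sub>R f x \<partial>lborel)"
      by (rule Bochner_Integration.integral_cong) (auto simp: u_def indicator_def)
    also have "\<dots> = F y - F 0"
    proof (rule integral_FTC_atLeastAtMost[OF elim])
      show "(F has_vector_derivative f x) (at x within {0..y})" for x
        using F[of x] by (simp add: has_real_derivative_iff_has_vector_derivative has_vector_derivative_at_within)
      show "continuous_on {0..y} f"
        by (rule continuous_on_subset[OF cont]) simp
    qed
    finally show ?case by simp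
  qed
  ultimately show ?thesis
    using Lim_transform_eventually by blast
qed

lemma antiderivative_tendsto_at_bot:
  fixes F f :: "real \<Rightarrow> real"
  assumes F: "\<And>x. (F has_real_derivative f x) (at x)"
    and cont: "continuous_on UNIV f" and int: "integrable lborel f"
  shows "\<exists>A. (F \<longlongrightarrow> A) at_bot"
proof -
  have "\<exists>A. ((\<lambda>x. - F (- x)) \<longlongrightarrow> A) at_top"
  proof (rule antiderivative_tendsto_at_top[where f="\<lambda>x. f (- x)"])
    show "((\<lambda>x. - F (- x)) has_real_derivative f (- x)) (at x)" for x
      using F[of "- x"] by (auto intro!: derivative_eq_intros DERIV_chain2[where f=F])
    show "continuous_on UNIV (\<lambda>x. f (- x))"
      by (intro continuous_on_compose2[OF cont] continuous_intros) auto
    show "integrable lborel (\<lambda>x. f (- x))"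
      using lborel_integrable_real_affine[OF int, of "-1" 0] by simp
  qed
  then obtain A where "((\<lambda>x. - F (- x)) \<longlongrightarrow> A) at_top" by blast
  then have "((\<lambda>x. F (- x)) \<longlongrightarrow> - A) at_top"
    using tendsto_minus by fastforce
  then have "(F \<longlongrightarrow> - A) at_bot"
    by (simp add: filterlim_at_bot_mirror)
  then show ?thesis by blast
qed

lemma integral_derivative_real_line:
  fixes F f :: "real \<Rightarrow> real"
  assumes F: "\<And>x. (F has_real_derivative f x) (at x)"
    and cont: "continuous_on UNIV f" and int: "integrable lborel f"
    and A: "(F \<longlongrightarrow> A) at_top" and B: "(F \<longlongrightarrow> B) at_bot"
  shows "(\<integral>x. f x \<partial>lborel) = A - B"
proof -
  have "(LBINT x=-\<infinity>..\<infinity>. f x) = A - B"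
  proof (rule interval_integral_FTC_integrable)
    show "(F has_vector_derivative f x) (at x)" for x
      using F by (simp add: has_real_derivative_iff_has_vector_derivative)
    show "isCont f x" for x
      using cont by (simp add: continuous_on_eq_continuous_at)
    show "set_integrable lborel (einterval (-\<infinity>) \<infinity>) f"
      using int by (simp add: set_integrable_def)
    show "((F \<circ> real_of_ereal) \<longlongrightarrow> A) (at_left \<infinity>)"
      using A ereal_tendsto_simps1(3)[of F A] by blast
    show "((F \<circ> real_of_ereal) \<longlongrightarrow> B) (at_right (-\<infinity>))"
      using B ereal_tendsto_simps1(4)[of F B] by blast
  qed auto
  then show ?thesis
    by (simp add: interval_lebesgue_integral_def set_lebesgue_integral_def)
qed

text \<open>
  Multiplied by \<open>exp (- x\<^sup>2 / 2)\<close>, the function \<open>\<beta> + 2 * \<alpha> / (1 + x)\<close> decreases at least as fast as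
  the equally weighted \<open>u\<close> can change, and both vanish at infinity; hence it dominates \<open>u\<close> from infinity inwards.  The same
  barrier serves for a solution of Stein's equation, where \<open>\<kappa>\<close> grows linearly, and for its derivative,
  where \<open>\<kappa>\<close> is bounded and the decay in \<open>x\<close> is what controls the second derivative.
\<close>

lemma stein_barrier:
  fixes u \<kappa> :: "real \<Rightarrow> real"
  assumes der: "\<And>x. x \<ge> 0 \<Longrightarrow> (u has_real_derivative x * u x + \<kappa> x) (at x)"
    and bound: "\<And>x. x \<ge> 0 \<Longrightarrow> \<bar>\<kappa> x\<bar> \<le> \<alpha> + \<beta> * x" and ab: "\<alpha> \<ge> 0" "\<beta> \<ge> 0"
    and lim: "((\<lambda>x. exp (- x\<^sup>2 / 2) * u x) \<longlongrightarrow> 0) at_top"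
    and x: "x \<ge> 0"
  shows "\<bar>u x\<bar> \<le> \<beta> + 2 * \<alpha> / (1 + x)"
proof -
  have *: "s * u x \<le> \<beta> + 2 * \<alpha> / (1 + x)" if s: "s = 1 \<or> s = -1" for s :: real
  proof -
    \<comment> \<open>\<open>s\<close> selects the sign of \<open>u x\<close>; \<open>D\<close> is the weighted gap between the barrier \<open>r\<close> and \<open>s * u\<close>.\<close>
    define r where "r y = \<beta> + 2 * \<alpha> / (1 + y)" for y
    define D where "D y = exp (- y\<^sup>2 / 2) * r y - s * (exp (- y\<^sup>2 / 2) * u y)" for y
    have r': "(r has_real_derivative - (2 * \<alpha> / (1 + y)\<^sup>2)) (at y)" if "y \<ge> 0" for y
      unfolding r_def using that by (auto intro!: derivative_eq_intros simp: power2_eq_square)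
    have D': "(D has_real_derivative exp (- y\<^sup>2 / 2) * (- y * (\<beta> + 2 * \<alpha> / (1 + y)) - 2 * \<alpha> / (1 + y)\<^sup>2 - s * \<kappa> y)) (at y)"
      if "y \<ge> 0" for y
    proof -
      have "(D has_real_derivative exp (- y\<^sup>2 / 2) * (- y * r y - 2 * \<alpha> / (1 + y)\<^sup>2 - s * \<kappa> y)) (at y)"
        unfolding D_def using that
        by (auto intro!: derivative_eq_intros der r' simp: algebra_simps)
      then show ?thesis by (simp add: r_def)
    qed
    have neg: "- y * (\<beta> + 2 * \<alpha> / (1 + y)) - 2 * \<alpha> / (1 + y)\<^sup>2 - s * \<kappa> y \<le> 0" if y: "y \<ge> 0" for y
    proof -
      have "- s * \<kappa> y \<le> \<alpha> + \<beta> * y" using bound[OF y] s by auto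
      moreover have "\<alpha> \<le> 2 * \<alpha> * y / (1 + y) + 2 * \<alpha> / (1 + y)\<^sup>2"
      proof -
        have "1 \<le> 2 * y / (1 + y) + 2 / (1 + y)\<^sup>2"
          using y by (simp add: divide_simps) (simp add: algebra_simps power2_eq_square)
        then have "\<alpha> * 1 \<le> \<alpha> * (2 * y / (1 + y) + 2 / (1 + y)\<^sup>2)"
          using ab by (intro mult_left_mono)
        then show ?thesis by (simp add: algebra_simps)
      qed
      ultimately show ?thesis by (simp add: algebra_simps)
    qed
    have "D y \<le> D x" if "x \<le> y" for y
    proof (rule DERIV_nonpos_imp_nonincreasing[OF that])
      fix z assume "x \<le> z" "z \<le> y"
      then have "z \<ge> 0" using x by simp
      then show "\<exists>d. (D has_real_derivative d) (at z) \<and> d \<le> 0"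
        using D'[of z] neg[of z] by (meson exp_ge_zero mult_nonneg_nonpos)
    qed
    then have ev: "\<forall>\<^sub>F y in at_top. D y \<le> D x"
      by (rule eventually_mono[OF eventually_ge_at_top[of x]])
    have "(D \<longlongrightarrow> 0 * (\<beta> + 0) - s * 0) at_top"
      unfolding D_def r_def
    proof (intro tendsto_intros lim)
      show "((\<lambda>y::real. exp (- y\<^sup>2 / 2)) \<longlongrightarrow> 0) at_top" by real_asymp
      show "((\<lambda>y::real. 2 * \<alpha> / (1 + y)) \<longlongrightarrow> 0) at_top" by real_asymp
    qed
    then have "0 \<le> D x"
      using ev by (intro tendsto_upperbound[of D 0 at_top]) auto
    then have "0 \<le> exp (- x\<^sup>2 / 2) * (\<beta> + 2 * \<alpha> / (1 + x) - s * u x)"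
      by (simp add: D_def r_def algebra_simps)
    then show ?thesis by (simp add: zero_le_mult_iff)
  qed
  show ?thesis using *[of 1] *[of "-1"] by simp
qed

lemma stein_barrier_two_sided:
  fixes u \<kappa> :: "real \<Rightarrow> real"
  assumes der: "\<And>x. (u has_real_derivative x * u x + \<kappa> x) (at x)"
    and bound: "\<And>x. \<bar>\<kappa> x\<bar> \<le> \<alpha> + \<beta> * \<bar>x\<bar>" and ab: "\<alpha> \<ge> 0" "\<beta> \<ge> 0"
    and lim: "((\<lambda>x. exp (- x\<^sup>2 / 2) * u x) \<longlongrightarrow> 0) at_top" "((\<lambda>x. exp (- x\<^sup>2 / 2) * u x) \<longlongrightarrow> 0) at_bot"
  shows "\<bar>u x\<bar> \<le> \<beta> + 2 * \<alpha> / (1 + \<bar>x\<bar>)"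
proof (cases "x \<ge> 0")
  case True
  have "\<bar>\<kappa> y\<bar> \<le> \<alpha> + \<beta> * y" if "y \<ge> 0" for y using bound[of y] that by simp
  from stein_barrier[OF der this ab lim(1) True] True show ?thesis by simp
next
  case False
  have "\<bar>u (- (- x))\<bar> \<le> \<beta> + 2 * \<alpha> / (1 + (- x))"
  proof (rule stein_barrier[where u="\<lambda>y. u (- y)" and \<kappa>="\<lambda>y. - \<kappa> (- y)"])
    show "((\<lambda>y. u (- y)) has_real_derivative y * u (- y) + - \<kappa> (- y)) (at y)" for y
    proof -
      have "((\<lambda>y. u (- y)) has_real_derivative (- y * u (- y) + \<kappa> (- y)) * (- 1)) (at y)"
        by (rule DERIV_chain2[OF der]) (auto intro!: derivative_eq_intros)
      then show ?thesis by (simp add: algebra_simps)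
    qed
    show "\<bar>- \<kappa> (- y)\<bar> \<le> \<alpha> + \<beta> * y" if "y \<ge> 0" for y using bound[of "- y"] that by simp
    show "((\<lambda>x. exp (- x\<^sup>2 / 2) * u (- x)) \<longlongrightarrow> 0) at_top"
      using lim(2) by (simp add: filterlim_at_bot_mirror)
  qed (use False ab in auto)
  then show ?thesis using False by simp
qed

lemma tendsto_zero_by_linear_growth:
  fixes u :: "real \<Rightarrow> real"
  assumes "\<And>x. \<bar>u x\<bar> \<le> a + b * \<bar>x\<bar>"
  shows "((\<lambda>x. exp (- x\<^sup>2 / 2) * u x) \<longlongrightarrow> 0) at_top" "((\<lambda>x. exp (- x\<^sup>2 / 2) * u x) \<longlongrightarrow> 0) at_bot"
proof -
  have b: "norm (exp (- x\<^sup>2 / 2) * u x) \<le> exp (- x\<^sup>2 / 2) * (a + b * \<bar>x\<bar>)" for x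
    using assms[of x] by (simp add: abs_mult)
  show "((\<lambda>x. exp (- x\<^sup>2 / 2) * u x) \<longlongrightarrow> 0) at_top"
  proof (rule Lim_null_comparison)
    show "\<forall>\<^sub>F x in at_top. norm (exp (- x\<^sup>2 / 2) * u x) \<le> exp (- x\<^sup>2 / 2) * (a + b * \<bar>x\<bar>)" using b by simp
    have "((\<lambda>x. exp (- x\<^sup>2 / 2) * (a + b * x)) \<longlongrightarrow> 0) at_top" by real_asymp
    then show "((\<lambda>x. exp (- x\<^sup>2 / 2) * (a + b * \<bar>x\<bar>)) \<longlongrightarrow> 0) at_top"
      by (rule Lim_transform_eventually) (use eventually_ge_at_top[of 0] in eventually_elim, simp)
  qed
  show "((\<lambda>x. exp (- x\<^sup>2 / 2) * u x) \<longlongrightarrow> 0) at_bot"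
  proof (rule Lim_null_comparison)
    show "\<forall>\<^sub>F x in at_bot. norm (exp (- x\<^sup>2 / 2) * u x) \<le> exp (- x\<^sup>2 / 2) * (a + b * \<bar>x\<bar>)" using b by simp
    have "((\<lambda>x. exp (- x\<^sup>2 / 2) * (a - b * x)) \<longlongrightarrow> 0) at_bot" by real_asymp
    then show "((\<lambda>x. exp (- x\<^sup>2 / 2) * (a + b * \<bar>x\<bar>)) \<longlongrightarrow> 0) at_bot"
      by (rule Lim_transform_eventually) (use eventually_le_at_bot[of 0] in eventually_elim, simp)
  qed
qed

lemma integrable_std_normal_lipschitz:
  fixes h :: "real \<Rightarrow> real"
  assumes [measurable]: "h \<in> borel_measurable borel" and h: "\<And>x. \<bar>h x - h 0\<bar> \<le> \<bar>x\<bar>"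
  shows "integrable lborel (\<lambda>x. std_normal_density x * h x)"
proof (rule Bochner_Integration.integrable_bound)
  show "integrable lborel (\<lambda>x. std_normal_density x * \<bar>x\<bar>^1 + std_normal_density x * \<bar>h 0\<bar>)"
    by (intro Bochner_Integration.integrable_add integrable_std_normal_moment_abs integrable_mult_left) auto
  show "AE x in lborel. norm (std_normal_density x * h x) \<le> norm (std_normal_density x * \<bar>x\<bar>^1 + std_normal_density x * \<bar>h 0\<bar>)"
  proof (intro AE_I2)
    fix x
    have "\<bar>h x\<bar> \<le> \<bar>x\<bar> + \<bar>h 0\<bar>" using h[of x] by linarith
    then have "std_normal_density x * \<bar>h x\<bar> \<le> std_normal_density x * (\<bar>x\<bar> + \<bar>h 0\<bar>)"
      by (intro mult_left_mono) auto
    then show "norm (std_normal_density x * h x) \<le> norm (std_normal_density x * \<bar>x\<bar>^1 + std_normal_density x * \<bar>h 0\<bar>)"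
      by (simp add: abs_mult algebra_simps)
  qed
qed measurable

lemma std_normal_abs_moment_le_1: "(\<integral>x. std_normal_density x * \<bar>x\<bar> \<partial>lborel) \<le> 1"
proof -
  have "(\<integral>x. std_normal_density x * \<bar>x\<bar>^(2*0+1) \<partial>lborel) = sqrt (2 / pi) * 2^0 * fact 0"
    by (rule integral_std_normal_moment_abs_odd)
  then have "(\<integral>x. std_normal_density x * \<bar>x\<bar> \<partial>lborel) = sqrt (2 / pi)" by simp
  also have "\<dots> \<le> 1" using pi_ge_two by (simp add: divide_simps)
  finally show ?thesis .
qed

lemma lipschitz_std_normal_mean:
  fixes h :: "real \<Rightarrow> real"
  assumes [measurable]: "h \<in> borel_measurable borel" and h: "\<And>x y. \<bar>h x - h y\<bar> \<le> \<bar>x - y\<bar>"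
  shows "\<bar>h y - normal_mean h\<bar> \<le> 1 + \<bar>y\<bar>"
proof -
  have int: "integrable lborel (\<lambda>x. std_normal_density x * h x)"
    using h[of _ 0] by (intro integrable_std_normal_lipschitz) auto
  have one: "(\<integral>x. std_normal_density x * h y \<partial>lborel) = h y"
    by simp
  have int2: "integrable lborel (\<lambda>x. std_normal_density x * h y)" by simp
  have int3: "integrable lborel (\<lambda>x. std_normal_density x * \<bar>x\<bar>)"
    using integrable_std_normal_moment_abs[of 1] by simp
  have int4: "integrable lborel (\<lambda>x. std_normal_density x * \<bar>y\<bar>)" by simp
  have "\<bar>h y - normal_mean h\<bar> = \<bar>\<integral>x. std_normal_density x * h y - std_normal_density x * h x \<partial>lborel\<bar>"
    using int int2 one by simp
  also have "\<dots> \<le> (\<integral>x. \<bar>std_normal_density x * h y - std_normal_density x * h x\<bar> \<partial>lborel)"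
    by (rule integral_abs_bound)
  also have "\<dots> \<le> (\<integral>x. std_normal_density x * \<bar>x\<bar> + std_normal_density x * \<bar>y\<bar> \<partial>lborel)"
  proof (rule integral_mono)
    show "integrable lborel (\<lambda>x. \<bar>std_normal_density x * h y - std_normal_density x * h x\<bar>)"
      using int int2 by auto
    show "integrable lborel (\<lambda>x. std_normal_density x * \<bar>x\<bar> + std_normal_density x * \<bar>y\<bar>)"
      using int3 int4 by auto
    show "\<bar>std_normal_density x * h y - std_normal_density x * h x\<bar> \<le> std_normal_density x * \<bar>x\<bar> + std_normal_density x * \<bar>y\<bar>" for x
    proof -
      have "std_normal_density x * \<bar>h y - h x\<bar> \<le> std_normal_density x * (\<bar>x\<bar> + \<bar>y\<bar>)"
        using h[of y x] by (intro mult_left_mono) auto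
      then show ?thesis by (simp add: abs_mult right_diff_distrib[symmetric] distrib_left)
    qed
  qed
  also have "\<dots> \<le> 1 + \<bar>y\<bar>"
    using int3 int4 std_normal_abs_moment_le_1 by simp
  finally show ?thesis .
qed

text \<open>
  Stein's equation \<open>f' x - x * f x = h x - c\<close> for a Lipschitz right-hand side.  With \<open>\<phi> x = exp (- x\<^sup>2 / 2)\<close>
  the function \<open>f * \<phi>\<close> has to be the antiderivative of \<open>\<phi> * (h - c)\<close> that vanishes at infinity; since \<open>c\<close> is
  the Gaussian mean of \<open>h\<close>, it vanishes at both ends, which makes \<open>f\<close> bounded.  Differentiating once
  more shows that \<open>f'\<close> solves an equation of the same kind with right-hand side \<open>f + h'\<close>.  The constants
  3, 8, 12 are not optimal.
\<close>

lemma stein_solution: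
  fixes h h' :: "real \<Rightarrow> real"
  assumes h: "\<And>x. (h has_real_derivative h' x) (at x)" and h': "\<And>x. \<bar>h' x\<bar> \<le> 1"
    and ch': "continuous_on UNIV h'"
  defines "c \<equiv> normal_mean h"
  obtains f f' f'' :: "real \<Rightarrow> real"
  where "\<And>x. (f has_real_derivative f' x) (at x)" "\<And>x. (f' has_real_derivative f'' x) (at x)"
    "continuous_on UNIV f''" "\<And>x. f' x - x * f x = h x - c"
    "\<And>x. \<bar>f x\<bar> \<le> 3" "\<And>x. \<bar>f' x\<bar> \<le> 8" "\<And>x. \<bar>f'' x\<bar> \<le> 12"
proof -
  have conth: "continuous_on UNIV h"
    using h DERIV_continuous_on by blast
  have [measurable]: "h \<in> borel_measurable borel"
    using conth by (rule borel_measurable_continuous_onI)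
  have lip: "\<bar>h x - h y\<bar> \<le> \<bar>x - y\<bar>" for x y
    using field_differentiable_bound[of UNIV h h' 1 x y] h h' by auto
  define \<phi> where "\<phi> x = exp (- x\<^sup>2 / 2)" for x :: real
  have dens: "std_normal_density x = 1 / sqrt (2 * pi) * \<phi> x" for x
    by (simp add: std_normal_density_def \<phi>_def)
  define k where "k x = h x - c" for x
  have contk: "continuous_on UNIV (\<lambda>x. \<phi> x * k x)"
    unfolding \<phi>_def k_def by (intro continuous_intros conth) auto
  have kint: "has_bochner_integral lborel (\<lambda>x. sqrt (2 * pi) * (std_normal_density x * h x - std_normal_density x * c)) (sqrt (2 * pi) * (c - c))"
  proof (intro has_bochner_integral_mult_right has_bochner_integral_diff)
    show "has_bochner_integral lborel (\<lambda>x. std_normal_density x * h x) c"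
      unfolding c_def by (rule has_bochner_integral_integrable, rule integrable_std_normal_lipschitz) (use lip[of _ 0] in auto)
    show "has_bochner_integral lborel (\<lambda>x. std_normal_density x * c) c"
      by (simp add: has_bochner_integral_iff)
  qed
  have "(\<lambda>x. sqrt (2 * pi) * (std_normal_density x * h x - std_normal_density x * c)) = (\<lambda>x. \<phi> x * k x)"
    by (auto simp: dens k_def fun_eq_iff algebra_simps)
  with kint have kint: "integrable lborel (\<lambda>x. \<phi> x * k x)" "(\<integral>x. \<phi> x * k x \<partial>lborel) = 0"
    by (auto simp: has_bochner_integral_iff)
  obtain F0 where F0: "\<And>x. (F0 has_real_derivative \<phi> x * k x) (at x)"
    using einterval_antiderivative[of "-\<infinity>" \<infinity> "\<lambda>x. \<phi> x * k x"] contk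
    by (auto simp: continuous_on_eq_continuous_at has_real_derivative_iff_has_vector_derivative)
  obtain A where A: "(F0 \<longlongrightarrow> A) at_top"
    using antiderivative_tendsto_at_top[OF F0 contk kint(1)] by blast
  obtain B where B: "(F0 \<longlongrightarrow> B) at_bot"
    using antiderivative_tendsto_at_bot[OF F0 contk kint(1)] by blast
  have AB: "A = B"
    using integral_derivative_real_line[OF F0 contk kint(1) A B] kint(2) by simp
  define f where "f x = exp (x\<^sup>2 / 2) * (F0 x - A)" for x
  define f' where "f' x = x * f x + k x" for x
  define f'' where "f'' x = x * f' x + (f x + h' x)" for x
  have inv: "exp (x\<^sup>2 / 2) * \<phi> x = 1" "\<phi> x * exp (x\<^sup>2 / 2) = 1" for x :: real
    by (simp_all add: \<phi>_def exp_add[symmetric])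
  have d1: "(f has_real_derivative x * f x + k x) (at x)" for x
  proof -
    have "(f has_real_derivative (x * exp (x\<^sup>2 / 2)) * (F0 x - A) + exp (x\<^sup>2 / 2) * (\<phi> x * k x)) (at x)"
      unfolding f_def by (auto intro!: derivative_eq_intros F0)
    moreover have "exp (x\<^sup>2 / 2) * (\<phi> x * k x) = k x"
      using inv(1)[of x] by (metis mult.assoc mult_1)
    ultimately show ?thesis by (simp add: f_def mult.assoc)
  qed
  have kb: "\<bar>k x\<bar> \<le> 1 + 1 * \<bar>x\<bar>" for x
    unfolding k_def c_def using lipschitz_std_normal_mean[of h x] lip by simp
  have lf: "exp (- x\<^sup>2 / 2) * f x = F0 x - A" for x
    using inv(2)[of x] by (simp add: f_def \<phi>_def mult.assoc[symmetric])
  have f3: "\<bar>f x\<bar> \<le> 3" for x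
  proof -
    have "\<bar>f x\<bar> \<le> 1 + 2 * 1 / (1 + \<bar>x\<bar>)"
    proof (rule stein_barrier_two_sided[OF d1 kb])
      show "((\<lambda>x. exp (- x\<^sup>2 / 2) * f x) \<longlongrightarrow> 0) at_top" "((\<lambda>x. exp (- x\<^sup>2 / 2) * f x) \<longlongrightarrow> 0) at_bot"
        unfolding lf using tendsto_diff[OF A tendsto_const[of A]] tendsto_diff[OF B tendsto_const[of A]] AB by simp_all
    qed auto
    also have "2 * 1 / (1 + \<bar>x\<bar>) \<le> 2" by (simp add: divide_simps)
    finally show ?thesis by simp
  qed
  have d1': "(f has_real_derivative f' x) (at x)" for x
    using d1 by (simp add: f'_def)
  have d2: "(f' has_real_derivative x * f' x + (f x + h' x)) (at x)" for x
    unfolding f'_def k_def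
    by (auto intro!: derivative_eq_intros d1 h simp: k_def algebra_simps)
  have f8: "\<bar>f' x\<bar> \<le> 0 + 2 * 4 / (1 + \<bar>x\<bar>)" for x
  proof (rule stein_barrier_two_sided[OF d2])
    show "\<bar>f x + h' x\<bar> \<le> 4 + 0 * \<bar>x\<bar>" for x using f3[of x] h'[of x] by simp
    have "\<bar>f' x\<bar> \<le> 1 + 4 * \<bar>x\<bar>" for x
    proof -
      have "\<bar>x * f x\<bar> \<le> \<bar>x\<bar> * 3" unfolding abs_mult using f3[of x] by (intro mult_left_mono) auto
      then show ?thesis using kb[of x] unfolding f'_def by linarith
    qed
    then show "((\<lambda>x. exp (- x\<^sup>2 / 2) * f' x) \<longlongrightarrow> 0) at_top" "((\<lambda>x. exp (- x\<^sup>2 / 2) * f' x) \<longlongrightarrow> 0) at_bot"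
      by (rule tendsto_zero_by_linear_growth)+
  qed auto
  show ?thesis
  proof (rule that[OF d1'])
    show "(f' has_real_derivative f'' x) (at x)" for x using d2 by (simp add: f''_def)
    show "continuous_on UNIV f''"
      unfolding f''_def using d1 d2 ch'
      by (intro continuous_intros DERIV_continuous_on[where f=f] DERIV_continuous_on[where f=f']) (auto intro: DERIV_subset)
    show "f' x - x * f x = h x - c" for x by (simp add: f'_def k_def)
    show "\<bar>f x\<bar> \<le> 3" for x by (rule f3)
    show "\<bar>f' x\<bar> \<le> 8" for x
    proof -
      have "2 * 4 / (1 + \<bar>x\<bar>) \<le> 8" by (simp add: divide_simps)
      then show ?thesis using f8[of x] by linarith
    qed
    show "\<bar>f'' x\<bar> \<le> 12" for x
    proof -
      have "\<bar>x\<bar> * \<bar>f' x\<bar> \<le> \<bar>x\<bar> * (8 / (1 + \<bar>x\<bar>))" using f8[of x] by (intro mult_left_mono) auto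
      also have "\<dots> \<le> 8" by (simp add: divide_simps)
      finally show ?thesis unfolding f''_def using f3[of x] h'[of x] abs_mult[of x "f' x"] by linarith
    qed
  qed
qed

section \<open>Centered Gaussian random variables\<close>

lemma (in prob_space) centered_gaussian_rv_cases:
  assumes "centered_gaussian_rv M Y"
  obtains (zero) "AE \<omega> in M. Y \<omega> = 0"
    | (normal) \<sigma> where "\<sigma> > 0" "distributed M lborel Y (\<lambda>x. ennreal (normal_density 0 \<sigma> x))"
proof -
  from assms obtain \<sigma> where [measurable]: "Y \<in> borel_measurable M" and \<sigma>: "\<sigma> \<ge> 0"
    "distr M borel Y = (if \<sigma> = 0 then return borel 0 else density lborel (\<lambda>x. ennreal (normal_density 0 \<sigma> x)))"
    unfolding centered_gaussian_rv_def by blast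
  show ?thesis
  proof (cases "\<sigma> = 0")
    case True
    then have eq: "distr M borel Y = return borel 0" using \<sigma> by simp
    have "AE x in distr M borel Y. x = 0"
      unfolding eq by (subst AE_return) auto
    then have "AE \<omega> in M. Y \<omega> = 0"
      by (simp add: AE_distr_iff)
    then show ?thesis by (rule zero)
  next
    case False
    then have "distr M lborel Y = density lborel (\<lambda>x. ennreal (normal_density 0 \<sigma> x))"
      using \<sigma> by (metis (no_types) distr_cong sets_lborel)
    then have "distributed M lborel Y (\<lambda>x. ennreal (normal_density 0 \<sigma> x))"
      unfolding distributed_def by auto
    with False \<sigma>(1) show ?thesis by (intro normal[of \<sigma>]) auto
  qed
qed

lemma centered_gaussian_rv_measurable: "centered_gaussian_rv M Y \<Longrightarrow> Y \<in> borel_measurable M"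
  by (simp add: centered_gaussian_rv_def)

lemma (in prob_space) gaussian_integrable_power:
  assumes "centered_gaussian_rv M Y"
  shows "integrable M (\<lambda>\<omega>. \<bar>Y \<omega>\<bar> ^ k)" "integrable M (\<lambda>\<omega>. Y \<omega> ^ k)"
proof -
  note [measurable] = centered_gaussian_rv_measurable[OF assms]
  show *: "integrable M (\<lambda>\<omega>. \<bar>Y \<omega>\<bar> ^ k)"
    using assms
  proof (cases rule: centered_gaussian_rv_cases)
    case zero
    have "integrable M (\<lambda>\<omega>. \<bar>Y \<omega>\<bar> ^ k) \<longleftrightarrow> integrable M (\<lambda>\<omega>. \<bar>0::real\<bar> ^ k)"
      by (rule integrable_cong_AE) (use zero in \<open>auto elim!: eventually_mono\<close>)
    then show ?thesis by simp
  next
    case (normal \<sigma>)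
    have "integrable lborel (\<lambda>x. normal_density 0 \<sigma> x * \<bar>x\<bar> ^ k)"
      using integrable_normal_moment_abs[OF normal(1), of 0 k] by simp
    then show ?thesis
      using distributed_integrable[OF normal(2), of "\<lambda>x. \<bar>x\<bar> ^ k"] by simp
  qed
  show "integrable M (\<lambda>\<omega>. Y \<omega> ^ k)"
    by (rule Bochner_Integration.integrable_bound[OF *]) (auto simp: power_abs)
qed

lemma (in prob_space) gaussian_moments:
  assumes "centered_gaussian_rv M Y"
  shows "expectation (\<lambda>\<omega>. Y \<omega> ^ 4) = 3 * (expectation (\<lambda>\<omega>. (Y \<omega>)\<^sup>2))\<^sup>2"
    and "expectation (\<lambda>\<omega>. Y \<omega> ^ 8) = 105 * (expectation (\<lambda>\<omega>. (Y \<omega>)\<^sup>2)) ^ 4"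
proof -
  note [measurable] = centered_gaussian_rv_measurable[OF assms]
  have "expectation (\<lambda>\<omega>. Y \<omega> ^ 4) = 3 * (expectation (\<lambda>\<omega>. (Y \<omega>)\<^sup>2))\<^sup>2
    \<and> expectation (\<lambda>\<omega>. Y \<omega> ^ 8) = 105 * (expectation (\<lambda>\<omega>. (Y \<omega>)\<^sup>2)) ^ 4"
    using assms
  proof (cases rule: centered_gaussian_rv_cases)
    case zero
    have "expectation (\<lambda>\<omega>. Y \<omega> ^ k) = expectation (\<lambda>\<omega>. 0 ^ k)" for k
      by (rule integral_cong_AE) (use zero in \<open>auto elim!: eventually_mono\<close>)
    from this[of 2] this[of 4] this[of 8] show ?thesis by simp
  next
    case (normal \<sigma>)
    have mom: "expectation (\<lambda>\<omega>. Y \<omega> ^ k) = (\<integral>x. normal_density 0 \<sigma> x * x ^ k \<partial>lborel)" for k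
      using distributed_integral[OF normal(2), of "\<lambda>x. x ^ k"] by simp
    have ev: "(\<integral>x. normal_density 0 \<sigma> x * x ^ (2 * k) \<partial>lborel) = fact (2 * k) / ((2 / \<sigma>\<^sup>2)^k * fact k)" for k
      using integral_normal_moment_even[OF normal(1), of 0 k] by simp
    have s2: "expectation (\<lambda>\<omega>. (Y \<omega>)\<^sup>2) = \<sigma>\<^sup>2"
      using mom[of 2] ev[of 1] normal(1) by (simp add: fact_numeral)
    have s4: "expectation (\<lambda>\<omega>. (Y \<omega>)^4) = 3 * (\<sigma>\<^sup>2)\<^sup>2"
      using mom[of 4] ev[of 2] normal(1) by (simp add: fact_numeral field_simps)
    have s8: "expectation (\<lambda>\<omega>. (Y \<omega>)^8) = 105 * (\<sigma>\<^sup>2)^4"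
      using mom[of 8] ev[of 4] normal(1) by (simp add: fact_numeral field_simps)
    from s2 s4 s8 show ?thesis by simp
  qed
  then show "expectation (\<lambda>\<omega>. Y \<omega> ^ 4) = 3 * (expectation (\<lambda>\<omega>. (Y \<omega>)\<^sup>2))\<^sup>2"
    "expectation (\<lambda>\<omega>. Y \<omega> ^ 8) = 105 * (expectation (\<lambda>\<omega>. (Y \<omega>)\<^sup>2)) ^ 4" by auto
qed

lemma (in prob_space) distributed_gaussian:
  assumes "centered_gaussian_rv M Y" "expectation (\<lambda>\<omega>. (Y \<omega>)\<^sup>2) > 0"
  shows "distributed M lborel Y (\<lambda>x. ennreal (normal_density 0 (sqrt (expectation (\<lambda>\<omega>. (Y \<omega>)\<^sup>2))) x))"
  using assms(1)
proof (cases rule: centered_gaussian_rv_cases)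
  case zero
  note [measurable] = centered_gaussian_rv_measurable[OF assms(1)]
  have "expectation (\<lambda>\<omega>. (Y \<omega>)\<^sup>2) = expectation (\<lambda>\<omega>. 0)"
    by (rule integral_cong_AE) (use zero in \<open>auto elim!: eventually_mono\<close>)
  with assms(2) show ?thesis by simp
next
  case (normal \<sigma>)
  have "expectation (\<lambda>\<omega>. (Y \<omega>)\<^sup>2) = (\<integral>x. normal_density 0 \<sigma> x * x ^ 2 \<partial>lborel)"
    using distributed_integral[OF normal(2), of "\<lambda>x. x ^ 2"] by simp
  also have "\<dots> = \<sigma>\<^sup>2"
    using integral_normal_moment_even[OF normal(1), of 0 1] normal(1) by (simp add: fact_numeral)
  finally show ?thesis using normal by simp
qed

lemma (in prob_space) gaussian_AE_nonzero:
  assumes "centered_gaussian_rv M Y" "expectation (\<lambda>\<omega>. (Y \<omega>)\<^sup>2) > 0"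
  shows "AE \<omega> in M. Y \<omega> \<noteq> 0"
proof -
  note [measurable] = centered_gaussian_rv_measurable[OF assms(1)]
  have eq: "distr M lborel Y = density lborel (\<lambda>x. ennreal (normal_density 0 (sqrt (expectation (\<lambda>\<omega>. (Y \<omega>)\<^sup>2))) x))"
    using distributed_gaussian[OF assms] by (rule distributed_distr_eq_density)
  have "AE x in lborel. x \<noteq> (0::real)" by (rule AE_lborel_singleton)
  then have "AE x in density lborel (\<lambda>x. ennreal (normal_density 0 (sqrt (expectation (\<lambda>\<omega>. (Y \<omega>)\<^sup>2))) x)). x \<noteq> 0"
    by (subst AE_density) (auto elim: eventually_mono)
  then have "AE x in distr M lborel Y. x \<noteq> 0" unfolding eq .
  then show ?thesis by (simp add: AE_distr_iff)
qed

lemma (in prob_space) AE_zero_if_second_moment_zero: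
  assumes "integrable M (\<lambda>\<omega>. (Y \<omega>)\<^sup>2)" "expectation (\<lambda>\<omega>. (Y \<omega>)\<^sup>2) = 0"
  shows "AE \<omega> in M. Y \<omega> = (0::real)"
proof -
  have "AE \<omega> in M. (Y \<omega>)\<^sup>2 = 0"
    using integral_nonneg_eq_0_iff_AE[OF assms(1)] assms(2) by simp
  then show ?thesis by simp
qed

lemma (in prob_space) gaussian_cos_sin:
  assumes "centered_gaussian_rv M Y"
  shows "expectation (\<lambda>\<omega>. cos (Y \<omega>)) = exp (- expectation (\<lambda>\<omega>. (Y \<omega>)\<^sup>2) / 2)"
    and "expectation (\<lambda>\<omega>. sin (Y \<omega>)) = 0"
proof -
  note [measurable] = centered_gaussian_rv_measurable[OF assms]
  define v where "v = expectation (\<lambda>\<omega>. (Y \<omega>)\<^sup>2)"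
  have int: "integrable M (\<lambda>\<omega>. (Y \<omega>)\<^sup>2)" using gaussian_integrable_power(2)[OF assms, of 2] .
  have v0: "v \<ge> 0" unfolding v_def by simp
  have "expectation (\<lambda>\<omega>. cos (Y \<omega>)) = exp (- v / 2) \<and> expectation (\<lambda>\<omega>. sin (Y \<omega>)) = 0"
  proof (cases "v = 0")
    case True
    then have Y0: "AE \<omega> in M. Y \<omega> = 0"
      using AE_zero_if_second_moment_zero[OF int] by (simp add: v_def)
    have "expectation (\<lambda>\<omega>. cos (Y \<omega>)) = expectation (\<lambda>\<omega>. 1)" "expectation (\<lambda>\<omega>. sin (Y \<omega>)) = expectation (\<lambda>\<omega>. 0)"
      by (rule integral_cong_AE; use Y0 in \<open>auto elim!: eventually_mono\<close>)+
    then show ?thesis using True by (simp add: prob_space)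
  next
    case False
    then have pos: "v > 0" using v0 by simp
    then have sq: "sqrt v > 0" by simp
    have "distributed M lborel (\<lambda>\<omega>. (Y \<omega> - 0) / sqrt v) (\<lambda>x. ennreal (std_normal_density x))"
      using distributed_gaussian[OF assms] pos normal_standard_normal_convert[OF sq, of Y 0] by (simp add: v_def)
    then have d: "distr M lborel (\<lambda>\<omega>. Y \<omega> / sqrt v) = std_normal_distribution"
      by (simp add: distributed_distr_eq_density)
    have "char (distr M lborel (\<lambda>\<omega>. Y \<omega> / sqrt v)) (sqrt v) = (CLINT \<omega>|M. iexp (sqrt v * (Y \<omega> / sqrt v)))"
      unfolding char_def by (subst integral_distr) auto
    also have "\<dots> = (CLINT \<omega>|M. iexp (Y \<omega>))" using pos by simp
    finally have ch: "(CLINT \<omega>|M. iexp (Y \<omega>)) = exp (- (sqrt v)\<^sup>2 / 2)"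
      unfolding d by (simp add: char_std_normal_distribution)
    have I: "complex_integrable M (\<lambda>\<omega>. iexp (Y \<omega>))"
      by (rule integrable_iexp) auto
    have c: "Re (iexp (Y \<omega>)) = cos (Y \<omega>)" "Im (iexp (Y \<omega>)) = sin (Y \<omega>)" for \<omega>
      by (simp_all add: exp_Euler cos_of_real sin_of_real del: exp_of_real)

    have "expectation (\<lambda>\<omega>. cos (Y \<omega>)) = Re (CLINT \<omega>|M. iexp (Y \<omega>))"
      "expectation (\<lambda>\<omega>. sin (Y \<omega>)) = Im (CLINT \<omega>|M. iexp (Y \<omega>))"
      using integral_Re[OF I] integral_Im[OF I] by (simp_all only: c)
    then show ?thesis unfolding ch using pos by (simp add: exp_of_real[symmetric] del: of_real_exp)
  qed
  then show "expectation (\<lambda>\<omega>. cos (Y \<omega>)) = exp (- expectation (\<lambda>\<omega>. (Y \<omega>)\<^sup>2) / 2)" "expectation (\<lambda>\<omega>. sin (Y \<omega>)) = 0"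
    by (auto simp: v_def)
qed

lemma (in prob_space) integrable_bounded_mult:
  fixes V u :: "'a \<Rightarrow> real"
  assumes "integrable M V" "u \<in> borel_measurable M" "\<And>\<omega>. \<bar>u \<omega>\<bar> \<le> 1"
  shows "integrable M (\<lambda>\<omega>. V \<omega> * u \<omega>)"
proof (rule Bochner_Integration.integrable_bound[OF assms(1)])
  show "(\<lambda>\<omega>. V \<omega> * u \<omega>) \<in> borel_measurable M" using assms(1,2) by auto
  show "AE \<omega> in M. norm (V \<omega> * u \<omega>) \<le> norm (V \<omega>)"
    using assms(3) by (auto simp: abs_mult mult_left_le)
qed

lemma integrable_mult_of_squares:
  fixes X Y :: "'a \<Rightarrow> real"
  assumes [measurable]: "X \<in> borel_measurable M" "Y \<in> borel_measurable M"
    and sq: "integrable M (\<lambda>\<omega>. (X \<omega>)\<^sup>2)" "integrable M (\<lambda>\<omega>. (Y \<omega>)\<^sup>2)"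
  shows "integrable M (\<lambda>\<omega>. X \<omega> * Y \<omega>)"
proof (rule Bochner_Integration.integrable_bound[OF Bochner_Integration.integrable_add[OF sq]])
  have "\<bar>x * y\<bar> \<le> x\<^sup>2 + y\<^sup>2" for x y :: real
    using sum_squares_bound[of "\<bar>x\<bar>" "\<bar>y\<bar>"] mult_nonneg_nonneg[of "\<bar>x\<bar>" "\<bar>y\<bar>"] unfolding abs_mult power2_abs by linarith
  then show "AE \<omega> in M. norm (X \<omega> * Y \<omega>) \<le> norm ((X \<omega>)\<^sup>2 + (Y \<omega>)\<^sup>2)" by auto
qed simp

text \<open>
  If a signed weight \<open>V\<close> is orthogonal to all characters of \<open>Y\<close>, it is orthogonal to all events of
  \<open>Y\<close>: the normalised positive and negative parts of \<open>V\<close> push forward under \<open>Y\<close> to two laws with the same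
  characteristic function, and these coincide by Levy's uniqueness theorem.
\<close>

lemma (in prob_space) fourier_determines_weight:
  fixes V Y :: "'a \<Rightarrow> real"
  assumes V: "integrable M V" and [measurable]: "Y \<in> borel_measurable M"
    and cs: "\<And>b. expectation (\<lambda>\<omega>. V \<omega> * cos (b * Y \<omega>)) = 0" "\<And>b. expectation (\<lambda>\<omega>. V \<omega> * sin (b * Y \<omega>)) = 0"
    and A: "A \<in> sets borel"
  shows "expectation (\<lambda>\<omega>. V \<omega> * indicator A (Y \<omega>)) = 0"
proof -
  have [measurable]: "V \<in> borel_measurable M" using V by auto
  have [measurable]: "A \<in> sets borel" by (rule A)
  define p where "p \<omega> = max (V \<omega>) 0" for \<omega>
  define n where "n \<omega> = max (- V \<omega>) 0" for \<omega>
  have [measurable]: "p \<in> borel_measurable M" "n \<in> borel_measurable M"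
    unfolding p_def n_def by auto
  have pn: "V \<omega> = p \<omega> - n \<omega>" "p \<omega> \<ge> 0" "n \<omega> \<ge> 0" for \<omega> by (auto simp: p_def n_def)
  have ip: "integrable M p" "integrable M n"
    unfolding p_def n_def using V by auto
  define c where "c = expectation p"
  have cn: "expectation n = c"
    using cs(1)[of 0] ip unfolding c_def by (simp add: pn(1))
  have c0: "c \<ge> 0" unfolding c_def using pn by simp
  have ipu: "integrable M (\<lambda>\<omega>. p \<omega> * u \<omega>)" "integrable M (\<lambda>\<omega>. n \<omega> * u \<omega>)"
    if "u \<in> borel_measurable M" "\<And>\<omega>. \<bar>u \<omega>\<bar> \<le> 1" for u :: "'a \<Rightarrow> real"
    using that ip by (auto intro: integrable_bounded_mult)
  show ?thesis
  proof (cases "c = 0")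
    case True
    then have "AE \<omega> in M. p \<omega> = 0" "AE \<omega> in M. n \<omega> = 0"
      using integral_nonneg_eq_0_iff_AE[OF ip(1)] integral_nonneg_eq_0_iff_AE[OF ip(2)] pn(2,3) cn
      by (auto simp: c_def)
    then have "AE \<omega> in M. V \<omega> = 0" by eventually_elim (simp add: pn(1))
    then have "expectation (\<lambda>\<omega>. V \<omega> * indicator A (Y \<omega>)) = expectation (\<lambda>\<omega>. 0)"
      by (intro integral_cong_AE) (auto elim!: eventually_mono)
    then show ?thesis by simp
  next
    case False
    with c0 have pos: "c > 0" by simp
    define N where "N q = distr (density M (\<lambda>\<omega>. ennreal (q \<omega> / c))) borel Y" for q
    have rd: "real_distribution (N q)" and
      intN: "\<And>u :: real \<Rightarrow> complex. u \<in> borel_measurable borel \<Longrightarrow> integral\<^sup>L (N q) u = (CLINT \<omega>|M. (q \<omega> / c) *\<^sub>R u (Y \<omega>))" and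
      mN: "measure (N q) A = expectation (\<lambda>\<omega>. (q \<omega> / c) * indicator A (Y \<omega>))"
      if [measurable]: "q \<in> borel_measurable M" and q0: "\<And>\<omega>. q \<omega> \<ge> 0" and iq: "integrable M q" and qc: "expectation q = c" for q
    proof -
      have "(\<integral>\<^sup>+\<omega>. ennreal (q \<omega> / c) \<partial>M) = ennreal (expectation (\<lambda>\<omega>. q \<omega> / c))"
        using iq q0 pos by (intro nn_integral_eq_integral) auto
      also have "\<dots> = 1" using qc pos by simp
      finally have "prob_space (density M (\<lambda>\<omega>. ennreal (q \<omega> / c)))"
        by (intro prob_spaceI) (simp add: emeasure_density cong: nn_integral_cong)
      then show "real_distribution (N q)"
        unfolding N_def by (intro prob_space.real_distribution_distr) auto
      show intN: "integral\<^sup>L (N q) u = (CLINT \<omega>|M. (q \<omega> / c) *\<^sub>R u (Y \<omega>))" if [measurable]: "u \<in> borel_measurable borel" for u :: "real \<Rightarrow> complex"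
        unfolding N_def using q0 pos
        by (subst integral_distr; (subst integral_density)?) auto
      have "measure (N q) A = integral\<^sup>L (N q) (indicator A)"
        by (simp add: N_def)
      also have "\<dots> = expectation (\<lambda>\<omega>. (q \<omega> / c) *\<^sub>R indicator A (Y \<omega>))"
        unfolding N_def using q0 pos
        by (subst integral_distr; (subst integral_density)?) auto
      finally show "measure (N q) A = expectation (\<lambda>\<omega>. (q \<omega> / c) * indicator A (Y \<omega>))" by simp
    qed
    have "char (N p) b = char (N n) b" for b
    proof -
      have I: "complex_integrable M (\<lambda>\<omega>. (q \<omega> / c) *\<^sub>R iexp (b * Y \<omega>))" if [measurable]: "integrable M q" for q
        by (rule Bochner_Integration.integrable_bound[where f="\<lambda>\<omega>. q \<omega> / c"]) (use that in \<open>auto simp: norm_mult\<close>)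
      have "char (N p) b - char (N n) b = (CLINT \<omega>|M. (p \<omega> / c) *\<^sub>R iexp (b * Y \<omega>)) - (CLINT \<omega>|M. (n \<omega> / c) *\<^sub>R iexp (b * Y \<omega>))"
        unfolding char_def using ip pn cn by (subst (1 2) intN) (auto simp: c_def)
      also have "\<dots> = (CLINT \<omega>|M. (V \<omega> / c) *\<^sub>R iexp (b * Y \<omega>))"
        using I[OF ip(1)] I[OF ip(2)]
        by (subst Bochner_Integration.integral_diff[symmetric]) (auto simp: pn(1) scaleR_diff_left[symmetric] diff_divide_distrib)
      also have "\<dots> = 0"
      proof -
        have c: "Re ((V \<omega> / c) *\<^sub>R iexp (b * Y \<omega>)) = (V \<omega> * cos (b * Y \<omega>)) / c"
          "Im ((V \<omega> / c) *\<^sub>R iexp (b * Y \<omega>)) = (V \<omega> * sin (b * Y \<omega>)) / c" for \<omega>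
          by (simp_all add: exp_Euler cos_of_real sin_of_real flip: of_real_mult)
        have "Re (CLINT \<omega>|M. (V \<omega> / c) *\<^sub>R iexp (b * Y \<omega>)) = 0" "Im (CLINT \<omega>|M. (V \<omega> / c) *\<^sub>R iexp (b * Y \<omega>)) = 0"
          unfolding integral_Re[OF I[OF V], symmetric] integral_Im[OF I[OF V], symmetric] c
          using cs[of b] by simp_all
        then show ?thesis by (simp add: complex_eq_iff)
      qed
      finally show ?thesis by simp
    qed
    then have "N p = N n"
      using ip pn cn by (intro Levy_uniqueness rd) (auto simp: c_def)
    then have "measure (N p) A = measure (N n) A" by simp
    then have "expectation (\<lambda>\<omega>. (p \<omega> / c) * indicator A (Y \<omega>)) = expectation (\<lambda>\<omega>. (n \<omega> / c) * indicator A (Y \<omega>))"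
      using ip pn cn by (simp add: mN c_def)
    then have "expectation (\<lambda>\<omega>. p \<omega> * indicator A (Y \<omega>)) = expectation (\<lambda>\<omega>. n \<omega> * indicator A (Y \<omega>))"
      using pos by simp
    moreover have "integrable M (\<lambda>\<omega>. p \<omega> * indicator A (Y \<omega>))" "integrable M (\<lambda>\<omega>. n \<omega> * indicator A (Y \<omega>))"
      by (intro ipu; auto simp: indicator_def)+
    ultimately show ?thesis
      by (simp add: pn(1) left_diff_distrib)
  qed
qed

text \<open>
  Finitely many variables are treated one at a time: by the addition theorems the weight
  \<open>V * cos S\<close>, where \<open>S\<close> is a combination of the other variables, is orthogonal to the characters of
  \<open>Y k\<close>, and the one-dimensional lemma replaces them by an indicator, which joins the weight.  This
  avoids characteristic functions of random vectors.
\<close>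

lemma (in prob_space) fourier_determines_weight_finite:
  fixes V :: "'a \<Rightarrow> real" and Y :: "'i \<Rightarrow> 'a \<Rightarrow> real"
  assumes "finite J" and "integrable M V" and "\<And>j. j \<in> J \<Longrightarrow> Y j \<in> borel_measurable M"
    and "\<And>b. expectation (\<lambda>\<omega>. V \<omega> * cos (\<Sum>j\<in>J. b j * Y j \<omega>)) = 0"
    and "\<And>b. expectation (\<lambda>\<omega>. V \<omega> * sin (\<Sum>j\<in>J. b j * Y j \<omega>)) = 0"
    and "\<And>j. j \<in> J \<Longrightarrow> A j \<in> sets borel"
  shows "expectation (\<lambda>\<omega>. V \<omega> * (\<Prod>j\<in>J. indicator (A j) (Y j \<omega>))) = 0"
  using assms
proof (induction J arbitrary: V rule: finite_induct)
  case empty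
  then show ?case by simp
next
  case (insert k J)
  note [measurable] = insert.prems(2)
  have Vm[measurable]: "V \<in> borel_measurable M" using insert.prems(1) by auto
  have Ym[measurable]: "Y j \<in> borel_measurable M" if "j \<in> J" for j using insert.prems(2) that by auto
  have Ykm[measurable]: "Y k \<in> borel_measurable M" using insert.prems(2) by auto
  have Akm[measurable]: "A k \<in> sets borel" using insert.prems(5) by auto
  have Iu: "integrable M (\<lambda>\<omega>. V \<omega> * u \<omega>)" if "u \<in> borel_measurable M" "\<And>\<omega>. \<bar>u \<omega>\<bar> \<le> 1" for u
    using that insert.prems(1) by (intro integrable_bounded_mult)
  have key: "expectation (\<lambda>\<omega>. (V \<omega> * cos (\<Sum>j\<in>J. b j * Y j \<omega>)) * indicator (A k) (Y k \<omega>)) = 0 \<and>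
    expectation (\<lambda>\<omega>. (V \<omega> * sin (\<Sum>j\<in>J. b j * Y j \<omega>)) * indicator (A k) (Y k \<omega>)) = 0" for b
  proof -
    define S where "S \<omega> = (\<Sum>j\<in>J. b j * Y j \<omega>)" for \<omega>
    have [measurable]: "S \<in> borel_measurable M" unfolding S_def by measurable
    have sum: "(\<Sum>j\<in>insert k J. (if j = k then c else s * b j) * Y j \<omega>) = c * Y k \<omega> + s * S \<omega>" for c s \<omega>
    proof -
      have "(\<Sum>j\<in>J. (if j = k then c else s * b j) * Y j \<omega>) = (\<Sum>j\<in>J. s * (b j * Y j \<omega>))"
        using insert.hyps(2) by (intro sum.cong) auto
      then show ?thesis using insert.hyps by (simp add: S_def sum_distrib_left)
    qed
    have C: "expectation (\<lambda>\<omega>. V \<omega> * cos (c * Y k \<omega> + s * S \<omega>)) = 0"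
      and D: "expectation (\<lambda>\<omega>. V \<omega> * sin (c * Y k \<omega> + s * S \<omega>)) = 0" for c s
      using insert.prems(3)[of "\<lambda>j. if j = k then c else s * b j"] insert.prems(4)[of "\<lambda>j. if j = k then c else s * b j"]
      by (simp_all only: sum)
    have IC: "integrable M (\<lambda>\<omega>. V \<omega> * cos (c * Y k \<omega> + s * S \<omega>))" "integrable M (\<lambda>\<omega>. V \<omega> * sin (c * Y k \<omega> + s * S \<omega>))" for c s
      by (intro Iu; simp)+
    have "expectation (\<lambda>\<omega>. (V \<omega> * cos (S \<omega>)) * indicator (A k) (Y k \<omega>)) = 0"
    proof (rule fourier_determines_weight[OF Iu _ _ _ Akm])
      fix c
      have "(\<lambda>\<omega>. V \<omega> * cos (S \<omega>) * cos (c * Y k \<omega>)) = (\<lambda>\<omega>. (V \<omega> * cos (c * Y k \<omega> + 1 * S \<omega>) + V \<omega> * cos (c * Y k \<omega> + (-1) * S \<omega>)) / 2)"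
        by (simp add: fun_eq_iff cos_add cos_diff algebra_simps)
      then show "expectation (\<lambda>\<omega>. V \<omega> * cos (S \<omega>) * cos (c * Y k \<omega>)) = 0"
        using C[of c 1] C[of c "-1"] IC(1)[of c 1] IC(1)[of c "-1"] by simp
      have "(\<lambda>\<omega>. V \<omega> * cos (S \<omega>) * sin (c * Y k \<omega>)) = (\<lambda>\<omega>. (V \<omega> * sin (c * Y k \<omega> + 1 * S \<omega>) + V \<omega> * sin (c * Y k \<omega> + (-1) * S \<omega>)) / 2)"
        by (simp add: fun_eq_iff sin_add sin_diff algebra_simps)
      then show "expectation (\<lambda>\<omega>. V \<omega> * cos (S \<omega>) * sin (c * Y k \<omega>)) = 0"
        using D[of c 1] D[of c "-1"] IC(2)[of c 1] IC(2)[of c "-1"] by simp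
    qed auto
    moreover have "expectation (\<lambda>\<omega>. (V \<omega> * sin (S \<omega>)) * indicator (A k) (Y k \<omega>)) = 0"
    proof (rule fourier_determines_weight[OF Iu _ _ _ Akm])
      fix c
      have "(\<lambda>\<omega>. V \<omega> * sin (S \<omega>) * cos (c * Y k \<omega>)) = (\<lambda>\<omega>. (V \<omega> * sin (c * Y k \<omega> + 1 * S \<omega>) - V \<omega> * sin (c * Y k \<omega> + (-1) * S \<omega>)) / 2)"
        by (simp add: fun_eq_iff sin_add sin_diff algebra_simps)
      then show "expectation (\<lambda>\<omega>. V \<omega> * sin (S \<omega>) * cos (c * Y k \<omega>)) = 0"
        using D[of c 1] D[of c "-1"] IC(2)[of c 1] IC(2)[of c "-1"] by simp
      have "(\<lambda>\<omega>. V \<omega> * sin (S \<omega>) * sin (c * Y k \<omega>)) = (\<lambda>\<omega>. (V \<omega> * cos (c * Y k \<omega> + (-1) * S \<omega>) - V \<omega> * cos (c * Y k \<omega> + 1 * S \<omega>)) / 2)"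
        by (simp add: fun_eq_iff cos_add cos_diff algebra_simps)
      then show "expectation (\<lambda>\<omega>. V \<omega> * sin (S \<omega>) * sin (c * Y k \<omega>)) = 0"
        using C[of c 1] C[of c "-1"] IC(1)[of c 1] IC(1)[of c "-1"] by simp
    qed auto
    ultimately show ?thesis by (simp add: S_def)
  qed
  have "expectation (\<lambda>\<omega>. (V \<omega> * indicator (A k) (Y k \<omega>)) * (\<Prod>j\<in>J. indicator (A j) (Y j \<omega>))) = 0"
  proof (rule insert.IH)
    show "integrable M (\<lambda>\<omega>. V \<omega> * indicator (A k) (Y k \<omega>))"
      by (rule Iu) (auto simp: indicator_def)
    show "expectation (\<lambda>\<omega>. V \<omega> * indicator (A k) (Y k \<omega>) * cos (\<Sum>j\<in>J. b j * Y j \<omega>)) = 0"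
      "expectation (\<lambda>\<omega>. V \<omega> * indicator (A k) (Y k \<omega>) * sin (\<Sum>j\<in>J. b j * Y j \<omega>)) = 0" for b
      using key[of b] by (simp_all add: mult_ac)
  qed (use insert.prems in auto)
  then show ?case using insert.hyps by (simp add: mult_ac)
qed

text \<open>
  For jointly Gaussian variables the variance of \<open>a * W + S\<close> splits when \<open>W\<close> and \<open>S\<close> are uncorrelated,
  so its characteristic function factorises; the two Fourier lemmas turn this into the product formula
  for events.
\<close>

lemma (in prob_space) gaussian_uncorrelated_independent:
  fixes W :: "'a \<Rightarrow> real" and Y :: "'i \<Rightarrow> 'a \<Rightarrow> real"
  assumes J: "finite J"
    and G: "\<And>a b. centered_gaussian_rv M (\<lambda>\<omega>. a * W \<omega> + (\<Sum>j\<in>J. b j * Y j \<omega>))"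
    and Wm[measurable]: "W \<in> borel_measurable M" and Ym[measurable]: "\<And>j. j \<in> J \<Longrightarrow> Y j \<in> borel_measurable M"
    and unc: "\<And>j. j \<in> J \<Longrightarrow> expectation (\<lambda>\<omega>. W \<omega> * Y j \<omega>) = 0"
    and A: "A \<in> sets borel" and B: "\<And>j. j \<in> J \<Longrightarrow> B j \<in> sets borel"
  shows "(expectation (\<lambda>\<omega>. indicator A (W \<omega>) * (\<Prod>j\<in>J. indicator (B j) (Y j \<omega>))) :: real) =
    expectation (\<lambda>\<omega>. indicator A (W \<omega>)) * expectation (\<lambda>\<omega>. \<Prod>j\<in>J. indicator (B j) (Y j \<omega>))"
proof -
  note [measurable] = A
  have bi: "integrable M u" if "u \<in> borel_measurable M" "\<And>\<omega>. \<bar>u \<omega>\<bar> \<le> 1" for u :: "'a \<Rightarrow> real"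
    using integrable_bounded_mult[of "\<lambda>_. 1" u] that by simp
  have GW: "centered_gaussian_rv M W" using G[of 1 "\<lambda>_. 0"] by simp
  have sq: "integrable M (\<lambda>\<omega>. (W \<omega>)\<^sup>2)" using gaussian_integrable_power(2)[OF GW, of 2] .
  define p where "p = expectation (\<lambda>\<omega>. indicator A (W \<omega>) :: real)"
  have main: "expectation (\<lambda>\<omega>. (indicator A (W \<omega>) - p) * cos (\<Sum>j\<in>J. b j * Y j \<omega>)) = 0 \<and>
    expectation (\<lambda>\<omega>. (indicator A (W \<omega>) - p) * sin (\<Sum>j\<in>J. b j * Y j \<omega>)) = 0" for b
  proof -
    define S where "S \<omega> = (\<Sum>j\<in>J. b j * Y j \<omega>)" for \<omega>
    have [measurable]: "S \<in> borel_measurable M" unfolding S_def by measurable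
    have GS: "centered_gaussian_rv M S" using G[of 0 b] by (simp add: S_def[abs_def])
    have sqS: "integrable M (\<lambda>\<omega>. (S \<omega>)\<^sup>2)" using gaussian_integrable_power(2)[OF GS, of 2] .
    have GY: "centered_gaussian_rv M (Y j)" if "j \<in> J" for j
    proof -
      have "(\<Sum>i\<in>J. (if i = j then 1 else 0) * Y i \<omega>) = Y j \<omega>" for \<omega>
        using J that by (simp add: if_distrib[of "\<lambda>x. x * _"] cong: if_cong)
      then show ?thesis using G[of 0 "\<lambda>i. if i = j then 1 else 0"] by simp
    qed
    have sqY: "integrable M (\<lambda>\<omega>. (Y j \<omega>)\<^sup>2)" if "j \<in> J" for j
      using gaussian_integrable_power(2)[OF GY[OF that], of 2] .
    have IWY: "integrable M (\<lambda>\<omega>. W \<omega> * Y j \<omega>)" if "j \<in> J" for j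
      by (rule integrable_mult_of_squares) (use sq sqY[OF that] that in auto)
    have WS: "expectation (\<lambda>\<omega>. W \<omega> * S \<omega>) = 0"
    proof -
      have "(\<lambda>\<omega>. W \<omega> * S \<omega>) = (\<lambda>\<omega>. \<Sum>j\<in>J. b j * (W \<omega> * Y j \<omega>))"
        by (simp add: S_def sum_distrib_left mult_ac)
      then show ?thesis using IWY unc by (simp add: Bochner_Integration.integral_sum)
    qed
    have IWS: "integrable M (\<lambda>\<omega>. W \<omega> * S \<omega>)"
    proof -
      have "(\<lambda>\<omega>. W \<omega> * S \<omega>) = (\<lambda>\<omega>. \<Sum>j\<in>J. b j * (W \<omega> * Y j \<omega>))"
        by (simp add: S_def sum_distrib_left mult_ac)
      then show ?thesis using IWY by simp
    qed
    define v where "v = expectation (\<lambda>\<omega>. (W \<omega>)\<^sup>2)"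
    define w where "w = expectation (\<lambda>\<omega>. (S \<omega>)\<^sup>2)"
    have char: "expectation (\<lambda>\<omega>. cos (a * W \<omega> + s * S \<omega>)) = exp (- (a\<^sup>2 * v) / 2) * exp (- (s\<^sup>2 * w) / 2)"
      "expectation (\<lambda>\<omega>. sin (a * W \<omega> + s * S \<omega>)) = 0" for a s
    proof -
      have g: "centered_gaussian_rv M (\<lambda>\<omega>. a * W \<omega> + s * S \<omega>)"
        using G[of a "\<lambda>j. s * b j"] by (simp add: S_def sum_distrib_left mult.assoc)
      have "(\<lambda>\<omega>. (a * W \<omega> + s * S \<omega>)\<^sup>2) = (\<lambda>\<omega>. a\<^sup>2 * (W \<omega>)\<^sup>2 + 2 * a * s * (W \<omega> * S \<omega>) + s\<^sup>2 * (S \<omega>)\<^sup>2)"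
        by (simp add: fun_eq_iff power2_sum power_mult_distrib algebra_simps)
      then have "expectation (\<lambda>\<omega>. (a * W \<omega> + s * S \<omega>)\<^sup>2) = a\<^sup>2 * v + s\<^sup>2 * w"
        using sq sqS IWS WS by (simp add: v_def w_def)
      then show "expectation (\<lambda>\<omega>. cos (a * W \<omega> + s * S \<omega>)) = exp (- (a\<^sup>2 * v) / 2) * exp (- (s\<^sup>2 * w) / 2)"
        "expectation (\<lambda>\<omega>. sin (a * W \<omega> + s * S \<omega>)) = 0"
        using gaussian_cos_sin[OF g] by (simp_all add: exp_add[symmetric] add_divide_distrib)
    qed
    have IC: "integrable M (\<lambda>\<omega>. cos (a * W \<omega> + s * S \<omega>))" "integrable M (\<lambda>\<omega>. sin (a * W \<omega> + s * S \<omega>))"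
      "integrable M (\<lambda>\<omega>. cos (a * W \<omega>))" "integrable M (\<lambda>\<omega>. sin (a * W \<omega>))"
      "integrable M (\<lambda>\<omega>. cos (S \<omega>))" "integrable M (\<lambda>\<omega>. sin (S \<omega>))" for a s
      by (intro bi; simp)+
    define c where "c = expectation (\<lambda>\<omega>. cos (S \<omega>))"
    have c: "c = exp (- w / 2)" using char(1)[of 0 1] by (simp add: c_def)
    have s0: "expectation (\<lambda>\<omega>. sin (S \<omega>)) = 0" using char(2)[of 0 1] by simp
    have W0: "expectation (\<lambda>\<omega>. cos (a * W \<omega>)) = exp (- (a\<^sup>2 * v) / 2)" "expectation (\<lambda>\<omega>. sin (a * W \<omega>)) = 0" for a
      using char[of a 0] by simp_all
    have "expectation (\<lambda>\<omega>. (cos (S \<omega>) - c) * indicator A (W \<omega>)) = 0"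
    proof (rule fourier_determines_weight[OF _ Wm _ _ A])
      show "integrable M (\<lambda>\<omega>. cos (S \<omega>) - c)" using IC by simp
      fix a
      have "(\<lambda>\<omega>. (cos (S \<omega>) - c) * cos (a * W \<omega>)) = (\<lambda>\<omega>. (cos (a * W \<omega> + 1 * S \<omega>) + cos (a * W \<omega> + (-1) * S \<omega>)) / 2 - c * cos (a * W \<omega>))"
        by (simp add: fun_eq_iff cos_add cos_diff algebra_simps)
      then show "expectation (\<lambda>\<omega>. (cos (S \<omega>) - c) * cos (a * W \<omega>)) = 0"
        using IC(1)[of a 1] IC(1)[of a "-1"] IC(3)[of a] char(1)[of a 1] char(1)[of a "-1"] W0[of a] by (simp add: c)
      have "(\<lambda>\<omega>. (cos (S \<omega>) - c) * sin (a * W \<omega>)) = (\<lambda>\<omega>. (sin (a * W \<omega> + 1 * S \<omega>) + sin (a * W \<omega> + (-1) * S \<omega>)) / 2 - c * sin (a * W \<omega>))"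
        by (simp add: fun_eq_iff sin_add sin_diff algebra_simps)
      then show "expectation (\<lambda>\<omega>. (cos (S \<omega>) - c) * sin (a * W \<omega>)) = 0"
        using IC(2)[of a 1] IC(2)[of a "-1"] IC(4)[of a] char(2)[of a 1] char(2)[of a "-1"] W0[of a] by simp
    qed
    moreover have "expectation (\<lambda>\<omega>. sin (S \<omega>) * indicator A (W \<omega>)) = 0"
    proof (rule fourier_determines_weight[OF _ Wm _ _ A])
      show "integrable M (\<lambda>\<omega>. sin (S \<omega>))" using IC by simp
      fix a
      have "(\<lambda>\<omega>. sin (S \<omega>) * cos (a * W \<omega>)) = (\<lambda>\<omega>. (sin (a * W \<omega> + 1 * S \<omega>) - sin (a * W \<omega> + (-1) * S \<omega>)) / 2)"
        by (simp add: fun_eq_iff sin_add sin_diff algebra_simps)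
      then show "expectation (\<lambda>\<omega>. sin (S \<omega>) * cos (a * W \<omega>)) = 0"
        using IC(2)[of a 1] IC(2)[of a "-1"] char(2)[of a 1] char(2)[of a "-1"] by simp
      have "(\<lambda>\<omega>. sin (S \<omega>) * sin (a * W \<omega>)) = (\<lambda>\<omega>. (cos (a * W \<omega> + (-1) * S \<omega>) - cos (a * W \<omega> + 1 * S \<omega>)) / 2)"
        by (simp add: fun_eq_iff cos_add cos_diff algebra_simps)
      then show "expectation (\<lambda>\<omega>. sin (S \<omega>) * sin (a * W \<omega>)) = 0"
        using IC(1)[of a 1] IC(1)[of a "-1"] char(1)[of a 1] char(1)[of a "-1"] by simp
    qed
    moreover have IA: "integrable M (\<lambda>\<omega>. indicator A (W \<omega>) * cos (S \<omega>))" "integrable M (\<lambda>\<omega>. indicator A (W \<omega>) * sin (S \<omega>))"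
      "integrable M (\<lambda>\<omega>. indicator A (W \<omega>) :: real)"
      by (intro bi; auto simp: indicator_def)+
    ultimately show ?thesis
      using IC(5,6) s0 by (simp add: S_def[symmetric] left_diff_distrib mult.commute[of "cos _"] mult.commute[of "sin _"] p_def c_def)
  qed
  have Im: "integrable M (\<lambda>\<omega>. indicator A (W \<omega>) * (\<Prod>j\<in>J. indicator (B j) (Y j \<omega>)) :: real)"
    "integrable M (\<lambda>\<omega>. \<Prod>j\<in>J. indicator (B j) (Y j \<omega>) :: real)"
  proof -
    have P: "\<bar>\<Prod>j\<in>J. indicator (B j) (Y j \<omega>) :: real\<bar> \<le> 1" for \<omega>
      by (subst abs_prod) (rule prod_le_1, auto simp: indicator_def)
    have [measurable]: "(\<lambda>\<omega>. \<Prod>j\<in>J. indicator (B j) (Y j \<omega>) :: real) \<in> borel_measurable M"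
    proof (rule borel_measurable_prod)
      fix j assume j: "j \<in> J"
      note [measurable] = Ym[OF j] B[OF j]
      show "(\<lambda>\<omega>. indicator (B j) (Y j \<omega>) :: real) \<in> borel_measurable M" by measurable
    qed
    show 2: "integrable M (\<lambda>\<omega>. \<Prod>j\<in>J. indicator (B j) (Y j \<omega>) :: real)"
      by (intro bi P) auto
    have "integrable M (\<lambda>\<omega>. (\<Prod>j\<in>J. indicator (B j) (Y j \<omega>)) * indicator A (W \<omega>) :: real)"
      by (rule integrable_bounded_mult[OF 2]) (auto simp: indicator_def)
    then show "integrable M (\<lambda>\<omega>. indicator A (W \<omega>) * (\<Prod>j\<in>J. indicator (B j) (Y j \<omega>)) :: real)"
      by (simp add: mult.commute)
  qed
  have "expectation (\<lambda>\<omega>. (indicator A (W \<omega>) - p) * (\<Prod>j\<in>J. indicator (B j) (Y j \<omega>))) = 0"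
  proof (rule fourier_determines_weight_finite[OF J _ Ym])
    show "integrable M (\<lambda>\<omega>. indicator A (W \<omega>) - p)"
      by (intro Bochner_Integration.integrable_diff integrable_const bi) (auto simp: indicator_def)
  qed (use main B in auto)
  then show ?thesis using Im by (simp add: left_diff_distrib p_def)
qed

section \<open>Gaussian integration by parts\<close>

text \<open>
  The product formula for rectangles determines the joint law of \<open>W\<close> and the vector of the \<open>Y j\<close>.
  It is used to integrate over \<open>W\<close> with the vector held fixed.
\<close>

lemma (in prob_space) gaussian_uncorrelated_pair_measure:
  fixes W :: "'a \<Rightarrow> real" and Y :: "'i \<Rightarrow> 'a \<Rightarrow> real"
  assumes J: "finite J"
    and G: "\<And>a b. centered_gaussian_rv M (\<lambda>\<omega>. a * W \<omega> + (\<Sum>j\<in>J. b j * Y j \<omega>))"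
    and Wm[measurable]: "W \<in> borel_measurable M" and Ym: "\<And>j. j \<in> J \<Longrightarrow> Y j \<in> borel_measurable M"
    and unc: "\<And>j. j \<in> J \<Longrightarrow> expectation (\<lambda>\<omega>. W \<omega> * Y j \<omega>) = 0"
  shows "distr M borel W \<Otimes>\<^sub>M distr M (Pi\<^sub>M J (\<lambda>_. borel)) (\<lambda>\<omega>. \<lambda>j\<in>J. Y j \<omega>) =
    distr M (borel \<Otimes>\<^sub>M Pi\<^sub>M J (\<lambda>_. borel)) (\<lambda>\<omega>. (W \<omega>, \<lambda>j\<in>J. Y j \<omega>))"
proof -
  define V where "V \<omega> = (\<lambda>j\<in>J. Y j \<omega>)" for \<omega>
  have Vm[measurable]: "V \<in> measurable M (Pi\<^sub>M J (\<lambda>_. borel))"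
    unfolding V_def[abs_def] using Ym by (intro measurable_restrict) auto
  have "distr M borel W \<Otimes>\<^sub>M distr M (Pi\<^sub>M J (\<lambda>_. borel)) V = distr M (borel \<Otimes>\<^sub>M Pi\<^sub>M J (\<lambda>_. borel)) (\<lambda>\<omega>. (W \<omega>, V \<omega>))"
  proof (rule pair_measure_eqI)
    interpret W: prob_space "distr M borel W" by (rule prob_space_distr) simp
    interpret V: prob_space "distr M (Pi\<^sub>M J (\<lambda>_. borel)) V" by (rule prob_space_distr) simp
    show "sigma_finite_measure (distr M borel W)" by unfold_locales
    show "sigma_finite_measure (distr M (Pi\<^sub>M J (\<lambda>_. borel)) V)" by unfold_locales
    show "sets (distr M borel W \<Otimes>\<^sub>M distr M (Pi\<^sub>M J (\<lambda>_. borel)) V) = sets (distr M (borel \<Otimes>\<^sub>M Pi\<^sub>M J (\<lambda>_. borel)) (\<lambda>\<omega>. (W \<omega>, V \<omega>)))"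
      by (simp cong: sets_pair_measure_cong)
    fix A B assume "A \<in> sets (distr M borel W)" "B \<in> sets (distr M (Pi\<^sub>M J (\<lambda>_. borel)) V)"
    then have A[measurable]: "A \<in> sets borel" and B[measurable]: "B \<in> sets (Pi\<^sub>M J (\<lambda>_. borel))" by auto
    define \<mu>1 where "\<mu>1 = distr (density M (\<lambda>\<omega>. indicator A (W \<omega>))) (Pi\<^sub>M J (\<lambda>_. borel)) V"
    define \<mu>2 where "\<mu>2 = scale_measure (emeasure (distr M borel W) A) (distr M (Pi\<^sub>M J (\<lambda>_. borel)) V)"
    have e1: "emeasure \<mu>1 C = (\<integral>\<^sup>+\<omega>. indicator A (W \<omega>) * indicator C (V \<omega>) \<partial>M)" if [measurable]: "C \<in> sets (Pi\<^sub>M J (\<lambda>_. borel))" for C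
    proof -
      have "emeasure \<mu>1 C = emeasure (density M (\<lambda>\<omega>. indicator A (W \<omega>))) (V -` C \<inter> space M)"
        unfolding \<mu>1_def by (subst emeasure_distr) auto
      also have "\<dots> = (\<integral>\<^sup>+\<omega>. indicator A (W \<omega>) * indicator (V -` C \<inter> space M) \<omega> \<partial>M)"
        by (subst emeasure_density) auto
      also have "\<dots> = (\<integral>\<^sup>+\<omega>. indicator A (W \<omega>) * indicator C (V \<omega>) \<partial>M)"
        by (rule nn_integral_cong) (auto simp: indicator_def)
      finally show ?thesis .
    qed
    have e3: "emeasure (distr M borel W) A = (\<integral>\<^sup>+\<omega>. indicator A (W \<omega>) \<partial>M)"
      by (subst emeasure_distr) (auto simp: nn_integral_indicator[symmetric] simp del: nn_integral_indicator intro!: nn_integral_cong split: split_indicator)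
    have e4: "emeasure (distr M (Pi\<^sub>M J (\<lambda>_. borel)) V) C = (\<integral>\<^sup>+\<omega>. indicator C (V \<omega>) \<partial>M)" if [measurable]: "C \<in> sets (Pi\<^sub>M J (\<lambda>_. borel))" for C
      by (subst emeasure_distr) (auto simp: nn_integral_indicator[symmetric] simp del: nn_integral_indicator intro!: nn_integral_cong split: split_indicator)
    have "\<mu>1 = \<mu>2"
    proof (rule measure_eqI_PiM_finite[OF J])
      show "sets \<mu>1 = sets (Pi\<^sub>M J (\<lambda>_. borel))" "sets \<mu>2 = sets (Pi\<^sub>M J (\<lambda>_. borel))"
        by (simp_all add: \<mu>1_def \<mu>2_def)
      show "range (\<lambda>_::nat. space (Pi\<^sub>M J (\<lambda>_. borel :: real measure))) \<subseteq> prod_algebra J (\<lambda>_. borel)"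
        by (auto simp: space_PiM intro!: prod_algebraI_finite[OF J])
      show "(\<Union>i::nat. space (Pi\<^sub>M J (\<lambda>_. borel :: real measure))) = space (Pi\<^sub>M J (\<lambda>_. borel))" by simp
      have "emeasure \<mu>1 (space (Pi\<^sub>M J (\<lambda>_. borel))) \<le> (\<integral>\<^sup>+\<omega>. 1 \<partial>M)"
        by (subst e1[OF sets.top], rule nn_integral_mono) (auto simp: indicator_def)
      then show "emeasure \<mu>1 (space (Pi\<^sub>M J (\<lambda>_. borel))) \<noteq> \<infinity>"
        using emeasure_space_1 by (auto simp: top_unique)
      fix D :: "'i \<Rightarrow> real set" assume D: "\<And>i. i \<in> J \<Longrightarrow> D i \<in> sets borel"
      have Ds[measurable]: "Pi\<^sub>E J D \<in> sets (Pi\<^sub>M J (\<lambda>_. borel))"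
        using D by (intro sets_PiM_I_finite[OF J]) auto
      have ind: "indicator (Pi\<^sub>E J D) (V \<omega>) = (\<Prod>j\<in>J. indicator (D j) (Y j \<omega>) :: real)" for \<omega>
      proof (cases "\<forall>j\<in>J. Y j \<omega> \<in> D j")
        case True
        then show ?thesis by (simp add: V_def indicator_def)
      next
        case False
        then obtain j where j: "j \<in> J" "Y j \<omega> \<notin> D j" by blast
        then have "(\<Prod>j\<in>J. indicator (D j) (Y j \<omega>) :: real) = 0"
          using J by (intro prod_zero) (auto simp: indicator_def)
        moreover have "V \<omega> \<notin> Pi\<^sub>E J D" using j by (auto simp: V_def PiE_def Pi_def)
        ultimately show ?thesis by simp
      qed
      have "(\<integral>\<^sup>+\<omega>. indicator A (W \<omega>) * indicator (Pi\<^sub>E J D) (V \<omega>) \<partial>M) = (\<integral>\<^sup>+\<omega>. ennreal (indicator A (W \<omega>) * indicator (Pi\<^sub>E J D) (V \<omega>)) \<partial>M)"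
        by (rule nn_integral_cong) (auto simp: indicator_def)
      also have "\<dots> = ennreal (expectation (\<lambda>\<omega>. indicator A (W \<omega>) * indicator (Pi\<^sub>E J D) (V \<omega>)))"
        by (rule nn_integral_eq_integral) (auto intro!: integrable_const_bound[where B=1] simp: indicator_def)
      also have "\<dots> = ennreal (expectation (\<lambda>\<omega>. indicator A (W \<omega>)) * expectation (\<lambda>\<omega>. indicator (Pi\<^sub>E J D) (V \<omega>)))"
        using gaussian_uncorrelated_independent[OF J G Wm Ym unc A D] by (simp add: ind)
      also have "\<dots> = ennreal (expectation (\<lambda>\<omega>. indicator A (W \<omega>))) * ennreal (expectation (\<lambda>\<omega>. indicator (Pi\<^sub>E J D) (V \<omega>)))"
        by (rule ennreal_mult) auto
      also have "ennreal (expectation (\<lambda>\<omega>. indicator A (W \<omega>))) = (\<integral>\<^sup>+\<omega>. indicator A (W \<omega>) \<partial>M)"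
        by (subst nn_integral_eq_integral[symmetric]) (auto intro!: integrable_const_bound[where B=1] nn_integral_cong simp: indicator_def)
      also have "ennreal (expectation (\<lambda>\<omega>. indicator (Pi\<^sub>E J D) (V \<omega>))) = (\<integral>\<^sup>+\<omega>. indicator (Pi\<^sub>E J D) (V \<omega>) \<partial>M)"
        by (subst nn_integral_eq_integral[symmetric]) (auto intro!: integrable_const_bound[where B=1] nn_integral_cong simp: indicator_def)
      finally show "emeasure \<mu>1 (Pi\<^sub>E J D) = emeasure \<mu>2 (Pi\<^sub>E J D)"
        by (simp add: e1 e3 e4 \<mu>2_def)
    qed
    then have "emeasure \<mu>1 B = emeasure \<mu>2 B" by simp
    then have "emeasure (distr M borel W) A * emeasure (distr M (Pi\<^sub>M J (\<lambda>_. borel)) V) B = (\<integral>\<^sup>+\<omega>. indicator A (W \<omega>) * indicator B (V \<omega>) \<partial>M)"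
      by (simp add: e1 \<mu>2_def)
    also have "\<dots> = (\<integral>\<^sup>+\<omega>. indicator ((\<lambda>\<omega>. (W \<omega>, V \<omega>)) -` (A \<times> B) \<inter> space M) \<omega> \<partial>M)"
      by (rule nn_integral_cong) (auto simp: indicator_def)
    also have "\<dots> = emeasure (distr M (borel \<Otimes>\<^sub>M Pi\<^sub>M J (\<lambda>_. borel)) (\<lambda>\<omega>. (W \<omega>, V \<omega>))) (A \<times> B)"
      by (subst emeasure_distr) auto
    finally show "emeasure (distr M borel W) A * emeasure (distr M (Pi\<^sub>M J (\<lambda>_. borel)) V) B = emeasure (distr M (borel \<Otimes>\<^sub>M Pi\<^sub>M J (\<lambda>_. borel)) (\<lambda>\<omega>. (W \<omega>, V \<omega>))) (A \<times> B)" .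
  qed
  then show ?thesis by (simp add: V_def[abs_def])
qed

lemma (in prob_space) gaussian_fubini_eq:
  fixes W :: "'a \<Rightarrow> real" and Y :: "'i \<Rightarrow> 'a \<Rightarrow> real" and h1 h2 :: "real \<times> ('i \<Rightarrow> real) \<Rightarrow> real"
  assumes J: "finite J"
    and G: "\<And>a b. centered_gaussian_rv M (\<lambda>\<omega>. a * W \<omega> + (\<Sum>j\<in>J. b j * Y j \<omega>))"
    and Wm[measurable]: "W \<in> borel_measurable M" and Ym: "\<And>j. j \<in> J \<Longrightarrow> Y j \<in> borel_measurable M"
    and unc: "\<And>j. j \<in> J \<Longrightarrow> expectation (\<lambda>\<omega>. W \<omega> * Y j \<omega>) = 0"
    and hm[measurable]: "h1 \<in> borel_measurable (borel \<Otimes>\<^sub>M Pi\<^sub>M J (\<lambda>_. borel))" "h2 \<in> borel_measurable (borel \<Otimes>\<^sub>M Pi\<^sub>M J (\<lambda>_. borel))"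
    and I: "integrable M (\<lambda>\<omega>. h1 (W \<omega>, \<lambda>j\<in>J. Y j \<omega>))" "integrable M (\<lambda>\<omega>. h2 (W \<omega>, \<lambda>j\<in>J. Y j \<omega>))"
    and eq: "\<And>y. (\<integral>w. h1 (w, y) \<partial>distr M borel W) = (\<integral>w. h2 (w, y) \<partial>distr M borel W)"
  shows "expectation (\<lambda>\<omega>. h1 (W \<omega>, \<lambda>j\<in>J. Y j \<omega>)) = expectation (\<lambda>\<omega>. h2 (W \<omega>, \<lambda>j\<in>J. Y j \<omega>))"
proof -
  define V where "V \<omega> = (\<lambda>j\<in>J. Y j \<omega>)" for \<omega>
  have Vm[measurable]: "V \<in> measurable M (Pi\<^sub>M J (\<lambda>_. borel))"
    unfolding V_def[abs_def] using Ym by (intro measurable_restrict) auto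
  let ?D = "distr M (Pi\<^sub>M J (\<lambda>_. borel)) V"
  interpret W: prob_space "distr M borel W" by (rule prob_space_distr) simp
  interpret V: prob_space ?D by (rule prob_space_distr) simp
  interpret P: pair_prob_space "distr M borel W" ?D by unfold_locales
  have pm: "distr M borel W \<Otimes>\<^sub>M ?D = distr M (borel \<Otimes>\<^sub>M Pi\<^sub>M J (\<lambda>_. borel)) (\<lambda>\<omega>. (W \<omega>, V \<omega>))"
    using gaussian_uncorrelated_pair_measure[OF J G Wm Ym unc] by (simp add: V_def[abs_def])
  have *: "expectation (\<lambda>\<omega>. h (W \<omega>, V \<omega>)) = (\<integral>y. (\<integral>w. h (w, y) \<partial>distr M borel W) \<partial>?D)"
    if [measurable]: "h \<in> borel_measurable (borel \<Otimes>\<^sub>M Pi\<^sub>M J (\<lambda>_. borel))" and "integrable M (\<lambda>\<omega>. h (W \<omega>, V \<omega>))" for h :: "real \<times> ('i \<Rightarrow> real) \<Rightarrow> real"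
  proof -
    have "expectation (\<lambda>\<omega>. h (W \<omega>, V \<omega>)) = integral\<^sup>L (distr M borel W \<Otimes>\<^sub>M ?D) h"
      unfolding pm by (subst integral_distr) auto
    moreover have "integrable (distr M borel W \<Otimes>\<^sub>M ?D) h"
      unfolding pm using that by (subst integrable_distr_eq) auto
    ultimately show ?thesis using P.integral_snd[of "\<lambda>w y. h (w, y)"] by simp
  qed
  show ?thesis
    using *[of h1] *[of h2] hm I eq by (simp add: V_def[abs_def])
qed

lemma integrable_normal_polynomial:
  assumes "\<sigma> > 0" shows "integrable lborel (\<lambda>w. normal_density 0 \<sigma> w * (1 + \<bar>w\<bar>) ^ n)"
proof -
  have "integrable lborel (\<lambda>w. 2 ^ n * (normal_density 0 \<sigma> w * 1 + normal_density 0 \<sigma> w * \<bar>w - 0\<bar> ^ n))"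
    using assms by (intro integrable_mult_right Bochner_Integration.integrable_add integrable_normal_moment_abs integrable_mult_left) auto
  then show ?thesis
  proof (rule Bochner_Integration.integrable_bound)
    have b: "(1 + \<bar>w\<bar>) ^ n \<le> 2 ^ n * (1 + \<bar>w\<bar> ^ n)" for w :: real
    proof (cases "\<bar>w\<bar> \<le> 1")
      case True
      then have "(1 + \<bar>w\<bar>) ^ n \<le> 2 ^ n" by (intro power_mono) auto
      also have "\<dots> \<le> 2 ^ n * (1 + \<bar>w\<bar> ^ n)" by simp
      finally show ?thesis .
    next
      case False
      then have "(1 + \<bar>w\<bar>) ^ n \<le> (2 * \<bar>w\<bar>) ^ n" by (intro power_mono) auto
      also have "\<dots> \<le> 2 ^ n * (1 + \<bar>w\<bar> ^ n)" by (simp add: power_mult_distrib)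
      finally show ?thesis .
    qed
    have "normal_density 0 \<sigma> w * (1 + \<bar>w\<bar>) ^ n \<le> normal_density 0 \<sigma> w * (2 ^ n * (1 + \<bar>w\<bar> ^ n))" for w
      by (intro mult_left_mono b) auto
    then show "AE w in lborel. norm (normal_density 0 \<sigma> w * (1 + \<bar>w\<bar>) ^ n) \<le> norm (2 ^ n * (normal_density 0 \<sigma> w * 1 + normal_density 0 \<sigma> w * \<bar>w - 0\<bar> ^ n))"
      by (auto simp: abs_mult algebra_simps)
  qed simp
qed

text \<open>
  The difference of the two integrands is the derivative of
  \<open>\<sigma>\<^sup>2 * normal_density 0 \<sigma> w * k w\<close>, which vanishes at both ends under polynomial growth of \<open>k\<close>.
\<close>

lemma normal_density_ibp:
  fixes k k' :: "real \<Rightarrow> real"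
  assumes \<sigma>: "\<sigma> > 0" and k: "\<And>w. (k has_real_derivative k' w) (at w)" and ck': "continuous_on UNIV k'"
    and b: "\<And>w. \<bar>k w\<bar> \<le> C * (1 + \<bar>w\<bar>) ^ 3" and b': "\<And>w. \<bar>k' w\<bar> \<le> C * (1 + \<bar>w\<bar>) ^ 3"
  shows "(\<integral>w. normal_density 0 \<sigma> w * (w * k w) \<partial>lborel) = (\<integral>w. normal_density 0 \<sigma> w * (\<sigma>\<^sup>2 * k' w) \<partial>lborel)"
proof -
  have ck: "continuous_on UNIV k" by (rule DERIV_continuous_on[OF k])
  have [measurable]: "k \<in> borel_measurable borel" "k' \<in> borel_measurable borel"
    using ck ck' by (auto intro: borel_measurable_continuous_onI)
  have C0: "C \<ge> 0" using b[of 0] by simp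
  have bw: "\<bar>w * k w\<bar> \<le> C * (1 + \<bar>w\<bar>) ^ 4" for w
  proof -
    have "\<bar>w * k w\<bar> \<le> (1 + \<bar>w\<bar>) * (C * (1 + \<bar>w\<bar>) ^ 3)"
      unfolding abs_mult using b[of w] by (intro mult_mono) auto
    then show ?thesis by (simp add: eval_nat_numeral algebra_simps)
  qed
  have I1: "integrable lborel (\<lambda>w. normal_density 0 \<sigma> w * (w * k w))"
  proof (rule Bochner_Integration.integrable_bound[OF integrable_mult_right[OF integrable_normal_polynomial[OF \<sigma>, of 4], of C]])
    show "AE w in lborel. norm (normal_density 0 \<sigma> w * (w * k w)) \<le> norm (C * (normal_density 0 \<sigma> w * (1 + \<bar>w\<bar>) ^ 4))"
    proof (intro AE_I2)
      fix w
      have "normal_density 0 \<sigma> w * \<bar>w * k w\<bar> \<le> normal_density 0 \<sigma> w * (C * (1 + \<bar>w\<bar>) ^ 4)"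
        using bw[of w] by (intro mult_left_mono) auto
      then show "norm (normal_density 0 \<sigma> w * (w * k w)) \<le> norm (C * (normal_density 0 \<sigma> w * (1 + \<bar>w\<bar>) ^ 4))"
        using C0 by (simp add: abs_mult mult_ac)
    qed
  qed simp
  have I2: "integrable lborel (\<lambda>w. normal_density 0 \<sigma> w * k' w)"
  proof (rule Bochner_Integration.integrable_bound[OF integrable_mult_right[OF integrable_normal_polynomial[OF \<sigma>, of 3], of C]])
    show "AE w in lborel. norm (normal_density 0 \<sigma> w * k' w) \<le> norm (C * (normal_density 0 \<sigma> w * (1 + \<bar>w\<bar>) ^ 3))"
    proof (intro AE_I2)
      fix w
      have "normal_density 0 \<sigma> w * \<bar>k' w\<bar> \<le> normal_density 0 \<sigma> w * (C * (1 + \<bar>w\<bar>) ^ 3)"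
        using b'[of w] by (intro mult_left_mono) auto
      then show "norm (normal_density 0 \<sigma> w * k' w) \<le> norm (C * (normal_density 0 \<sigma> w * (1 + \<bar>w\<bar>) ^ 3))"
        using C0 by (simp add: abs_mult mult_ac)
    qed
  qed simp
  define f where "f w = normal_density 0 \<sigma> w * (\<sigma>\<^sup>2 * k' w) - normal_density 0 \<sigma> w * (w * k w)" for w
  have nd: "(normal_density 0 \<sigma> has_real_derivative - (w / \<sigma>\<^sup>2) * normal_density 0 \<sigma> w) (at w)" for w
  proof -
    define c where "c = 1 / sqrt (2 * pi * \<sigma>\<^sup>2)"
    define e where "e = 1 / (2 * \<sigma>\<^sup>2)"
    have eq: "normal_density 0 \<sigma> = (\<lambda>w. c * exp (- (e * w\<^sup>2)))"
      by (simp add: fun_eq_iff normal_density_def c_def e_def)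
    have "w / \<sigma>\<^sup>2 = 2 * e * w" by (simp add: e_def)
    then show ?thesis unfolding eq by (auto intro!: derivative_eq_intros)
  qed
  have "(\<integral>w. f w \<partial>lborel) = 0 - 0"
  proof (rule integral_derivative_real_line)
    show "((\<lambda>w. \<sigma>\<^sup>2 * (normal_density 0 \<sigma> w * k w)) has_real_derivative f w) (at w)" for w
    proof -
      have "((\<lambda>w. \<sigma>\<^sup>2 * (normal_density 0 \<sigma> w * k w)) has_real_derivative
          \<sigma>\<^sup>2 * ((- (w / \<sigma>\<^sup>2) * normal_density 0 \<sigma> w) * k w + k' w * normal_density 0 \<sigma> w)) (at w)"
        by (intro DERIV_cmult DERIV_mult nd k)
      moreover have "\<sigma>\<^sup>2 * ((- (w / \<sigma>\<^sup>2) * normal_density 0 \<sigma> w) * k w + k' w * normal_density 0 \<sigma> w) = f w"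
        unfolding f_def using \<sigma> by (simp add: algebra_simps)
      ultimately show ?thesis by simp
    qed
    have "continuous_on UNIV (normal_density 0 \<sigma>)" by (rule DERIV_continuous_on[OF nd])
    with ck ck' show "continuous_on UNIV f"
      unfolding f_def by (auto intro!: continuous_intros)
    show "integrable lborel f"
      unfolding f_def using I1 integrable_mult_right[OF I2, of "\<sigma>\<^sup>2"] by (simp add: mult_ac)
    have bd: "norm (\<sigma>\<^sup>2 * (normal_density 0 \<sigma> w * k w)) \<le> \<sigma>\<^sup>2 * (1 / sqrt (2 * pi * \<sigma>\<^sup>2) * exp (- w\<^sup>2 / (2 * \<sigma>\<^sup>2)) * (C * (1 + \<bar>w\<bar>) ^ 3))" for w
    proof -
      have "normal_density 0 \<sigma> w * \<bar>k w\<bar> \<le> normal_density 0 \<sigma> w * (C * (1 + \<bar>w\<bar>) ^ 3)"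
        using b[of w] by (intro mult_left_mono) auto
      then have "\<sigma>\<^sup>2 * (normal_density 0 \<sigma> w * \<bar>k w\<bar>) \<le> \<sigma>\<^sup>2 * (normal_density 0 \<sigma> w * (C * (1 + \<bar>w\<bar>) ^ 3))"
        by (rule mult_left_mono) simp
      then show ?thesis by (simp add: abs_mult normal_density_def del: mult_le_cancel_left_pos)
    qed
    have "((\<lambda>w. \<sigma>\<^sup>2 * (1 / sqrt (2 * pi * \<sigma>\<^sup>2) * exp (- w\<^sup>2 / (2 * \<sigma>\<^sup>2)) * (C * (1 + w) ^ 3))) \<longlongrightarrow> 0) at_top"
      using \<sigma> by real_asymp
    then have l1: "((\<lambda>w. \<sigma>\<^sup>2 * (1 / sqrt (2 * pi * \<sigma>\<^sup>2) * exp (- w\<^sup>2 / (2 * \<sigma>\<^sup>2)) * (C * (1 + \<bar>w\<bar>) ^ 3))) \<longlongrightarrow> 0) at_top"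
      by (rule Lim_transform_eventually) (use eventually_ge_at_top[of 0] in eventually_elim, simp)
    then show "((\<lambda>w. \<sigma>\<^sup>2 * (normal_density 0 \<sigma> w * k w)) \<longlongrightarrow> 0) at_top"
      by (rule Lim_null_comparison[OF always_eventually[OF allI[OF bd]]])
    have l2: "((\<lambda>w. \<sigma>\<^sup>2 * (1 / sqrt (2 * pi * \<sigma>\<^sup>2) * exp (- w\<^sup>2 / (2 * \<sigma>\<^sup>2)) * (C * (1 + \<bar>w\<bar>) ^ 3))) \<longlongrightarrow> 0) at_bot"
      using l1 by (simp add: filterlim_at_bot_mirror)
    then show "((\<lambda>w. \<sigma>\<^sup>2 * (normal_density 0 \<sigma> w * k w)) \<longlongrightarrow> 0) at_bot"
      by (rule Lim_null_comparison[OF always_eventually[OF allI[OF bd]]])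
  qed
  then show ?thesis
    unfolding f_def using I1 integrable_mult_right[OF I2, of "\<sigma>\<^sup>2"] by (simp add: mult_ac)
qed

lemma lipschitz_growth:
  fixes \<psi> \<psi>' :: "real \<Rightarrow> real"
  assumes "\<And>x. (\<psi> has_real_derivative \<psi>' x) (at x)" "\<And>x. x \<ge> 0 \<Longrightarrow> \<bar>\<psi>' x\<bar> \<le> K" "x \<ge> 0"
  shows "\<bar>\<psi> x\<bar> \<le> \<bar>\<psi> 0\<bar> + K * x"
proof -
  have "norm (\<psi> x - \<psi> 0) \<le> K * norm (x - 0)"
    by (rule field_differentiable_bound[of "{0..x}" \<psi> \<psi>' K]) (use assms in \<open>auto intro: DERIV_subset\<close>)
  then show ?thesis using assms(3) by simp
qed

lemma sum_squares_shift_growth: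
  fixes v y c :: "'i \<Rightarrow> real" and w :: real
  assumes "\<And>i. i \<in> I \<Longrightarrow> v i \<ge> 0"
  shows "(\<Sum>i\<in>I. v i * (y i + c i * w)\<^sup>2) \<le> (\<Sum>i\<in>I. v i * (\<bar>y i\<bar> + \<bar>c i\<bar>)\<^sup>2) * (1 + \<bar>w\<bar>)\<^sup>2"
  unfolding sum_distrib_right
proof (intro sum_mono)
  fix i assume i: "i \<in> I"
  have "\<bar>y i + c i * w\<bar> \<le> \<bar>y i\<bar> + \<bar>c i\<bar> * \<bar>w\<bar>" by (metis abs_mult abs_triangle_ineq)
  also have "\<dots> \<le> (\<bar>y i\<bar> + \<bar>c i\<bar>) * (1 + \<bar>w\<bar>)" by (simp add: algebra_simps)
  finally have "(y i + c i * w)\<^sup>2 \<le> ((\<bar>y i\<bar> + \<bar>c i\<bar>) * (1 + \<bar>w\<bar>))\<^sup>2"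
    by (metis abs_ge_zero power2_abs power_mono)
  then have "v i * (y i + c i * w)\<^sup>2 \<le> v i * ((\<bar>y i\<bar> + \<bar>c i\<bar>) * (1 + \<bar>w\<bar>))\<^sup>2"
    using assms[OF i] by (intro mult_left_mono)
  then show "v i * (y i + c i * w)\<^sup>2 \<le> v i * (\<bar>y i\<bar> + \<bar>c i\<bar>)\<^sup>2 * (1 + \<bar>w\<bar>)\<^sup>2"
    by (simp add: power_mult_distrib mult.assoc)
qed

text \<open>
  A Gaussian vector is given by its finite index set; degenerate covariance is allowed, as grid values
  of a Gaussian path may well be linearly dependent.
\<close>

locale gaussian_vector = prob_space M for M :: "'a measure" +
  fixes I :: "'i set" and X :: "'i \<Rightarrow> 'a \<Rightarrow> real"
  assumes finI: "finite I"
    and gauss: "\<And>a. centered_gaussian_rv M (\<lambda>\<omega>. \<Sum>i\<in>I. a i * X i \<omega>)"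
begin

definition cov :: "'i \<Rightarrow> 'i \<Rightarrow> real" where
  "cov i j = expectation (\<lambda>\<omega>. X i \<omega> * X j \<omega>)"

lemma gauss_component: "i \<in> I \<Longrightarrow> centered_gaussian_rv M (X i)"
proof -
  assume "i \<in> I"
  then have "(\<Sum>j\<in>I. (if j = i then 1 else 0) * X j \<omega>) = X i \<omega>" for \<omega>
    using finI by (simp add: if_distrib[of "\<lambda>x. x * _"] cong: if_cong)
  then show ?thesis using gauss[of "\<lambda>j. if j = i then 1 else 0"] by simp
qed

lemma measurable_component[measurable]: "i \<in> I \<Longrightarrow> X i \<in> borel_measurable M"
  using gauss_component centered_gaussian_rv_measurable by blast

text \<open>
  All integrands below are dominated by powers of this variable, which has all moments.
\<close>

definition total :: "'a \<Rightarrow> real" where "total \<omega> = 1 + (\<Sum>i\<in>I. \<bar>X i \<omega>\<bar>)"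

lemma total_ge_1: "1 \<le> total \<omega>"
  by (simp add: total_def sum_nonneg)

lemma total_measurable[measurable]: "total \<in> borel_measurable M"
  unfolding total_def[abs_def] by measurable

lemma abs_le_total: "i \<in> I \<Longrightarrow> \<bar>X i \<omega>\<bar> \<le> total \<omega>"
  unfolding total_def using member_le_sum[of i I "\<lambda>i. \<bar>X i \<omega>\<bar>"] finI by simp

lemma integrable_total_power: "integrable M (\<lambda>\<omega>. total \<omega> ^ k)"
proof (rule Bochner_Integration.integrable_bound)
  show "integrable M (\<lambda>\<omega>. (1 + real (card I)) ^ k * (1 + (\<Sum>i\<in>I. \<bar>X i \<omega>\<bar> ^ k)))"
    using gaussian_integrable_power(1)[OF gauss_component] by (intro integrable_mult_right Bochner_Integration.integrable_add) auto
  have "total \<omega> ^ k \<le> (1 + real (card I)) ^ k * (1 + (\<Sum>i\<in>I. \<bar>X i \<omega>\<bar> ^ k))" for \<omega>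
  proof -
    define m where "m = Max (insert 1 ((\<lambda>i. \<bar>X i \<omega>\<bar>) ` I))"
    have m1: "1 \<le> m" "\<And>i. i \<in> I \<Longrightarrow> \<bar>X i \<omega>\<bar> \<le> m"
      unfolding m_def using finI by auto
    have "m \<in> insert 1 ((\<lambda>i. \<bar>X i \<omega>\<bar>) ` I)"
      unfolding m_def using finI by (intro Max_in) auto
    then have mk: "m ^ k \<le> 1 + (\<Sum>i\<in>I. \<bar>X i \<omega>\<bar> ^ k)"
    proof
      assume "m = 1" then show ?thesis by (simp add: sum_nonneg)
    next
      assume "m \<in> (\<lambda>i. \<bar>X i \<omega>\<bar>) ` I"
      then obtain i where "i \<in> I" "m = \<bar>X i \<omega>\<bar>" by blast
      then show ?thesis using member_le_sum[of i I "\<lambda>i. \<bar>X i \<omega>\<bar> ^ k"] finI by simp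
    qed
    have "total \<omega> \<le> 1 + (\<Sum>i\<in>I. m)"
      unfolding total_def using m1 by (intro add_left_mono sum_mono) auto
    also have "\<dots> \<le> (1 + real (card I)) * m" using m1 by (simp add: algebra_simps)
    finally have "total \<omega> ^ k \<le> ((1 + real (card I)) * m) ^ k"
      using total_ge_1[of \<omega>] by (intro power_mono) auto
    also have "\<dots> = (1 + real (card I)) ^ k * m ^ k" by (rule power_mult_distrib)
    also have "\<dots> \<le> (1 + real (card I)) ^ k * (1 + (\<Sum>i\<in>I. \<bar>X i \<omega>\<bar> ^ k))"
      using mk by (intro mult_left_mono) auto
    finally show ?thesis .
  qed
  then show "AE \<omega> in M. norm (total \<omega> ^ k) \<le> norm ((1 + real (card I)) ^ k * (1 + (\<Sum>i\<in>I. \<bar>X i \<omega>\<bar> ^ k)))"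
    using total_ge_1 by (intro AE_I2) (smt (verit) abs_of_nonneg real_norm_def zero_le_power)
qed simp

lemma integrable_poly_bound:
  assumes "f \<in> borel_measurable M" "\<And>\<omega>. \<bar>f \<omega>\<bar> \<le> C * total \<omega> ^ k"
  shows "integrable M f"
  by (rule Bochner_Integration.integrable_bound[OF integrable_mult_right[OF integrable_total_power[of k], of C]])
    (use assms in \<open>auto intro!: AE_I2 order_trans[OF _ abs_ge_self]\<close>)

end

locale gaussian_quadratic = gaussian_vector M I X for M :: "'a measure" and I :: "'i set" and X +
  fixes v :: "'i \<Rightarrow> real"
  assumes v_nonneg: "\<And>i. i \<in> I \<Longrightarrow> v i \<ge> 0"
begin

definition F :: "'a \<Rightarrow> real" where "F \<omega> = (\<Sum>i\<in>I. v i * (X i \<omega>)\<^sup>2)"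

lemma F_nonneg: "F \<omega> \<ge> 0"
  unfolding F_def using v_nonneg by (intro sum_nonneg) auto

lemma F_measurable[measurable]: "F \<in> borel_measurable M"
  unfolding F_def[abs_def] by measurable

lemma F_le_total: "F \<omega> \<le> (\<Sum>i\<in>I. v i) * total \<omega> ^ 2"
  unfolding F_def sum_distrib_right
proof (intro sum_mono mult_left_mono)
  fix i assume "i \<in> I"
  then show "(X i \<omega>)\<^sup>2 \<le> (total \<omega>)\<^sup>2" using power_mono[OF abs_le_total, of i \<omega> 2] by simp
qed (use v_nonneg in auto)

lemma integrable_quadratic_weight:
  fixes \<phi> :: "real \<Rightarrow> real"
  assumes [measurable]: "\<phi> \<in> borel_measurable borel" and \<phi>: "\<forall>x\<ge>0. \<bar>\<phi> x\<bar> \<le> A + K * x" and K: "K \<ge> 0"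
  shows "integrable M (\<lambda>\<omega>. \<phi> (F \<omega>))"
    and "i \<in> I \<Longrightarrow> j \<in> I \<Longrightarrow> integrable M (\<lambda>\<omega>. X i \<omega> * X j \<omega> * \<phi> (F \<omega>))"
proof -
  define V where "V = (\<Sum>i\<in>I. v i)"
  have A: "A \<ge> 0" using \<phi> by (auto dest: spec[of _ 0])
  have b: "\<bar>\<phi> (F \<omega>)\<bar> \<le> (A + K * V) * total \<omega> ^ 2" for \<omega>
  proof -
    have "\<bar>\<phi> (F \<omega>)\<bar> \<le> A * 1 + K * F \<omega>" using \<phi> F_nonneg[of \<omega>] by auto
    also have "\<dots> \<le> A * total \<omega> ^ 2 + K * (V * total \<omega> ^ 2)"
      using F_le_total[of \<omega>] K A total_ge_1[of \<omega>] by (intro add_mono mult_left_mono) (auto simp: V_def)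
    finally show ?thesis by (simp add: algebra_simps)
  qed
  show "integrable M (\<lambda>\<omega>. \<phi> (F \<omega>))"
    by (rule integrable_poly_bound[OF _ b]) simp
  assume i: "i \<in> I" and j: "j \<in> I"
  show "integrable M (\<lambda>\<omega>. X i \<omega> * X j \<omega> * \<phi> (F \<omega>))"
  proof (rule integrable_poly_bound[where k=4 and C="A + K * V"])
    show "(\<lambda>\<omega>. X i \<omega> * X j \<omega> * \<phi> (F \<omega>)) \<in> borel_measurable M" using i j by measurable
    show "\<bar>X i \<omega> * X j \<omega> * \<phi> (F \<omega>)\<bar> \<le> (A + K * V) * total \<omega> ^ 4" for \<omega>
    proof -
      have "\<bar>X i \<omega> * X j \<omega> * \<phi> (F \<omega>)\<bar> \<le> total \<omega> * total \<omega> * ((A + K * V) * total \<omega> ^ 2)"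
        unfolding abs_mult using abs_le_total[OF i, of \<omega>] abs_le_total[OF j, of \<omega>] b[of \<omega>] total_ge_1[of \<omega>]
        by (intro mult_mono) auto
      then show ?thesis by (simp add: eval_nat_numeral mult_ac)
    qed
  qed
qed

text \<open>
  Gaussian integration by parts for a function of the quadratic form \<open>F\<close>.  Write
  \<open>X i = Y i + c i * X s\<close>, where \<open>c i\<close> is the regression coefficient, so that the vector of the \<open>Y i\<close> is
  uncorrelated with \<open>X s\<close> and hence independent of it.  With \<open>y\<close> for the values of the \<open>Y i\<close>, the claim
  reduces to integration by parts in the single real variable \<open>w = X s\<close>.
  If \<open>X s\<close> has variance zero, both sides vanish.
\<close>

theorem gaussian_ibp:
  fixes \<psi> \<psi>' :: "real \<Rightarrow> real"
  assumes \<psi>: "\<And>x. (\<psi> has_real_derivative \<psi>' x) (at x)" and c\<psi>': "continuous_on UNIV \<psi>'"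
    and K: "\<And>x. x \<ge> 0 \<Longrightarrow> \<bar>\<psi>' x\<bar> \<le> K"
    and s: "s \<in> I" and t: "t \<in> I"
  shows "expectation (\<lambda>\<omega>. X s \<omega> * X t \<omega> * \<psi> (F \<omega>)) =
    cov s t * expectation (\<lambda>\<omega>. \<psi> (F \<omega>)) + 2 * (\<Sum>i\<in>I. v i * cov s i * expectation (\<lambda>\<omega>. X t \<omega> * X i \<omega> * \<psi>' (F \<omega>)))"
proof (cases "cov s s = 0")
  case True
  have "integrable M (\<lambda>\<omega>. (X s \<omega>)\<^sup>2)" using gaussian_integrable_power(2)[OF gauss_component[OF s], of 2] .
  then have X0: "AE \<omega> in M. X s \<omega> = 0"
    using True by (intro AE_zero_if_second_moment_zero) (auto simp: cov_def power2_eq_square)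
  have [measurable]: "\<psi> \<in> borel_measurable borel"
    by (rule borel_measurable_continuous_onI[OF DERIV_continuous_on[OF \<psi>]])
  note [measurable] = measurable_component[OF s] measurable_component[OF t]
  have c0: "cov s i = 0" if i: "i \<in> I" for i
  proof -
    note [measurable] = measurable_component[OF i]
    have "cov s i = expectation (\<lambda>\<omega>. 0)"
      unfolding cov_def by (rule integral_cong_AE) (use X0 in \<open>auto elim!: eventually_mono\<close>)
    then show ?thesis by simp
  qed
  have "expectation (\<lambda>\<omega>. X s \<omega> * X t \<omega> * \<psi> (F \<omega>)) = expectation (\<lambda>\<omega>. 0)"
    by (rule integral_cong_AE) (use X0 in \<open>auto elim!: eventually_mono\<close>)
  then show ?thesis using c0 t by simp
next
  case False
  have sqs: "integrable M (\<lambda>\<omega>. (X i \<omega>)\<^sup>2)" if "i \<in> I" for i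
    using gaussian_integrable_power(2)[OF gauss_component[OF that], of 2] .
  have Icov: "integrable M (\<lambda>\<omega>. X i \<omega> * X j \<omega>)" if "i \<in> I" "j \<in> I" for i j
    using that by (intro integrable_mult_of_squares sqs) auto
  have css: "cov s s = expectation (\<lambda>\<omega>. (X s \<omega>)\<^sup>2)" by (simp add: cov_def power2_eq_square)
  then have "cov s s \<ge> 0" by simp
  with False have pos: "cov s s > 0" by simp
  define c where "c i = cov s i / cov s s" for i
  define Y where "Y i \<omega> = X i \<omega> - c i * X s \<omega>" for i \<omega>
  have Ym[measurable]: "Y i \<in> borel_measurable M" if "i \<in> I" for i
    unfolding Y_def[abs_def] using that s by measurable
  note [measurable] = measurable_component[OF s]
  have cont\<psi>: "continuous_on UNIV \<psi>" by (rule DERIV_continuous_on[OF \<psi>])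
  have [measurable]: "\<psi> \<in> borel_measurable borel" "\<psi>' \<in> borel_measurable borel"
    using cont\<psi> c\<psi>' by (auto intro: borel_measurable_continuous_onI)
  define Q where "Q w y = (\<Sum>i\<in>I. v i * (y i + c i * w)\<^sup>2)" for w y
  define Q' where "Q' w y = (\<Sum>i\<in>I. v i * c i * (y i + c i * w))" for w y
  \<comment> \<open>\<open>h1\<close> and \<open>h2\<close> are the two integrands as functions of \<open>w\<close> and \<open>y\<close>; in these coordinates \<open>F\<close> is
    \<open>Q w y\<close>, its \<open>w\<close>-derivative is \<open>2 * Q' w y\<close>, and \<open>k'\<close> is the \<open>w\<close>-derivative of \<open>X t * \<psi> F\<close>.\<close>
  define h1 where "h1 = (\<lambda>(w, y). w * ((y t + c t * w) * \<psi> (Q w y)))"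
  define k' where "k' w y = c t * \<psi> (Q w y) + (y t + c t * w) * (\<psi>' (Q w y) * (2 * Q' w y))" for w y
  define h2 where "h2 = (\<lambda>(w, y). cov s s * k' w y)"
  have cm[measurable]: "(\<lambda>(p :: real \<times> ('i \<Rightarrow> real)). snd p i) \<in> borel_measurable (borel \<Otimes>\<^sub>M Pi\<^sub>M I (\<lambda>_. borel))" if "i \<in> I" for i
    by (rule measurable_compose[OF measurable_snd measurable_component_singleton[OF that, of "\<lambda>_. borel"]])
  have hm[measurable]: "h1 \<in> borel_measurable (borel \<Otimes>\<^sub>M Pi\<^sub>M I (\<lambda>_. borel))" "h2 \<in> borel_measurable (borel \<Otimes>\<^sub>M Pi\<^sub>M I (\<lambda>_. borel))"
    unfolding h1_def h2_def k'_def Q_def Q'_def case_prod_beta using t by measurable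
  have recon: "(\<lambda>j\<in>I. Y j \<omega>) i + c i * X s \<omega> = X i \<omega>" if "i \<in> I" for i \<omega>
    using that by (simp add: Y_def)
  have QF: "Q (X s \<omega>) (\<lambda>j\<in>I. Y j \<omega>) = F \<omega>" for \<omega>
    unfolding Q_def F_def using recon by (intro sum.cong) auto
  have Q'F: "Q' (X s \<omega>) (\<lambda>j\<in>I. Y j \<omega>) = (\<Sum>i\<in>I. v i * c i * X i \<omega>)" for \<omega>
    unfolding Q'_def using recon by (intro sum.cong) auto
  have h1X: "h1 (X s \<omega>, \<lambda>j\<in>I. Y j \<omega>) = X s \<omega> * X t \<omega> * \<psi> (F \<omega>)" for \<omega>
    by (simp only: h1_def case_prod_conv QF recon[OF t] mult.assoc)
  have h2X: "h2 (X s \<omega>, \<lambda>j\<in>I. Y j \<omega>) = cov s t * \<psi> (F \<omega>) + 2 * (\<Sum>i\<in>I. v i * cov s i * (X t \<omega> * X i \<omega> * \<psi>' (F \<omega>)))" for \<omega>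
  proof -
    have "h2 (X s \<omega>, \<lambda>j\<in>I. Y j \<omega>) = cov s s * c t * \<psi> (F \<omega>) + 2 * X t \<omega> * \<psi>' (F \<omega>) * (\<Sum>i\<in>I. (cov s s * c i) * v i * X i \<omega>)"
    proof -
      have "h2 (X s \<omega>, \<lambda>j\<in>I. Y j \<omega>) = cov s s * (c t * \<psi> (F \<omega>) + X t \<omega> * (\<psi>' (F \<omega>) * (2 * (\<Sum>i\<in>I. v i * c i * X i \<omega>))))"
        by (simp only: h2_def k'_def case_prod_conv QF Q'F recon[OF t])
      also have "\<dots> = cov s s * c t * \<psi> (F \<omega>) + 2 * X t \<omega> * \<psi>' (F \<omega>) * (cov s s * (\<Sum>i\<in>I. v i * c i * X i \<omega>))"
        by (simp add: distrib_left mult_ac)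
      also have "cov s s * (\<Sum>i\<in>I. v i * c i * X i \<omega>) = (\<Sum>i\<in>I. (cov s s * c i) * v i * X i \<omega>)"
        by (simp add: sum_distrib_left mult_ac)
      finally show ?thesis .
    qed
    also have "(\<Sum>i\<in>I. (cov s s * c i) * v i * X i \<omega>) = (\<Sum>i\<in>I. cov s i * v i * X i \<omega>)"
      using pos by (simp add: c_def)
    finally have eq: "h2 (X s \<omega>, \<lambda>j\<in>I. Y j \<omega>) = cov s s * c t * \<psi> (F \<omega>) + 2 * X t \<omega> * \<psi>' (F \<omega>) * (\<Sum>i\<in>I. cov s i * v i * X i \<omega>)" .
    show ?thesis unfolding eq using pos by (simp add: c_def sum_distrib_left mult_ac)
  qed
  have K0: "K \<ge> 0" using K[of 0] by simp
  have g\<psi>: "\<forall>x\<ge>0. \<bar>\<psi> x\<bar> \<le> \<bar>\<psi> 0\<bar> + K * x" using lipschitz_growth[OF \<psi> K] by blast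
  have g\<psi>': "\<forall>x\<ge>0. \<bar>\<psi>' x\<bar> \<le> K + 0 * x" using K by simp
  have I\<psi>: "integrable M (\<lambda>\<omega>. \<psi> (F \<omega>))"
    by (rule integrable_quadratic_weight(1)[OF _ g\<psi> K0]) simp
  have I1: "integrable M (\<lambda>\<omega>. X s \<omega> * X t \<omega> * \<psi> (F \<omega>))"
    by (rule integrable_quadratic_weight(2)[OF _ g\<psi> K0 s t]) simp
  have I2: "integrable M (\<lambda>\<omega>. X t \<omega> * X i \<omega> * \<psi>' (F \<omega>))" if i: "i \<in> I" for i
    by (rule integrable_quadratic_weight(2)[OF _ g\<psi>' order.refl t i]) simp
  have "expectation (\<lambda>\<omega>. h1 (X s \<omega>, \<lambda>j\<in>I. Y j \<omega>)) = expectation (\<lambda>\<omega>. h2 (X s \<omega>, \<lambda>j\<in>I. Y j \<omega>))"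
  proof (rule gaussian_fubini_eq[OF finI _ _ Ym _ hm])
    show "centered_gaussian_rv M (\<lambda>\<omega>. a * X s \<omega> + (\<Sum>j\<in>I. b j * Y j \<omega>))" for a b
    proof -
      define d where "d = a - (\<Sum>j\<in>I. b j * c j)"
      have "(\<Sum>i\<in>I. (b i + (if i = s then d else 0)) * X i \<omega>) = a * X s \<omega> + (\<Sum>j\<in>I. b j * Y j \<omega>)" for \<omega>
      proof -
        have "(\<Sum>i\<in>I. (b i + (if i = s then d else 0)) * X i \<omega>) = (\<Sum>i\<in>I. b i * X i \<omega>) + (\<Sum>i\<in>I. if i = s then d * X i \<omega> else 0)"
          by (simp add: sum.distrib[symmetric] distrib_right if_distrib[of "\<lambda>x. x * _"] cong: if_cong)
        also have "(\<Sum>i\<in>I. if i = s then d * X i \<omega> else 0) = d * X s \<omega>" using finI s by simp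
        also have "(\<Sum>i\<in>I. b i * X i \<omega>) = (\<Sum>i\<in>I. b i * Y i \<omega>) + (\<Sum>i\<in>I. b i * c i) * X s \<omega>"
          by (simp add: Y_def right_diff_distrib sum_subtractf sum_distrib_right mult.assoc)
        finally show ?thesis by (simp add: d_def algebra_simps)
      qed
      then show ?thesis using gauss[of "\<lambda>i. b i + (if i = s then d else 0)"] by simp
    qed
    show "expectation (\<lambda>\<omega>. X s \<omega> * Y j \<omega>) = 0" if j: "j \<in> I" for j
    proof -
      have "(\<lambda>\<omega>. X s \<omega> * Y j \<omega>) = (\<lambda>\<omega>. X s \<omega> * X j \<omega> - c j * (X s \<omega> * X s \<omega>))"
        by (simp add: Y_def fun_eq_iff algebra_simps)
      then show ?thesis using Icov[OF s j] Icov[OF s s] pos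
        by (simp add: cov_def[symmetric] c_def)
    qed
    show "integrable M (\<lambda>\<omega>. h1 (X s \<omega>, \<lambda>j\<in>I. Y j \<omega>))" using I1 by (simp add: h1X)
    show "integrable M (\<lambda>\<omega>. h2 (X s \<omega>, \<lambda>j\<in>I. Y j \<omega>))" unfolding h2X using I\<psi> I2 by simp
    fix y :: "'i \<Rightarrow> real"
    define \<sigma> where "\<sigma> = sqrt (cov s s)"
    have \<sigma>: "\<sigma> > 0" "\<sigma>\<^sup>2 = cov s s" using pos by (simp_all add: \<sigma>_def)
    have d: "distr M borel (X s) = density lborel (\<lambda>x. ennreal (normal_density 0 \<sigma> x))"
    proof -
      have "distr M lborel (X s) = density lborel (\<lambda>x. ennreal (normal_density 0 \<sigma> x))"
        using distributed_distr_eq_density[OF distributed_gaussian[OF gauss_component[OF s]]] pos css by (simp add: \<sigma>_def)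
      moreover have "distr M lborel (X s) = distr M borel (X s)" by (rule distr_cong) auto
      ultimately show ?thesis by simp
    qed
    have [measurable]: "(\<lambda>w. Q w y) \<in> borel_measurable borel" "(\<lambda>w. Q' w y) \<in> borel_measurable borel"
      unfolding Q_def Q'_def by measurable
    have int: "(\<integral>w. u w \<partial>distr M borel (X s)) = (\<integral>w. normal_density 0 \<sigma> w * u w \<partial>lborel)" if [measurable]: "u \<in> borel_measurable borel" for u :: "real \<Rightarrow> real"
      unfolding d by (subst integral_density) auto
    define B where "B = (\<Sum>i\<in>I. v i * (\<bar>y i\<bar> + \<bar>c i\<bar>)\<^sup>2)"
    define B' where "B' = (\<Sum>i\<in>I. v i * \<bar>c i\<bar> * (\<bar>y i\<bar> + \<bar>c i\<bar>))"
    have B0: "B \<ge> 0" "B' \<ge> 0" unfolding B_def B'_def using v_nonneg by (auto intro!: sum_nonneg)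
    have lin: "\<bar>y i + c i * w\<bar> \<le> (\<bar>y i\<bar> + \<bar>c i\<bar>) * (1 + \<bar>w\<bar>)" for i w
    proof -
      have "\<bar>y i + c i * w\<bar> \<le> \<bar>y i\<bar> + \<bar>c i\<bar> * \<bar>w\<bar>" by (metis abs_mult abs_triangle_ineq)
      also have "\<dots> \<le> (\<bar>y i\<bar> + \<bar>c i\<bar>) * (1 + \<bar>w\<bar>)" by (simp add: algebra_simps)
      finally show ?thesis .
    qed
    have Q0: "Q w y \<ge> 0" for w unfolding Q_def using v_nonneg by (intro sum_nonneg) auto
    have QB: "Q w y \<le> B * (1 + \<bar>w\<bar>)\<^sup>2" for w
      unfolding Q_def B_def by (rule sum_squares_shift_growth[OF v_nonneg])
    have Q'B: "\<bar>Q' w y\<bar> \<le> B' * (1 + \<bar>w\<bar>)" for w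
    proof -
      have "\<bar>Q' w y\<bar> \<le> (\<Sum>i\<in>I. \<bar>v i * c i * (y i + c i * w)\<bar>)" unfolding Q'_def by (rule sum_abs)
      also have "\<dots> \<le> (\<Sum>i\<in>I. v i * \<bar>c i\<bar> * ((\<bar>y i\<bar> + \<bar>c i\<bar>) * (1 + \<bar>w\<bar>)))"
        unfolding abs_mult using lin v_nonneg by (intro sum_mono mult_mono) auto
      finally show ?thesis by (simp add: B'_def sum_distrib_right mult.assoc)
    qed
    have \<psi>Q: "\<bar>\<psi> (Q w y)\<bar> \<le> (\<bar>\<psi> 0\<bar> + K * B) * (1 + \<bar>w\<bar>)\<^sup>2" for w
    proof -
      have "\<bar>\<psi> (Q w y)\<bar> \<le> \<bar>\<psi> 0\<bar> * 1 + K * Q w y" using lipschitz_growth[OF \<psi> K Q0, of w] by simp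
      also have "\<dots> \<le> \<bar>\<psi> 0\<bar> * (1 + \<bar>w\<bar>)\<^sup>2 + K * (B * (1 + \<bar>w\<bar>)\<^sup>2)"
        using QB[of w] K0 by (intro add_mono mult_left_mono) auto
      finally show ?thesis by (simp add: algebra_simps)
    qed
    define D where "D = max ((\<bar>y t\<bar> + \<bar>c t\<bar>) * (\<bar>\<psi> 0\<bar> + K * B)) (\<bar>c t\<bar> * (\<bar>\<psi> 0\<bar> + K * B) + (\<bar>y t\<bar> + \<bar>c t\<bar>) * (K * (2 * B')))"
    have pw: "(1 + \<bar>w\<bar>) ^ 3 = (1 + \<bar>w\<bar>) * (1 + \<bar>w\<bar>)\<^sup>2" "(1 + \<bar>w\<bar>)\<^sup>2 \<le> (1 + \<bar>w\<bar>) ^ 3" for w :: real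
      by (simp add: eval_nat_numeral) (rule power_increasing, auto)
    have "(\<integral>w. normal_density 0 \<sigma> w * (w * ((y t + c t * w) * \<psi> (Q w y))) \<partial>lborel) = (\<integral>w. normal_density 0 \<sigma> w * (\<sigma>\<^sup>2 * k' w y) \<partial>lborel)"
    proof (rule normal_density_ibp[OF \<sigma>(1)])
      have Qd: "((\<lambda>w. Q w y) has_real_derivative 2 * Q' w y) (at w)" for w
        unfolding Q_def Q'_def by (auto intro!: derivative_eq_intros simp: sum_distrib_left mult_ac)
      show "((\<lambda>w. (y t + c t * w) * \<psi> (Q w y)) has_real_derivative k' w y) (at w)" for w
        unfolding k'_def
        by (auto intro!: derivative_eq_intros DERIV_chain2[OF \<psi>] Qd)
      show "continuous_on UNIV (\<lambda>w. k' w y)"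
        unfolding k'_def Q_def Q'_def
        by (intro continuous_intros continuous_on_compose2[OF cont\<psi>] continuous_on_compose2[OF c\<psi>']) auto
      show "\<bar>(y t + c t * w) * \<psi> (Q w y)\<bar> \<le> D * (1 + \<bar>w\<bar>) ^ 3" for w
      proof -
        have "\<bar>(y t + c t * w) * \<psi> (Q w y)\<bar> \<le> ((\<bar>y t\<bar> + \<bar>c t\<bar>) * (1 + \<bar>w\<bar>)) * ((\<bar>\<psi> 0\<bar> + K * B) * (1 + \<bar>w\<bar>)\<^sup>2)"
          unfolding abs_mult using lin[of t w] \<psi>Q[of w] by (intro mult_mono) auto
        also have "\<dots> = ((\<bar>y t\<bar> + \<bar>c t\<bar>) * (\<bar>\<psi> 0\<bar> + K * B)) * (1 + \<bar>w\<bar>) ^ 3" by (simp add: pw(1))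
        also have "\<dots> \<le> D * (1 + \<bar>w\<bar>) ^ 3" unfolding D_def by (intro mult_right_mono) auto
        finally show ?thesis .
      qed
      show "\<bar>k' w y\<bar> \<le> D * (1 + \<bar>w\<bar>) ^ 3" for w
      proof -
        have a: "\<bar>c t * \<psi> (Q w y)\<bar> \<le> \<bar>c t\<bar> * (\<bar>\<psi> 0\<bar> + K * B) * (1 + \<bar>w\<bar>) ^ 3"
        proof -
          have "\<bar>c t * \<psi> (Q w y)\<bar> \<le> \<bar>c t\<bar> * ((\<bar>\<psi> 0\<bar> + K * B) * (1 + \<bar>w\<bar>)\<^sup>2)"
            unfolding abs_mult using \<psi>Q[of w] by (intro mult_left_mono) auto
          also have "\<dots> \<le> \<bar>c t\<bar> * ((\<bar>\<psi> 0\<bar> + K * B) * (1 + \<bar>w\<bar>) ^ 3)"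
            using pw(2)[of w] K0 B0 by (intro mult_left_mono) auto
          finally show ?thesis by (simp add: mult_ac)
        qed
        have b: "\<bar>(y t + c t * w) * (\<psi>' (Q w y) * (2 * Q' w y))\<bar> \<le> (\<bar>y t\<bar> + \<bar>c t\<bar>) * (K * (2 * B')) * (1 + \<bar>w\<bar>) ^ 3"
        proof -
          have "\<bar>(y t + c t * w) * (\<psi>' (Q w y) * (2 * Q' w y))\<bar> \<le> ((\<bar>y t\<bar> + \<bar>c t\<bar>) * (1 + \<bar>w\<bar>)) * (K * (2 * (B' * (1 + \<bar>w\<bar>))))"
            unfolding abs_mult using lin[of t w] K[OF Q0, of w] Q'B[of w] K0 B0 by (intro mult_mono) auto
          also have "\<dots> = (\<bar>y t\<bar> + \<bar>c t\<bar>) * (K * (2 * B')) * (1 + \<bar>w\<bar>)\<^sup>2" by (simp add: power2_eq_square)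
          also have "\<dots> \<le> (\<bar>y t\<bar> + \<bar>c t\<bar>) * (K * (2 * B')) * (1 + \<bar>w\<bar>) ^ 3"
            using pw(2)[of w] K0 B0 by (intro mult_left_mono) auto
          finally show ?thesis .
        qed
        have "\<bar>k' w y\<bar> \<le> (\<bar>c t\<bar> * (\<bar>\<psi> 0\<bar> + K * B) + (\<bar>y t\<bar> + \<bar>c t\<bar>) * (K * (2 * B'))) * (1 + \<bar>w\<bar>) ^ 3"
          unfolding k'_def distrib_right[of _ _ "(1 + \<bar>w\<bar>) ^ 3"]
          by (rule order_trans[OF abs_triangle_ineq add_mono[OF a b]])
        also have "\<dots> \<le> D * (1 + \<bar>w\<bar>) ^ 3" unfolding D_def by (intro mult_right_mono) auto
        finally show ?thesis .
      qed
    qed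
    then show "(\<integral>w. h1 (w, y) \<partial>distr M borel (X s)) = (\<integral>w. h2 (w, y) \<partial>distr M borel (X s))"
      unfolding h1_def h2_def k'_def case_prod_conv \<sigma>(2) by (subst (1 2) int) (auto simp: mult.assoc)
  qed (use s in auto)
  then have "expectation (\<lambda>\<omega>. X s \<omega> * X t \<omega> * \<psi> (F \<omega>)) = expectation (\<lambda>\<omega>. cov s t * \<psi> (F \<omega>) + 2 * (\<Sum>i\<in>I. v i * cov s i * (X t \<omega> * X i \<omega> * \<psi>' (F \<omega>))))"
    unfolding h1X h2X .
  also have "\<dots> = cov s t * expectation (\<lambda>\<omega>. \<psi> (F \<omega>)) + 2 * (\<Sum>i\<in>I. v i * cov s i * expectation (\<lambda>\<omega>. X t \<omega> * X i \<omega> * \<psi>' (F \<omega>)))"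
    using I\<psi> I2 by (simp add: Bochner_Integration.integral_sum)
  finally show ?thesis .
qed

end

section \<open>Quadratic forms in Gaussian vectors\<close>

context gaussian_quadratic
begin

lemma integrable_XX: "i \<in> I \<Longrightarrow> j \<in> I \<Longrightarrow> integrable M (\<lambda>\<omega>. X i \<omega> * X j \<omega>)"
  using integrable_quadratic_weight(2)[of "\<lambda>x. 1" 1 0] by simp

text \<open>
  Let \<open>S\<close> be the covariance matrix, scaled on both sides by the square roots of the weights.  Then
  \<open>mean\<close> is the trace of \<open>S\<close>, \<open>hs2\<close> is the trace of its square (the squared Hilbert-Schmidt norm) and
  \<open>tr3\<close> the trace of its cube.  \<open>Q\<close> and \<open>Q2\<close> are the quadratic forms of \<open>S\<close> and of its square in the
  scaled vector, whose expectations are \<open>hs2\<close> and \<open>tr3\<close>; up to constants, the variance of \<open>F\<close> is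
  \<open>hs2\<close> and its third cumulant is \<open>tr3\<close>.
\<close>

definition mean :: real where "mean = (\<Sum>i\<in>I. v i * cov i i)"
definition hs2 :: real where "hs2 = (\<Sum>i\<in>I. \<Sum>j\<in>I. v i * v j * (cov i j)\<^sup>2)"
definition tr3 :: real where "tr3 = (\<Sum>i\<in>I. \<Sum>j\<in>I. \<Sum>k\<in>I. v i * v j * v k * (cov i j * cov i k * cov j k))"
definition Q :: "'a \<Rightarrow> real" where "Q \<omega> = (\<Sum>i\<in>I. \<Sum>j\<in>I. v i * v j * cov i j * (X i \<omega> * X j \<omega>))"
definition Q2 :: "'a \<Rightarrow> real" where "Q2 \<omega> = (\<Sum>i\<in>I. v i * (\<Sum>j\<in>I. v j * cov i j * X j \<omega>)\<^sup>2)"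

lemma mean_eq: "expectation F = mean"
  unfolding F_def[abs_def] mean_def cov_def
  using integrable_XX by (subst Bochner_Integration.integral_sum) (auto simp: power2_eq_square)

text \<open>
  Cauchy-Schwarz for the Hilbert-Schmidt inner product of \<open>S\<close> with the rank-one matrix of the scaled
  vector, whose Hilbert-Schmidt norm is \<open>F\<close>.  Because of this bound, the Poincare inequality below
  contains only the first power of \<open>F\<close>.
\<close>

lemma abs_Q_le: "\<bar>Q \<omega>\<bar> \<le> sqrt hs2 * F \<omega>"
proof -
  define a where "a = (\<lambda>(i, j). sqrt (v i * v j) * cov i j)"
  define b where "b = (\<lambda>(i, j). sqrt (v i * v j) * (X i \<omega> * X j \<omega>))"
  have sq: "sqrt (v i * v j) * sqrt (v i * v j) = v i * v j" if "i \<in> I" "j \<in> I" for i j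
    using that v_nonneg by simp
  have Q: "Q \<omega> = (\<Sum>p\<in>I \<times> I. a p * b p)"
    unfolding Q_def sum.cartesian_product a_def b_def
  proof (intro sum.cong refl)
    fix p assume "p \<in> I \<times> I"
    then obtain i j where p: "p = (i, j)" "i \<in> I" "j \<in> I" by auto
    have "v i * v j * cov i j * (X i \<omega> * X j \<omega>) = (sqrt (v i * v j) * sqrt (v i * v j)) * (cov i j * (X i \<omega> * X j \<omega>))"
      unfolding sq[OF p(2,3)] by simp
    then show "(case p of (i, j) \<Rightarrow> v i * v j * cov i j * (X i \<omega> * X j \<omega>)) = (case p of (i, j) \<Rightarrow> sqrt (v i * v j) * cov i j) * (case p of (i, j) \<Rightarrow> sqrt (v i * v j) * (X i \<omega> * X j \<omega>))"
      unfolding p(1) case_prod_conv by (simp only: mult_ac)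
  qed
  have A: "(\<Sum>p\<in>I \<times> I. (a p)\<^sup>2) = hs2"
    unfolding hs2_def sum.cartesian_product a_def
    by (intro sum.cong refl) (use v_nonneg in \<open>auto simp: power_mult_distrib\<close>)
  have B: "(\<Sum>p\<in>I \<times> I. (b p)\<^sup>2) = (F \<omega>)\<^sup>2"
    unfolding F_def power2_eq_square[of "sum _ _"] sum_product sum.cartesian_product b_def
    by (intro sum.cong refl) (use v_nonneg in \<open>auto simp: power_mult_distrib mult_ac\<close>)
  have "(Q \<omega>)\<^sup>2 \<le> hs2 * (F \<omega>)\<^sup>2"
    using Cauchy_Schwarz_ineq_sum[of a b "I \<times> I"] by (simp add: Q A B)
  then have "sqrt ((Q \<omega>)\<^sup>2) \<le> sqrt (hs2 * (F \<omega>)\<^sup>2)" by (rule real_sqrt_le_mono)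
  then show ?thesis using F_nonneg[of \<omega>] by (simp add: real_sqrt_mult)
qed

lemma Q2_nonneg: "Q2 \<omega> \<ge> 0"
  unfolding Q2_def using v_nonneg by (intro sum_nonneg) auto

lemma Q2_eq: "Q2 \<omega> = (\<Sum>i\<in>I. \<Sum>j\<in>I. \<Sum>k\<in>I. v i * v j * v k * (cov i j * cov i k) * (X j \<omega> * X k \<omega>))"
  unfolding Q2_def power2_eq_square sum_product by (simp add: sum_distrib_left mult_ac)

lemma Q2_mean: "integrable M Q2" "expectation Q2 = tr3"
proof -
  have eq: "Q2 = (\<lambda>\<omega>. \<Sum>i\<in>I. \<Sum>j\<in>I. \<Sum>k\<in>I. v i * v j * v k * (cov i j * cov i k) * (X j \<omega> * X k \<omega>))"
    using Q2_eq by auto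
  show "integrable M Q2" unfolding eq using integrable_XX by (intro Bochner_Integration.integrable_sum integrable_mult_right)
  show "expectation Q2 = tr3"
    unfolding eq tr3_def using integrable_XX
    by (simp add: Bochner_Integration.integral_sum cov_def[symmetric] mult.assoc)
qed

lemma integral_Q_weight:
  assumes [measurable]: "\<phi> \<in> borel_measurable borel" and \<phi>: "\<forall>x\<ge>0. \<bar>\<phi> x\<bar> \<le> A + K * x" and K: "K \<ge> 0"
  shows "integrable M (\<lambda>\<omega>. Q \<omega> * \<phi> (F \<omega>))"
    "expectation (\<lambda>\<omega>. Q \<omega> * \<phi> (F \<omega>)) = (\<Sum>i\<in>I. \<Sum>j\<in>I. v i * v j * cov i j * expectation (\<lambda>\<omega>. X i \<omega> * X j \<omega> * \<phi> (F \<omega>)))"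
    "integrable M (\<lambda>\<omega>. Q2 \<omega> * \<phi> (F \<omega>))"
    "expectation (\<lambda>\<omega>. Q2 \<omega> * \<phi> (F \<omega>)) = (\<Sum>i\<in>I. \<Sum>j\<in>I. \<Sum>k\<in>I. v i * v j * v k * (cov i j * cov i k) * expectation (\<lambda>\<omega>. X j \<omega> * X k \<omega> * \<phi> (F \<omega>)))"
proof -
  note I2 = integrable_quadratic_weight(2)[OF assms]
  have e1: "(\<lambda>\<omega>. Q \<omega> * \<phi> (F \<omega>)) = (\<lambda>\<omega>. \<Sum>i\<in>I. \<Sum>j\<in>I. v i * v j * cov i j * (X i \<omega> * X j \<omega> * \<phi> (F \<omega>)))"
    by (simp add: Q_def sum_distrib_right mult.assoc)
  have e2: "(\<lambda>\<omega>. Q2 \<omega> * \<phi> (F \<omega>)) = (\<lambda>\<omega>. \<Sum>i\<in>I. \<Sum>j\<in>I. \<Sum>k\<in>I. v i * v j * v k * (cov i j * cov i k) * (X j \<omega> * X k \<omega> * \<phi> (F \<omega>)))"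
    by (simp add: Q2_eq sum_distrib_right mult.assoc)
  show "integrable M (\<lambda>\<omega>. Q \<omega> * \<phi> (F \<omega>))" "integrable M (\<lambda>\<omega>. Q2 \<omega> * \<phi> (F \<omega>))"
    unfolding e1 e2 using I2 by (intro Bochner_Integration.integrable_sum integrable_mult_right; simp)+
  show "expectation (\<lambda>\<omega>. Q \<omega> * \<phi> (F \<omega>)) = (\<Sum>i\<in>I. \<Sum>j\<in>I. v i * v j * cov i j * expectation (\<lambda>\<omega>. X i \<omega> * X j \<omega> * \<phi> (F \<omega>)))"
    "expectation (\<lambda>\<omega>. Q2 \<omega> * \<phi> (F \<omega>)) = (\<Sum>i\<in>I. \<Sum>j\<in>I. \<Sum>k\<in>I. v i * v j * v k * (cov i j * cov i k) * expectation (\<lambda>\<omega>. X j \<omega> * X k \<omega> * \<phi> (F \<omega>)))"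
    unfolding e1 e2 using I2 by (simp_all add: Bochner_Integration.integral_sum)
qed

text \<open>
  Integration by parts at each diagonal entry \<open>(X i)\<^sup>2\<close>.  Applied once more, to \<open>Q\<close> in place of \<open>F\<close>,
  it produces the next power of the covariance matrix.
\<close>

lemma centered_F_ibp:
  fixes \<psi> \<psi>' :: "real \<Rightarrow> real"
  assumes \<psi>: "\<And>x. (\<psi> has_real_derivative \<psi>' x) (at x)" and c\<psi>': "continuous_on UNIV \<psi>'"
    and K: "\<forall>x\<ge>0. \<bar>\<psi>' x\<bar> \<le> K"
  shows "integrable M (\<lambda>\<omega>. (F \<omega> - mean) * \<psi> (F \<omega>))"
    and "expectation (\<lambda>\<omega>. (F \<omega> - mean) * \<psi> (F \<omega>)) = 2 * expectation (\<lambda>\<omega>. Q \<omega> * \<psi>' (F \<omega>))"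
proof -
  have K0: "K \<ge> 0" using K by (auto dest: spec[of _ 0])
  have m: "\<psi> \<in> borel_measurable borel" "\<psi>' \<in> borel_measurable borel"
    using DERIV_continuous_on[OF \<psi>] c\<psi>' by (auto intro: borel_measurable_continuous_onI)
  have K': "\<bar>\<psi>' x\<bar> \<le> K" if "x \<ge> 0" for x using K that by blast
  have g: "\<forall>x\<ge>0. \<bar>\<psi> x\<bar> \<le> \<bar>\<psi> 0\<bar> + K * x" using lipschitz_growth[OF \<psi> K'] by blast
  have ibp: "expectation (\<lambda>\<omega>. X s \<omega> * X t \<omega> * \<psi> (F \<omega>)) =
    cov s t * expectation (\<lambda>\<omega>. \<psi> (F \<omega>)) + 2 * (\<Sum>i\<in>I. v i * cov s i * expectation (\<lambda>\<omega>. X t \<omega> * X i \<omega> * \<psi>' (F \<omega>)))"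
    if "s \<in> I" "t \<in> I" for s t by (rule gaussian_ibp[OF \<psi> c\<psi>' K' that])
  have g': "\<forall>x\<ge>0. \<bar>\<psi>' x\<bar> \<le> K + 0 * x" using K by simp
  note Ip = integrable_quadratic_weight[OF m(1) g K0]
  have eq: "(\<lambda>\<omega>. (F \<omega> - mean) * \<psi> (F \<omega>)) = (\<lambda>\<omega>. \<Sum>i\<in>I. v i * (X i \<omega> * X i \<omega> * \<psi> (F \<omega>)) - v i * cov i i * \<psi> (F \<omega>))"
    by (simp add: F_def mean_def sum_subtractf left_diff_distrib sum_distrib_right power2_eq_square mult.assoc)
  show "integrable M (\<lambda>\<omega>. (F \<omega> - mean) * \<psi> (F \<omega>))"
    unfolding eq using Ip by (intro Bochner_Integration.integrable_sum Bochner_Integration.integrable_diff integrable_mult_right) auto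
  have "expectation (\<lambda>\<omega>. (F \<omega> - mean) * \<psi> (F \<omega>)) = (\<Sum>i\<in>I. v i * expectation (\<lambda>\<omega>. X i \<omega> * X i \<omega> * \<psi> (F \<omega>)) - v i * cov i i * expectation (\<lambda>\<omega>. \<psi> (F \<omega>)))"
    unfolding eq using Ip by (subst Bochner_Integration.integral_sum) auto
  also have "\<dots> = (\<Sum>i\<in>I. v i * (2 * (\<Sum>j\<in>I. v j * cov i j * expectation (\<lambda>\<omega>. X i \<omega> * X j \<omega> * \<psi>' (F \<omega>)))))"
  proof (intro sum.cong refl)
    fix i assume i: "i \<in> I"
    show "v i * expectation (\<lambda>\<omega>. X i \<omega> * X i \<omega> * \<psi> (F \<omega>)) - v i * cov i i * expectation (\<lambda>\<omega>. \<psi> (F \<omega>)) = v i * (2 * (\<Sum>j\<in>I. v j * cov i j * expectation (\<lambda>\<omega>. X i \<omega> * X j \<omega> * \<psi>' (F \<omega>))))"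
      unfolding ibp[OF i i] by (simp add: algebra_simps)
  qed
  also have "\<dots> = 2 * expectation (\<lambda>\<omega>. Q \<omega> * \<psi>' (F \<omega>))"
    unfolding integral_Q_weight(2)[OF m(2) g' order.refl] by (simp add: sum_distrib_left mult_ac)
  finally show "expectation (\<lambda>\<omega>. (F \<omega> - mean) * \<psi> (F \<omega>)) = 2 * expectation (\<lambda>\<omega>. Q \<omega> * \<psi>' (F \<omega>))" .
qed

lemma Q_ibp:
  fixes \<psi> \<psi>' :: "real \<Rightarrow> real"
  assumes \<psi>: "\<And>x. (\<psi> has_real_derivative \<psi>' x) (at x)" and c\<psi>': "continuous_on UNIV \<psi>'"
    and K: "\<forall>x\<ge>0. \<bar>\<psi>' x\<bar> \<le> K"
  shows "expectation (\<lambda>\<omega>. Q \<omega> * \<psi> (F \<omega>)) = hs2 * expectation (\<lambda>\<omega>. \<psi> (F \<omega>)) + 2 * expectation (\<lambda>\<omega>. Q2 \<omega> * \<psi>' (F \<omega>))"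
proof -
  have K0: "K \<ge> 0" using K by (auto dest: spec[of _ 0])
  have m: "\<psi> \<in> borel_measurable borel" "\<psi>' \<in> borel_measurable borel"
    using DERIV_continuous_on[OF \<psi>] c\<psi>' by (auto intro: borel_measurable_continuous_onI)
  have K': "\<bar>\<psi>' x\<bar> \<le> K" if "x \<ge> 0" for x using K that by blast
  have g: "\<forall>x\<ge>0. \<bar>\<psi> x\<bar> \<le> \<bar>\<psi> 0\<bar> + K * x" using lipschitz_growth[OF \<psi> K'] by blast
  have ibp: "expectation (\<lambda>\<omega>. X s \<omega> * X t \<omega> * \<psi> (F \<omega>)) =
    cov s t * expectation (\<lambda>\<omega>. \<psi> (F \<omega>)) + 2 * (\<Sum>i\<in>I. v i * cov s i * expectation (\<lambda>\<omega>. X t \<omega> * X i \<omega> * \<psi>' (F \<omega>)))"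
    if "s \<in> I" "t \<in> I" for s t by (rule gaussian_ibp[OF \<psi> c\<psi>' K' that])
  have g': "\<forall>x\<ge>0. \<bar>\<psi>' x\<bar> \<le> K + 0 * x" using K by simp
  have "expectation (\<lambda>\<omega>. Q \<omega> * \<psi> (F \<omega>)) = (\<Sum>i\<in>I. \<Sum>j\<in>I. v i * v j * cov i j * expectation (\<lambda>\<omega>. X i \<omega> * X j \<omega> * \<psi> (F \<omega>)))"
    by (rule integral_Q_weight(2)[OF m(1) g K0])
  also have "\<dots> = (\<Sum>i\<in>I. \<Sum>j\<in>I. v i * v j * (cov i j)\<^sup>2 * expectation (\<lambda>\<omega>. \<psi> (F \<omega>)) +
      2 * (\<Sum>k\<in>I. v i * v j * v k * (cov i j * cov i k) * expectation (\<lambda>\<omega>. X j \<omega> * X k \<omega> * \<psi>' (F \<omega>))))"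
  proof (intro sum.cong refl)
    fix i j assume ij: "i \<in> I" "j \<in> I"
    show "v i * v j * cov i j * expectation (\<lambda>\<omega>. X i \<omega> * X j \<omega> * \<psi> (F \<omega>)) = v i * v j * (cov i j)\<^sup>2 * expectation (\<lambda>\<omega>. \<psi> (F \<omega>)) +
      2 * (\<Sum>k\<in>I. v i * v j * v k * (cov i j * cov i k) * expectation (\<lambda>\<omega>. X j \<omega> * X k \<omega> * \<psi>' (F \<omega>)))"
      unfolding ibp[OF ij] by (simp add: power2_eq_square distrib_left sum_distrib_left mult_ac)
  qed
  also have "\<dots> = hs2 * expectation (\<lambda>\<omega>. \<psi> (F \<omega>)) + 2 * expectation (\<lambda>\<omega>. Q2 \<omega> * \<psi>' (F \<omega>))"
    unfolding integral_Q_weight(4)[OF m(2) g' order.refl] hs2_def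
    by (simp add: sum.distrib sum_distrib_left sum_distrib_right)
  finally show ?thesis .
qed

text \<open>
  A weighted Poincare inequality in \<open>L\<^sup>1\<close>: no square of \<open>\<psi>'\<close> occurs on the right.  That is what later
  allows only the first moment of the second derivative of the estimating function to enter.
\<close>

theorem quadratic_form_poincare:
  fixes \<psi> \<psi>' :: "real \<Rightarrow> real"
  assumes \<psi>: "\<And>x. (\<psi> has_real_derivative \<psi>' x) (at x)" and c\<psi>': "continuous_on UNIV \<psi>'"
    and K: "\<forall>x\<ge>0. \<bar>\<psi>' x\<bar> \<le> K"
  shows "\<bar>expectation (\<lambda>\<omega>. (F \<omega> - mean) * \<psi> (F \<omega>))\<bar> \<le> 2 * sqrt hs2 * expectation (\<lambda>\<omega>. F \<omega> * \<bar>\<psi>' (F \<omega>)\<bar>)"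
proof -
  have K0: "K \<ge> 0" using K by (auto dest: spec[of _ 0])
  have m[measurable]: "\<psi>' \<in> borel_measurable borel"
    using c\<psi>' by (auto intro: borel_measurable_continuous_onI)
  have g': "\<forall>x\<ge>0. \<bar>\<psi>' x\<bar> \<le> K + 0 * x" using K by simp
  have IQ: "integrable M (\<lambda>\<omega>. Q \<omega> * \<psi>' (F \<omega>))" by (rule integral_Q_weight(1)[OF m g' order.refl])
  have IF: "integrable M (\<lambda>\<omega>. F \<omega> * \<bar>\<psi>' (F \<omega>)\<bar>)"
    by (rule integrable_quadratic_weight(1)[of "\<lambda>x. x * \<bar>\<psi>' x\<bar>" 0 K])
      (use K K0 in \<open>auto simp: abs_mult mult_left_mono mult.commute\<close>)
  have "\<bar>expectation (\<lambda>\<omega>. (F \<omega> - mean) * \<psi> (F \<omega>))\<bar> = 2 * \<bar>expectation (\<lambda>\<omega>. Q \<omega> * \<psi>' (F \<omega>))\<bar>"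
    unfolding centered_F_ibp(2)[OF assms] by simp
  also have "\<dots> \<le> 2 * expectation (\<lambda>\<omega>. \<bar>Q \<omega> * \<psi>' (F \<omega>)\<bar>)"
    using integral_abs_bound by simp
  also have "expectation (\<lambda>\<omega>. \<bar>Q \<omega> * \<psi>' (F \<omega>)\<bar>) \<le> expectation (\<lambda>\<omega>. sqrt hs2 * (F \<omega> * \<bar>\<psi>' (F \<omega>)\<bar>))"
  proof (rule integral_mono)
    show "\<bar>Q \<omega> * \<psi>' (F \<omega>)\<bar> \<le> sqrt hs2 * (F \<omega> * \<bar>\<psi>' (F \<omega>)\<bar>)" for \<omega>
      unfolding abs_mult mult.assoc[symmetric] by (rule mult_right_mono[OF abs_Q_le]) simp
  qed (use IQ IF in auto)
  finally show ?thesis by simp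
qed

lemma variance_F: "integrable M (\<lambda>\<omega>. (F \<omega> - mean)\<^sup>2)" "expectation (\<lambda>\<omega>. (F \<omega> - mean)\<^sup>2) = 2 * hs2"
proof -
  have d: "((\<lambda>x. x - mean) has_real_derivative (\<lambda>x. 1) x) (at x)" for x :: real
    by (auto intro!: derivative_eq_intros)
  have c: "continuous_on UNIV (\<lambda>x::real. 1::real)" by simp
  have d1: "((\<lambda>x. 1) has_real_derivative (\<lambda>x. 0) x) (at x)" for x :: real by simp
  have c1: "continuous_on UNIV (\<lambda>x::real. 0::real)" by simp
  show "integrable M (\<lambda>\<omega>. (F \<omega> - mean)\<^sup>2)"
    using centered_F_ibp(1)[OF d c, of 1] by (simp add: power2_eq_square)
  have "expectation (\<lambda>\<omega>. (F \<omega> - mean)\<^sup>2) = 2 * expectation (\<lambda>\<omega>. Q \<omega> * 1)"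
    using centered_F_ibp(2)[OF d c, of 1] by (simp add: power2_eq_square)
  also have "expectation (\<lambda>\<omega>. Q \<omega> * 1) = hs2"
    using Q_ibp[OF d1 c1, of 0] by (simp add: prob_space)
  finally show "expectation (\<lambda>\<omega>. (F \<omega> - mean)\<^sup>2) = 2 * hs2" .
qed

text \<open>
  Stein's method.  The expectation of the left-hand side of Stein's equation at the normalised \<open>F\<close> is
  evaluated by two integrations by parts: the first leaves \<open>Q\<close> where the variance should be, the
  second replaces \<open>Q\<close> by its mean \<open>hs2\<close>, which cancels exactly, at the cost of \<open>Q2\<close> times the second
  derivative of Stein's solution.  As \<open>Q2\<close> is nonnegative with mean \<open>tr3\<close>, the error is at most a multiple of
  the third cumulant of the normalised form, without any fourth cumulant.
\<close>

theorem quadratic_form_clt: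
  fixes h h' :: "real \<Rightarrow> real"
  assumes h: "\<And>x. (h has_real_derivative h' x) (at x)" and h': "\<And>x. \<bar>h' x\<bar> \<le> 1"
    and ch': "continuous_on UNIV h'" and pos: "hs2 > 0"
  shows "\<bar>expectation (\<lambda>\<omega>. h ((F \<omega> - mean) / sqrt (2 * hs2))) - normal_mean h\<bar>
    \<le> 48 * tr3 / sqrt (2 * hs2) ^ 3"
proof -
  define \<sigma> where "\<sigma> = sqrt (2 * hs2)"
  have \<sigma>: "\<sigma> > 0" "\<sigma>\<^sup>2 = 2 * hs2" using pos by (simp_all add: \<sigma>_def)
  define c where "c = normal_mean h"
  obtain f f' f'' where f: "\<And>x. (f has_real_derivative f' x) (at x)" "\<And>x. (f' has_real_derivative f'' x) (at x)"
    "continuous_on UNIV f''" "\<And>x. f' x - x * f x = h x - c"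
    "\<And>x. \<bar>f x\<bar> \<le> 3" "\<And>x. \<bar>f' x\<bar> \<le> 8" "\<And>x. \<bar>f'' x\<bar> \<le> 12"
    by (rule stein_solution[OF h h' ch', folded c_def]) blast
  define Y where "Y x = (x - mean) / \<sigma>" for x
  have Y': "(Y has_real_derivative 1 / \<sigma>) (at x)" for x
    unfolding Y_def using \<sigma>(1) by (auto intro!: derivative_eq_intros)
  have d1: "((\<lambda>x. f (Y x)) has_real_derivative f' (Y x) / \<sigma>) (at x)" for x
    using DERIV_chain2[OF f(1) Y'] by simp
  have d2: "((\<lambda>x. f' (Y x) / \<sigma>) has_real_derivative f'' (Y x) / \<sigma>\<^sup>2) (at x)" for x
    using DERIV_cdivide[OF DERIV_chain2[OF f(2) Y'], of \<sigma>] by (simp add: power2_eq_square)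
  have cf': "continuous_on UNIV f'" by (rule DERIV_continuous_on[OF f(2)])
  have cY: "continuous_on UNIV Y" by (rule DERIV_continuous_on[OF Y'])
  have c1: "continuous_on UNIV (\<lambda>x. f' (Y x) / \<sigma>)"
    using \<sigma> by (intro continuous_intros continuous_on_compose2[OF cf' cY]) auto
  have c2: "continuous_on UNIV (\<lambda>x. f'' (Y x) / \<sigma>\<^sup>2)"
    using \<sigma> by (intro continuous_intros continuous_on_compose2[OF f(3) cY]) auto
  have b1: "\<forall>x\<ge>0. \<bar>f' (Y x) / \<sigma>\<bar> \<le> 8 / \<sigma>" using f(6) \<sigma> by (simp add: divide_right_mono)
  have b2': "\<bar>f'' (Y x) / \<sigma>\<^sup>2\<bar> \<le> 12 / \<sigma>\<^sup>2" for x using f(7)[of "Y x"] \<sigma>(1) by (simp add: divide_right_mono)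
  then have b2: "\<forall>x\<ge>0. \<bar>f'' (Y x) / \<sigma>\<^sup>2\<bar> \<le> 12 / \<sigma>\<^sup>2" by blast
  have [measurable]: "f \<in> borel_measurable borel" "f' \<in> borel_measurable borel" "f'' \<in> borel_measurable borel" "Y \<in> borel_measurable borel"
    using DERIV_continuous_on[OF f(1)] cf' f(3) cY by (auto intro: borel_measurable_continuous_onI)
  have If': "integrable M (\<lambda>\<omega>. f' (Y (F \<omega>)))"
    by (rule integrable_const_bound[of _ 8]) (use f(6) in auto)
  have I1: "integrable M (\<lambda>\<omega>. (F \<omega> - mean) * f (Y (F \<omega>)))" by (rule centered_F_ibp(1)[OF d1 c1 b1])
  have "expectation (\<lambda>\<omega>. h (Y (F \<omega>))) = expectation (\<lambda>\<omega>. c + f' (Y (F \<omega>)) - (F \<omega> - mean) * f (Y (F \<omega>)) / \<sigma>)"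
    using f(4) by (intro Bochner_Integration.integral_cong) (auto simp: Y_def algebra_simps)
  also have "\<dots> = c + expectation (\<lambda>\<omega>. f' (Y (F \<omega>))) - expectation (\<lambda>\<omega>. (F \<omega> - mean) * f (Y (F \<omega>))) / \<sigma>"
    using If' I1 by (simp add: prob_space)
  also have "expectation (\<lambda>\<omega>. (F \<omega> - mean) * f (Y (F \<omega>))) = 2 * expectation (\<lambda>\<omega>. Q \<omega> * (f' (Y (F \<omega>)) / \<sigma>))"
    by (rule centered_F_ibp(2)[OF d1 c1 b1])
  also have "expectation (\<lambda>\<omega>. Q \<omega> * (f' (Y (F \<omega>)) / \<sigma>)) = hs2 * expectation (\<lambda>\<omega>. f' (Y (F \<omega>)) / \<sigma>) + 2 * expectation (\<lambda>\<omega>. Q2 \<omega> * (f'' (Y (F \<omega>)) / \<sigma>\<^sup>2))"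
    by (rule Q_ibp[OF d2 c2 b2])
  also have "expectation (\<lambda>\<omega>. f' (Y (F \<omega>)) / \<sigma>) = expectation (\<lambda>\<omega>. f' (Y (F \<omega>))) / \<sigma>" by simp
  finally have Eh: "expectation (\<lambda>\<omega>. h (Y (F \<omega>))) = c + expectation (\<lambda>\<omega>. f' (Y (F \<omega>)))
    - 2 * (hs2 * (expectation (\<lambda>\<omega>. f' (Y (F \<omega>))) / \<sigma>) + 2 * expectation (\<lambda>\<omega>. Q2 \<omega> * (f'' (Y (F \<omega>)) / \<sigma>\<^sup>2))) / \<sigma>" .
  \<comment> \<open>the terms with the expectation \<open>a\<close> of \<open>f'\<close> cancel because \<open>\<sigma>\<^sup>2 = 2 * hs2\<close>\<close>
  have alg: "c + a - 2 * (hs2 * (a / \<sigma>) + 2 * q) / \<sigma> - c = - 4 / \<sigma> * q" for a q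
  proof -
    have "2 * (hs2 * (a / \<sigma>) + 2 * q) / \<sigma> = (2 * hs2) / \<sigma>\<^sup>2 * a + 4 / \<sigma> * q"
      using \<sigma>(1) by (simp add: power2_eq_square add_divide_distrib)
    then show ?thesis using \<sigma> pos by simp
  qed
  have eq: "expectation (\<lambda>\<omega>. h (Y (F \<omega>))) - c = - 4 / \<sigma> * expectation (\<lambda>\<omega>. Q2 \<omega> * (f'' (Y (F \<omega>)) / \<sigma>\<^sup>2))"
    unfolding Eh by (rule alg)
  have IQ: "integrable M (\<lambda>\<omega>. Q2 \<omega> * (f'' (Y (F \<omega>)) / \<sigma>\<^sup>2))"
    by (rule integral_Q_weight(3)[of "\<lambda>x. f'' (Y x) / \<sigma>\<^sup>2" "12 / \<sigma>\<^sup>2" 0]) (use b2 in auto)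
  have "\<bar>expectation (\<lambda>\<omega>. Q2 \<omega> * (f'' (Y (F \<omega>)) / \<sigma>\<^sup>2))\<bar> \<le> expectation (\<lambda>\<omega>. \<bar>Q2 \<omega> * (f'' (Y (F \<omega>)) / \<sigma>\<^sup>2)\<bar>)"
    by (rule integral_abs_bound)
  also have "\<dots> \<le> expectation (\<lambda>\<omega>. Q2 \<omega> * (12 / \<sigma>\<^sup>2))"
  proof (rule integral_mono)
    show "\<bar>Q2 \<omega> * (f'' (Y (F \<omega>)) / \<sigma>\<^sup>2)\<bar> \<le> Q2 \<omega> * (12 / \<sigma>\<^sup>2)" for \<omega>
      unfolding abs_mult abs_of_nonneg[OF Q2_nonneg] using b2' Q2_nonneg by (intro mult_left_mono)
    show "integrable M (\<lambda>\<omega>. \<bar>Q2 \<omega> * (f'' (Y (F \<omega>)) / \<sigma>\<^sup>2)\<bar>)" by (rule integrable_abs[OF IQ])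
    show "integrable M (\<lambda>\<omega>. Q2 \<omega> * (12 / \<sigma>\<^sup>2))" by (rule integrable_mult_left) (use Q2_mean in auto)
  qed
  also have "\<dots> = 12 / \<sigma>\<^sup>2 * tr3" using Q2_mean by simp
  finally have *: "\<bar>expectation (\<lambda>\<omega>. Q2 \<omega> * (f'' (Y (F \<omega>)) / \<sigma>\<^sup>2))\<bar> \<le> 12 / \<sigma>\<^sup>2 * tr3" .
  have "\<bar>expectation (\<lambda>\<omega>. h (Y (F \<omega>))) - c\<bar> = 4 / \<sigma> * \<bar>expectation (\<lambda>\<omega>. Q2 \<omega> * (f'' (Y (F \<omega>)) / \<sigma>\<^sup>2))\<bar>"
    unfolding eq using \<sigma> by (simp add: abs_mult)
  also have "\<dots> \<le> 4 / \<sigma> * (12 / \<sigma>\<^sup>2 * tr3)"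
    using * \<sigma> by (intro mult_left_mono) auto
  also have "\<dots> = 48 * tr3 / \<sigma> ^ 3" by (simp add: eval_nat_numeral)
  finally show ?thesis by (simp add: Y_def c_def \<sigma>_def)
qed

text \<open>
  Convexity of the fourth power, as two applications of Cauchy-Schwarz.  The bound does not depend on
  the number of variables, so it gives uniform integrability along refining grids.
\<close>

lemma fourth_moment_F_le:
  assumes v1: "(\<Sum>i\<in>I. v i) \<le> 1" and B: "\<And>i. i \<in> I \<Longrightarrow> cov i i \<le> B"
  shows "integrable M (\<lambda>\<omega>. F \<omega> ^ 4)" "expectation (\<lambda>\<omega>. F \<omega> ^ 4) \<le> 105 * B ^ 4"
proof -
  have X8: "integrable M (\<lambda>\<omega>. X i \<omega> ^ 8)" if "i \<in> I" for i
    using gaussian_integrable_power(2)[OF gauss_component[OF that], of 8] .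
  have ptw: "F \<omega> ^ 4 \<le> (\<Sum>i\<in>I. v i * X i \<omega> ^ 8)" for \<omega>
  proof -
    have CS: "(\<Sum>i\<in>I. v i * u i)\<^sup>2 \<le> (\<Sum>i\<in>I. v i * (u i)\<^sup>2)" for u :: "'i \<Rightarrow> real"
    proof -
      have "(\<Sum>i\<in>I. v i * u i) = (\<Sum>i\<in>I. sqrt (v i) * (sqrt (v i) * u i))"
        using v_nonneg by (intro sum.cong) (auto simp: mult.assoc[symmetric])
      then have "(\<Sum>i\<in>I. v i * u i)\<^sup>2 \<le> (\<Sum>i\<in>I. (sqrt (v i))\<^sup>2) * (\<Sum>i\<in>I. (sqrt (v i) * u i)\<^sup>2)"
        using Cauchy_Schwarz_ineq_sum[of "\<lambda>i. sqrt (v i)" "\<lambda>i. sqrt (v i) * u i" I] by simp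
      also have "\<dots> = (\<Sum>i\<in>I. v i) * (\<Sum>i\<in>I. v i * (u i)\<^sup>2)"
        using v_nonneg by (simp add: power_mult_distrib)
      also have "\<dots> \<le> 1 * (\<Sum>i\<in>I. v i * (u i)\<^sup>2)"
        using v1 v_nonneg by (intro mult_right_mono sum_nonneg) auto
      finally show ?thesis by simp
    qed
    have "F \<omega> ^ 4 = ((F \<omega>)\<^sup>2)\<^sup>2" by simp
    also have "\<dots> \<le> (\<Sum>i\<in>I. v i * ((X i \<omega>)\<^sup>2)\<^sup>2)\<^sup>2"
      unfolding F_def by (intro power_mono CS) auto
    also have "\<dots> \<le> (\<Sum>i\<in>I. v i * (((X i \<omega>)\<^sup>2)\<^sup>2)\<^sup>2)" by (rule CS)
    finally show ?thesis by simp
  qed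
  show I4: "integrable M (\<lambda>\<omega>. F \<omega> ^ 4)"
  proof (rule Bochner_Integration.integrable_bound)
    show "integrable M (\<lambda>\<omega>. \<Sum>i\<in>I. v i * X i \<omega> ^ 8)"
      using X8 by (intro Bochner_Integration.integrable_sum integrable_mult_right)
    show "AE \<omega> in M. norm (F \<omega> ^ 4) \<le> norm (\<Sum>i\<in>I. v i * X i \<omega> ^ 8)"
      using ptw F_nonneg by (intro AE_I2) (auto intro: order_trans[OF _ abs_ge_self])
  qed simp
  have cov0: "cov i i \<ge> 0" for i by (simp add: cov_def power2_eq_square[symmetric])
  have "expectation (\<lambda>\<omega>. F \<omega> ^ 4) \<le> expectation (\<lambda>\<omega>. \<Sum>i\<in>I. v i * X i \<omega> ^ 8)"
    using X8 by (intro integral_mono I4 ptw Bochner_Integration.integrable_sum integrable_mult_right)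
  also have "\<dots> = (\<Sum>i\<in>I. v i * (105 * cov i i ^ 4))"
    using X8 gaussian_moments(2)[OF gauss_component]
    by (simp add: Bochner_Integration.integral_sum cov_def power2_eq_square)
  also have "\<dots> \<le> (\<Sum>i\<in>I. v i * (105 * B ^ 4))"
    using B cov0 v_nonneg by (intro sum_mono mult_left_mono power_mono) auto
  also have "\<dots> = (\<Sum>i\<in>I. v i) * (105 * B ^ 4)" by (simp add: sum_distrib_right)
  also have "\<dots> \<le> 1 * (105 * B ^ 4)"
    using v1 by (intro mult_right_mono) auto
  finally show "expectation (\<lambda>\<omega>. F \<omega> ^ 4) \<le> 105 * B ^ 4" by simp
qed

end

section \<open>Time averages of squared Gaussian paths\<close>

text \<open>
  Vitali's theorem in the form needed here: bounded second moments imply uniform integrability.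
\<close>

lemma (in prob_space) L1_convergence_bounded_second_moments:
  fixes Y :: "nat \<Rightarrow> 'a \<Rightarrow> real"
  assumes Ym[measurable]: "\<And>n. Y n \<in> borel_measurable M" and [measurable]: "Z \<in> borel_measurable M"
    and lim: "AE \<omega> in M. (\<lambda>n. Y n \<omega>) \<longlonglongrightarrow> Z \<omega>"
    and I: "\<And>n. integrable M (\<lambda>\<omega>. (Y n \<omega>)\<^sup>2)" and C: "\<And>n. expectation (\<lambda>\<omega>. (Y n \<omega>)\<^sup>2) \<le> C"
  shows "integrable M (\<lambda>\<omega>. (Z \<omega>)\<^sup>2)" "integrable M Z"
    "(\<lambda>n. expectation (Y n)) \<longlonglongrightarrow> expectation Z"
proof -
  have C0: "C \<ge> 0" using C[of 0] order_trans[OF Bochner_Integration.integral_nonneg[of M "\<lambda>\<omega>. (Y 0 \<omega>)\<^sup>2"]] by simp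
  have "(\<integral>\<^sup>+\<omega>. ennreal ((Z \<omega>)\<^sup>2) \<partial>M) = (\<integral>\<^sup>+\<omega>. liminf (\<lambda>n. ennreal ((Y n \<omega>)\<^sup>2)) \<partial>M)"
  proof (rule nn_integral_cong_AE)
    show "AE \<omega> in M. ennreal ((Z \<omega>)\<^sup>2) = liminf (\<lambda>n. ennreal ((Y n \<omega>)\<^sup>2))"
      using lim
    proof eventually_elim
      case (elim \<omega>)
      have "(\<lambda>n. ennreal ((Y n \<omega>)\<^sup>2)) \<longlonglongrightarrow> ennreal ((Z \<omega>)\<^sup>2)"
        by (intro tendsto_ennrealI tendsto_power elim)
      then show ?case by (rule lim_imp_Liminf[OF sequentially_bot, symmetric])
    qed
  qed
  also have "\<dots> \<le> liminf (\<lambda>n. \<integral>\<^sup>+\<omega>. ennreal ((Y n \<omega>)\<^sup>2) \<partial>M)"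
    by (rule nn_integral_liminf) simp
  also have "\<dots> \<le> ennreal C"
  proof (rule Liminf_le)
    show "\<forall>\<^sub>F n in sequentially. (\<integral>\<^sup>+\<omega>. ennreal ((Y n \<omega>)\<^sup>2) \<partial>M) \<le> ennreal C"
      using C I by (intro always_eventually allI) (simp add: nn_integral_eq_integral ennreal_leI)
  qed simp
  finally have bZ: "(\<integral>\<^sup>+\<omega>. ennreal ((Z \<omega>)\<^sup>2) \<partial>M) \<le> ennreal C" .
  show IZ2: "integrable M (\<lambda>\<omega>. (Z \<omega>)\<^sup>2)"
    using bZ by (intro integrableI_bounded) (auto simp: less_top top_unique intro: le_less_trans)
  have EZ2: "expectation (\<lambda>\<omega>. (Z \<omega>)\<^sup>2) \<le> C"
    using bZ IZ2 C0 by (simp add: nn_integral_eq_integral)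
  have sq: "integrable M f" if "f \<in> borel_measurable M" "integrable M (\<lambda>\<omega>. (f \<omega>)\<^sup>2)" for f :: "'a \<Rightarrow> real"
    using integrable_mult_of_squares[of f M "\<lambda>_. 1"] that by simp
  show IZ: "integrable M Z" by (rule sq[OF _ IZ2]) simp
  have IY: "integrable M (Y n)" for n by (rule sq[OF _ I]) simp
  have L: "(\<lambda>n. expectation (\<lambda>\<omega>. \<bar>Y n \<omega> - Z \<omega>\<bar>)) \<longlonglongrightarrow> 0"
  proof (rule LIMSEQ_I)
    fix r :: real assume r: "r > 0"
    \<comment> \<open>truncation level: beyond it, the second moments leave less than \<open>r / 2\<close>\<close>
    define K where "K = 8 * C / r + 1"
    have K: "K > 0" unfolding K_def using C0 r by (simp add: add_nonneg_pos)
    have K2: "4 * C / K < r / 2 \<or> C = 0"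
    proof -
      have "8 * C < r * K" unfolding K_def using r by (simp add: field_simps)
      then show ?thesis using K r by (simp add: field_simps)
    qed
    then have K2: "4 * C / K < r / 2" using r by auto
    have "(\<lambda>n. expectation (\<lambda>\<omega>. min \<bar>Y n \<omega> - Z \<omega>\<bar> K)) \<longlonglongrightarrow> expectation (\<lambda>\<omega>. 0)"
    proof (rule integral_dominated_convergence[where w="\<lambda>_. K"])
      show "AE \<omega> in M. (\<lambda>n. min \<bar>Y n \<omega> - Z \<omega>\<bar> K) \<longlonglongrightarrow> 0"
        using lim
      proof eventually_elim
        case (elim \<omega>)
        have "(\<lambda>n. \<bar>Y n \<omega> - Z \<omega>\<bar>) \<longlonglongrightarrow> 0" using tendsto_rabs[OF tendsto_diff[OF elim tendsto_const[of "Z \<omega>"]]] by simp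
        from tendsto_min[OF this tendsto_const[of K]] K show ?case by simp
      qed
    qed (use K in auto)
    then have "\<forall>\<^sub>F n in sequentially. expectation (\<lambda>\<omega>. min \<bar>Y n \<omega> - Z \<omega>\<bar> K) < r / 2"
      using r by (intro order_tendstoD(2)) auto
    then obtain N where N: "\<And>n. n \<ge> N \<Longrightarrow> expectation (\<lambda>\<omega>. min \<bar>Y n \<omega> - Z \<omega>\<bar> K) < r / 2"
      unfolding eventually_sequentially by blast
    have "expectation (\<lambda>\<omega>. \<bar>Y n \<omega> - Z \<omega>\<bar>) < r" if "n \<ge> N" for n
    proof -
      have ptw: "\<bar>y - z\<bar> \<le> min \<bar>y - z\<bar> K + (2 * y\<^sup>2 + 2 * z\<^sup>2) / K" for y z :: real
      proof (cases "\<bar>y - z\<bar> \<le> K")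
        case True then show ?thesis using K by simp
      next
        case False
        have "\<bar>y - z\<bar> * K \<le> \<bar>y - z\<bar> * \<bar>y - z\<bar>" using False by (intro mult_left_mono) auto
        also have "\<dots> = (y - z)\<^sup>2" by (simp add: power2_eq_square abs_mult[symmetric])
        also have "\<dots> \<le> 2 * y\<^sup>2 + 2 * z\<^sup>2"
          using zero_le_power2[of "y + z"] by (simp add: power2_sum power2_diff)
        finally have "\<bar>y - z\<bar> \<le> (2 * y\<^sup>2 + 2 * z\<^sup>2) / K" using K by (simp add: field_simps)
        then show ?thesis using K False by simp
      qed
      have Im: "integrable M (\<lambda>\<omega>. min \<bar>Y n \<omega> - Z \<omega>\<bar> K)"
        using K by (intro integrable_const_bound[of _ K]) auto
      have "expectation (\<lambda>\<omega>. \<bar>Y n \<omega> - Z \<omega>\<bar>) \<le> expectation (\<lambda>\<omega>. min \<bar>Y n \<omega> - Z \<omega>\<bar> K + (2 * (Y n \<omega>)\<^sup>2 + 2 * (Z \<omega>)\<^sup>2) / K)"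
        using ptw IY IZ IZ2 I Im by (intro integral_mono) auto
      also have "\<dots> = expectation (\<lambda>\<omega>. min \<bar>Y n \<omega> - Z \<omega>\<bar> K) + (2 * expectation (\<lambda>\<omega>. (Y n \<omega>)\<^sup>2) + 2 * expectation (\<lambda>\<omega>. (Z \<omega>)\<^sup>2)) / K"
        using IZ2 I Im by simp
      also have "\<dots> \<le> expectation (\<lambda>\<omega>. min \<bar>Y n \<omega> - Z \<omega>\<bar> K) + 4 * C / K"
        using C[of n] EZ2 K by (intro add_left_mono divide_right_mono) auto
      also have "\<dots> < r" using N[OF that] K2 by simp
      finally show ?thesis .
    qed
    then show "\<exists>N. \<forall>n\<ge>N. norm (expectation (\<lambda>\<omega>. \<bar>Y n \<omega> - Z \<omega>\<bar>) - 0) < r"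
      by (intro exI[of _ N]) auto
  qed
  have "(\<lambda>n. expectation (Y n) - expectation Z) \<longlonglongrightarrow> 0"
  proof (rule Lim_null_comparison[OF _ L])
    show "\<forall>\<^sub>F n in sequentially. norm (expectation (Y n) - expectation Z) \<le> expectation (\<lambda>\<omega>. \<bar>Y n \<omega> - Z \<omega>\<bar>)"
      using IY IZ integral_abs_bound[of M "\<lambda>\<omega>. Y _ \<omega> - Z \<omega>"] by (intro always_eventually allI) (simp flip: Bochner_Integration.integral_diff)
  qed
  then show "(\<lambda>n. expectation (Y n)) \<longlonglongrightarrow> expectation Z" by (simp add: LIM_zero_iff)
qed

lemma (in prob_space) lipschitz_comp_integrable:
  fixes h :: "real \<Rightarrow> real"
  assumes lip: "\<And>x y. \<bar>h x - h y\<bar> \<le> \<bar>x - y\<bar>" and U: "integrable M U"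
  shows "integrable M (\<lambda>\<omega>. h (U \<omega>))" "h \<in> borel_measurable borel"
proof -
  have "1-lipschitz_on UNIV h" using lip by (intro lipschitz_onI) (auto simp: dist_real_def)
  then show [measurable]: "h \<in> borel_measurable borel"
    by (intro borel_measurable_continuous_onI lipschitz_on_continuous_on)
  have [measurable]: "U \<in> borel_measurable M" using U by simp
  show "integrable M (\<lambda>\<omega>. h (U \<omega>))"
  proof (rule Bochner_Integration.integrable_bound)
    show "integrable M (\<lambda>\<omega>. \<bar>h 0\<bar> + \<bar>U \<omega>\<bar>)" using U by simp
    have "\<bar>h x\<bar> \<le> \<bar>h 0\<bar> + \<bar>x\<bar>" for x using lip[of x 0] by linarith
    then show "AE \<omega> in M. norm (h (U \<omega>)) \<le> norm (\<bar>h 0\<bar> + \<bar>U \<omega>\<bar>)" by (intro AE_I2) simp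
  qed measurable
qed

lemma riemann_sums_tendsto:
  fixes \<phi> :: "real \<Rightarrow> real"
  assumes T: "T > 0" and cont: "continuous_on {0..T} \<phi>"
  shows "(\<lambda>n. (\<Sum>i<n. \<phi> (real i * T / real n)) / real n) \<longlonglongrightarrow> integral {0..T} \<phi> / T"
proof (rule LIMSEQ_I)
  fix r :: real assume r: "r > 0"
  have "uniformly_continuous_on {0..T} \<phi>" by (rule compact_uniformly_continuous[OF cont]) simp
  then obtain d where d: "d > 0" "\<And>x y. x \<in> {0..T} \<Longrightarrow> y \<in> {0..T} \<Longrightarrow> dist y x < d \<Longrightarrow> dist (\<phi> y) (\<phi> x) < r / 2"
    unfolding uniformly_continuous_on_def using r by (metis half_gt_zero)
  obtain N :: nat where N: "T / d < real N" using reals_Archimedean2 by blast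
  have "\<bar>(\<Sum>i<n. \<phi> (real i * T / real n)) / real n - integral {0..T} \<phi> / T\<bar> < r" if n: "n \<ge> Suc N" for n
  proof -
    have n0: "real n > 0" using n by simp
    have mesh: "T / real n < d"
    proof -
      have "T / d < real n" using N n by linarith
      then show ?thesis using d n0 by (simp add: field_simps)
    qed
    define t where "t i = real i * T / real n" for i
    have tS: "t (Suc i) = t i + T / real n" for i by (simp add: t_def distrib_right add_divide_distrib)
    have t0: "0 \<le> t i" for i unfolding t_def using T by simp
    have tT: "t i \<le> T" if "i \<le> n" for i unfolding t_def using T n0 that by (simp add: field_simps)
    have sub: "{t i..t (Suc i)} \<subseteq> {0..T}" if "i < n" for i using t0[of i] tT[of "Suc i"] that by auto
    have "integral {0..t k} \<phi> = (\<Sum>i<k. integral {t i..t (Suc i)} \<phi>)" if "k \<le> n" for k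
      using that
    proof (induction k)
      case 0 then show ?case by (simp add: t_def)
    next
      case (Suc k)
      have "integral {0..t k} \<phi> + integral {t k..t (Suc k)} \<phi> = integral {0..t (Suc k)} \<phi>"
        using t0[of k] tS[of k] T n0 tT[of "Suc k"] Suc.prems
        by (intro Henstock_Kurzweil_Integration.integral_combine integrable_continuous_real continuous_on_subset[OF cont]) auto
      then show ?case using Suc by simp
    qed
    from this[of n] have int: "integral {0..T} \<phi> = (\<Sum>i<n. integral {t i..t (Suc i)} \<phi>)"
      using n0 by (simp add: t_def)
    have cell: "\<bar>T / real n * \<phi> (t i) - integral {t i..t (Suc i)} \<phi>\<bar> \<le> r / 2 * (T / real n)" if i: "i < n" for i
    proof -
      have le: "t i \<le> t (Suc i)" using tS[of i] T n0 by simp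
      have c: "continuous_on {t i..t (Suc i)} \<phi>" by (rule continuous_on_subset[OF cont sub[OF i]])
      have "norm (integral {t i..t (Suc i)} (\<lambda>x. \<phi> (t i) - \<phi> x)) \<le> r / 2 * (t (Suc i) - t i)"
      proof (rule integral_bound[OF le])
        show "continuous_on {t i..t (Suc i)} (\<lambda>x. \<phi> (t i) - \<phi> x)" by (intro continuous_intros c)
        fix x assume x: "x \<in> {t i..t (Suc i)}"
        then have "dist (t i) x < d" using mesh tS[of i] by (simp add: dist_real_def)
        then show "norm (\<phi> (t i) - \<phi> x) \<le> r / 2"
          using d(2)[of x "t i"] x sub[OF i] le by (force simp: dist_real_def)
      qed
      moreover have "integral {t i..t (Suc i)} (\<lambda>x. \<phi> (t i) - \<phi> x) = T / real n * \<phi> (t i) - integral {t i..t (Suc i)} \<phi>"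
      proof -
        have "integral {t i..t (Suc i)} (\<lambda>x. \<phi> (t i) - \<phi> x) = integral {t i..t (Suc i)} (\<lambda>x. \<phi> (t i)) - integral {t i..t (Suc i)} \<phi>"
          by (rule Henstock_Kurzweil_Integration.integral_diff) (auto intro!: integrable_continuous_real c)
        then show ?thesis using le tS[of i] by simp
      qed
      ultimately show ?thesis using tS[of i] by simp
    qed
    have "\<bar>T * ((\<Sum>i<n. \<phi> (t i)) / real n) - integral {0..T} \<phi>\<bar> = \<bar>\<Sum>i<n. T / real n * \<phi> (t i) - integral {t i..t (Suc i)} \<phi>\<bar>"
      unfolding int by (simp add: sum_subtractf sum_distrib_left sum_divide_distrib)
    also have "\<dots> \<le> (\<Sum>i<n. r / 2 * (T / real n))"
      by (rule order_trans[OF sum_abs sum_mono]) (use cell in auto)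
    also have "\<dots> = T * (r / 2)" using n0 by simp
    finally have "\<bar>T * ((\<Sum>i<n. \<phi> (t i)) / real n - integral {0..T} \<phi> / T)\<bar> \<le> T * (r / 2)"
      using T by (simp add: right_diff_distrib)
    then have "\<bar>(\<Sum>i<n. \<phi> (t i)) / real n - integral {0..T} \<phi> / T\<bar> \<le> r / 2"
      using T by (simp add: abs_mult)
    then show ?thesis using r by (simp add: t_def)
  qed
  then show "\<exists>N. \<forall>n\<ge>N. norm ((\<Sum>i<n. \<phi> (real i * T / real n)) / real n - integral {0..T} \<phi> / T) < r"
    by auto
qed

text \<open>
  A moving average of width \<open>\<epsilon>\<close> is continuously differentiable and keeps the Lipschitz constant.
\<close>

lemma lipschitz_smoothing:
  fixes h :: "real \<Rightarrow> real"
  assumes lip: "\<And>x y. \<bar>h x - h y\<bar> \<le> \<bar>x - y\<bar>" and \<epsilon>: "\<epsilon> > 0"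
  obtains g g' where "\<And>x. (g has_real_derivative g' x) (at x)" "\<And>x. \<bar>g' x\<bar> \<le> 1" "continuous_on UNIV g'" "\<And>x. \<bar>g x - h x\<bar> \<le> \<epsilon>"
proof -
  have conth: "continuous_on UNIV h"
    by (rule continuous_onI) (metis dist_real_def lip less_imp_le order_le_less_trans)
  obtain H where H: "\<And>x. (H has_real_derivative h x) (at x)"
    using einterval_antiderivative[of "-\<infinity>" \<infinity> h] conth
    by (auto simp: continuous_on_eq_continuous_at has_real_derivative_iff_has_vector_derivative)
  show ?thesis
  proof (rule that[of "\<lambda>x. (H (x + \<epsilon>) - H x) / \<epsilon>" "\<lambda>x. (h (x + \<epsilon>) - h x) / \<epsilon>"])
    show "((\<lambda>x. (H (x + \<epsilon>) - H x) / \<epsilon>) has_real_derivative (h (x + \<epsilon>) - h x) / \<epsilon>) (at x)" for x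
    proof -
      have "((\<lambda>x. H (x + \<epsilon>)) has_real_derivative h (x + \<epsilon>) * 1) (at x)"
        by (rule DERIV_chain2[OF H]) (auto intro!: derivative_eq_intros)
      from DERIV_cdivide[OF DERIV_diff[OF this H]] show ?thesis by simp
    qed
    show "\<bar>(h (x + \<epsilon>) - h x) / \<epsilon>\<bar> \<le> 1" for x using lip[of "x + \<epsilon>" x] \<epsilon> by simp
    show "continuous_on UNIV (\<lambda>x. (h (x + \<epsilon>) - h x) / \<epsilon>)"
      using \<epsilon> by (intro continuous_intros conth continuous_on_compose2[OF conth]) auto
    show "\<bar>(H (x + \<epsilon>) - H x) / \<epsilon> - h x\<bar> \<le> \<epsilon>" for x
    proof -
      obtain z where z: "x < z" "z < x + \<epsilon>" "H (x + \<epsilon>) - H x = \<epsilon> * h z"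
        using MVT2[of x "x + \<epsilon>" H h] \<epsilon> H by auto
      then show ?thesis using lip[of z x] \<epsilon> by simp
    qed
  qed
qed

text \<open>
  A Gaussian process with continuous paths on a compact interval.  Its time average \<open>V\<close> is the
  pointwise limit of the quadratic forms \<open>Fn\<close> in the values on uniform grids with equal weights; \<open>en\<close>,
  \<open>sn\<close> and \<open>tn\<close> are the three traces belonging to these forms.
\<close>

locale gaussian_path = prob_space M for M :: "'a measure" +
  fixes T :: real and X :: "real \<Rightarrow> 'a \<Rightarrow> real" and B :: real
  assumes T: "T > 0"
    and gaussX: "\<And>J a. finite J \<Longrightarrow> J \<subseteq> {0..T} \<Longrightarrow> centered_gaussian_rv M (\<lambda>\<omega>. \<Sum>t\<in>J. a t * X t \<omega>)"
    and paths: "\<And>\<omega>. \<omega> \<in> space M \<Longrightarrow> continuous_on {0..T} (\<lambda>t. X t \<omega>)"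
    and var_le: "\<And>t. t \<in> {0..T} \<Longrightarrow> expectation (\<lambda>\<omega>. (X t \<omega>)\<^sup>2) \<le> B"
begin

definition V :: "'a \<Rightarrow> real" where "V \<omega> = integral {0..T} (\<lambda>t. (X t \<omega>)\<^sup>2) / T"

definition grid :: "nat \<Rightarrow> nat \<Rightarrow> 'a \<Rightarrow> real" where "grid n i = X (real i * T / real n)"

definition r :: "real \<Rightarrow> real \<Rightarrow> real" where "r s t = expectation (\<lambda>\<omega>. X s \<omega> * X t \<omega>)"

abbreviation "Fn n \<equiv> gaussian_quadratic.F {..<n} (grid n) (\<lambda>_. 1 / real n)"
abbreviation "en n \<equiv> gaussian_quadratic.mean M {..<n} (grid n) (\<lambda>_. 1 / real n)"
abbreviation "sn n \<equiv> gaussian_quadratic.hs2 M {..<n} (grid n) (\<lambda>_. 1 / real n)"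
abbreviation "tn n \<equiv> gaussian_quadratic.tr3 M {..<n} (grid n) (\<lambda>_. 1 / real n)"

lemma grid_point: "i < n \<Longrightarrow> real i * T / real n \<in> {0..T}"
  using T by (auto simp: field_simps)

sublocale grid: gaussian_quadratic M "{..<n}" "grid n" "\<lambda>_. 1 / real n" for n
proof unfold_locales
  show "finite {..<n}" by simp
  show "0 \<le> 1 / real n" for i :: nat by simp
  fix a :: "nat \<Rightarrow> real"
  define p where "p i = real i * T / real n" for i
  have inj: "inj_on p {..<n}"
    using T by (auto simp: inj_on_def p_def)
  have "(\<Sum>t\<in>p ` {..<n}. a (the_inv_into {..<n} p t) * X t \<omega>) = (\<Sum>i<n. a i * grid n i \<omega>)" for \<omega>
  proof -
    have "(\<Sum>t\<in>p ` {..<n}. a (the_inv_into {..<n} p t) * X t \<omega>) = (\<Sum>i<n. a (the_inv_into {..<n} p (p i)) * X (p i) \<omega>)"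
      by (subst sum.reindex[OF inj]) simp
    also have "\<dots> = (\<Sum>i<n. a i * X (p i) \<omega>)"
      by (intro sum.cong refl) (simp add: the_inv_into_f_f[OF inj])
    finally show ?thesis by (simp add: grid_def p_def)
  qed
  moreover have "centered_gaussian_rv M (\<lambda>\<omega>. \<Sum>t\<in>p ` {..<n}. a (the_inv_into {..<n} p t) * X t \<omega>)"
    using grid_point by (intro gaussX) (auto simp: p_def simp del: atLeastAtMost_iff)
  ultimately show "centered_gaussian_rv M (\<lambda>\<omega>. \<Sum>i<n. a i * grid n i \<omega>)" by simp
qed

lemma cov_grid: "gaussian_vector.cov M (grid n) i j = r (real i * T / real n) (real j * T / real n)"
  by (simp add: grid.cov_def grid_def r_def)

lemma en_eq: "en n = (\<Sum>i<n. r (real i * T / real n) (real i * T / real n)) / real n"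
  by (simp add: grid.mean_def cov_grid sum_divide_distrib)

lemma sn_eq: "sn n = (\<Sum>i<n. \<Sum>j<n. (r (real i * T / real n) (real j * T / real n))\<^sup>2) / (real n)\<^sup>2"
  by (simp add: grid.hs2_def cov_grid sum_divide_distrib power2_eq_square)

lemma tn_eq: "tn n = (\<Sum>i<n. \<Sum>j<n. \<Sum>k<n. r (real i * T / real n) (real j * T / real n) * r (real i * T / real n) (real k * T / real n) * r (real j * T / real n) (real k * T / real n)) / real n ^ 3"
  by (simp add: grid.tr3_def cov_grid sum_divide_distrib power3_eq_cube mult.assoc)

lemma Fn_tendsto: "\<omega> \<in> space M \<Longrightarrow> (\<lambda>n. Fn n \<omega>) \<longlonglongrightarrow> V \<omega>"
  unfolding V_def grid.F_def grid_def
  using riemann_sums_tendsto[OF T continuous_on_power[OF paths], of \<omega> 2] by (simp add: sum_divide_distrib)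

lemma Fn_measurable[measurable]: "Fn n \<in> borel_measurable M"
  by (rule grid.F_measurable)

lemma V_measurable[measurable]: "V \<in> borel_measurable M"
  by (rule borel_measurable_LIMSEQ_real[OF Fn_tendsto Fn_measurable])

lemma V_nonneg: "V \<omega> \<ge> 0"
proof -
  have "integral {0..T} (\<lambda>t. (X t \<omega>)\<^sup>2) \<ge> 0"
    by (cases "(\<lambda>t. (X t \<omega>)\<^sup>2) integrable_on {0..T}")
      (auto intro: Henstock_Kurzweil_Integration.integral_nonneg simp: not_integrable_integral)
  then show ?thesis unfolding V_def using T by simp
qed

lemma r_diag_nonneg: "r t t \<ge> 0" by (simp add: r_def power2_eq_square[symmetric])

lemma r_diag_le: "t \<in> {0..T} \<Longrightarrow> r t t \<le> B" using var_le by (simp add: r_def power2_eq_square)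

lemma B_nonneg: "B \<ge> 0" using r_diag_nonneg[of 0] r_diag_le[of 0] T by simp

lemma weights_le: "(\<Sum>i<n. 1 / real n) \<le> 1" by simp

text \<open>
  Passage to the limit in the grid.  The offset \<open>N\<close> allows sequences whose first terms are discarded.
\<close>

lemma expectation_tendsto:
  fixes u :: "nat \<Rightarrow> 'a \<Rightarrow> real"
  assumes [measurable]: "\<And>n. u n \<in> borel_measurable M" "w \<in> borel_measurable M"
    and lim: "\<And>\<omega>. \<omega> \<in> space M \<Longrightarrow> (\<lambda>n. u n \<omega>) \<longlonglongrightarrow> w \<omega>"
    and bd: "\<And>n \<omega>. \<omega> \<in> space M \<Longrightarrow> \<bar>u n \<omega>\<bar> \<le> c * (1 + Fn (n + N) \<omega>)\<^sup>2"
  shows "integrable M (\<lambda>\<omega>. (w \<omega>)\<^sup>2)" "integrable M w" "(\<lambda>n. expectation (u n)) \<longlonglongrightarrow> expectation w"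
proof -
  have F4: "integrable M (\<lambda>\<omega>. Fn n \<omega> ^ 4)" "expectation (\<lambda>\<omega>. Fn n \<omega> ^ 4) \<le> 105 * B ^ 4" for n
  proof -
    have c: "gaussian_vector.cov M (grid n) i i \<le> B" if "i \<in> {..<n}" for i
      using that unfolding cov_grid by (intro r_diag_le grid_point) simp
    show "integrable M (\<lambda>\<omega>. Fn n \<omega> ^ 4)" "expectation (\<lambda>\<omega>. Fn n \<omega> ^ 4) \<le> 105 * B ^ 4"
      using grid.fourth_moment_F_le[OF weights_le c] by auto
  qed
  have b: "(u n \<omega>)\<^sup>2 \<le> c\<^sup>2 * (8 * (1 + Fn (n + N) \<omega> ^ 4))" if \<omega>: "\<omega> \<in> space M" for n \<omega>
  proof -
    define x where "x = Fn (n + N) \<omega>"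
    have "(u n \<omega>)\<^sup>2 \<le> (c * (1 + x)\<^sup>2)\<^sup>2"
      using bd[OF \<omega>, of n] unfolding x_def by (metis abs_ge_zero power2_abs power_mono)
    also have "\<dots> = c\<^sup>2 * (1 + x) ^ 4" by (simp add: power_mult_distrib)
    also have "(1 + x) ^ 4 \<le> 8 * (1 + x ^ 4)"
    proof -
      have "(1 + x)\<^sup>2 \<le> 2 * (1 + x\<^sup>2)" using zero_le_power2[of "1 - x"] by (simp add: power2_eq_square algebra_simps)
      then have "((1 + x)\<^sup>2)\<^sup>2 \<le> (2 * (1 + x\<^sup>2))\<^sup>2" by (intro power_mono) auto
      also have "\<dots> = 4 * (1 + x\<^sup>2)\<^sup>2" by (simp only: power_mult_distrib) simp
      also have "(1 + x\<^sup>2)\<^sup>2 \<le> 2 * (1 + (x\<^sup>2)\<^sup>2)" using zero_le_power2[of "1 - x\<^sup>2"] by (simp add: power2_eq_square algebra_simps)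
      finally show ?thesis by simp
    qed
    finally show ?thesis by (simp add: x_def mult_left_mono)
  qed
  have Id: "integrable M (\<lambda>\<omega>. c\<^sup>2 * (8 * (1 + Fn (n + N) \<omega> ^ 4)))" for n
    by (intro integrable_mult_right Bochner_Integration.integrable_add integrable_const F4(1))
  have Iu: "integrable M (\<lambda>\<omega>. (u n \<omega>)\<^sup>2)" for n
    by (rule Bochner_Integration.integrable_bound[OF Id[of n]])
      (use b in \<open>auto intro!: AE_I2 order_trans[OF _ abs_ge_self]\<close>)
  have Ed: "expectation (\<lambda>\<omega>. c\<^sup>2 * (8 * (1 + Fn m \<omega> ^ 4))) = c\<^sup>2 * (8 * (1 + expectation (\<lambda>\<omega>. Fn m \<omega> ^ 4)))" for m
    using F4(1)[of m] by (simp add: prob_space)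
  have Eu: "expectation (\<lambda>\<omega>. (u n \<omega>)\<^sup>2) \<le> c\<^sup>2 * (8 * (1 + 105 * B ^ 4))" for n
  proof -
    have "expectation (\<lambda>\<omega>. (u n \<omega>)\<^sup>2) \<le> expectation (\<lambda>\<omega>. c\<^sup>2 * (8 * (1 + Fn (n + N) \<omega> ^ 4)))"
      by (rule integral_mono[OF Iu Id b])
    also have "\<dots> = c\<^sup>2 * (8 * (1 + expectation (\<lambda>\<omega>. Fn (n + N) \<omega> ^ 4)))"
      by (rule Ed)
    also have "\<dots> \<le> c\<^sup>2 * (8 * (1 + 105 * B ^ 4))"
      by (intro mult_left_mono add_left_mono F4(2)) auto
    finally show ?thesis .
  qed
  have L: "AE \<omega> in M. (\<lambda>n. u n \<omega>) \<longlonglongrightarrow> w \<omega>" using lim by auto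
  note R = L1_convergence_bounded_second_moments[OF assms(1,2) L Iu Eu]
  show "integrable M (\<lambda>\<omega>. (w \<omega>)\<^sup>2)" "integrable M w" "(\<lambda>n. expectation (u n)) \<longlonglongrightarrow> expectation w"
    using R by auto
qed

lemma V_integrable: "integrable M V" and V2_integrable: "integrable M (\<lambda>\<omega>. (V \<omega>)\<^sup>2)" and en_tendsto: "en \<longlonglongrightarrow> expectation V"
proof -
  have b: "\<bar>Fn n \<omega>\<bar> \<le> 1 * (1 + Fn (n + 0) \<omega>)\<^sup>2" for n \<omega>
    using grid.F_nonneg[of n \<omega>] by (simp add: power2_eq_square algebra_simps)
  note R = expectation_tendsto[OF Fn_measurable V_measurable Fn_tendsto b]
  show "integrable M V" "integrable M (\<lambda>\<omega>. (V \<omega>)\<^sup>2)" "en \<longlonglongrightarrow> expectation V"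
    using R by (simp_all add: grid.mean_eq)
qed

definition e :: real where "e = expectation V"
definition s2 :: real where "s2 = variance V"

lemma en_nonneg: "en n \<ge> 0" unfolding en_eq using r_diag_nonneg by (simp add: sum_nonneg)

lemma en_le: "en n \<le> B"
proof (cases "n = 0")
  case True then show ?thesis unfolding en_eq using B_nonneg by simp
next
  case False
  have "(\<Sum>i<n. r (real i * T / real n) (real i * T / real n)) \<le> (\<Sum>i<n. B)"
    using r_diag_le grid_point by (intro sum_mono) auto
  then show ?thesis using False by (simp add: en_eq field_simps)
qed

lemma centered_Fn_le: "\<bar>Fn n \<omega> - en n\<bar> \<le> (1 + B) * (1 + Fn n \<omega>)"
proof -
  have "\<bar>Fn n \<omega> - en n\<bar> \<le> Fn n \<omega> + B" using grid.F_nonneg[of n \<omega>] en_nonneg[of n] en_le[of n] by linarith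
  also have "\<dots> \<le> (1 + B) * (1 + Fn n \<omega>)" using B_nonneg grid.F_nonneg[of n \<omega>] by (simp add: algebra_simps)
  finally show ?thesis .
qed

lemma e_le: "e \<le> B" "e \<ge> 0"
  using LIMSEQ_le_const2[OF en_tendsto, of B] LIMSEQ_le_const[OF en_tendsto, of 0] en_le en_nonneg by (auto simp: e_def)

lemma sn_tendsto: "(\<lambda>n. 2 * sn n) \<longlonglongrightarrow> s2"
proof -
  have bb: "\<bar>(Fn n \<omega> - en n)\<^sup>2\<bar> \<le> (1 + B)\<^sup>2 * (1 + Fn (n + 0) \<omega>)\<^sup>2" for n \<omega>
  proof -
    have "(Fn n \<omega> - en n)\<^sup>2 \<le> ((1 + B) * (1 + Fn n \<omega>))\<^sup>2"
      using centered_Fn_le[of n \<omega>] by (metis abs_ge_zero power2_abs power_mono)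
    then show ?thesis by (simp add: power_mult_distrib)
  qed
  have "(\<lambda>n. expectation (\<lambda>\<omega>. (Fn n \<omega> - en n)\<^sup>2)) \<longlonglongrightarrow> expectation (\<lambda>\<omega>. (V \<omega> - e)\<^sup>2)"
    by (rule expectation_tendsto[OF _ _ _ bb]) (auto intro!: tendsto_intros Fn_tendsto en_tendsto[folded e_def])
  then show ?thesis by (simp add: grid.variance_F s2_def e_def)
qed

lemma s2_nonneg: "s2 \<ge> 0" by (simp add: s2_def)

theorem V_poincare:
  fixes \<psi> \<psi>' :: "real \<Rightarrow> real"
  assumes \<psi>: "\<And>x. (\<psi> has_real_derivative \<psi>' x) (at x)" and c\<psi>': "continuous_on UNIV \<psi>'"
    and K: "\<forall>x\<ge>0. \<bar>\<psi>' x\<bar> \<le> K"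
  shows "integrable M (\<lambda>\<omega>. (V \<omega> - e) * \<psi> (V \<omega>))" "integrable M (\<lambda>\<omega>. V \<omega> * \<bar>\<psi>' (V \<omega>)\<bar>)"
    "\<bar>expectation (\<lambda>\<omega>. (V \<omega> - e) * \<psi> (V \<omega>))\<bar> \<le> sqrt 2 * sqrt s2 * expectation (\<lambda>\<omega>. V \<omega> * \<bar>\<psi>' (V \<omega>)\<bar>)"
proof -
  have K0: "K \<ge> 0" using K by (auto dest: spec[of _ 0])
  have K': "\<bar>\<psi>' x\<bar> \<le> K" if "x \<ge> 0" for x using K that by blast
  have c\<psi>: "continuous_on UNIV \<psi>" by (rule DERIV_continuous_on[OF \<psi>])
  have [measurable]: "\<psi> \<in> borel_measurable borel" "\<psi>' \<in> borel_measurable borel"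
    using c\<psi> c\<psi>' by (auto intro: borel_measurable_continuous_onI)
  have iso: "isCont \<psi> x" "isCont \<psi>' x" for x using c\<psi> c\<psi>' by (auto simp: continuous_on_eq_continuous_at)
  have b1: "\<bar>(Fn n \<omega> - en n) * \<psi> (Fn n \<omega>)\<bar> \<le> ((1 + B) * (\<bar>\<psi> 0\<bar> + K)) * (1 + Fn (n + 0) \<omega>)\<^sup>2" for n \<omega>
  proof -
    have F0: "Fn n \<omega> \<ge> 0" by (rule grid.F_nonneg)
    have "\<bar>\<psi> (Fn n \<omega>)\<bar> \<le> \<bar>\<psi> 0\<bar> + K * Fn n \<omega>" by (rule lipschitz_growth[OF \<psi> K' F0])
    also have "\<dots> \<le> (\<bar>\<psi> 0\<bar> + K) * (1 + Fn n \<omega>)" using F0 K0 by (simp add: algebra_simps)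
    finally have "\<bar>(Fn n \<omega> - en n) * \<psi> (Fn n \<omega>)\<bar> \<le> ((1 + B) * (1 + Fn n \<omega>)) * ((\<bar>\<psi> 0\<bar> + K) * (1 + Fn n \<omega>))"
      unfolding abs_mult using B_nonneg F0 by (intro mult_mono centered_Fn_le) auto
    then show ?thesis by (simp add: power2_eq_square mult_ac)
  qed
  have b2: "\<bar>Fn n \<omega> * \<bar>\<psi>' (Fn n \<omega>)\<bar>\<bar> \<le> K * (1 + Fn (n + 0) \<omega>)\<^sup>2" for n \<omega>
  proof -
    have F0: "Fn n \<omega> \<ge> 0" by (rule grid.F_nonneg)
    have "\<bar>Fn n \<omega> * \<bar>\<psi>' (Fn n \<omega>)\<bar>\<bar> \<le> (1 + Fn n \<omega>)\<^sup>2 * K"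
      unfolding abs_mult using F0 K'[OF F0] by (intro mult_mono) (auto simp: power2_eq_square algebra_simps)
    then show ?thesis by (simp add: mult.commute)
  qed
  have "(\<lambda>\<omega>. (V \<omega> - e) * \<psi> (V \<omega>)) \<in> borel_measurable M" by simp
  note R1 = expectation_tendsto[OF _ this _ b1]
  have L1: "(\<lambda>n. (Fn n \<omega> - en n) * \<psi> (Fn n \<omega>)) \<longlonglongrightarrow> (V \<omega> - e) * \<psi> (V \<omega>)" if "\<omega> \<in> space M" for \<omega>
    by (intro tendsto_intros Fn_tendsto[OF that] en_tendsto[folded e_def] isCont_tendsto_compose[OF iso(1)])
  have L2: "(\<lambda>n. Fn n \<omega> * \<bar>\<psi>' (Fn n \<omega>)\<bar>) \<longlonglongrightarrow> V \<omega> * \<bar>\<psi>' (V \<omega>)\<bar>" if "\<omega> \<in> space M" for \<omega>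
    by (intro tendsto_intros Fn_tendsto[OF that] isCont_tendsto_compose[OF iso(2)])
  show "integrable M (\<lambda>\<omega>. (V \<omega> - e) * \<psi> (V \<omega>))"
    by (rule expectation_tendsto(2)[OF _ _ L1 b1]) simp_all
  show "integrable M (\<lambda>\<omega>. V \<omega> * \<bar>\<psi>' (V \<omega>)\<bar>)"
    by (rule expectation_tendsto(2)[OF _ _ L2 b2]) simp_all
  have E1: "(\<lambda>n. expectation (\<lambda>\<omega>. (Fn n \<omega> - en n) * \<psi> (Fn n \<omega>))) \<longlonglongrightarrow> expectation (\<lambda>\<omega>. (V \<omega> - e) * \<psi> (V \<omega>))"
    by (rule expectation_tendsto(3)[OF _ _ L1 b1]) simp_all
  have E2: "(\<lambda>n. expectation (\<lambda>\<omega>. Fn n \<omega> * \<bar>\<psi>' (Fn n \<omega>)\<bar>)) \<longlonglongrightarrow> expectation (\<lambda>\<omega>. V \<omega> * \<bar>\<psi>' (V \<omega>)\<bar>)"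
    by (rule expectation_tendsto(3)[OF _ _ L2 b2]) simp_all
  have sq: "2 * sqrt (sn n) = sqrt 2 * sqrt (2 * sn n)" for n
    by (simp add: real_sqrt_mult)
  show "\<bar>expectation (\<lambda>\<omega>. (V \<omega> - e) * \<psi> (V \<omega>))\<bar> \<le> sqrt 2 * sqrt s2 * expectation (\<lambda>\<omega>. V \<omega> * \<bar>\<psi>' (V \<omega>)\<bar>)"
  proof (rule LIMSEQ_le[OF tendsto_rabs[OF E1] tendsto_mult[OF tendsto_mult[OF tendsto_const tendsto_real_sqrt[OF sn_tendsto]] E2]])
    show "\<exists>N. \<forall>n\<ge>N. \<bar>expectation (\<lambda>\<omega>. (Fn n \<omega> - en n) * \<psi> (Fn n \<omega>))\<bar> \<le> sqrt 2 * sqrt (2 * sn n) * expectation (\<lambda>\<omega>. Fn n \<omega> * \<bar>\<psi>' (Fn n \<omega>)\<bar>)"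
      using grid.quadratic_form_poincare[OF \<psi> c\<psi>' K] unfolding sq by blast
  qed
qed

text \<open>
  The bound for quadratic forms passes to the limit in the grid, first for smooth and then by
  \<open>lipschitz_smoothing\<close> for Lipschitz functions.  The traces \<open>tn\<close> enter through a convergent majorant, as
  such majorants are what row sums of the covariance provide.
\<close>

theorem V_clt:
  fixes h :: "real \<Rightarrow> real"
  assumes lip: "\<And>x y. \<bar>h x - h y\<bar> \<le> \<bar>x - y\<bar>" and pos: "s2 > 0"
    and \<tau>: "\<And>n. tn n \<le> \<tau>n n" "\<tau>n \<longlonglongrightarrow> \<tau>"
  shows "\<bar>expectation (\<lambda>\<omega>. h ((V \<omega> - e) / sqrt s2)) - normal_mean h\<bar> \<le> 48 * \<tau> / sqrt s2 ^ 3"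
proof -
  define \<sigma> where "\<sigma> = sqrt s2"
  have \<sigma>: "\<sigma> > 0" using pos by (simp add: \<sigma>_def)
  have lim\<sigma>: "(\<lambda>n. sqrt (2 * sn n)) \<longlonglongrightarrow> \<sigma>" unfolding \<sigma>_def by (intro tendsto_real_sqrt sn_tendsto)
  have "\<forall>\<^sub>F n in sequentially. sqrt (2 * sn n) > \<sigma> / 2" using \<sigma> by (intro order_tendstoD(1)[OF lim\<sigma>]) auto
  then obtain N where N: "\<And>n. n \<ge> N \<Longrightarrow> sqrt (2 * sn n) > \<sigma> / 2" unfolding eventually_sequentially by blast
  have smooth: "\<bar>expectation (\<lambda>\<omega>. g ((V \<omega> - e) / \<sigma>)) - normal_mean g\<bar> \<le> 48 * \<tau> / \<sigma> ^ 3"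
    if g: "\<And>x. (g has_real_derivative g' x) (at x)" "\<And>x. \<bar>g' x\<bar> \<le> 1" "continuous_on UNIV g'" for g g'
  proof -
    have cg: "continuous_on UNIV g" by (rule DERIV_continuous_on[OF g(1)])
    have isog: "isCont g x" for x using cg by (simp add: continuous_on_eq_continuous_at)
    have [measurable]: "g \<in> borel_measurable borel" using cg by (rule borel_measurable_continuous_onI)
    have glip: "\<bar>g x - g y\<bar> \<le> \<bar>x - y\<bar>" for x y
      using field_differentiable_bound[of UNIV g g' 1 x y] g by auto
    \<comment> \<open>for early grids the form may be degenerate; start where its deviation exceeds \<open>\<sigma> / 2\<close>\<close>
    define m where "m n = n + N" for n
    have sm: "sqrt (2 * sn (m n)) > \<sigma> / 2" for n using N[of "m n"] by (simp add: m_def)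
    have lm: "filterlim m at_top sequentially" unfolding m_def by (rule filterlim_add_const_nat_at_top)
    have b: "\<bar>g ((Fn (m n) \<omega> - en (m n)) / sqrt (2 * sn (m n)))\<bar> \<le> (\<bar>g 0\<bar> + (1 + B) * 2 / \<sigma>) * (1 + Fn (n + N) \<omega>)\<^sup>2" for n \<omega>
    proof -
      define F where "F = Fn (m n) \<omega>"
      have F0: "F \<ge> 0" unfolding F_def by (rule grid.F_nonneg)
      have a: "\<bar>F - en (m n)\<bar> \<le> (1 + B) * (1 + F)" unfolding F_def by (rule centered_Fn_le)
      have "\<bar>g ((F - en (m n)) / sqrt (2 * sn (m n)))\<bar> \<le> \<bar>g 0\<bar> + \<bar>(F - en (m n)) / sqrt (2 * sn (m n))\<bar>"
        using glip[of "(F - en (m n)) / sqrt (2 * sn (m n))" 0] by simp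
      also have "\<bar>(F - en (m n)) / sqrt (2 * sn (m n))\<bar> \<le> (1 + B) * (1 + F) / (\<sigma> / 2)"
        unfolding abs_divide using a sm[of n] \<sigma> B_nonneg F0 by (intro frac_le) auto
      also have "\<bar>g 0\<bar> + (1 + B) * (1 + F) / (\<sigma> / 2) \<le> (\<bar>g 0\<bar> + (1 + B) * 2 / \<sigma>) * (1 + F)"
        using F0 by (simp add: algebra_simps)
      also have "\<dots> \<le> (\<bar>g 0\<bar> + (1 + B) * 2 / \<sigma>) * (1 + F)\<^sup>2"
        using F0 \<sigma> B_nonneg by (intro mult_left_mono) (auto simp: power2_eq_square)
      finally show ?thesis by (simp add: F_def m_def)
    qed
    have L: "(\<lambda>n. g ((Fn (m n) \<omega> - en (m n)) / sqrt (2 * sn (m n)))) \<longlonglongrightarrow> g ((V \<omega> - e) / \<sigma>)" if "\<omega> \<in> space M" for \<omega>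
      using \<sigma> by (intro isCont_tendsto_compose[OF isog] tendsto_divide tendsto_diff
          filterlim_compose[OF Fn_tendsto[OF that] lm] filterlim_compose[OF en_tendsto[folded e_def] lm] filterlim_compose[OF lim\<sigma> lm]) auto
    have E: "(\<lambda>n. expectation (\<lambda>\<omega>. g ((Fn (m n) \<omega> - en (m n)) / sqrt (2 * sn (m n))))) \<longlonglongrightarrow> expectation (\<lambda>\<omega>. g ((V \<omega> - e) / \<sigma>))"
      by (rule expectation_tendsto(3)[OF _ _ L b]) simp_all
    have R: "(\<lambda>n. 48 * \<tau>n (m n) / sqrt (2 * sn (m n)) ^ 3) \<longlonglongrightarrow> 48 * \<tau> / \<sigma> ^ 3"
      using \<sigma> by (intro tendsto_intros filterlim_compose[OF \<tau>(2) lm] filterlim_compose[OF lim\<sigma> lm]) auto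
    show ?thesis
    proof (rule LIMSEQ_le[OF tendsto_rabs[OF tendsto_diff[OF E tendsto_const]] R], intro exI allI impI)
      fix n
      have p: "sqrt (2 * sn (m n)) > 0" using sm[of n] \<sigma> by linarith
      then have "sn (m n) > 0" by simp
      then have "\<bar>expectation (\<lambda>\<omega>. g ((Fn (m n) \<omega> - en (m n)) / sqrt (2 * sn (m n)))) - normal_mean g\<bar> \<le> 48 * tn (m n) / sqrt (2 * sn (m n)) ^ 3"
        by (rule grid.quadratic_form_clt[OF g])
      also have "\<dots> \<le> 48 * \<tau>n (m n) / sqrt (2 * sn (m n)) ^ 3"
        using \<tau>(1)[of "m n"] p by (intro divide_right_mono mult_left_mono) auto
      finally show "\<bar>expectation (\<lambda>\<omega>. g ((Fn (m n) \<omega> - en (m n)) / sqrt (2 * sn (m n)))) - normal_mean g\<bar> \<le> 48 * \<tau>n (m n) / sqrt (2 * sn (m n)) ^ 3" .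
    qed
  qed
  have conth: "continuous_on UNIV h"
    by (rule continuous_onI) (metis dist_real_def lip less_imp_le order_le_less_trans)
  have hm[measurable]: "h \<in> borel_measurable borel" using conth by (rule borel_measurable_continuous_onI)
  have IV: "integrable M (\<lambda>\<omega>. h ((V \<omega> - e) / \<sigma>))" if "\<And>x y. \<bar>h x - h y\<bar> \<le> \<bar>x - y\<bar>" for h :: "real \<Rightarrow> real"
    by (rule lipschitz_comp_integrable(1)[OF that]) (use V_integrable in simp)
  have "\<bar>expectation (\<lambda>\<omega>. h ((V \<omega> - e) / \<sigma>)) - normal_mean h\<bar> \<le> 48 * \<tau> / \<sigma> ^ 3 + \<epsilon>" if \<epsilon>: "\<epsilon> > 0" for \<epsilon>
  proof -
    obtain g g' where g: "\<And>x. (g has_real_derivative g' x) (at x)" "\<And>x. \<bar>g' x\<bar> \<le> 1" "continuous_on UNIV g'" "\<And>x. \<bar>g x - h x\<bar> \<le> \<epsilon> / 2"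
      using lipschitz_smoothing[OF lip, of "\<epsilon> / 2"] \<epsilon> by (metis half_gt_zero)
    have cg: "continuous_on UNIV g" by (rule DERIV_continuous_on[OF g(1)])
    have gm[measurable]: "g \<in> borel_measurable borel" using cg by (rule borel_measurable_continuous_onI)
    have glip: "\<bar>g x - g y\<bar> \<le> \<bar>x - y\<bar>" for x y
      using field_differentiable_bound[of UNIV g g' 1 x y] g by auto
    have d1: "\<bar>expectation (\<lambda>\<omega>. g ((V \<omega> - e) / \<sigma>)) - expectation (\<lambda>\<omega>. h ((V \<omega> - e) / \<sigma>))\<bar> \<le> \<epsilon> / 2"
    proof -
      have "\<bar>expectation (\<lambda>\<omega>. g ((V \<omega> - e) / \<sigma>)) - expectation (\<lambda>\<omega>. h ((V \<omega> - e) / \<sigma>))\<bar> = \<bar>expectation (\<lambda>\<omega>. g ((V \<omega> - e) / \<sigma>) - h ((V \<omega> - e) / \<sigma>))\<bar>"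
        using IV[OF glip] IV[OF lip] by simp
      also have "\<dots> \<le> expectation (\<lambda>\<omega>. \<bar>g ((V \<omega> - e) / \<sigma>) - h ((V \<omega> - e) / \<sigma>)\<bar>)" by (rule integral_abs_bound)
      also have "\<dots> \<le> expectation (\<lambda>\<omega>. \<epsilon> / 2)"
        using IV[OF glip] IV[OF lip] g(4) by (intro integral_mono) auto
      finally show ?thesis by (simp add: prob_space)
    qed
    have d2: "\<bar>normal_mean g - normal_mean h\<bar> \<le> \<epsilon> / 2"
    proof -
      have I: "integrable lborel (\<lambda>x. std_normal_density x * g x)" "integrable lborel (\<lambda>x. std_normal_density x * h x)"
        using glip[of _ 0] lip[of _ 0] by (auto intro!: integrable_std_normal_lipschitz)
      have "\<bar>normal_mean g - normal_mean h\<bar> = \<bar>\<integral>x. std_normal_density x * g x - std_normal_density x * h x \<partial>lborel\<bar>"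
        using I by simp
      also have "\<dots> \<le> (\<integral>x. \<bar>std_normal_density x * g x - std_normal_density x * h x\<bar> \<partial>lborel)" by (rule integral_abs_bound)
      also have "\<dots> \<le> (\<integral>x. std_normal_density x * (\<epsilon> / 2) \<partial>lborel)"
      proof (rule integral_mono)
        show "\<bar>std_normal_density x * g x - std_normal_density x * h x\<bar> \<le> std_normal_density x * (\<epsilon> / 2)" for x
          using mult_left_mono[OF g(4)[of x], of "std_normal_density x"]
          unfolding right_diff_distrib[symmetric] abs_mult by simp
      qed (use I in auto)
      finally show ?thesis by simp
    qed
    show ?thesis using smooth[OF g(1-3)] d1 d2 by linarith
  qed
  then show ?thesis unfolding \<sigma>_def using field_le_epsilon by blast
qed

end

section \<open>Smooth images of a variable with a Poincare inequality\<close>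

lemma continuous_antiderivative:
  fixes k :: "real \<Rightarrow> real"
  assumes "continuous_on UNIV k"
  obtains L where "\<And>x. (L has_real_derivative k x) (at x)" "L c = 0"
proof -
  obtain L where L: "\<And>x. (L has_real_derivative k x) (at x)"
    using einterval_antiderivative[of "-\<infinity>" \<infinity> k] assms
    by (auto simp: continuous_on_eq_continuous_at has_real_derivative_iff_has_vector_derivative)
  have "((\<lambda>x. L x - L c) has_real_derivative k x) (at x)" for x
    using DERIV_diff[OF L DERIV_const] by simp
  then show ?thesis by (rule that) simp
qed

lemma constant_of_zero_derivative:
  fixes L :: "real \<Rightarrow> real"
  assumes "\<And>x. (L has_real_derivative k x) (at x)" "a \<le> b" "\<And>x. a \<le> x \<Longrightarrow> x \<le> b \<Longrightarrow> k x = 0"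
  shows "L b = L a"
proof (rule antisym)
  show "L b \<le> L a"
    by (rule DERIV_nonpos_imp_nonincreasing[OF assms(2)]) (use assms in \<open>auto intro!: exI[of _ "k _"]\<close>)
  show "L a \<le> L b"
    by (rule DERIV_nonneg_imp_nondecreasing[OF assms(2)]) (use assms in \<open>auto intro!: exI[of _ "k _"]\<close>)
qed

text \<open>
  A nonnegative function that vanishes to the right of \<open>a\<close>, integrated towards the left; the last
  property bounds the result by the length of the interval times the maximum of the function on it.
\<close>

lemma left_primitive:
  fixes k :: "real \<Rightarrow> real"
  assumes c: "continuous_on UNIV k" and nn: "\<And>x. k x \<ge> 0" and z: "\<And>x. x \<ge> a \<Longrightarrow> k x = 0"
    and K: "\<And>x. x \<ge> 0 \<Longrightarrow> k x \<le> K" and a: "a \<ge> 0"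
  obtains \<Lambda> where "\<forall>x. (\<Lambda> has_real_derivative - k x) (at x)" "\<forall>x. \<Lambda> x \<ge> 0" "\<forall>x. x \<ge> a \<longrightarrow> \<Lambda> x = 0"
    "\<forall>x. x \<ge> 0 \<longrightarrow> \<Lambda> x \<le> K * a" "\<forall>x y. x \<le> y \<longrightarrow> \<Lambda> y \<le> \<Lambda> x"
    "\<forall>x m. x \<le> a \<longrightarrow> (\<forall>u. x \<le> u \<longrightarrow> u \<le> a \<longrightarrow> k u \<le> m) \<longrightarrow> \<Lambda> x \<le> (a - x) * m"
proof -
  obtain L where L: "\<And>x. (L has_real_derivative k x) (at x)" "L a = 0"
    using continuous_antiderivative[OF c] by blast
  have d: "((\<lambda>x. - L x) has_real_derivative - k x) (at x)" for x by (rule DERIV_minus[OF L(1)])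
  have mono: "- L y \<le> - L x" if "x \<le> y" for x y
    using DERIV_nonneg_imp_nondecreasing[OF that, of L] L(1) nn by auto
  have z': "- L x = 0" if "x \<ge> a" for x
    using constant_of_zero_derivative[OF L(1) that] z L(2) by auto
  have n: "- L x \<ge> 0" for x
  proof (cases "x \<le> a")
    case True then show ?thesis using mono[OF True] L(2) by simp
  next
    case False then show ?thesis using z'[of x] by simp
  qed
  have bd: "- L x \<le> (a - x) * m" if "x \<le> a" "\<And>u. x \<le> u \<Longrightarrow> u \<le> a \<Longrightarrow> k u \<le> m" for x m
  proof (cases "x = a")
    case False
    then have "x < a" using that(1) by simp
    from MVT2[OF this, of L k] L(1) obtain w where "x < w" "w < a" "L a - L x = (a - x) * k w"
      by blast
    then show ?thesis using that(2)[of w] that(1) L(2) by (simp add: mult_left_mono)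
  qed (simp add: L(2))
  have b: "- L x \<le> K * a" if x: "x \<ge> 0" for x
  proof (cases "x \<le> a")
    case True
    have "- L x \<le> (a - x) * K" using x by (intro bd[OF True] K) auto
    also have "\<dots> \<le> a * K" using x K[of 0] nn[of 0] by (intro mult_right_mono) auto
    finally show ?thesis by (simp add: mult.commute)
  next
    case False then show ?thesis using z'[of x] a K[of 0] nn[of 0] by simp
  qed
  show ?thesis by (rule that[of "\<lambda>x. - L x"]) (use d n z' b mono bd in blast)+
qed

lemma right_primitive:
  fixes k :: "real \<Rightarrow> real"
  assumes c: "continuous_on UNIV k" and nn: "\<And>x. k x \<ge> 0" and z: "\<And>x. x \<le> b \<Longrightarrow> k x = 0"
  obtains \<Lambda> where "\<forall>x. (\<Lambda> has_real_derivative k x) (at x)" "\<forall>x. \<Lambda> x \<ge> 0" "\<forall>x. x \<le> b \<longrightarrow> \<Lambda> x = 0"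
    "\<forall>x y. x \<le> y \<longrightarrow> \<Lambda> x \<le> \<Lambda> y"
proof -
  obtain L where L: "\<And>x. (L has_real_derivative k x) (at x)" "L b = 0"
    using continuous_antiderivative[OF c] by blast
  have mono: "L x \<le> L y" if "x \<le> y" for x y
    using DERIV_nonneg_imp_nondecreasing[OF that, of L] L(1) nn by auto
  have z': "L x = 0" if "x \<le> b" for x
    using constant_of_zero_derivative[OF L(1) that] z L(2) by auto
  have n: "L x \<ge> 0" for x using mono[of b x] z'[of x] L(2) by (cases "b \<le> x") auto
  show ?thesis by (rule that[of L]) (use L(1) n z' mono in blast)+
qed

text \<open>
  A convex function with a double zero is nonnegative.  It is used to turn bounds on second
  derivatives into bounds on Taylor remainders without writing the remainder as an integral.
\<close>

lemma convex_touching_nonneg: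
  fixes D D' D'' :: "real \<Rightarrow> real"
  assumes D: "\<And>x. x \<in> {l..u} \<Longrightarrow> (D has_real_derivative D' x) (at x)"
    "\<And>x. x \<in> {l..u} \<Longrightarrow> (D' has_real_derivative D'' x) (at x)"
    and nn: "\<And>x. x \<in> {l..u} \<Longrightarrow> D'' x \<ge> 0" and c: "c \<in> {l..u}" "D c = 0" "D' c = 0" and x: "x \<in> {l..u}"
  shows "D x \<ge> 0"
proof (cases "c \<le> x")
  case True
  have D': "D' y \<ge> 0" if y: "c \<le> y" "y \<le> x" for y
  proof -
    have "D' c \<le> D' y"
    proof (rule DERIV_nonneg_imp_nondecreasing[OF y(1)])
      fix z assume "c \<le> z" "z \<le> y"
      then have "z \<in> {l..u}" using c x y by auto
      then show "\<exists>d. (D' has_real_derivative d) (at z) \<and> d \<ge> 0" using D(2) nn by blast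
    qed
    then show ?thesis using c by simp
  qed
  have "D c \<le> D x"
  proof (rule DERIV_nonneg_imp_nondecreasing[OF True])
    fix z assume z: "c \<le> z" "z \<le> x"
    then have "z \<in> {l..u}" using c x by auto
    then show "\<exists>d. (D has_real_derivative d) (at z) \<and> d \<ge> 0" using D(1) D'[OF z] by blast
  qed
  then show ?thesis using c by simp
next
  case False
  then have xc: "x \<le> c" by simp
  have D': "D' y \<le> 0" if y: "x \<le> y" "y \<le> c" for y
  proof -
    have "D' y \<le> D' c"
    proof (rule DERIV_nonneg_imp_nondecreasing[OF y(2)])
      fix z assume "y \<le> z" "z \<le> c"
      then have "z \<in> {l..u}" using c x y by auto
      then show "\<exists>d. (D' has_real_derivative d) (at z) \<and> d \<ge> 0" using D(2) nn by blast
    qed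
    then show ?thesis using c by simp
  qed
  have "D c \<le> D x"
  proof (rule DERIV_nonpos_imp_nonincreasing[OF xc])
    fix z assume z: "x \<le> z" "z \<le> c"
    then have "z \<in> {l..u}" using c x by auto
    then show "\<exists>d. (D has_real_derivative d) (at z) \<and> d \<le> 0" using D(1) D'[OF z] by blast
  qed
  then show ?thesis using c by simp
qed

text \<open>
  The excess of \<open>q\<close> over \<open>K\<close>, for arguments below \<open>f\<close>, replaced by a bounded continuous function that
  agrees with it except near 0, where \<open>q\<close> may blow up.  \<open>cutoff_right\<close> does the same near infinity.  The
  cut-off makes the test functions below admissible in the Poincare inequality.
\<close>

lemma cutoff_left:
  fixes q :: "real \<Rightarrow> real"
  assumes q: "continuous_on {0<..} q" and qn: "\<And>x. q x \<ge> 0" and a: "0 < a" "a \<le> f"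
    and K: "\<And>x. a \<le> x \<Longrightarrow> x \<le> f \<Longrightarrow> q x \<le> K" and \<epsilon>: "\<epsilon> > 0"
  obtains k B where "continuous_on UNIV k" "\<forall>x. k x \<ge> 0" "\<forall>x. x \<ge> a \<longrightarrow> k x = 0" "\<forall>x. x > 0 \<longrightarrow> k x \<le> q x"
    "\<forall>x. k x \<le> B" "\<forall>x. 2 * \<epsilon> \<le> x \<longrightarrow> x \<le> f \<longrightarrow> q x \<le> K + k x"
proof -
  define ramp where "ramp x = max 0 (min 1 (x / \<epsilon> - 1))" for x
  have K0: "K \<ge> 0" using K[of f] qn[of f] a by simp
  define k1 where "k1 x = ramp x * max (q (min (max x (min \<epsilon> f)) f) - K) 0" for x
  have pos: "min (max x (min \<epsilon> f)) f > 0" for x using \<epsilon> a by auto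
  have c1: "continuous_on UNIV k1"
    unfolding k1_def ramp_def
    by (intro continuous_intros continuous_on_compose2[OF q]) (use pos \<epsilon> in auto)
  have ramp: "0 \<le> ramp x" "ramp x \<le> 1" for x by (auto simp: ramp_def)
  have n1: "k1 x \<ge> 0" for x unfolding k1_def using ramp by auto
  have ramp0: "ramp x = 0" if "x \<le> \<epsilon>" for x using that \<epsilon> by (auto simp: ramp_def field_simps max_def min_def)
  have ramp1: "ramp x = 1" if "x \<ge> 2 * \<epsilon>" for x using that \<epsilon> by (auto simp: ramp_def field_simps max_def min_def)
  have z1: "k1 x = 0" if "x \<ge> a" for x
  proof -
    have "q (min (max x (min \<epsilon> f)) f) \<le> K" using that a by (intro K) auto
    then show ?thesis by (simp add: k1_def)
  qed
  have le1: "k1 x \<le> q x" if "x > 0" for x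
  proof (cases "x \<ge> a \<or> x \<le> \<epsilon>")
    case True
    then have "k1 x = 0" using z1 ramp0 by (auto simp: k1_def)
    then show ?thesis using qn by simp
  next
    case False
    then have "min (max x (min \<epsilon> f)) f = x" using a by auto
    then have "k1 x = ramp x * max (q x - K) 0" by (simp add: k1_def)
    also have "\<dots> \<le> 1 * max (q x - K) 0" using ramp by (intro mult_right_mono) auto
    also have "\<dots> \<le> q x" using K0 qn[of x] by auto
    finally show ?thesis .
  qed
  have ex: "\<exists>B. \<forall>x. k1 x \<le> B"
  proof -
    have "bounded (k1 ` {0..a})"
      by (intro compact_imp_bounded compact_continuous_image continuous_on_subset[OF c1]) auto
    then obtain B where B: "\<And>x. x \<in> {0..a} \<Longrightarrow> \<bar>k1 x\<bar> \<le> B" unfolding bounded_iff by (metis imageI real_norm_def)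
    have "k1 x \<le> max B 0" for x
    proof (cases "x \<in> {0..a}")
      case True then show ?thesis using B[of x] by linarith
    next
      case False
      then have "k1 x = 0" using z1[of x] ramp0[of x] \<epsilon> by (auto simp: k1_def)
      then show ?thesis by simp
    qed
    then show ?thesis by blast
  qed
  then obtain B where B: "\<And>x. k1 x \<le> B" by blast
  have ub: "q x \<le> K + k1 x" if "2 * \<epsilon> \<le> x" "x \<le> f" for x
  proof -
    have "min (max x (min \<epsilon> f)) f = x" using that \<epsilon> by auto
    then show ?thesis using ramp1[OF that(1)] by (simp add: k1_def)
  qed
  show ?thesis by (rule that[of k1 B]) (use c1 n1 z1 le1 B ub in blast)+
qed

lemma cutoff_right:
  fixes q :: "real \<Rightarrow> real"
  assumes q: "continuous_on {0<..} q" and qn: "\<And>x. q x \<ge> 0" and b: "0 < f" "f \<le> b"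
    and K: "\<And>x. f \<le> x \<Longrightarrow> x \<le> b \<Longrightarrow> q x \<le> K" and n: "n > 0"
  obtains k B N where "continuous_on UNIV k" "\<forall>x. k x \<ge> 0" "\<forall>x. x \<le> b \<longrightarrow> k x = 0" "\<forall>x. x > 0 \<longrightarrow> k x \<le> q x"
    "\<forall>x. k x \<le> B" "\<forall>x. x \<ge> N \<longrightarrow> k x = 0" "N \<ge> b" "\<forall>x. f \<le> x \<longrightarrow> x \<le> n \<longrightarrow> q x \<le> K + k x"
proof -
  define ramp where "ramp x = max 0 (min 1 (2 - x / n))" for x
  define k where "k x = ramp x * max (q (max x f) - K) 0" for x
  have K0: "K \<ge> 0" using K[of f] qn[of f] b by simp
  have c: "continuous_on UNIV k"
    unfolding k_def ramp_def
    by (intro continuous_intros continuous_on_compose2[OF q]) (use b n in auto)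
  have ramp: "0 \<le> ramp x" "ramp x \<le> 1" for x by (auto simp: ramp_def)
  have nn: "k x \<ge> 0" for x unfolding k_def using ramp by auto
  have z: "k x = 0" if "x \<le> b" for x
  proof -
    have "q (max x f) \<le> K" using that b by (intro K) auto
    then show ?thesis by (simp add: k_def)
  qed
  have ramp0: "ramp x = 0" if "x \<ge> 2 * n" for x using that n by (auto simp: ramp_def field_simps max_def min_def)
  have ramp1: "ramp x = 1" if "x \<le> n" for x using that n by (auto simp: ramp_def field_simps max_def min_def)
  have z2: "k x = 0" if "x \<ge> max (2 * n) b" for x using ramp0[of x] that by (auto simp: k_def)
  have le: "k x \<le> q x" if "x > 0" for x
  proof (cases "x \<le> b")
    case True then show ?thesis using z qn by simp
  next
    case False
    then have "max x f = x" using b by auto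
    then have "k x = ramp x * max (q x - K) 0" by (simp add: k_def)
    also have "\<dots> \<le> 1 * max (q x - K) 0" using ramp by (intro mult_right_mono) auto
    also have "\<dots> \<le> q x" using K0 qn[of x] by auto
    finally show ?thesis .
  qed
  have "bounded (k ` {b..max (2 * n) b})"
    by (intro compact_imp_bounded compact_continuous_image continuous_on_subset[OF c]) auto
  then obtain B where B: "\<And>x. x \<in> {b..max (2 * n) b} \<Longrightarrow> \<bar>k x\<bar> \<le> B" unfolding bounded_iff by (metis imageI real_norm_def)
  have B': "k x \<le> max B 0" for x
  proof (cases "x \<in> {b..max (2 * n) b}")
    case True then show ?thesis using B[of x] by linarith
  next
    case False
    then have "x \<le> b \<or> x \<ge> max (2 * n) b" by auto
    then have "k x = 0" using z z2 by blast
    then show ?thesis by simp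
  qed
  have ub: "q x \<le> K + k x" if "f \<le> x" "x \<le> n" for x
    using ramp1[OF that(2)] that(1) by (simp add: k_def max_absorb1)
  have "max (2 * n) b \<ge> b" by simp
  then show ?thesis by (intro that[of k "max B 0" "max (2 * n) b"]) (use c nn z le B' z2 ub in blast)+
qed

text \<open>
  All that the estimates of this part need from the time average is collected here; \<open>\<sigma>\<close> is its standard
  deviation.
\<close>

locale poincare_variable = prob_space M for M :: "'a measure" +
  fixes V :: "'a \<Rightarrow> real" and e \<sigma> :: real
  assumes V_meas[measurable]: "V \<in> borel_measurable M"
    and V_nn: "\<And>\<omega>. V \<omega> \<ge> 0" and V_pos: "AE \<omega> in M. V \<omega> > 0"
    and V_int: "integrable M V" and V2_int: "integrable M (\<lambda>\<omega>. (V \<omega>)\<^sup>2)"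
    and e_def: "e = expectation V" and \<sigma>_pos: "\<sigma> > 0" and \<sigma>_sq: "\<sigma>\<^sup>2 = variance V"
    and poincare: "\<And>\<psi> \<psi>' K. (\<And>x. (\<psi> has_real_derivative \<psi>' x) (at x)) \<Longrightarrow> continuous_on UNIV \<psi>' \<Longrightarrow> \<forall>x\<ge>0. \<bar>\<psi>' x\<bar> \<le> K \<Longrightarrow>
      integrable M (\<lambda>\<omega>. (V \<omega> - e) * \<psi> (V \<omega>)) \<and> integrable M (\<lambda>\<omega>. V \<omega> * \<bar>\<psi>' (V \<omega>)\<bar>) \<and>
      \<bar>expectation (\<lambda>\<omega>. (V \<omega> - e) * \<psi> (V \<omega>))\<bar> \<le> 2 * \<sigma> * expectation (\<lambda>\<omega>. V \<omega> * \<bar>\<psi>' (V \<omega>)\<bar>)"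
begin

lemma e_nonneg: "e \<ge> 0" unfolding e_def using V_nn by simp

lemma lipschitz_integrable:
  assumes d: "\<And>x. (H has_real_derivative H' x) (at x)" and K: "\<forall>x\<ge>0. \<bar>H' x\<bar> \<le> K"
  shows "integrable M (\<lambda>\<omega>. H (V \<omega>))" and "(H :: real \<Rightarrow> real) \<in> borel_measurable borel" and "\<And>x. x \<ge> 0 \<Longrightarrow> \<bar>H x - H 0\<bar> \<le> K * x"
proof -
  show m[measurable]: "H \<in> borel_measurable borel"
    by (rule borel_measurable_continuous_onI[OF DERIV_continuous_on[OF d]])
  show b: "\<bar>H x - H 0\<bar> \<le> K * x" if "x \<ge> 0" for x
  proof -
    have "norm (H x - H 0) \<le> K * norm (x - 0)"
      by (rule field_differentiable_bound[of "{0..x}" H H' K]) (use d K that in \<open>auto intro: DERIV_subset\<close>)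
    then show ?thesis using that by simp
  qed
  show "integrable M (\<lambda>\<omega>. H (V \<omega>))"
  proof (rule Bochner_Integration.integrable_bound)
    show "integrable M (\<lambda>\<omega>. \<bar>H 0\<bar> + K * V \<omega>)" using V_int by simp
    show "AE \<omega> in M. norm (H (V \<omega>)) \<le> norm (\<bar>H 0\<bar> + K * V \<omega>)"
    proof (intro AE_I2)
      fix \<omega> show "norm (H (V \<omega>)) \<le> norm (\<bar>H 0\<bar> + K * V \<omega>)" using b[OF V_nn, of \<omega>] by simp
    qed
  qed simp
qed

text \<open>
  Below \<open>a\<close> the factor \<open>e - V\<close> is at least \<open>\<delta>\<close>, so the Poincare inequality for \<open>\<psi> = H\<close> bounds the mean of
  \<open>H\<close> by \<open>\<sigma>\<close> times the mean of its derivative.  Two such steps gain the factor \<open>\<sigma>\<^sup>2\<close> that a second-order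
  Taylor remainder should have, although only the first moment of the second derivative is available.
\<close>

lemma step_left:
  fixes H H' :: "real \<Rightarrow> real"
  assumes d: "\<And>x. (H has_real_derivative H' x) (at x)" and c: "continuous_on UNIV H'"
    and K: "\<forall>x\<ge>0. \<bar>H' x\<bar> \<le> K" and nn: "\<And>x. H x \<ge> 0"
    and z: "\<And>x. x \<ge> a \<Longrightarrow> H x = 0" "\<And>x. x \<ge> a \<Longrightarrow> H' x = 0" and \<delta>: "e - a \<ge> \<delta>" "\<delta> > 0" and a: "a > 0"
  shows "expectation (\<lambda>\<omega>. H (V \<omega>)) \<le> (2 * \<sigma> * a / \<delta>) * expectation (\<lambda>\<omega>. \<bar>H' (V \<omega>)\<bar>)"
proof -
  note P = poincare[OF d c K]
  have [measurable]: "H' \<in> borel_measurable borel" using c by (rule borel_measurable_continuous_onI)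
  have IH: "integrable M (\<lambda>\<omega>. H (V \<omega>))" by (rule lipschitz_integrable(1)[OF d K])
  have IH': "integrable M (\<lambda>\<omega>. \<bar>H' (V \<omega>)\<bar>)"
    by (rule integrable_const_bound[of _ K]) (use K V_nn in auto)
  have "\<delta> * expectation (\<lambda>\<omega>. H (V \<omega>)) = expectation (\<lambda>\<omega>. \<delta> * H (V \<omega>))" by simp
  also have "\<dots> \<le> expectation (\<lambda>\<omega>. - ((V \<omega> - e) * H (V \<omega>)))"
  proof (rule integral_mono)
    fix \<omega>
    show "\<delta> * H (V \<omega>) \<le> - ((V \<omega> - e) * H (V \<omega>))"
    proof (cases "V \<omega> \<ge> a")
      case False
      then have "\<delta> * H (V \<omega>) \<le> (e - V \<omega>) * H (V \<omega>)" using \<delta> nn by (intro mult_right_mono) auto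
      then show ?thesis by (simp add: algebra_simps)
    qed (simp add: z)
  qed (use IH P in auto)
  also have "\<dots> \<le> \<bar>expectation (\<lambda>\<omega>. (V \<omega> - e) * H (V \<omega>))\<bar>" by simp
  also have "\<dots> \<le> 2 * \<sigma> * expectation (\<lambda>\<omega>. V \<omega> * \<bar>H' (V \<omega>)\<bar>)" using P by blast
  also have "expectation (\<lambda>\<omega>. V \<omega> * \<bar>H' (V \<omega>)\<bar>) \<le> expectation (\<lambda>\<omega>. a * \<bar>H' (V \<omega>)\<bar>)"
  proof (rule integral_mono)
    fix \<omega>
    show "V \<omega> * \<bar>H' (V \<omega>)\<bar> \<le> a * \<bar>H' (V \<omega>)\<bar>"
      by (cases "V \<omega> \<ge> a") (auto simp: z intro!: mult_right_mono)
  qed (use IH' P in auto)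
  finally have "\<delta> * expectation (\<lambda>\<omega>. H (V \<omega>)) \<le> 2 * \<sigma> * (a * expectation (\<lambda>\<omega>. \<bar>H' (V \<omega>)\<bar>))"
    using \<sigma>_pos by simp
  then show ?thesis using \<delta>(2) by (simp add: field_simps)
qed

text \<open>
  The analogue of \<open>step_left\<close> far to the right.  With \<open>\<psi> = H\<close> the factor \<open>V\<close> on the right-hand side of the
  Poincare inequality would be unbounded; the multiplier \<open>x / (1 + x\<^sup>2)\<close>, which behaves like \<open>1 / x\<close>,
  compensates it.  The derivative of the multiplier yields a multiple of the mean of \<open>H\<close> itself, which
  is absorbed on the left because \<open>b\<close> is at least \<open>16 * \<sigma>\<close>.
\<close>

lemma step_right:
  fixes H H' :: "real \<Rightarrow> real"
  assumes d: "\<And>x. (H has_real_derivative H' x) (at x)" and c: "continuous_on UNIV H'"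
    and K: "\<forall>x\<ge>0. \<bar>H' x\<bar> \<le> K" and nn: "\<And>x. H x \<ge> 0"
    and z: "\<And>x. x \<le> b \<Longrightarrow> H x = 0" "\<And>x. x \<le> b \<Longrightarrow> H' x = 0" and b: "b \<ge> 1" "b \<ge> 2 * e" "b \<ge> 16 * \<sigma>"
  shows "expectation (\<lambda>\<omega>. H (V \<omega>)) \<le> 16 * \<sigma> * expectation (\<lambda>\<omega>. \<bar>H' (V \<omega>)\<bar>)"
proof -
  have K0: "K \<ge> 0" using K by (auto dest: spec[of _ 0])
  have [measurable]: "H' \<in> borel_measurable borel" using c by (rule borel_measurable_continuous_onI)
  have IH: "integrable M (\<lambda>\<omega>. H (V \<omega>))" by (rule lipschitz_integrable(1)[OF d K])
  have IH': "integrable M (\<lambda>\<omega>. \<bar>H' (V \<omega>)\<bar>)"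
    by (rule integrable_const_bound[of _ K]) (use K V_nn in auto)
  have Hb: "H x \<le> K * x" if "x \<ge> 0" for x
    using lipschitz_integrable(3)[OF d K that] z(1)[of 0] b by simp
  define \<psi> where "\<psi> x = H x * (x / (1 + x\<^sup>2))" for x
  define \<psi>' where "\<psi>' x = H' x * (x / (1 + x\<^sup>2)) + H x * ((1 - x\<^sup>2) / (1 + x\<^sup>2)\<^sup>2)" for x
  have p: "1 + x\<^sup>2 > 0" "1 + x\<^sup>2 \<noteq> 0" for x :: real
    using zero_le_power2[of x] by linarith+
  have d\<psi>: "(\<psi> has_real_derivative \<psi>' x) (at x)" for x
  proof -
    have "((\<lambda>x. x / (1 + x\<^sup>2)) has_real_derivative ((1 - x\<^sup>2) / (1 + x\<^sup>2)\<^sup>2)) (at x)"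
      using p[of x] by (auto intro!: derivative_eq_intros simp: power2_eq_square algebra_simps)
    from DERIV_mult[OF d this] show ?thesis unfolding \<psi>_def \<psi>'_def by (simp add: algebra_simps)
  qed
  have c\<psi>': "continuous_on UNIV \<psi>'"
    unfolding \<psi>'_def by (intro continuous_intros c DERIV_continuous_on[OF d]) (use p in auto)
  have frac: "\<bar>(1 - x\<^sup>2) / (1 + x\<^sup>2)\<^sup>2\<bar> \<le> 1 / (1 + x\<^sup>2)" for x :: real
  proof -
    have "\<bar>1 - x\<^sup>2\<bar> \<le> 1 + x\<^sup>2" using zero_le_power2[of x] by linarith
    then have "\<bar>1 - x\<^sup>2\<bar> / (1 + x\<^sup>2)\<^sup>2 \<le> (1 + x\<^sup>2) / (1 + x\<^sup>2)\<^sup>2" by (intro divide_right_mono) auto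
    also have "\<dots> = 1 / (1 + x\<^sup>2)" using p[of x] by (simp add: power2_eq_square)
    finally show ?thesis by (simp add: abs_divide)
  qed
  have fx: "x / (1 + x\<^sup>2) \<le> 1" "x * (x / (1 + x\<^sup>2)) \<le> 1" if "x \<ge> 0" for x :: real
  proof -
    have "x \<le> 1 + x\<^sup>2" using zero_le_power2[of "x - 1 / 2"] by (simp add: power2_eq_square algebra_simps)
    then show "x / (1 + x\<^sup>2) \<le> 1" using p[of x] by simp
    show "x * (x / (1 + x\<^sup>2)) \<le> 1" using p[of x] by (simp add: power2_eq_square)
  qed
  have K\<psi>': "\<forall>x\<ge>0. \<bar>\<psi>' x\<bar> \<le> 2 * K"
  proof (intro allI impI)
    fix x :: real assume x: "x \<ge> 0"
    have "\<bar>H' x * (x / (1 + x\<^sup>2))\<bar> \<le> K * 1"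
      unfolding abs_mult using K x fx(1)[OF x] p[of x] by (intro mult_mono) auto
    moreover have "\<bar>H x * ((1 - x\<^sup>2) / (1 + x\<^sup>2)\<^sup>2)\<bar> \<le> K"
    proof -
      have "\<bar>H x * ((1 - x\<^sup>2) / (1 + x\<^sup>2)\<^sup>2)\<bar> \<le> (K * x) * (1 / (1 + x\<^sup>2))"
        unfolding abs_mult using Hb[OF x] nn[of x] frac[of x] by (intro mult_mono) auto
      also have "\<dots> = K * (x / (1 + x\<^sup>2))" by simp
      also have "\<dots> \<le> K * 1" using K0 fx(1)[OF x] by (intro mult_left_mono) auto
      finally show ?thesis by simp
    qed
    ultimately have "\<bar>H' x * (x / (1 + x\<^sup>2))\<bar> + \<bar>H x * ((1 - x\<^sup>2) / (1 + x\<^sup>2)\<^sup>2)\<bar> \<le> 2 * K" by simp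
    then show "\<bar>\<psi>' x\<bar> \<le> 2 * K" unfolding \<psi>'_def by (rule order_trans[OF abs_triangle_ineq])
  qed
  note P = poincare[OF d\<psi> c\<psi>' K\<psi>']
  have b0: "b > 0" using b by simp
  have "expectation (\<lambda>\<omega>. H (V \<omega>)) / 4 = expectation (\<lambda>\<omega>. H (V \<omega>) / 4)" by simp
  also have "\<dots> \<le> expectation (\<lambda>\<omega>. (V \<omega> - e) * \<psi> (V \<omega>))"
  proof (rule integral_mono)
    fix \<omega>
    show "H (V \<omega>) / 4 \<le> (V \<omega> - e) * \<psi> (V \<omega>)"
    proof (cases "V \<omega> \<le> b")
      case True then show ?thesis by (simp add: z \<psi>_def)
    next
      case False
      define x where "x = V \<omega>"
      have x: "x > b" "x \<ge> 1" "x / 2 \<le> x - e" using False b by (auto simp: x_def)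
      have "1 / 4 \<le> (x / 2) * (x / (1 + x\<^sup>2))"
      proof -
        have "1 \<le> x\<^sup>2" using x(2) by (simp add: one_le_power)
        then show ?thesis using p[of x] by (simp add: power2_eq_square field_simps)
      qed
      also have "\<dots> \<le> (x - e) * (x / (1 + x\<^sup>2))" using x p[of x] by (intro mult_right_mono) auto
      finally have "H x * (1 / 4) \<le> H x * ((x - e) * (x / (1 + x\<^sup>2)))" using nn by (intro mult_left_mono)
      then show ?thesis by (simp add: \<psi>_def x_def mult_ac)
    qed
  qed (use IH P in auto)
  also have "\<dots> \<le> 2 * \<sigma> * expectation (\<lambda>\<omega>. V \<omega> * \<bar>\<psi>' (V \<omega>)\<bar>)" using P by linarith
  also have "expectation (\<lambda>\<omega>. V \<omega> * \<bar>\<psi>' (V \<omega>)\<bar>) \<le> expectation (\<lambda>\<omega>. \<bar>H' (V \<omega>)\<bar> + H (V \<omega>) / b)"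
  proof (rule integral_mono)
    fix \<omega>
    define x where "x = V \<omega>"
    have x0: "x \<ge> 0" using V_nn by (simp add: x_def)
    show "V \<omega> * \<bar>\<psi>' (V \<omega>)\<bar> \<le> \<bar>H' (V \<omega>)\<bar> + H (V \<omega>) / b"
    proof (cases "x \<le> b")
      case True then show ?thesis by (simp add: z \<psi>'_def x_def)
    next
      case False
      have "x * \<bar>\<psi>' x\<bar> \<le> x * (\<bar>H' x * (x / (1 + x\<^sup>2))\<bar> + \<bar>H x * ((1 - x\<^sup>2) / (1 + x\<^sup>2)\<^sup>2)\<bar>)"
        unfolding \<psi>'_def using x0 by (intro mult_left_mono abs_triangle_ineq)
      also have "\<dots> = \<bar>H' x\<bar> * (x * (x / (1 + x\<^sup>2))) + H x * (x * \<bar>(1 - x\<^sup>2) / (1 + x\<^sup>2)\<^sup>2\<bar>)"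
      proof -
        have "\<bar>H' x * (x / (1 + x\<^sup>2))\<bar> = \<bar>H' x\<bar> * (x / (1 + x\<^sup>2))" using x0 p[of x] by (simp add: abs_mult)
        moreover have "\<bar>H x * ((1 - x\<^sup>2) / (1 + x\<^sup>2)\<^sup>2)\<bar> = H x * \<bar>(1 - x\<^sup>2) / (1 + x\<^sup>2)\<^sup>2\<bar>"
          unfolding abs_mult using nn[of x] by simp
        ultimately show ?thesis by (simp only: distrib_left mult_ac)
      qed
      also have "\<dots> \<le> \<bar>H' x\<bar> * 1 + H x * (1 / b)"
      proof (intro add_mono mult_left_mono)
        show "x * (x / (1 + x\<^sup>2)) \<le> 1" by (rule fx(2)[OF x0])
        have "x * \<bar>(1 - x\<^sup>2) / (1 + x\<^sup>2)\<^sup>2\<bar> \<le> x * (1 / (1 + x\<^sup>2))" using frac x0 by (intro mult_left_mono)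
        also have "\<dots> \<le> 1 / x" using False b0 p[of x] by (simp add: power2_eq_square field_simps)
        also have "\<dots> \<le> 1 / b" using False b0 by (intro divide_left_mono) auto
        finally show "x * \<bar>(1 - x\<^sup>2) / (1 + x\<^sup>2)\<^sup>2\<bar> \<le> 1 / b" .
      qed (use nn in auto)
      finally show ?thesis by (simp add: x_def)
    qed
  qed (use IH IH' P in auto)
  also have "\<dots> = expectation (\<lambda>\<omega>. \<bar>H' (V \<omega>)\<bar>) + expectation (\<lambda>\<omega>. H (V \<omega>)) / b"
    using IH IH' by simp
  finally have *: "expectation (\<lambda>\<omega>. H (V \<omega>)) / 4 \<le> 2 * \<sigma> * expectation (\<lambda>\<omega>. \<bar>H' (V \<omega>)\<bar>) + (2 * \<sigma> / b) * expectation (\<lambda>\<omega>. H (V \<omega>))"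
    using \<sigma>_pos by (simp add: distrib_left)
  have "(2 * \<sigma> / b) * expectation (\<lambda>\<omega>. H (V \<omega>)) \<le> (1 / 8) * expectation (\<lambda>\<omega>. H (V \<omega>))"
    using b b0 nn by (intro mult_right_mono) (auto simp: field_simps)
  with * show ?thesis by simp
qed

text \<open>
  Fatou's lemma along the events that \<open>V\<close> lies between \<open>1 / N\<close> and \<open>N\<close>, which exhaust the space as \<open>V\<close> is
  positive almost surely.  It removes the cut-offs at the end.
\<close>

lemma expectation_exhaust:
  fixes Y :: "'a \<Rightarrow> real"
  assumes [measurable]: "Y \<in> borel_measurable M" and nn: "\<And>\<omega>. Y \<omega> \<ge> 0" and c: "c \<ge> 0"
    and U: "\<And>N::nat. N \<ge> 1 \<Longrightarrow> \<exists>U. integrable M U \<and> (\<forall>\<omega>\<in>space M. U \<omega> \<ge> 0) \<and>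
      (\<forall>\<omega>\<in>space M. 1 / real N \<le> V \<omega> \<and> V \<omega> \<le> real N \<longrightarrow> Y \<omega> \<le> U \<omega>) \<and> expectation U \<le> c"
  shows "integrable M Y" "expectation Y \<le> c"
proof -
  define S where "S N = {x. 1 / real (Suc N) \<le> x \<and> x \<le> real (Suc N)}" for N
  have [measurable]: "S N \<in> sets borel" for N unfolding S_def by measurable
  have b: "(\<integral>\<^sup>+\<omega>. ennreal (indicator (S N) (V \<omega>) * Y \<omega>) \<partial>M) \<le> ennreal c" for N
  proof -
    obtain U where U: "integrable M U" "\<And>\<omega>. \<omega> \<in> space M \<Longrightarrow> U \<omega> \<ge> 0"
      "\<And>\<omega>. \<omega> \<in> space M \<Longrightarrow> 1 / real (Suc N) \<le> V \<omega> \<Longrightarrow> V \<omega> \<le> real (Suc N) \<Longrightarrow> Y \<omega> \<le> U \<omega>" "expectation U \<le> c"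
      using U[of "Suc N"] by auto
    have "(\<integral>\<^sup>+\<omega>. ennreal (indicator (S N) (V \<omega>) * Y \<omega>) \<partial>M) \<le> (\<integral>\<^sup>+\<omega>. ennreal (U \<omega>) \<partial>M)"
      using U(2,3) by (intro nn_integral_mono ennreal_leI) (auto simp: indicator_def S_def)
    also have "\<dots> = ennreal (expectation U)" using U by (intro nn_integral_eq_integral) auto
    also have "\<dots> \<le> ennreal c" using U by (intro ennreal_leI)
    finally show ?thesis .
  qed
  have "(\<integral>\<^sup>+\<omega>. ennreal (Y \<omega>) \<partial>M) = (\<integral>\<^sup>+\<omega>. liminf (\<lambda>N. ennreal (indicator (S N) (V \<omega>) * Y \<omega>)) \<partial>M)"
  proof (rule nn_integral_cong_AE)
    show "AE \<omega> in M. ennreal (Y \<omega>) = liminf (\<lambda>N. ennreal (indicator (S N) (V \<omega>) * Y \<omega>))"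
      using V_pos
    proof eventually_elim
      case (elim \<omega>)
      obtain n1 :: nat where n1: "1 / V \<omega> \<le> real n1" using real_arch_simple by blast
      obtain n2 :: nat where n2: "V \<omega> \<le> real n2" using real_arch_simple by blast
      have ev: "indicator (S N) (V \<omega>) * Y \<omega> = Y \<omega>" if "N \<ge> max n1 n2" for N
      proof -
        have "1 / V \<omega> \<le> real (Suc N)" "V \<omega> \<le> real (Suc N)" using that n1 n2 by auto
        then have "V \<omega> \<in> S N" using elim by (simp add: S_def field_simps)
        then show ?thesis by simp
      qed
      have "\<forall>\<^sub>F N in sequentially. ennreal (indicator (S N) (V \<omega>) * Y \<omega>) = ennreal (Y \<omega>)"
        by (intro eventually_sequentiallyI[of "max n1 n2"]) (simp only: ev)
      then have "(\<lambda>N. ennreal (indicator (S N) (V \<omega>) * Y \<omega>)) \<longlonglongrightarrow> ennreal (Y \<omega>)"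
        by (rule tendsto_eventually)
      then show ?case by (rule lim_imp_Liminf[OF sequentially_bot, symmetric])
    qed
  qed
  also have "\<dots> \<le> liminf (\<lambda>N. \<integral>\<^sup>+\<omega>. ennreal (indicator (S N) (V \<omega>) * Y \<omega>) \<partial>M)"
    by (rule nn_integral_liminf) simp
  also have "\<dots> \<le> ennreal c"
    using b by (intro Liminf_le always_eventually allI) auto
  finally have bY: "(\<integral>\<^sup>+\<omega>. ennreal (Y \<omega>) \<partial>M) \<le> ennreal c" .
  show I: "integrable M Y"
    using bY nn by (intro integrableI_bounded) (auto simp: less_top top_unique intro: le_less_trans)
  show "expectation Y \<le> c" using bY I nn c by (simp add: nn_integral_eq_integral)
qed

lemma second_moment_about:
  "integrable M (\<lambda>\<omega>. (V \<omega> - c)\<^sup>2)" "expectation (\<lambda>\<omega>. (V \<omega> - c)\<^sup>2) = \<sigma>\<^sup>2 + (e - c)\<^sup>2"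
proof -
  have eq: "(\<lambda>\<omega>. (V \<omega> - c)\<^sup>2) = (\<lambda>\<omega>. (V \<omega>)\<^sup>2 - 2 * c * V \<omega> + c\<^sup>2)"
    by (simp add: fun_eq_iff power2_diff algebra_simps)
  show "integrable M (\<lambda>\<omega>. (V \<omega> - c)\<^sup>2)" unfolding eq using V_int V2_int by simp
  have "expectation (\<lambda>\<omega>. (V \<omega> - c)\<^sup>2) = expectation (\<lambda>\<omega>. (V \<omega>)\<^sup>2) - 2 * c * e + c\<^sup>2"
    unfolding eq using V_int V2_int by (simp add: e_def prob_space)
  moreover have "\<sigma>\<^sup>2 = expectation (\<lambda>\<omega>. (V \<omega>)\<^sup>2) - e\<^sup>2"
    unfolding \<sigma>_sq e_def by (rule variance_eq[OF V_int V2_int])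
  ultimately show "expectation (\<lambda>\<omega>. (V \<omega> - c)\<^sup>2) = \<sigma>\<^sup>2 + (e - c)\<^sup>2"
    by (simp add: power2_diff algebra_simps)
qed

lemma first_moment_about:
  "integrable M (\<lambda>\<omega>. \<bar>V \<omega> - c\<bar>)" "expectation (\<lambda>\<omega>. \<bar>V \<omega> - c\<bar>) \<le> \<sigma> + \<bar>e - c\<bar>"
proof -
  show 1: "integrable M (\<lambda>\<omega>. \<bar>V \<omega> - c\<bar>)" using V_int by auto
  have I: "integrable M (\<lambda>\<omega>. (\<bar>V \<omega> - c\<bar>)\<^sup>2)" using second_moment_about(1)[of c] by simp
  have "(expectation (\<lambda>\<omega>. \<bar>V \<omega> - c\<bar>))\<^sup>2 \<le> expectation (\<lambda>\<omega>. (\<bar>V \<omega> - c\<bar>)\<^sup>2)"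
    using variance_eq[OF 1 I] variance_positive[of "\<lambda>\<omega>. \<bar>V \<omega> - c\<bar>"] by simp
  also have "\<dots> = \<sigma>\<^sup>2 + (e - c)\<^sup>2" using second_moment_about(2)[of c] by simp
  also have "\<dots> \<le> (\<sigma> + \<bar>e - c\<bar>)\<^sup>2" using \<sigma>_pos by (simp add: power2_sum)
  finally show "expectation (\<lambda>\<omega>. \<bar>V \<omega> - c\<bar>) \<le> \<sigma> + \<bar>e - c\<bar>"
    by (rule power2_le_imp_le) (use \<sigma>_pos in simp)
qed

text \<open>
  \<open>L2\<close> is the second antiderivative, started at \<open>b\<close>, of the cut-off excess of \<open>q\<close> over \<open>K\<close>.  Two applications
  of \<open>step_right\<close> lead from its mean to that of \<open>W\<close>.
\<close>

lemma right_tail_bound: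
  fixes q :: "real \<Rightarrow> real" and W :: "'a \<Rightarrow> real"
  assumes q: "continuous_on {0<..} q" and qn: "\<And>x. q x \<ge> 0" and f: "0 < f" "f \<le> b"
    and K: "\<And>x. f \<le> x \<Longrightarrow> x \<le> b \<Longrightarrow> q x \<le> K" and b: "b \<ge> 1" "b \<ge> 2 * e" "b \<ge> 16 * \<sigma>"
    and W: "integrable M W" "\<And>\<omega>. \<omega> \<in> space M \<Longrightarrow> V \<omega> > 0 \<Longrightarrow> q (V \<omega>) \<le> W \<omega>" and n: "n > 0"
  obtains k L1 L2 where "\<forall>x. (L2 has_real_derivative L1 x) (at x)" "\<forall>x. (L1 has_real_derivative k x) (at x)"
    "\<forall>x. L2 x \<ge> 0" "\<forall>x. x \<le> b \<longrightarrow> L2 x = 0" "\<forall>x. x \<le> b \<longrightarrow> L1 x = 0" "\<forall>x. k x \<ge> 0" "\<forall>x. L1 x \<ge> 0"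
    "\<forall>x. f \<le> x \<longrightarrow> x \<le> n \<longrightarrow> q x \<le> K + k x"
    "integrable M (\<lambda>\<omega>. L2 (V \<omega>))" "expectation (\<lambda>\<omega>. L2 (V \<omega>)) \<le> 256 * \<sigma>\<^sup>2 * expectation W"
proof -
  obtain k Bk N where k0: "continuous_on UNIV k" "\<forall>x. k x \<ge> 0" "\<forall>x. x \<le> b \<longrightarrow> k x = 0" "\<forall>x. x > 0 \<longrightarrow> k x \<le> q x"
    "\<forall>x. k x \<le> Bk" "\<forall>x. x \<ge> N \<longrightarrow> k x = 0" "N \<ge> b" "\<forall>x. f \<le> x \<longrightarrow> x \<le> n \<longrightarrow> q x \<le> K + k x"
    by (rule cutoff_right[OF q qn f K n]) assumption+
  note k = k0[rule_format]
  obtain L1 where L10: "\<forall>x. (L1 has_real_derivative k x) (at x)" "\<forall>x. L1 x \<ge> 0" "\<forall>x. x \<le> b \<longrightarrow> L1 x = 0" "\<forall>x y. x \<le> y \<longrightarrow> L1 x \<le> L1 y"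
    by (rule right_primitive[OF k(1,2,3)]) assumption+
  note L1 = L10[rule_format]
  have cL1: "continuous_on UNIV L1" by (rule DERIV_continuous_on[OF L1(1)])
  obtain L2 where L20: "\<forall>x. (L2 has_real_derivative L1 x) (at x)" "\<forall>x. L2 x \<ge> 0" "\<forall>x. x \<le> b \<longrightarrow> L2 x = 0" "\<forall>x y. x \<le> y \<longrightarrow> L2 x \<le> L2 y"
    by (rule right_primitive[OF cL1 L1(2,3)]) assumption+
  note L2 = L20[rule_format]
  have L1N: "L1 x \<le> L1 N" for x
  proof (cases "x \<le> N")
    case True then show ?thesis by (rule L1(4))
  next
    case False
    then have "L1 x = L1 N" using constant_of_zero_derivative[OF L1(1), of N x] k(6) by auto
    then show ?thesis by simp
  qed
  have b1: "\<forall>x\<ge>0. \<bar>k x\<bar> \<le> Bk" using k(2,5) by auto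
  have b2: "\<forall>x\<ge>0. \<bar>L1 x\<bar> \<le> L1 N" using L1(2) L1N by auto
  have s2: "expectation (\<lambda>\<omega>. L2 (V \<omega>)) \<le> 16 * \<sigma> * expectation (\<lambda>\<omega>. \<bar>L1 (V \<omega>)\<bar>)"
    by (rule step_right[OF L2(1) cL1 b2 L2(2) L2(3) L1(3) b])
  have s1: "expectation (\<lambda>\<omega>. L1 (V \<omega>)) \<le> 16 * \<sigma> * expectation (\<lambda>\<omega>. \<bar>k (V \<omega>)\<bar>)"
    by (rule step_right[OF L1(1) k(1) b1 L1(2) L1(3) k(3) b])
  have [measurable]: "k \<in> borel_measurable borel" using k(1) by (rule borel_measurable_continuous_onI)
  have s0: "expectation (\<lambda>\<omega>. \<bar>k (V \<omega>)\<bar>) \<le> expectation W"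
  proof (rule integral_mono_AE)
    show "integrable M (\<lambda>\<omega>. \<bar>k (V \<omega>)\<bar>)" by (rule integrable_const_bound[of _ Bk]) (use k(2,5) in auto)
    show "AE \<omega> in M. \<bar>k (V \<omega>)\<bar> \<le> W \<omega>"
      using V_pos AE_space by eventually_elim (use k(2,4) W(2) in \<open>force intro: order_trans\<close>)
  qed (rule W)
  have "expectation (\<lambda>\<omega>. L2 (V \<omega>)) \<le> 16 * \<sigma> * (16 * \<sigma> * expectation (\<lambda>\<omega>. \<bar>k (V \<omega>)\<bar>))"
    using s2 s1 L1(2) \<sigma>_pos by (simp add: mult_left_mono order_trans)
  also have "\<dots> \<le> 16 * \<sigma> * (16 * \<sigma> * expectation W)" using s0 \<sigma>_pos by (intro mult_left_mono) auto
  finally have "expectation (\<lambda>\<omega>. L2 (V \<omega>)) \<le> 256 * \<sigma>\<^sup>2 * expectation W" by (simp add: power2_eq_square)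
  then show ?thesis
    by (intro that[of L2 L1 k]) (use L2 L1 k lipschitz_integrable(1)[OF L2(1) b2] in blast)+
qed

text \<open>
  On the compact interval from \<open>f / 2\<close> to \<open>b\<close> the second derivative is at most \<open>K\<close>, which contributes
  \<open>K / 2\<close> times the second moment about \<open>f\<close>.  The parts of \<open>\<bar>g''\<bar>\<close> exceeding \<open>K\<close> on the two sides are
  integrated twice, to \<open>A2\<close> and \<open>L2\<close>, whose means are bounded by the step lemmas.  The hypothesis on \<open>e\<close>
  keeps the mean away from the left part.
\<close>

theorem delta_remainder_bound:
  fixes g g' g'' :: "real \<Rightarrow> real" and W :: "'a \<Rightarrow> real"
  assumes g: "\<And>x. x > 0 \<Longrightarrow> (g has_real_derivative g' x) (at x)" "\<And>x. x > 0 \<Longrightarrow> (g' has_real_derivative g'' x) (at x)"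
    "continuous_on {0<..} g''" and gm: "(\<lambda>\<omega>. g (V \<omega>)) \<in> borel_measurable M"
    and f: "f > 0" "e \<ge> 3 / 4 * f" "f \<le> b" and b: "b \<ge> 1" "b \<ge> 2 * e" "b \<ge> 16 * \<sigma>"
    and K: "\<And>x. f / 2 \<le> x \<Longrightarrow> x \<le> b \<Longrightarrow> \<bar>g'' x\<bar> \<le> K"
    and W: "integrable M W" "\<And>\<omega>. \<omega> \<in> space M \<Longrightarrow> V \<omega> > 0 \<Longrightarrow> \<bar>g'' (V \<omega>)\<bar> \<le> W \<omega>" "\<And>\<omega>. W \<omega> \<ge> 0"
  shows "integrable M (\<lambda>\<omega>. \<bar>g (V \<omega>) - g f - g' f * (V \<omega> - f)\<bar>)"
    "expectation (\<lambda>\<omega>. \<bar>g (V \<omega>) - g f - g' f * (V \<omega> - f)\<bar>) \<le> K / 2 * (\<sigma>\<^sup>2 + (e - f)\<^sup>2) + 272 * \<sigma>\<^sup>2 * expectation W"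
proof -
  define q where "q x = \<bar>g'' x\<bar>" for x
  have q: "continuous_on {0<..} q" unfolding q_def by (intro continuous_intros g(3))
  have qn: "q x \<ge> 0" for x by (simp add: q_def)
  have "\<bar>g'' f\<bar> \<le> K" using f by (intro K) auto
  then have K0: "K \<ge> 0" by linarith
  have EW: "expectation W \<ge> 0" using W(3) by simp
  define Y where "Y \<omega> = \<bar>g (V \<omega>) - g f - g' f * (V \<omega> - f)\<bar>" for \<omega>
  have Ym: "Y \<in> borel_measurable M" unfolding Y_def[abs_def] using gm by measurable
  have c0: "K / 2 * (\<sigma>\<^sup>2 + (e - f)\<^sup>2) + 272 * \<sigma>\<^sup>2 * expectation W \<ge> 0" using K0 EW by simp
  have key: "\<exists>U. integrable M U \<and> (\<forall>\<omega>\<in>space M. U \<omega> \<ge> 0) \<and>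
      (\<forall>\<omega>\<in>space M. 1 / real N \<le> V \<omega> \<and> V \<omega> \<le> real N \<longrightarrow> Y \<omega> \<le> U \<omega>) \<and>
      expectation U \<le> K / 2 * (\<sigma>\<^sup>2 + (e - f)\<^sup>2) + 272 * \<sigma>\<^sup>2 * expectation W" if N: "N \<ge> 1" for N :: nat
  proof -
    define \<epsilon> where "\<epsilon> = 1 / real N / 2"
    have \<epsilon>: "\<epsilon> > 0" "2 * \<epsilon> = 1 / real N" using N by (simp_all add: \<epsilon>_def)
    have N0: "real N > 0" using N by simp
    have Kq: "q x \<le> K" if "f / 2 \<le> x" "x \<le> b" for x using K[OF that] by (simp add: q_def)
    have Kq1: "q x \<le> K" if "f / 2 \<le> x" "x \<le> f" for x using Kq[of x] that f by simp
    have Kq2: "q x \<le> K" if "f \<le> x" "x \<le> b" for x using Kq[of x] that f by simp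
    have qW: "q (V \<omega>) \<le> W \<omega>" if "\<omega> \<in> space M" "V \<omega> > 0" for \<omega> using W(2)[OF that] by (simp add: q_def)
    obtain k L1 L2 where R0: "\<forall>x. (L2 has_real_derivative L1 x) (at x)" "\<forall>x. (L1 has_real_derivative k x) (at x)"
      "\<forall>x. L2 x \<ge> 0" "\<forall>x. x \<le> b \<longrightarrow> L2 x = 0" "\<forall>x. x \<le> b \<longrightarrow> L1 x = 0" "\<forall>x. k x \<ge> 0" "\<forall>x. L1 x \<ge> 0"
      "\<forall>x. f \<le> x \<longrightarrow> x \<le> real N \<longrightarrow> q x \<le> K + k x"
      "integrable M (\<lambda>\<omega>. L2 (V \<omega>))" "expectation (\<lambda>\<omega>. L2 (V \<omega>)) \<le> 256 * \<sigma>\<^sup>2 * expectation W"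
      by (rule right_tail_bound[OF q qn f(1,3) Kq2 b W(1) qW N0]) assumption+
    note R = R0[rule_format]
    have fh: "0 < f / 2" "f / 2 \<le> f" using f by auto
    obtain j Bj where j0: "continuous_on UNIV j" "\<forall>x. j x \<ge> 0" "\<forall>x. x \<ge> f / 2 \<longrightarrow> j x = 0" "\<forall>x. x > 0 \<longrightarrow> j x \<le> q x"
      "\<forall>x. j x \<le> Bj" "\<forall>x. 2 * \<epsilon> \<le> x \<longrightarrow> x \<le> f \<longrightarrow> q x \<le> K + j x"
      by (rule cutoff_left[OF q qn fh(1,2) Kq1 \<epsilon>(1)]) assumption+
    note j = j0[rule_format]
    have f2: "f / 2 \<ge> 0" using f by simp
    obtain A1 where A10: "\<forall>x. (A1 has_real_derivative - j x) (at x)" "\<forall>x. A1 x \<ge> 0" "\<forall>x. x \<ge> f / 2 \<longrightarrow> A1 x = 0"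
      "\<forall>x. x \<ge> 0 \<longrightarrow> A1 x \<le> Bj * (f / 2)" "\<forall>x y. x \<le> y \<longrightarrow> A1 y \<le> A1 x"
      "\<forall>x m. x \<le> f / 2 \<longrightarrow> (\<forall>u. x \<le> u \<longrightarrow> u \<le> f / 2 \<longrightarrow> j u \<le> m) \<longrightarrow> A1 x \<le> (f / 2 - x) * m"
      by (rule left_primitive[OF j(1,2,3) j(5) f2]) assumption+
    note A1 = A10[rule_format]
    have cA1: "continuous_on UNIV A1" by (rule DERIV_continuous_on[OF A1(1)])
    obtain A2 where A20: "\<forall>x. (A2 has_real_derivative - A1 x) (at x)" "\<forall>x. A2 x \<ge> 0" "\<forall>x. x \<ge> f / 2 \<longrightarrow> A2 x = 0"
      "\<forall>x. x \<ge> 0 \<longrightarrow> A2 x \<le> Bj * (f / 2) * (f / 2)" "\<forall>x y. x \<le> y \<longrightarrow> A2 y \<le> A2 x"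
      "\<forall>x m. x \<le> f / 2 \<longrightarrow> (\<forall>u. x \<le> u \<longrightarrow> u \<le> f / 2 \<longrightarrow> A1 u \<le> m) \<longrightarrow> A2 x \<le> (f / 2 - x) * m"
      by (rule left_primitive[OF cA1 A1(2,3,4) f2]) assumption+
    note A2 = A20[rule_format]
    have bA1: "\<forall>x\<ge>0. \<bar>- j x\<bar> \<le> Bj" using j(2,5) by auto
    have bA2: "\<forall>x\<ge>0. \<bar>- A1 x\<bar> \<le> Bj * (f / 2)" using A1(2,4) by auto
    have \<delta>: "e - f / 2 \<ge> f / 4" "f / 4 > 0" "f / 2 > 0" using f by auto
    \<comment> \<open>the factor of \<open>step_left\<close> for \<open>a = f / 2\<close> and \<open>\<delta> = f / 4\<close>\<close>
    have fac: "2 * \<sigma> * (f / 2) / (f / 4) = 4 * \<sigma>" using f by simp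
    have [measurable]: "j \<in> borel_measurable borel" using j(1) by (rule borel_measurable_continuous_onI)
    have "expectation (\<lambda>\<omega>. A2 (V \<omega>)) \<le> 4 * \<sigma> * expectation (\<lambda>\<omega>. \<bar>- A1 (V \<omega>)\<bar>)"
      using step_left[OF A2(1) continuous_on_minus[OF cA1] bA2 A2(2) A2(3) _ \<delta>] A1(3) unfolding fac by simp
    also have "\<dots> = 4 * \<sigma> * expectation (\<lambda>\<omega>. A1 (V \<omega>))" using A1(2) by simp
    also have "expectation (\<lambda>\<omega>. A1 (V \<omega>)) \<le> 4 * \<sigma> * expectation (\<lambda>\<omega>. \<bar>- j (V \<omega>)\<bar>)"
      using step_left[OF A1(1) continuous_on_minus[OF j(1)] bA1 A1(2) A1(3) _ \<delta>] j(3) unfolding fac by simp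
    also have "expectation (\<lambda>\<omega>. \<bar>- j (V \<omega>)\<bar>) \<le> expectation W"
    proof (rule integral_mono_AE)
      show "integrable M (\<lambda>\<omega>. \<bar>- j (V \<omega>)\<bar>)" by (rule integrable_const_bound[of _ Bj]) (use j(2,5) in auto)
      show "AE \<omega> in M. \<bar>- j (V \<omega>)\<bar> \<le> W \<omega>"
        using V_pos AE_space by eventually_elim (use j(2,4) qW in \<open>force intro: order_trans\<close>)
    qed (rule W)
    finally have EA: "expectation (\<lambda>\<omega>. A2 (V \<omega>)) \<le> 16 * \<sigma>\<^sup>2 * expectation W"
      using \<sigma>_pos by (simp add: power2_eq_square)
    have IA: "integrable M (\<lambda>\<omega>. A2 (V \<omega>))" by (rule lipschitz_integrable(1)[OF A2(1) bA2])
    define U where "U \<omega> = K / 2 * (V \<omega> - f)\<^sup>2 + A2 (V \<omega>) + L2 (V \<omega>)" for \<omega>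
    have IU: "integrable M U" unfolding U_def[abs_def] using second_moment_about(1)[of f] IA R(9) by simp
    have EU: "expectation U = K / 2 * (\<sigma>\<^sup>2 + (e - f)\<^sup>2) + expectation (\<lambda>\<omega>. A2 (V \<omega>)) + expectation (\<lambda>\<omega>. L2 (V \<omega>))"
      unfolding U_def[abs_def] using second_moment_about[of f] IA R(9) by simp
    have U0: "U \<omega> \<ge> 0" for \<omega> unfolding U_def using K0 A2(2) R(3) by simp
    have YU: "Y \<omega> \<le> U \<omega>" if v: "1 / real N \<le> V \<omega>" "V \<omega> \<le> real N" for \<omega>
    proof -
      define l where "l = min f (V \<omega>)"
      define u where "u = max f (V \<omega>)"
      have l0: "l > 0" using f v N0 unfolding l_def by (simp add: less_le_trans[OF divide_pos_pos[OF zero_less_one N0] v(1)])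
      have tri: "s * (g (V \<omega>) - g f - g' f * (V \<omega> - f)) \<le> U \<omega>" if s: "s = 1 \<or> s = -1" for s :: real
      proof -
        define D where "D x = K / 2 * (x - f)\<^sup>2 + A2 x + L2 x - s * (g x - g f - g' f * (x - f))" for x
        define D' where "D' x = K * (x - f) - A1 x + L1 x - s * (g' x - g' f)" for x
        define D'' where "D'' x = K + j x + k x - s * g'' x" for x
        have "D (V \<omega>) \<ge> 0"
        proof (rule convex_touching_nonneg[where D=D and x="V \<omega>" and D'=D' and D''=D'' and l=l and u=u and c=f])
          fix x assume x: "x \<in> {l..u}"
          then have x0: "x > 0" using l0 by auto
          show "(D has_real_derivative D' x) (at x)"
            unfolding D_def D'_def using x0
            by (auto intro!: derivative_eq_intros g A2(1) R(1) simp: field_simps)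
          show "(D' has_real_derivative D'' x) (at x)"
            unfolding D'_def D''_def using x0
            by (auto intro!: derivative_eq_intros g A1(1) R(2) simp: algebra_simps)
          have "q x \<le> K + j x + k x"
          proof (cases "x \<le> f")
            case True
            then have "x \<ge> 1 / real N \<or> x = f" using x v by (auto simp: l_def min_def split: if_splits)
            then show ?thesis using j(6)[of x] True Kq1[of x] j(2)[of x] R(6)[of x] f \<epsilon>(2) by auto
          next
            case False
            then have "x \<le> real N" using x v by (auto simp: u_def max_def split: if_splits)
            then show ?thesis using R(8)[of x] False j(2)[of x] by auto
          qed
          then show "D'' x \<ge> 0" unfolding D''_def q_def using s by auto
        next
          show "D f = 0" unfolding D_def using A2(3)[of f] R(4)[of f] f by simp
          show "D' f = 0" unfolding D'_def using A1(3)[of f] R(5)[of f] f by simp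
        qed (auto simp: l_def u_def)
        then show ?thesis by (simp add: D_def U_def)
      qed
      show ?thesis unfolding Y_def using tri[of 1] tri[of "-1"] by simp
    qed
    show ?thesis
    proof (intro exI[of _ U] conjI ballI impI)
      show "expectation U \<le> K / 2 * (\<sigma>\<^sup>2 + (e - f)\<^sup>2) + 272 * \<sigma>\<^sup>2 * expectation W"
        unfolding EU using EA R(10) by simp
    qed (use IU U0 YU in auto)
  qed
  have Yn: "Y \<omega> \<ge> 0" for \<omega> by (simp add: Y_def)
  note X = expectation_exhaust[OF Ym Yn c0 key]
  show "integrable M (\<lambda>\<omega>. \<bar>g (V \<omega>) - g f - g' f * (V \<omega> - f)\<bar>)"
    using X(1) by (simp add: Y_def[abs_def])
  show "expectation (\<lambda>\<omega>. \<bar>g (V \<omega>) - g f - g' f * (V \<omega> - f)\<bar>) \<le> K / 2 * (\<sigma>\<^sup>2 + (e - f)\<^sup>2) + 272 * \<sigma>\<^sup>2 * expectation W"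
    using X(2) by (simp add: Y_def[abs_def])
qed

text \<open>
  A first-order substitute for the preceding theorem when the mean \<open>e\<close> need not be close to \<open>f\<close>, in
  particular when it lies below \<open>f\<close>.  The expansion point \<open>e + 2 * \<sigma>\<close> is chosen such that \<open>V\<close> lies below it with
  probability at least \<open>3 / 4\<close> (Chebyshev); therefore the maximum \<open>\<mu>\<close> of \<open>\<bar>g''\<bar>\<close> between that point and
  \<open>f\<close> is controlled by the mean of \<open>W\<close>, since \<open>W\<close> dominates \<open>\<bar>g''\<bar>\<close> on the whole interval from \<open>V\<close> to \<open>f\<close>.
  To the left of the point, \<open>g'\<close> is bounded by a constant plus the antiderivative \<open>A1\<close> of the excess
  \<open>j\<close>, and the mean of \<open>(e + 2 * \<sigma> - V) * A1 V\<close> is once more a case of the Poincare inequality, with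
  \<open>\<psi> = A1\<close>.  To the right, the second-order argument applies.
\<close>

theorem lipschitz_image_bound:
  fixes g g' g'' :: "real \<Rightarrow> real" and W :: "'a \<Rightarrow> real"
  assumes g: "\<And>x. x > 0 \<Longrightarrow> (g has_real_derivative g' x) (at x)" "\<And>x. x > 0 \<Longrightarrow> (g' has_real_derivative g'' x) (at x)"
    "continuous_on {0<..} g''" and gm: "(\<lambda>\<omega>. g (V \<omega>)) \<in> borel_measurable M"
    and f: "f > 0" "f \<le> b" and b: "b \<ge> 1" "b \<ge> 2 * e" "b \<ge> 16 * \<sigma>" "b \<ge> e + 2 * \<sigma>"
    and K: "\<And>x. f \<le> x \<Longrightarrow> x \<le> b \<Longrightarrow> \<bar>g'' x\<bar> \<le> K" and K': "\<And>x. f \<le> x \<Longrightarrow> x \<le> b \<Longrightarrow> \<bar>g' x\<bar> \<le> K'"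
    and W: "integrable M W" "\<And>\<omega>. \<omega> \<in> space M \<Longrightarrow> V \<omega> > 0 \<Longrightarrow> \<bar>g'' (V \<omega>)\<bar> \<le> W \<omega>" "\<And>\<omega>. W \<omega> \<ge> 0"
      "\<And>\<omega> u. \<omega> \<in> space M \<Longrightarrow> V \<omega> > 0 \<Longrightarrow> V \<omega> \<le> u \<Longrightarrow> u \<le> f \<Longrightarrow> \<bar>g'' u\<bar> \<le> W \<omega>"
  defines "w \<equiv> expectation W"
  shows "integrable M (\<lambda>\<omega>. \<bar>g (V \<omega>) - g (e + 2 * \<sigma>)\<bar>)"
    "expectation (\<lambda>\<omega>. \<bar>g (V \<omega>) - g (e + 2 * \<sigma>)\<bar>) \<le>
      3 * \<sigma> * (K' + f * (K + 2 * w)) + 5 * \<sigma>\<^sup>2 * (K + w) + 4 * \<sigma> * f * w + 256 * \<sigma>\<^sup>2 * w"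
proof -
  define q where "q x = \<bar>g'' x\<bar>" for x
  have q: "continuous_on {0<..} q" unfolding q_def by (intro continuous_intros g(3))
  have qn: "q x \<ge> 0" for x by (simp add: q_def)
  have w0: "w \<ge> 0" unfolding w_def using W(3) by simp
  define x0 where "x0 = e + 2 * \<sigma>"
  define y0 where "y0 = min x0 f"
  have x0: "x0 > 0" "x0 \<le> b" using e_nonneg \<sigma>_pos b by (auto simp: x0_def)
  have y0: "y0 > 0" "y0 \<le> f" "y0 \<le> x0" using x0 f by (auto simp: y0_def)
  have "\<exists>z\<in>{y0..f}. \<forall>y\<in>{y0..f}. q y \<le> q z"
    using y0 by (intro continuous_attains_sup continuous_on_subset[OF q]) auto
  then obtain z where z: "y0 \<le> z" "z \<le> f" "\<And>y. y0 \<le> y \<Longrightarrow> y \<le> f \<Longrightarrow> q y \<le> q z" by auto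
  define \<mu> where "\<mu> = q z"
  have \<mu>0: "\<mu> \<ge> 0" using qn by (simp add: \<mu>_def)
  have qf: "q f \<le> K" using K[of f] f by (simp add: q_def)
  have K0: "K \<ge> 0" using qf qn[of f] by linarith
  have K'0: "K' \<ge> 0" using K'[of f] f by (meson abs_ge_zero order_refl order_trans)
  have qW: "q (V \<omega>) \<le> W \<omega>" if "\<omega> \<in> space M" "V \<omega> > 0" for \<omega> using W(2)[OF that] by (simp add: q_def)
  have qWu: "q u \<le> W \<omega>" if "\<omega> \<in> space M" "V \<omega> > 0" "V \<omega> \<le> u" "u \<le> f" for \<omega> u using W(4)[OF that] by (simp add: q_def)
  have \<mu>w: "\<mu> \<le> K + 2 * w"
  proof (cases "x0 \<ge> f")
    case True
    then have "z = f" using z by (simp add: y0_def)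
    then show ?thesis using qf w0 by (simp add: \<mu>_def)
  next
    case False
    define A where "A = {\<omega> \<in> space M. V \<omega> \<le> x0}"
    have [measurable]: "A \<in> events" unfolding A_def by measurable
    have "prob {\<omega> \<in> space M. 2 * \<sigma> \<le> \<bar>V \<omega> - expectation V\<bar>} \<le> variance V / (2 * \<sigma>)\<^sup>2"
      by (rule Chebyshev_inequality) (use V2_int \<sigma>_pos in auto)
    also have "\<dots> = 1 / 4" using \<sigma>_pos unfolding \<sigma>_sq[symmetric] by (simp add: power_mult_distrib)
    finally have c: "prob {\<omega> \<in> space M. 2 * \<sigma> \<le> \<bar>V \<omega> - expectation V\<bar>} \<le> 1 / 4" .
    have "prob (space M - A) \<le> prob {\<omega> \<in> space M. 2 * \<sigma> \<le> \<bar>V \<omega> - expectation V\<bar>}"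
      by (rule finite_measure_mono) (auto simp: A_def x0_def e_def)
    with c have pA: "prob A \<ge> 3 / 4" by (simp add: prob_compl)
    have "expectation (\<lambda>\<omega>. \<mu> * indicator A \<omega>) \<le> w"
      unfolding w_def
    proof (rule integral_mono_AE)
      show "integrable M (\<lambda>\<omega>. \<mu> * indicator A \<omega>)" by (intro integrable_mult_right) (simp add: integrable_indicator_iff less_top[symmetric])
      show "AE \<omega> in M. \<mu> * indicator A \<omega> \<le> W \<omega>"
        using V_pos AE_space
      proof eventually_elim
        case (elim \<omega>)
        show ?case
        proof (cases "\<omega> \<in> A")
          case True
          then have "V \<omega> \<le> z" using z(1) False by (simp add: A_def y0_def)
          then show ?thesis using qWu[OF elim(2,1) _ z(2)] True by (simp add: \<mu>_def)
        qed (simp add: W(3))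
      qed
    qed (rule W)
    then have "\<mu> * prob A \<le> w" by simp
    moreover have "\<mu> * (3 / 4) \<le> \<mu> * prob A" using pA \<mu>0 by (intro mult_left_mono)
    ultimately show ?thesis using w0 K0 by simp
  qed
  define C where "C = K' + f * \<mu>"
  have C0: "C \<ge> 0" using K'0 f \<mu>0 by (simp add: C_def)
  define Y where "Y \<omega> = \<bar>g (V \<omega>) - g x0\<bar>" for \<omega>
  have Ym: "Y \<in> borel_measurable M" unfolding Y_def[abs_def] using gm by measurable
  define bd where "bd = 3 * \<sigma> * C + (\<mu> + K) / 2 * (5 * \<sigma>\<^sup>2) + 4 * \<sigma> * f * w + 256 * \<sigma>\<^sup>2 * w"
  have bd0: "bd \<ge> 0" unfolding bd_def using C0 \<mu>0 K0 \<sigma>_pos f w0 by simp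
  have key: "\<exists>U. integrable M U \<and> (\<forall>\<omega>\<in>space M. U \<omega> \<ge> 0) \<and>
      (\<forall>\<omega>\<in>space M. 1 / real N \<le> V \<omega> \<and> V \<omega> \<le> real N \<longrightarrow> Y \<omega> \<le> U \<omega>) \<and> expectation U \<le> bd" if N: "N \<ge> 1" for N :: nat
  proof -
    define \<epsilon> where "\<epsilon> = 1 / real N / 2"
    have \<epsilon>: "\<epsilon> > 0" "2 * \<epsilon> = 1 / real N" using N by (simp_all add: \<epsilon>_def)
    have N0: "real N > 0" using N by simp
    have Kq: "q x \<le> K" if "f \<le> x" "x \<le> b" for x using K[OF that] by (simp add: q_def)
    have Kz: "q x \<le> \<mu>" if "y0 \<le> x" "x \<le> f" for x using z(3)[OF that] by (simp add: \<mu>_def)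
    obtain k L1 L2 where R0: "\<forall>x. (L2 has_real_derivative L1 x) (at x)" "\<forall>x. (L1 has_real_derivative k x) (at x)"
      "\<forall>x. L2 x \<ge> 0" "\<forall>x. x \<le> b \<longrightarrow> L2 x = 0" "\<forall>x. x \<le> b \<longrightarrow> L1 x = 0" "\<forall>x. k x \<ge> 0" "\<forall>x. L1 x \<ge> 0"
      "\<forall>x. f \<le> x \<longrightarrow> x \<le> real N \<longrightarrow> q x \<le> K + k x"
      "integrable M (\<lambda>\<omega>. L2 (V \<omega>))" "expectation (\<lambda>\<omega>. L2 (V \<omega>)) \<le> 256 * \<sigma>\<^sup>2 * expectation W"
      by (rule right_tail_bound[OF q qn f(1,2) Kq b(1-3) W(1) qW N0]) assumption+
    note R = R0[rule_format]
    obtain j Bj where j0: "continuous_on UNIV j" "\<forall>x. j x \<ge> 0" "\<forall>x. x \<ge> y0 \<longrightarrow> j x = 0" "\<forall>x. x > 0 \<longrightarrow> j x \<le> q x"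
      "\<forall>x. j x \<le> Bj" "\<forall>x. 2 * \<epsilon> \<le> x \<longrightarrow> x \<le> f \<longrightarrow> q x \<le> \<mu> + j x"
      by (rule cutoff_left[OF q qn y0(1,2) Kz \<epsilon>(1)]) assumption+
    note j = j0[rule_format]
    have y00: "y0 \<ge> 0" using y0 by simp
    obtain A1 where A10: "\<forall>x. (A1 has_real_derivative - j x) (at x)" "\<forall>x. A1 x \<ge> 0" "\<forall>x. x \<ge> y0 \<longrightarrow> A1 x = 0"
      "\<forall>x. x \<ge> 0 \<longrightarrow> A1 x \<le> Bj * y0" "\<forall>x y. x \<le> y \<longrightarrow> A1 y \<le> A1 x"
      "\<forall>x m. x \<le> y0 \<longrightarrow> (\<forall>u. x \<le> u \<longrightarrow> u \<le> y0 \<longrightarrow> j u \<le> m) \<longrightarrow> A1 x \<le> (y0 - x) * m"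
      by (rule left_primitive[OF j(1,2,3) j(5) y00]) assumption+
    note A1 = A10[rule_format]
    have bA1: "\<forall>x\<ge>0. \<bar>- j x\<bar> \<le> Bj" using j(2,5) by auto
    note P = poincare[OF A1(1) continuous_on_minus[OF j(1)] bA1]
    have IA: "integrable M (\<lambda>\<omega>. A1 (V \<omega>))" by (rule lipschitz_integrable(1)[OF A1(1) bA1])
    have EA: "expectation (\<lambda>\<omega>. A1 (V \<omega>)) \<le> f * w"
    proof -
      have "expectation (\<lambda>\<omega>. A1 (V \<omega>)) \<le> expectation (\<lambda>\<omega>. f * W \<omega>)"
      proof (rule integral_mono_AE[OF IA])
        show "AE \<omega> in M. A1 (V \<omega>) \<le> f * W \<omega>"
          using V_pos AE_space
        proof eventually_elim
          case (elim \<omega>)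
          show ?case
          proof (cases "V \<omega> \<le> y0")
            case True
            have "A1 (V \<omega>) \<le> (y0 - V \<omega>) * W \<omega>"
            proof (rule A1(6)[OF True])
              fix u assume u: "V \<omega> \<le> u" "u \<le> y0"
              have "j u \<le> q u" using u elim by (intro j(4)) auto
              also have "\<dots> \<le> W \<omega>" using u y0 elim by (intro qWu) auto
              finally show "j u \<le> W \<omega>" .
            qed
            also have "\<dots> \<le> f * W \<omega>" using elim y0 W(3) by (intro mult_right_mono) auto
            finally show ?thesis .
          qed (use A1(3) W(3) f in auto)
        qed
      qed (use W in auto)
      then show ?thesis by (simp add: w_def)
    qed
    have EVj: "expectation (\<lambda>\<omega>. V \<omega> * \<bar>- j (V \<omega>)\<bar>) \<le> f * w"
    proof -
      have "expectation (\<lambda>\<omega>. V \<omega> * \<bar>- j (V \<omega>)\<bar>) \<le> expectation (\<lambda>\<omega>. f * W \<omega>)"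
      proof (rule integral_mono_AE)
        show "integrable M (\<lambda>\<omega>. V \<omega> * \<bar>- j (V \<omega>)\<bar>)" using P by blast
        show "AE \<omega> in M. V \<omega> * \<bar>- j (V \<omega>)\<bar> \<le> f * W \<omega>"
          using V_pos AE_space
        proof eventually_elim
          case (elim \<omega>)
          show ?case
          proof (cases "V \<omega> \<le> y0")
            case True
            have "j (V \<omega>) \<le> W \<omega>" using j(4)[OF elim(1)] qW[OF elim(2,1)] by linarith
            then show ?thesis using True y0 elim j(2) by (intro mult_mono) auto
          qed (use j(3) W(3) f in auto)
        qed
      qed (use W in auto)
      then show ?thesis by (simp add: w_def)
    qed
    have eqA: "(\<lambda>\<omega>. (x0 - V \<omega>) * A1 (V \<omega>)) = (\<lambda>\<omega>. 2 * \<sigma> * A1 (V \<omega>) - (V \<omega> - e) * A1 (V \<omega>))"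
      by (simp add: fun_eq_iff x0_def algebra_simps)
    have IxA: "integrable M (\<lambda>\<omega>. (x0 - V \<omega>) * A1 (V \<omega>))"
      unfolding eqA using IA P by auto
    have ExA: "expectation (\<lambda>\<omega>. (x0 - V \<omega>) * A1 (V \<omega>)) \<le> 4 * \<sigma> * f * w"
    proof -
      have "expectation (\<lambda>\<omega>. (x0 - V \<omega>) * A1 (V \<omega>)) = 2 * \<sigma> * expectation (\<lambda>\<omega>. A1 (V \<omega>)) - expectation (\<lambda>\<omega>. (V \<omega> - e) * A1 (V \<omega>))"
        unfolding eqA using IA P by simp
      also have "\<dots> \<le> 2 * \<sigma> * expectation (\<lambda>\<omega>. A1 (V \<omega>)) + 2 * \<sigma> * expectation (\<lambda>\<omega>. V \<omega> * \<bar>- j (V \<omega>)\<bar>)"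
        using P by linarith
      also have "\<dots> \<le> 2 * \<sigma> * (f * w) + 2 * \<sigma> * (f * w)"
        using EA EVj \<sigma>_pos by (intro add_mono mult_left_mono) auto
      finally show ?thesis by simp
    qed
    define U where "U \<omega> = C * \<bar>V \<omega> - x0\<bar> + (\<mu> + K) / 2 * (V \<omega> - x0)\<^sup>2 + (x0 - V \<omega>) * A1 (V \<omega>) + L2 (V \<omega>)" for \<omega>
    have IU: "integrable M U" unfolding U_def[abs_def]
      by (intro Bochner_Integration.integrable_add integrable_mult_right first_moment_about(1) second_moment_about(1) IxA R(9))
    have EU: "expectation U = C * expectation (\<lambda>\<omega>. \<bar>V \<omega> - x0\<bar>) + (\<mu> + K) / 2 * expectation (\<lambda>\<omega>. (V \<omega> - x0)\<^sup>2) + expectation (\<lambda>\<omega>. (x0 - V \<omega>) * A1 (V \<omega>)) + expectation (\<lambda>\<omega>. L2 (V \<omega>))"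
      unfolding U_def[abs_def] using first_moment_about(1)[of x0] second_moment_about(1)[of x0] IxA R(9) by simp
    have xA0: "(x0 - V \<omega>) * A1 (V \<omega>) \<ge> 0" for \<omega>
    proof (cases "V \<omega> \<ge> y0")
      case False
      then show ?thesis using y0 A1(2) by (intro mult_nonneg_nonneg) auto
    qed (simp add: A1(3))
    have U0: "U \<omega> \<ge> 0" for \<omega>
      unfolding U_def using K0 \<mu>0 by (intro add_nonneg_nonneg xA0 R(3) mult_nonneg_nonneg[OF C0]) auto
    have g'b: "\<bar>g' u\<bar> \<le> C + A1 u" if u: "u \<ge> 1 / real N \<or> u \<ge> y0" "u \<le> b" for u
    proof (cases "u \<ge> f")
      case True
      then show ?thesis using K'[of u] u f \<mu>0 A1(2)[of u] unfolding C_def by (smt (verit) mult_nonneg_nonneg)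
    next
      case False
      have up: "u > 0" using u y0 N0 by (auto intro: less_le_trans[OF divide_pos_pos[OF zero_less_one N0]])
      have tri: "s * (g' u - g' f) \<le> f * \<mu> + A1 u" if s: "s = 1 \<or> s = -1" for s :: real
      proof -
        define D where "D x = \<mu> * (f - x) + A1 x - s * (g' x - g' f)" for x
        have "D f \<le> D u"
        proof (rule DERIV_nonpos_imp_nonincreasing[of u f D])
          show "u \<le> f" using False by simp
          fix x assume x: "u \<le> x" "x \<le> f"
          have d: "(D has_real_derivative - \<mu> - j x - s * g'' x) (at x)"
            unfolding D_def using up x by (auto intro!: derivative_eq_intros g A1(1))
          have "q x \<le> \<mu> + j x"
          proof (cases "x \<ge> y0")
            case True then show ?thesis using Kz[of x] x j(2)[of x] by simp
          next
            case False
            then have "2 * \<epsilon> \<le> x" using u x \<epsilon>(2) by auto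
            then show ?thesis by (rule j(6)[OF _ x(2)])
          qed
          then have "- \<mu> - j x - s * g'' x \<le> 0" using s unfolding q_def by auto
          with d show "\<exists>y. (D has_real_derivative y) (at x) \<and> y \<le> 0" by blast
        qed
        moreover have "D f = 0" unfolding D_def using A1(3)[OF y0(2)] by simp
        ultimately have "s * (g' u - g' f) \<le> \<mu> * (f - u) + A1 u" by (simp add: D_def)
        also have "\<mu> * (f - u) \<le> \<mu> * f" using \<mu>0 up by (intro mult_left_mono) auto
        finally show ?thesis by (simp add: mult.commute)
      qed
      have "\<bar>g' f\<bar> \<le> K'" using K'[of f] f by simp
      then show ?thesis using tri[of 1] tri[of "-1"] by (simp add: C_def)
    qed
    have YU: "Y \<omega> \<le> U \<omega>" if v: "1 / real N \<le> V \<omega>" "V \<omega> \<le> real N" for \<omega>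
    proof (cases "V \<omega> \<le> x0")
      case True
      have vp: "V \<omega> > 0" by (rule less_le_trans[OF divide_pos_pos[OF zero_less_one N0] v(1)])
      have "norm (g (V \<omega>) - g x0) \<le> (C + A1 (V \<omega>)) * norm (V \<omega> - x0)"
      proof (rule field_differentiable_bound[of "{V \<omega>..x0}" g g'])
        show "(g has_field_derivative g' u) (at u within {V \<omega>..x0})" if "u \<in> {V \<omega>..x0}" for u
          using g(1)[of u] that vp by (auto intro: DERIV_subset)
        show "norm (g' u) \<le> C + A1 (V \<omega>)" if "u \<in> {V \<omega>..x0}" for u
          using g'b[of u] that v x0 A1(5)[of "V \<omega>" u] by auto
      qed (use True in auto)
      then have "Y \<omega> \<le> C * \<bar>V \<omega> - x0\<bar> + (x0 - V \<omega>) * A1 (V \<omega>)"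
        using True by (simp add: Y_def algebra_simps)
      also have "\<dots> \<le> U \<omega>" unfolding U_def using K0 \<mu>0 R(3)[of "V \<omega>"] by simp
      finally show ?thesis .
    next
      case False
      then have xV: "x0 \<le> V \<omega>" by simp
      have tri: "s * (g (V \<omega>) - g x0 - g' x0 * (V \<omega> - x0)) \<le> (\<mu> + K) / 2 * (V \<omega> - x0)\<^sup>2 + L2 (V \<omega>)" if s: "s = 1 \<or> s = -1" for s :: real
      proof -
        define D where "D x = (\<mu> + K) / 2 * (x - x0)\<^sup>2 + L2 x - s * (g x - g x0 - g' x0 * (x - x0))" for x
        define D' where "D' x = (\<mu> + K) * (x - x0) + L1 x - s * (g' x - g' x0)" for x
        define D'' where "D'' x = \<mu> + K + k x - s * g'' x" for x
        have "D (V \<omega>) \<ge> 0"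
        proof (rule convex_touching_nonneg[where D=D and x="V \<omega>" and D'=D' and D''=D'' and l=x0 and u="V \<omega>" and c=x0])
          fix x assume x: "x \<in> {x0..V \<omega>}"
          then have xp: "x > 0" using x0 by auto
          show "(D has_real_derivative D' x) (at x)"
            unfolding D_def D'_def using xp
            by (auto intro!: derivative_eq_intros g R(1) simp: field_simps)
          show "(D' has_real_derivative D'' x) (at x)"
            unfolding D'_def D''_def using xp
            by (auto intro!: derivative_eq_intros g R(2) simp: algebra_simps)
          have "q x \<le> \<mu> + K + k x"
          proof (cases "x \<le> f")
            case True then show ?thesis using Kz[of x] x y0 K0 R(6)[of x] by auto
          next
            case False then show ?thesis using R(8)[of x] x v \<mu>0 by auto
          qed
          then show "D'' x \<ge> 0" unfolding D''_def q_def using s by auto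
        next
          show "D x0 = 0" unfolding D_def using R(4)[of x0] x0 by simp
          show "D' x0 = 0" unfolding D'_def using R(5)[of x0] x0 by simp
        qed (use xV in auto)
        then show ?thesis by (simp add: D_def)
      qed
      have g'x0: "\<bar>g' x0\<bar> \<le> C" using g'b[of x0] y0 x0 A1(3)[of x0] by simp
      have "\<bar>g (V \<omega>) - g x0 - g' x0 * (V \<omega> - x0)\<bar> \<le> (\<mu> + K) / 2 * (V \<omega> - x0)\<^sup>2 + L2 (V \<omega>)"
        using tri[of 1] tri[of "-1"] by simp
      then have "Y \<omega> \<le> \<bar>g' x0 * (V \<omega> - x0)\<bar> + ((\<mu> + K) / 2 * (V \<omega> - x0)\<^sup>2 + L2 (V \<omega>))"
        unfolding Y_def by linarith
      also have "\<bar>g' x0 * (V \<omega> - x0)\<bar> \<le> C * \<bar>V \<omega> - x0\<bar>"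
        unfolding abs_mult using g'x0 by (intro mult_right_mono) auto
      finally show ?thesis unfolding U_def using xA0[of \<omega>] by simp
    qed
    have x0e: "e - x0 = - (2 * \<sigma>)" by (simp add: x0_def)
    have EU': "expectation U \<le> bd"
    proof -
      have m1: "expectation (\<lambda>\<omega>. \<bar>V \<omega> - x0\<bar>) \<le> 3 * \<sigma>" using first_moment_about(2)[of x0] \<sigma>_pos unfolding x0e by simp
      have m2: "expectation (\<lambda>\<omega>. (V \<omega> - x0)\<^sup>2) = 5 * \<sigma>\<^sup>2" using second_moment_about(2)[of x0] unfolding x0e by (simp add: power_mult_distrib)
      have "C * expectation (\<lambda>\<omega>. \<bar>V \<omega> - x0\<bar>) \<le> C * (3 * \<sigma>)" using m1 C0 by (intro mult_left_mono)
      then show ?thesis unfolding EU m2 bd_def using ExA R(10) by (simp add: w_def mult_ac)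
    qed
    show ?thesis using IU U0 YU EU' by blast
  qed
  have Yn: "Y \<omega> \<ge> 0" for \<omega> by (simp add: Y_def)
  note X = expectation_exhaust[OF Ym Yn bd0 key]
  show "integrable M (\<lambda>\<omega>. \<bar>g (V \<omega>) - g (e + 2 * \<sigma>)\<bar>)"
    using X(1) by (simp add: Y_def[abs_def] x0_def)
  have "bd \<le> 3 * \<sigma> * (K' + f * (K + 2 * w)) + 5 * \<sigma>\<^sup>2 * (K + w) + 4 * \<sigma> * f * w + 256 * \<sigma>\<^sup>2 * w"
  proof -
    have 1: "3 * \<sigma> * C \<le> 3 * \<sigma> * (K' + f * (K + 2 * w))"
      unfolding C_def using \<mu>w f \<sigma>_pos by (intro mult_left_mono add_left_mono) auto
    have "(\<mu> + K) / 2 * (5 * \<sigma>\<^sup>2) \<le> (K + w) * (5 * \<sigma>\<^sup>2)"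
      using \<mu>w by (intro mult_right_mono) auto
    then show ?thesis unfolding bd_def using 1 by (simp add: mult_ac)
  qed
  then show "expectation (\<lambda>\<omega>. \<bar>g (V \<omega>) - g (e + 2 * \<sigma>)\<bar>) \<le>
      3 * \<sigma> * (K' + f * (K + 2 * w)) + 5 * \<sigma>\<^sup>2 * (K + w) + 4 * \<sigma> * f * w + 256 * \<sigma>\<^sup>2 * w"
    using X(2) by (simp add: Y_def[abs_def] x0_def)
qed

end

section \<open>The Gaussian Ornstein-Uhlenbeck process\<close>

text \<open>
  Quasi-subadditivity of powers, applied to the three summands that bound the covariance of the
  process started at 0.
\<close>

lemma power_sum_three:
  fixes x y z p :: real
  assumes "x \<ge> 0" "y \<ge> 0" "z \<ge> 0" "p \<ge> 0"
  shows "(x + y + z) powr p \<le> 3 powr p * (x powr p + y powr p + z powr p)"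
proof -
  define m where "m = max x (max y z)"
  have m: "x + y + z \<le> 3 * m" "m \<ge> 0" using assms by (auto simp: m_def)
  have mp: "m powr p \<le> x powr p + y powr p + z powr p"
    using assms by (auto simp: m_def max_def)
  have "(x + y + z) powr p \<le> (3 * m) powr p" using m assms by (intro powr_mono2) auto
  also have "\<dots> = 3 powr p * m powr p" using m by (simp add: powr_mult)
  also have "\<dots> \<le> 3 powr p * (x powr p + y powr p + z powr p)" using mp by (intro mult_left_mono) auto
  finally show ?thesis .
qed

lemma sum_abs_diff_le:
  fixes \<phi> :: "nat \<Rightarrow> real"
  assumes "\<And>k. \<phi> k \<ge> 0" "j < n"
  shows "(\<Sum>i<n. \<phi> (if i < j then j - i else i - j)) \<le> 2 * (\<Sum>k<n. \<phi> k)"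
proof -
  have split: "{..<n} = {..<j} \<union> {j..<n}" using assms(2) by auto
  have "(\<Sum>i<n. \<phi> (if i < j then j - i else i - j)) = (\<Sum>i<j. \<phi> (j - i)) + (\<Sum>i\<in>{j..<n}. \<phi> (i - j))"
    unfolding split by (subst sum.union_disjoint) (auto intro!: sum.cong arg_cong2[where f="(+)"])
  also have "(\<Sum>i<j. \<phi> (j - i)) = (\<Sum>k\<in>(\<lambda>i. j - i) ` {..<j}. \<phi> k)"
    by (subst sum.reindex) (auto simp: inj_on_def)
  also have "\<dots> \<le> (\<Sum>k<n. \<phi> k)" using assms by (intro sum_mono2) auto
  also have "(\<Sum>i\<in>{j..<n}. \<phi> (i - j)) = (\<Sum>k\<in>(\<lambda>i. i - j) ` {j..<n}. \<phi> k)"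
    by (subst sum.reindex) (auto simp: inj_on_def)
  also have "\<dots> \<le> (\<Sum>k<n. \<phi> k)" using assms by (intro sum_mono2) auto
  finally show ?thesis by simp
qed

text \<open>
  The inequality between arithmetic and geometric mean for the square roots of the three pairwise
  products.  It bounds a cyclic triple sum over a covariance matrix by squares of row sums of the
  powers \<open>3/2\<close>, which is where the exponent \<open>3/2\<close> of the final bound comes from.
\<close>

lemma product_three_le:
  fixes x y z :: real
  assumes "x \<ge> 0" "y \<ge> 0" "z \<ge> 0"
  shows "x * y * z \<le> (x powr (3/2) * y powr (3/2) + x powr (3/2) * z powr (3/2) + y powr (3/2) * z powr (3/2)) / 3"
proof -
  have amgm: "a * b * c \<le> (a ^ 3 + b ^ 3 + c ^ 3) / 3" if "a \<ge> 0" "b \<ge> 0" "c \<ge> 0" for a b c :: real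
  proof -
    have "0 \<le> (a + b + c) * ((a - b)\<^sup>2 + (b - c)\<^sup>2 + (c - a)\<^sup>2)" using that by (intro mult_nonneg_nonneg) auto
    also have "\<dots> = 2 * (a ^ 3 + b ^ 3 + c ^ 3) - 6 * (a * b * c)"
      by (simp add: power2_eq_square power3_eq_cube algebra_simps)
    finally show ?thesis by simp
  qed
  have c: "(sqrt u) ^ 3 = u powr (3/2)" if "u \<ge> 0" for u
    using that powr_powr[of u "1/2" 3] by (cases "u = 0") (auto simp: powr_half_sqrt powr_numeral)
  have "x * y * z = sqrt (x * y) * sqrt (x * z) * sqrt (y * z)"
  proof -
    have "sqrt (x * y) * sqrt (x * z) * sqrt (y * z) = sqrt ((x * y * z)\<^sup>2)"
      by (simp add: real_sqrt_mult[symmetric] power2_eq_square mult_ac)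
    then show ?thesis using assms by simp
  qed
  also have "\<dots> \<le> ((sqrt (x * y)) ^ 3 + (sqrt (x * z)) ^ 3 + (sqrt (y * z)) ^ 3) / 3"
    using assms by (intro amgm) auto
  also have "\<dots> = (x powr (3/2) * y powr (3/2) + x powr (3/2) * z powr (3/2) + y powr (3/2) * z powr (3/2)) / 3"
    using assms by (simp add: c powr_mult)
  finally show ?thesis .
qed

lemma nn_integral_square_add_le:
  fixes X Y :: "'a \<Rightarrow> real"
  assumes [measurable]: "X \<in> borel_measurable M" "Y \<in> borel_measurable M"
  shows "(\<integral>\<^sup>+\<omega>. ennreal ((X \<omega> + Y \<omega>)\<^sup>2) \<partial>M) \<le> 2 * (\<integral>\<^sup>+\<omega>. ennreal ((X \<omega>)\<^sup>2) \<partial>M) + 2 * (\<integral>\<^sup>+\<omega>. ennreal ((Y \<omega>)\<^sup>2) \<partial>M)"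
proof -
  have "(x + y)\<^sup>2 \<le> 2 * x\<^sup>2 + 2 * y\<^sup>2" for x y :: real
    using zero_le_power2[of "x - y"] by (simp add: power2_sum power2_diff)
  then have "(\<integral>\<^sup>+\<omega>. ennreal ((X \<omega> + Y \<omega>)\<^sup>2) \<partial>M) \<le> (\<integral>\<^sup>+\<omega>. ennreal (2 * (X \<omega>)\<^sup>2 + 2 * (Y \<omega>)\<^sup>2) \<partial>M)"
    by (intro nn_integral_mono ennreal_leI)
  also have "\<dots> = (\<integral>\<^sup>+\<omega>. 2 * ennreal ((X \<omega>)\<^sup>2) + 2 * ennreal ((Y \<omega>)\<^sup>2) \<partial>M)"
    by (intro nn_integral_cong) (simp add: ennreal_plus ennreal_mult'')
  also have "\<dots> = 2 * (\<integral>\<^sup>+\<omega>. ennreal ((X \<omega>)\<^sup>2) \<partial>M) + 2 * (\<integral>\<^sup>+\<omega>. ennreal ((Y \<omega>)\<^sup>2) \<partial>M)"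
    by (simp add: nn_integral_add nn_integral_cmult)
  finally show ?thesis .
qed

lemma nn_integral_square_cmult:
  fixes X :: "'a \<Rightarrow> real"
  assumes [measurable]: "X \<in> borel_measurable M"
  shows "(\<integral>\<^sup>+\<omega>. ennreal ((k * X \<omega>)\<^sup>2) \<partial>M) = ennreal (k\<^sup>2) * (\<integral>\<^sup>+\<omega>. ennreal ((X \<omega>)\<^sup>2) \<partial>M)"
  by (subst nn_integral_cmult[symmetric]) (auto simp: power_mult_distrib ennreal_mult)

lemma AE_eq_zero_of_small_square:
  fixes X :: "'a \<Rightarrow> real"
  assumes [measurable]: "X \<in> borel_measurable M"
    and small: "\<And>\<epsilon>. \<epsilon> > 0 \<Longrightarrow> (\<integral>\<^sup>+\<omega>. ennreal ((X \<omega>)\<^sup>2) \<partial>M) \<le> ennreal \<epsilon>"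
  shows "AE \<omega> in M. X \<omega> = 0"
proof -
  have "(\<integral>\<^sup>+\<omega>. ennreal ((X \<omega>)\<^sup>2) \<partial>M) \<le> 0"
    by (rule ennreal_le_epsilon) (use small in auto)
  then have "AE \<omega> in M. ennreal ((X \<omega>)\<^sup>2) = 0"
    by (subst nn_integral_0_iff_AE[symmetric]) auto
  then show ?thesis by eventually_elim (simp add: ennreal_eq_0_iff)
qed

text \<open>
  The union of fine tagged divisions of adjacent intervals is a fine tagged division, so the three
  Riemann-Stieltjes sums satisfy the identity exactly and the \<open>L\<^sup>2\<close> limits inherit it.  The factor \<open>k\<close> is
  included because the integrand of the stationary process depends on its time only through a factor.
\<close>

lemma wiener_integral_combine:
  assumes Gm: "\<And>t. G t \<in> borel_measurable M" and abc: "a \<le> b" "b \<le> c"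
    and A: "has_wiener_integral M G f a b A" and B: "has_wiener_integral M G f b c B"
    and C: "has_wiener_integral M G (\<lambda>s. k * f s) a c C"
  shows "AE \<omega> in M. C \<omega> = k * (A \<omega> + B \<omega>)"
proof -
  have [measurable]: "A \<in> borel_measurable M" "B \<in> borel_measurable M" "C \<in> borel_measurable M"
    using A B C by (auto simp: has_wiener_integral_def)
  note [measurable] = Gm
  define S where "S D u \<omega> = (\<Sum>(x, K)\<in>D. u x * (G (Sup K) \<omega> - G (Inf K) \<omega>))" for D :: "(real \<times> real set) set" and u :: "real \<Rightarrow> real" and \<omega>
  have [measurable]: "S D u \<in> borel_measurable M" for D u unfolding S_def[abs_def] by measurable
  have "AE \<omega> in M. C \<omega> - k * (A \<omega> + B \<omega>) = 0"
  proof (rule AE_eq_zero_of_small_square)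
    fix \<epsilon> :: real assume \<epsilon>: "\<epsilon> > 0"
    \<comment> \<open>the triangle inequality is used as \<open>(x + y)\<^sup>2 \<le> 2 * x\<^sup>2 + 2 * y\<^sup>2\<close>, once for the outer and once for
      the inner sum, hence the factor \<open>2 + 8 * k\<^sup>2\<close>\<close>
    define \<eta> where "\<eta> = \<epsilon> / (2 + 8 * k\<^sup>2)"
    have den: "2 + 8 * k\<^sup>2 > 0" using zero_le_power2[of k] by linarith
    have \<eta>: "\<eta> > 0" using \<epsilon> den by (simp add: \<eta>_def)
    obtain dA where dA: "dA > 0" "\<And>D. D tagged_division_of {a..b} \<Longrightarrow> (\<lambda>x. ball x dA) fine D \<Longrightarrow> (\<integral>\<^sup>+\<omega>. ennreal ((A \<omega> - S D f \<omega>)\<^sup>2) \<partial>M) < ennreal \<eta>"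
      using A \<eta> unfolding has_wiener_integral_def S_def by meson
    obtain dB where dB: "dB > 0" "\<And>D. D tagged_division_of {b..c} \<Longrightarrow> (\<lambda>x. ball x dB) fine D \<Longrightarrow> (\<integral>\<^sup>+\<omega>. ennreal ((B \<omega> - S D f \<omega>)\<^sup>2) \<partial>M) < ennreal \<eta>"
      using B \<eta> unfolding has_wiener_integral_def S_def by meson
    obtain dC where dC: "dC > 0" "\<And>D. D tagged_division_of {a..c} \<Longrightarrow> (\<lambda>x. ball x dC) fine D \<Longrightarrow> (\<integral>\<^sup>+\<omega>. ennreal ((C \<omega> - S D (\<lambda>s. k * f s) \<omega>)\<^sup>2) \<partial>M) < ennreal \<eta>"
      using C \<eta> unfolding has_wiener_integral_def S_def by meson
    define d where "d = min dA (min dB dC)"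
    have d: "d > 0" "d \<le> dA" "d \<le> dB" "d \<le> dC" using dA dB dC by (auto simp: d_def)
    have g: "gauge (\<lambda>x::real. ball x d)" using d by (simp add: gauge_def)
    have mono: "(\<lambda>x. ball x d') fine D" if "(\<lambda>x. ball x d) fine D" "d \<le> d'" for D :: "(real \<times> real set) set" and d'
      using that subset_ball[OF that(2)] unfolding fine_def by fastforce
    obtain D1 where D1: "D1 tagged_division_of {a..b}" "(\<lambda>x. ball x d) fine D1" by (rule fine_division_exists_real[OF g])
    obtain D2 where D2: "D2 tagged_division_of {b..c}" "(\<lambda>x. ball x d) fine D2" by (rule fine_division_exists_real[OF g])
    have int: "interior {a..b} \<inter> interior {b..c} = {}" by (auto simp: interior_atLeastAtMost_real)
    have un: "{a..b} \<union> {b..c} = {a..c}" using abc by auto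
    have D: "(D1 \<union> D2) tagged_division_of {a..c}"
      using tagged_division_Un[OF D1(1) D2(1) int] un by simp
    have Df: "(\<lambda>x. ball x d) fine (D1 \<union> D2)" using D1(2) D2(2) by (rule fine_Un)
    have fin: "finite D1" "finite D2" using D1(1) D2(1) by auto
    have sum: "S (D1 \<union> D2) (\<lambda>s. k * f s) \<omega> = k * (S D1 f \<omega> + S D2 f \<omega>)" for \<omega>
    proof -
      have "S (D1 \<union> D2) (\<lambda>s. k * f s) \<omega> = S D1 (\<lambda>s. k * f s) \<omega> + S D2 (\<lambda>s. k * f s) \<omega>"
        unfolding S_def
      proof (rule sum.union_inter_neutral[OF fin], intro ballI)
        fix p assume p: "p \<in> D1 \<inter> D2"
        obtain x K where xK: "p = (x, K)" by force
        have "(x, K) \<in> D1" "(x, K) \<in> D2" using p xK by auto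
        then have "x \<in> K" "K \<subseteq> {a..b}" "K \<subseteq> {b..c}"
          using tagged_division_ofD(2,3)[OF D1(1)] tagged_division_ofD(3)[OF D2(1)] by blast+
        \<comment> \<open>a common member of both divisions is a single point and contributes 0 to either sum\<close>
        then have "y = b" if "y \<in> K" for y using that by fastforce
        then have "K = {b}" using \<open>x \<in> K\<close> by blast
        then show "(case p of (x, K) \<Rightarrow> k * f x * (G (Sup K) \<omega> - G (Inf K) \<omega>)) = 0"
          by (simp add: xK)
      qed
      moreover have "S D (\<lambda>s. k * f s) \<omega> = k * S D f \<omega>" for D
        unfolding S_def sum_distrib_left by (intro sum.cong) auto
      ultimately show ?thesis by (simp add: distrib_left)
    qed
    have iA: "(\<integral>\<^sup>+\<omega>. ennreal ((A \<omega> - S D1 f \<omega>)\<^sup>2) \<partial>M) \<le> ennreal \<eta>"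
      using dA(2)[OF D1(1) mono[OF D1(2) d(2)]] by simp
    have iB: "(\<integral>\<^sup>+\<omega>. ennreal ((B \<omega> - S D2 f \<omega>)\<^sup>2) \<partial>M) \<le> ennreal \<eta>"
      using dB(2)[OF D2(1) mono[OF D2(2) d(3)]] by simp
    have iC: "(\<integral>\<^sup>+\<omega>. ennreal ((C \<omega> - S (D1 \<union> D2) (\<lambda>s. k * f s) \<omega>)\<^sup>2) \<partial>M) \<le> ennreal \<eta>"
      using dC(2)[OF D mono[OF Df d(4)]] by simp
    have "(\<integral>\<^sup>+\<omega>. ennreal ((C \<omega> - k * (A \<omega> + B \<omega>))\<^sup>2) \<partial>M) =
      (\<integral>\<^sup>+\<omega>. ennreal (((C \<omega> - S (D1 \<union> D2) (\<lambda>s. k * f s) \<omega>) + (- k) * ((A \<omega> - S D1 f \<omega>) + (B \<omega> - S D2 f \<omega>)))\<^sup>2) \<partial>M)"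
      by (intro nn_integral_cong) (simp add: sum algebra_simps)
    also have "\<dots> \<le> 2 * (\<integral>\<^sup>+\<omega>. ennreal ((C \<omega> - S (D1 \<union> D2) (\<lambda>s. k * f s) \<omega>)\<^sup>2) \<partial>M) +
      2 * (\<integral>\<^sup>+\<omega>. ennreal (((- k) * ((A \<omega> - S D1 f \<omega>) + (B \<omega> - S D2 f \<omega>)))\<^sup>2) \<partial>M)"
      by (rule nn_integral_square_add_le) measurable
    also have "\<dots> \<le> 2 * ennreal \<eta> + 2 * (ennreal ((- k)\<^sup>2) * (2 * ennreal \<eta> + 2 * ennreal \<eta>))"
    proof (intro add_mono mult_left_mono iC)
      have "(\<integral>\<^sup>+\<omega>. ennreal (((- k) * ((A \<omega> - S D1 f \<omega>) + (B \<omega> - S D2 f \<omega>)))\<^sup>2) \<partial>M) =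
        ennreal ((- k)\<^sup>2) * (\<integral>\<^sup>+\<omega>. ennreal (((A \<omega> - S D1 f \<omega>) + (B \<omega> - S D2 f \<omega>))\<^sup>2) \<partial>M)"
        by (rule nn_integral_square_cmult) measurable
      also have "\<dots> \<le> ennreal ((- k)\<^sup>2) * (2 * (\<integral>\<^sup>+\<omega>. ennreal ((A \<omega> - S D1 f \<omega>)\<^sup>2) \<partial>M) + 2 * (\<integral>\<^sup>+\<omega>. ennreal ((B \<omega> - S D2 f \<omega>)\<^sup>2) \<partial>M))"
        by (intro mult_left_mono nn_integral_square_add_le) measurable
      also have "\<dots> \<le> ennreal ((- k)\<^sup>2) * (2 * ennreal \<eta> + 2 * ennreal \<eta>)"
        by (intro mult_left_mono add_mono iA iB) auto
      finally show "(\<integral>\<^sup>+\<omega>. ennreal (((- k) * ((A \<omega> - S D1 f \<omega>) + (B \<omega> - S D2 f \<omega>)))\<^sup>2) \<partial>M) \<le> ennreal ((- k)\<^sup>2) * (2 * ennreal \<eta> + 2 * ennreal \<eta>)" .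
    qed auto
    also have "\<dots> = ennreal (2 * \<eta> + 2 * (k\<^sup>2 * (2 * \<eta> + 2 * \<eta>)))"
    proof -
      have two: "2 * ennreal x = ennreal (2 * x)" if "x \<ge> 0" for x
        using that by (simp add: ennreal_mult ennreal_numeral)
      have "2 * ennreal \<eta> + 2 * (ennreal ((- k)\<^sup>2) * (2 * ennreal \<eta> + 2 * ennreal \<eta>)) =
        ennreal (2 * \<eta>) + 2 * ennreal (k\<^sup>2 * (2 * \<eta> + 2 * \<eta>))"
      proof -
        have a: "2 * ennreal \<eta> = ennreal (2 * \<eta>)" using \<eta> by (intro two) simp
        have b: "ennreal (2 * \<eta>) + ennreal (2 * \<eta>) = ennreal (2 * \<eta> + 2 * \<eta>)" using \<eta> by (intro ennreal_plus[symmetric]) auto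
        have c: "ennreal (k\<^sup>2) * ennreal (2 * \<eta> + 2 * \<eta>) = ennreal (k\<^sup>2 * (2 * \<eta> + 2 * \<eta>))" using \<eta> by (intro ennreal_mult[symmetric]) auto
        show ?thesis unfolding a b c power2_minus ..
      qed
      also have "\<dots> = ennreal (2 * \<eta>) + ennreal (2 * (k\<^sup>2 * (2 * \<eta> + 2 * \<eta>)))"
        using \<eta> by (subst two) auto
      also have "\<dots> = ennreal (2 * \<eta> + 2 * (k\<^sup>2 * (2 * \<eta> + 2 * \<eta>)))"
        using \<eta> by (intro ennreal_plus[symmetric]) auto
      finally show ?thesis .
    qed
    also have "2 * \<eta> + 2 * (k\<^sup>2 * (2 * \<eta> + 2 * \<eta>)) = \<epsilon>"
    proof -
      have "2 * \<eta> + 2 * (k\<^sup>2 * (2 * \<eta> + 2 * \<eta>)) = \<eta> * (2 + 8 * k\<^sup>2)" by (simp add: algebra_simps)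
      then show ?thesis using den by (simp add: \<eta>_def)
    qed
    finally show "(\<integral>\<^sup>+\<omega>. ennreal ((C \<omega> - k * (A \<omega> + B \<omega>))\<^sup>2) \<partial>M) \<le> ennreal \<epsilon>" .
  qed measurable
  then show ?thesis by eventually_elim simp
qed

text \<open>
  The improper integral up to \<open>t\<close> splits at 0.  It identifies the process started at 0 with the stationary
  one up to an exponentially small term, through their definitions by Wiener integrals of the same \<open>G\<close>.
\<close>

lemma OU_stationary_relation:
  assumes Gm: "\<And>t. G t \<in> borel_measurable M"
    and Zt: "has_wiener_integral_at_bot M G (\<lambda>s. exp (- \<theta> * (t - s))) t Y"
    and Z0: "has_wiener_integral_at_bot M G (\<lambda>s. exp (- \<theta> * (0 - s))) 0 Y0"
    and J: "has_wiener_integral M G (\<lambda>s. exp (\<theta> * s)) 0 t J" and t: "t \<ge> 0"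
  shows "AE \<omega> in M. Y \<omega> = exp (- \<theta> * t) * (Y0 \<omega> + J \<omega>)"
proof -
  define k where "k = exp (- \<theta> * t)"
  have k0: "k > 0" by (simp add: k_def)
  have e1: "(\<lambda>s. exp (- \<theta> * (t - s))) = (\<lambda>s. k * exp (\<theta> * s))"
    by (simp add: fun_eq_iff k_def exp_add[symmetric] algebra_simps)
  have e0: "(\<lambda>s. exp (- \<theta> * (0 - s))) = (\<lambda>s. exp (\<theta> * s))" by simp
  obtain I where I: "\<And>a. a \<le> t \<Longrightarrow> has_wiener_integral M G (\<lambda>s. k * exp (\<theta> * s)) a t (I a)"
    "((\<lambda>a. \<integral>\<^sup>+\<omega>. ennreal ((Y \<omega> - I a \<omega>)\<^sup>2) \<partial>M) \<longlongrightarrow> 0) at_bot"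
    using Zt unfolding has_wiener_integral_at_bot_def e1 by blast
  obtain I0 where I0: "\<And>a. a \<le> 0 \<Longrightarrow> has_wiener_integral M G (\<lambda>s. exp (\<theta> * s)) a 0 (I0 a)"
    "((\<lambda>a. \<integral>\<^sup>+\<omega>. ennreal ((Y0 \<omega> - I0 a \<omega>)\<^sup>2) \<partial>M) \<longlongrightarrow> 0) at_bot"
    using Z0 unfolding has_wiener_integral_at_bot_def e0 by blast
  have [measurable]: "Y \<in> borel_measurable M" "Y0 \<in> borel_measurable M" "J \<in> borel_measurable M"
    using Zt Z0 J by (auto simp: has_wiener_integral_def has_wiener_integral_at_bot_def)
  have "AE \<omega> in M. Y \<omega> - k * (Y0 \<omega> + J \<omega>) = 0"
  proof (rule AE_eq_zero_of_small_square)
    fix \<epsilon> :: real assume \<epsilon>: "\<epsilon> > 0"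
    define \<eta> where "\<eta> = \<epsilon> / (2 + 2 * k\<^sup>2)"
    have den: "2 + 2 * k\<^sup>2 > 0" using zero_le_power2[of k] by linarith
    have \<eta>: "\<eta> > 0" using \<epsilon> den by (simp add: \<eta>_def)
    have "\<forall>\<^sub>F a in at_bot. (\<integral>\<^sup>+\<omega>. ennreal ((Y \<omega> - I a \<omega>)\<^sup>2) \<partial>M) < ennreal \<eta>"
      "\<forall>\<^sub>F a in at_bot. (\<integral>\<^sup>+\<omega>. ennreal ((Y0 \<omega> - I0 a \<omega>)\<^sup>2) \<partial>M) < ennreal \<eta>"
      using order_tendstoD(2)[OF I(2), of "ennreal \<eta>"] order_tendstoD(2)[OF I0(2), of "ennreal \<eta>"] \<eta> by auto
    then have "\<forall>\<^sub>F a in at_bot. a \<le> 0 \<and> (\<integral>\<^sup>+\<omega>. ennreal ((Y \<omega> - I a \<omega>)\<^sup>2) \<partial>M) < ennreal \<eta> \<and> (\<integral>\<^sup>+\<omega>. ennreal ((Y0 \<omega> - I0 a \<omega>)\<^sup>2) \<partial>M) < ennreal \<eta>"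
      using eventually_le_at_bot[of "0::real"] by eventually_elim auto
    from eventually_happens[OF this] obtain a where a: "a \<le> 0" "(\<integral>\<^sup>+\<omega>. ennreal ((Y \<omega> - I a \<omega>)\<^sup>2) \<partial>M) < ennreal \<eta>" "(\<integral>\<^sup>+\<omega>. ennreal ((Y0 \<omega> - I0 a \<omega>)\<^sup>2) \<partial>M) < ennreal \<eta>"
      by auto
    have hI: "has_wiener_integral M G (\<lambda>s. k * exp (\<theta> * s)) a t (I a)" using I(1) a t by simp
    note hI0 = I0(1)[OF a(1)]
    have [measurable]: "I a \<in> borel_measurable M" "I0 a \<in> borel_measurable M"
      using hI hI0 by (auto simp: has_wiener_integral_def)
    have ae: "AE \<omega> in M. I a \<omega> = k * (I0 a \<omega> + J \<omega>)"
      by (rule wiener_integral_combine[OF Gm a(1) t hI0 J hI])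
    have "(\<integral>\<^sup>+\<omega>. ennreal ((Y \<omega> - k * (Y0 \<omega> + J \<omega>))\<^sup>2) \<partial>M) = (\<integral>\<^sup>+\<omega>. ennreal (((Y \<omega> - I a \<omega>) + (- k) * (Y0 \<omega> - I0 a \<omega>))\<^sup>2) \<partial>M)"
    proof (rule nn_integral_cong_AE)
      show "AE \<omega> in M. ennreal ((Y \<omega> - k * (Y0 \<omega> + J \<omega>))\<^sup>2) = ennreal (((Y \<omega> - I a \<omega>) + (- k) * (Y0 \<omega> - I0 a \<omega>))\<^sup>2)"
        using ae by eventually_elim (simp add: algebra_simps)
    qed
    also have "\<dots> \<le> 2 * (\<integral>\<^sup>+\<omega>. ennreal ((Y \<omega> - I a \<omega>)\<^sup>2) \<partial>M) + 2 * (\<integral>\<^sup>+\<omega>. ennreal (((- k) * (Y0 \<omega> - I0 a \<omega>))\<^sup>2) \<partial>M)"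
      by (rule nn_integral_square_add_le) measurable
    also have "(\<integral>\<^sup>+\<omega>. ennreal (((- k) * (Y0 \<omega> - I0 a \<omega>))\<^sup>2) \<partial>M) = ennreal ((- k)\<^sup>2) * (\<integral>\<^sup>+\<omega>. ennreal ((Y0 \<omega> - I0 a \<omega>)\<^sup>2) \<partial>M)"
      by (rule nn_integral_square_cmult) measurable
    also have "2 * (\<integral>\<^sup>+\<omega>. ennreal ((Y \<omega> - I a \<omega>)\<^sup>2) \<partial>M) + 2 * (ennreal ((- k)\<^sup>2) * (\<integral>\<^sup>+\<omega>. ennreal ((Y0 \<omega> - I0 a \<omega>)\<^sup>2) \<partial>M)) \<le> 2 * ennreal \<eta> + 2 * (ennreal ((- k)\<^sup>2) * ennreal \<eta>)"
      using a by (intro add_mono mult_left_mono) auto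
    also have "\<dots> = ennreal (2 * \<eta> + 2 * (k\<^sup>2 * \<eta>))"
      using \<eta> by (simp add: ennreal_plus ennreal_mult'' ennreal_numeral)
    also have "2 * \<eta> + 2 * (k\<^sup>2 * \<eta>) = \<epsilon>"
    proof -
      have "2 * \<eta> + 2 * (k\<^sup>2 * \<eta>) = \<eta> * (2 + 2 * k\<^sup>2)" by (simp add: algebra_simps)
      then show ?thesis using den by (simp add: \<eta>_def)
    qed
    finally show "(\<integral>\<^sup>+\<omega>. ennreal ((Y \<omega> - k * (Y0 \<omega> + J \<omega>))\<^sup>2) \<partial>M) \<le> ennreal \<epsilon>" .
  qed measurable
  then show ?thesis by eventually_elim (simp add: k_def)
qed

lemma (in prob_space) centered_gaussian_rv_AE_cong:
  assumes "centered_gaussian_rv M Y" "AE \<omega> in M. Y \<omega> = Y' \<omega>" "Y' \<in> borel_measurable M"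
  shows "centered_gaussian_rv M Y'"
proof -
  have [measurable]: "Y \<in> borel_measurable M" using assms(1) by (rule centered_gaussian_rv_measurable)
  have "distr M borel Y = distr M borel Y'"
    by (rule distr_cong_AE) (use assms in auto)
  then show ?thesis using assms unfolding centered_gaussian_rv_def by simp
qed

text \<open>
  The probabilistic hypotheses on the process; the estimating function \<open>g\<close> does not occur yet.
\<close>

locale gaussian_OU_setting = prob_space M for M :: "'a measure" +
  fixes G :: "real \<Rightarrow> 'a \<Rightarrow> real" and \<theta> :: real and Z :: "real \<Rightarrow> 'a \<Rightarrow> real" and X :: "real \<Rightarrow> 'a \<Rightarrow> real"
  assumes G: "centered_gaussian_process M UNIV G" and Z: "stationary_gaussian_OU M G \<theta> Z" and \<theta>: "\<theta> > 0"
    and X: "gaussian_OU M G \<theta> X" and rho2: "integrable lborel (\<lambda>r. (autocov M Z r)\<^sup>2)"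
begin

abbreviation "\<rho> \<equiv> autocov M Z"
definition f0 :: real where "f0 = \<rho> 0"

lemma Z_gaussian: "finite J \<Longrightarrow> J \<subseteq> {0..} \<Longrightarrow> centered_gaussian_rv M (\<lambda>\<omega>. \<Sum>t\<in>J. a t * Z t \<omega>)"
  using Z unfolding stationary_gaussian_OU_def centered_gaussian_process_def by blast

lemma Zt_gaussian: "t \<ge> 0 \<Longrightarrow> centered_gaussian_rv M (Z t)"
  using Z_gaussian[of "{t}" "\<lambda>_. 1"] by simp

lemma Z_measurable[measurable]: "t \<ge> 0 \<Longrightarrow> Z t \<in> borel_measurable M"
  using Zt_gaussian centered_gaussian_rv_measurable by blast

lemma Z_square_integrable: "t \<ge> 0 \<Longrightarrow> integrable M (\<lambda>\<omega>. (Z t \<omega>)\<^sup>2)"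
  using gaussian_integrable_power(2)[OF Zt_gaussian, of t 2] .

lemma ZZ_integrable: "s \<ge> 0 \<Longrightarrow> t \<ge> 0 \<Longrightarrow> integrable M (\<lambda>\<omega>. Z s \<omega> * Z t \<omega>)"
  by (intro integrable_mult_of_squares Z_square_integrable) auto

lemma ZZ_cov:
  assumes "s \<ge> 0" "t \<ge> 0"
  shows "expectation (\<lambda>\<omega>. Z s \<omega> * Z t \<omega>) = \<rho> (t - s)"
proof -
  have shift: "expectation (\<lambda>\<omega>. Z h \<omega> * Z (u + h) \<omega>) = expectation (\<lambda>\<omega>. Z 0 \<omega> * Z u \<omega>)" if hu: "h \<ge> 0" "u \<ge> 0" for h u
  proof -
    define J where "J = {0, u}"
    have eq: "distr M (Pi\<^sub>M J (\<lambda>_. borel)) (\<lambda>\<omega>. \<lambda>t\<in>J. Z (t + h) \<omega>) = distr M (Pi\<^sub>M J (\<lambda>_. borel)) (\<lambda>\<omega>. \<lambda>t\<in>J. Z t \<omega>)"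
      using Z hu unfolding stationary_gaussian_OU_def stationary_process_def by (auto simp: J_def)
    have m1: "(\<lambda>\<omega>. \<lambda>t\<in>J. Z (t + h) \<omega>) \<in> measurable M (Pi\<^sub>M J (\<lambda>_. borel))"
      using hu by (intro measurable_restrict) (auto simp: J_def)
    have m2: "(\<lambda>\<omega>. \<lambda>t\<in>J. Z t \<omega>) \<in> measurable M (Pi\<^sub>M J (\<lambda>_. borel))"
      using hu by (intro measurable_restrict) (auto simp: J_def)
    have p: "(\<lambda>y. y 0 * y u :: real) \<in> borel_measurable (Pi\<^sub>M J (\<lambda>_. borel))"
      by (intro borel_measurable_times measurable_component_singleton) (auto simp: J_def)
    have "expectation (\<lambda>\<omega>. Z h \<omega> * Z (u + h) \<omega>) = (\<integral>y. y 0 * y u \<partial>distr M (Pi\<^sub>M J (\<lambda>_. borel)) (\<lambda>\<omega>. \<lambda>t\<in>J. Z (t + h) \<omega>))"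
      by (subst integral_distr[OF m1 p]) (simp add: J_def)
    also have "\<dots> = expectation (\<lambda>\<omega>. Z 0 \<omega> * Z u \<omega>)"
      unfolding eq by (subst integral_distr[OF m2 p]) (simp add: J_def)
    finally show ?thesis .
  qed
  show ?thesis
  proof (cases "s \<le> t")
    case True
    then show ?thesis using shift[of s "t - s"] assms by (simp add: autocov_def)
  next
    case False
    then show ?thesis using shift[of t "s - t"] assms by (simp add: autocov_def mult.commute)
  qed
qed

lemma rho_even: "\<rho> (- t) = \<rho> t" by (simp add: autocov_def)

lemma f0_pos: "f0 > 0"
  using Z unfolding stationary_gaussian_OU_def f0_def autocov_def by (simp add: power2_eq_square)

lemma Z_var: "t \<ge> 0 \<Longrightarrow> expectation (\<lambda>\<omega>. (Z t \<omega>)\<^sup>2) = f0"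
  using ZZ_cov[of t t] by (simp add: f0_def power2_eq_square)

text \<open>
  The mean square of \<open>Z 0 - s * Z \<bar>t\<bar>\<close> is nonnegative for both signs \<open>s\<close>.
\<close>

lemma abs_rho_le: "\<bar>\<rho> t\<bar> \<le> f0"
proof -
  have *: "s * \<rho> t \<le> f0" if s: "s = 1 \<or> s = -1" for s
  proof -
    have eq: "(\<lambda>\<omega>. (Z 0 \<omega> - s * Z \<bar>t\<bar> \<omega>)\<^sup>2) = (\<lambda>\<omega>. (Z 0 \<omega>)\<^sup>2 - 2 * s * (Z 0 \<omega> * Z \<bar>t\<bar> \<omega>) + (Z \<bar>t\<bar> \<omega>)\<^sup>2)"
      using s by (auto simp: fun_eq_iff power2_diff power2_sum algebra_simps)
    have "0 \<le> expectation (\<lambda>\<omega>. (Z 0 \<omega> - s * Z \<bar>t\<bar> \<omega>)\<^sup>2)" by simp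
    also have "\<dots> = 2 * f0 - 2 * s * \<rho> t"
      unfolding eq using Z_square_integrable[of 0] Z_square_integrable[of "\<bar>t\<bar>"] ZZ_integrable[of 0 "\<bar>t\<bar>"] Z_var[of 0] Z_var[of "\<bar>t\<bar>"]
      by (simp add: autocov_def)
    finally show ?thesis by simp
  qed
  show ?thesis using *[of 1] *[of "-1"] by simp
qed

text \<open>
  Path continuity gives pointwise convergence of the products; by Gaussianity their second moments
  are bounded, so the means converge.
\<close>

lemma rho_continuous: "continuous_on UNIV \<rho>"
proof (subst continuous_on_sequentially, intro allI ballI impI, elim conjE)
  fix x :: "nat \<Rightarrow> real" and t assume x: "x \<longlonglongrightarrow> t"
  have ax: "(\<lambda>n. \<bar>x n\<bar>) \<longlonglongrightarrow> \<bar>t\<bar>" by (intro tendsto_rabs x)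
  have "(\<lambda>n. expectation (\<lambda>\<omega>. Z 0 \<omega> * Z \<bar>x n\<bar> \<omega>)) \<longlonglongrightarrow> expectation (\<lambda>\<omega>. Z 0 \<omega> * Z \<bar>t\<bar> \<omega>)"
  proof (rule L1_convergence_bounded_second_moments(3))
    show "AE \<omega> in M. (\<lambda>n. Z 0 \<omega> * Z \<bar>x n\<bar> \<omega>) \<longlonglongrightarrow> Z 0 \<omega> * Z \<bar>t\<bar> \<omega>"
    proof (rule AE_I2)
      fix \<omega> assume "\<omega> \<in> space M"
      then have "continuous_on {0..} (\<lambda>t. Z t \<omega>)" using Z unfolding stationary_gaussian_OU_def by blast
      then have "(\<lambda>n. Z \<bar>x n\<bar> \<omega>) \<longlonglongrightarrow> Z \<bar>t\<bar> \<omega>"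
        by (rule continuous_on_tendsto_compose[OF _ ax]) auto
      then show "(\<lambda>n. Z 0 \<omega> * Z \<bar>x n\<bar> \<omega>) \<longlonglongrightarrow> Z 0 \<omega> * Z \<bar>t\<bar> \<omega>" by (intro tendsto_intros)
    qed
    have Z4: "integrable M (\<lambda>\<omega>. (Z t \<omega>)^4)" "expectation (\<lambda>\<omega>. (Z t \<omega>)^4) = 3 * f0\<^sup>2" if "t \<ge> 0" for t
      using gaussian_integrable_power(2)[OF Zt_gaussian[OF that], of 4] gaussian_moments(1)[OF Zt_gaussian[OF that]] Z_var[OF that] by auto
    have le: "(Z 0 \<omega> * Z u \<omega>)\<^sup>2 \<le> (Z 0 \<omega>)^4 + (Z u \<omega>)^4" for u \<omega>
    proof -
      have "0 \<le> (Z 0 \<omega>)\<^sup>2 * (Z u \<omega>)\<^sup>2" by simp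
      moreover have "2 * ((Z 0 \<omega>)\<^sup>2 * (Z u \<omega>)\<^sup>2) \<le> (Z 0 \<omega>) ^ 4 + (Z u \<omega>) ^ 4"
        using sum_squares_bound[of "(Z 0 \<omega>)\<^sup>2" "(Z u \<omega>)\<^sup>2"] by (simp add: mult.assoc)
      ultimately have "(Z 0 \<omega>)\<^sup>2 * (Z u \<omega>)\<^sup>2 \<le> (Z 0 \<omega>) ^ 4 + (Z u \<omega>) ^ 4" by linarith
      then show ?thesis by (simp add: power_mult_distrib)
    qed
    show I: "integrable M (\<lambda>\<omega>. (Z 0 \<omega> * Z \<bar>x n\<bar> \<omega>)\<^sup>2)" for n
    proof (rule Bochner_Integration.integrable_bound)
      show "integrable M (\<lambda>\<omega>. (Z 0 \<omega>)^4 + (Z \<bar>x n\<bar> \<omega>)^4)" using Z4 by auto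
      show "AE \<omega> in M. norm ((Z 0 \<omega> * Z \<bar>x n\<bar> \<omega>)\<^sup>2) \<le> norm ((Z 0 \<omega>)^4 + (Z \<bar>x n\<bar> \<omega>)^4)"
        using le by (auto intro!: AE_I2 order_trans[OF _ abs_ge_self])
    qed simp
    show "expectation (\<lambda>\<omega>. (Z 0 \<omega> * Z \<bar>x n\<bar> \<omega>)\<^sup>2) \<le> 6 * f0\<^sup>2" for n
    proof -
      have "expectation (\<lambda>\<omega>. (Z 0 \<omega> * Z \<bar>x n\<bar> \<omega>)\<^sup>2) \<le> expectation (\<lambda>\<omega>. (Z 0 \<omega>)^4 + (Z \<bar>x n\<bar> \<omega>)^4)"
        using I Z4 le by (intro integral_mono) auto
      also have "\<dots> = 6 * f0\<^sup>2" using Z4[of 0] Z4[of "\<bar>x n\<bar>"] by simp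
      finally show ?thesis .
    qed
  qed auto
  then show "(\<rho> \<circ> x) \<longlonglongrightarrow> \<rho> t" by (simp add: autocov_def comp_def)
qed

lemma X_measurable[measurable]: "t \<ge> 0 \<Longrightarrow> X t \<in> borel_measurable M"
proof -
  assume "t \<ge> 0"
  then obtain I where "has_wiener_integral M G (\<lambda>s. exp (\<theta> * s)) 0 t I" and XI: "\<forall>\<omega>\<in>space M. X t \<omega> = exp (- \<theta> * t) * I \<omega>"
    using X unfolding gaussian_OU_def by blast
  then have [measurable]: "I \<in> borel_measurable M" by (simp add: has_wiener_integral_def)
  have "(\<lambda>\<omega>. exp (- \<theta> * t) * I \<omega>) \<in> borel_measurable M" by measurable
  then show ?thesis using XI by (subst measurable_cong[of M "X t" "\<lambda>\<omega>. exp (- \<theta> * t) * I \<omega>"]) auto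
qed

lemma X_eq: "t \<ge> 0 \<Longrightarrow> AE \<omega> in M. X t \<omega> = Z t \<omega> - exp (- \<theta> * t) * Z 0 \<omega>"
proof -
  assume t: "t \<ge> 0"
  then obtain I where I: "has_wiener_integral M G (\<lambda>s. exp (\<theta> * s)) 0 t I" and XI: "\<forall>\<omega>\<in>space M. X t \<omega> = exp (- \<theta> * t) * I \<omega>"
    using X unfolding gaussian_OU_def by blast
  have Gm: "G t \<in> borel_measurable M" for t
  proof -
    have "centered_gaussian_rv M (\<lambda>\<omega>. \<Sum>s\<in>{t}. 1 * G s \<omega>)"
      using G unfolding centered_gaussian_process_def by (elim allE[of _ "{t}"] allE[of _ "\<lambda>_. 1"]) simp
    then show ?thesis using centered_gaussian_rv_measurable by fastforce
  qed
  have "AE \<omega> in M. Z t \<omega> = exp (- \<theta> * t) * (Z 0 \<omega> + I \<omega>)"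
    using Z t unfolding stationary_gaussian_OU_def
    by (intro OU_stationary_relation[OF Gm _ _ I t]) auto
  with AE_space show ?thesis by eventually_elim (simp add: XI algebra_simps)
qed

text \<open>
  \<open>X\<close> is almost surely a linear combination of values of \<open>Z\<close>, which is jointly Gaussian by assumption.
\<close>

lemma X_gaussian: "finite J \<Longrightarrow> J \<subseteq> {0..} \<Longrightarrow> centered_gaussian_rv M (\<lambda>\<omega>. \<Sum>t\<in>J. a t * X t \<omega>)"
proof -
  assume J: "finite J" "J \<subseteq> {0..}"
  define b where "b t = (if t \<in> J then a t else 0) + (if t = 0 then - (\<Sum>t\<in>J. a t * exp (- \<theta> * t)) else 0)" for t
  have "centered_gaussian_rv M (\<lambda>\<omega>. \<Sum>t\<in>insert 0 J. b t * Z t \<omega>)"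
    using J by (intro Z_gaussian) auto
  then show ?thesis
  proof (rule centered_gaussian_rv_AE_cong)
    have "AE \<omega> in M. \<forall>t\<in>J. X t \<omega> = Z t \<omega> - exp (- \<theta> * t) * Z 0 \<omega>"
      using J X_eq by (intro AE_finite_allI) auto
    then show "AE \<omega> in M. (\<Sum>t\<in>insert 0 J. b t * Z t \<omega>) = (\<Sum>t\<in>J. a t * X t \<omega>)"
    proof eventually_elim
      case (elim \<omega>)
      have "(\<Sum>t\<in>insert 0 J. b t * Z t \<omega>) = (\<Sum>t\<in>insert 0 J. if t \<in> J then a t * Z t \<omega> else 0) + (\<Sum>t\<in>insert 0 J. if t = 0 then - (\<Sum>t\<in>J. a t * exp (- \<theta> * t)) * Z 0 \<omega> else 0)"
        unfolding sum.distrib[symmetric] by (intro sum.cong) (auto simp: b_def algebra_simps)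
      also have "(\<Sum>t\<in>insert 0 J. if t = 0 then - (\<Sum>t\<in>J. a t * exp (- \<theta> * t)) * Z 0 \<omega> else 0) = - (\<Sum>t\<in>J. a t * exp (- \<theta> * t)) * Z 0 \<omega>"
        using J by (subst sum.delta) auto
      also have "(\<Sum>t\<in>insert 0 J. if t \<in> J then a t * Z t \<omega> else 0) = (\<Sum>t\<in>J. a t * Z t \<omega>)"
        using J by (intro sum.mono_neutral_cong_right) auto
      also have "(\<Sum>t\<in>J. a t * Z t \<omega>) + - (\<Sum>t\<in>J. a t * exp (- \<theta> * t)) * Z 0 \<omega> = (\<Sum>t\<in>J. a t * (Z t \<omega> - exp (- \<theta> * t) * Z 0 \<omega>))"
        by (simp add: sum_distrib_right right_diff_distrib sum_subtractf mult.assoc)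
      also have "\<dots> = (\<Sum>t\<in>J. a t * X t \<omega>)" using elim by (intro sum.cong) auto
      finally show ?case .
    qed
    show "(\<lambda>\<omega>. \<Sum>t\<in>J. a t * X t \<omega>) \<in> borel_measurable M"
      using J by (intro borel_measurable_sum borel_measurable_times X_measurable) auto
  qed
qed

definition r :: "real \<Rightarrow> real \<Rightarrow> real" where "r s t = expectation (\<lambda>\<omega>. X s \<omega> * X t \<omega>)"

lemma r_eq:
  assumes s: "s \<ge> 0" and t: "t \<ge> 0"
  shows "r s t = \<rho> (t - s) - exp (- \<theta> * t) * \<rho> s - exp (- \<theta> * s) * \<rho> t + exp (- \<theta> * s) * exp (- \<theta> * t) * f0"
proof -
  have [measurable]: "X s \<in> borel_measurable M" "X t \<in> borel_measurable M" "Z s \<in> borel_measurable M" "Z t \<in> borel_measurable M" "Z 0 \<in> borel_measurable M"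
    using s t by auto
  have "r s t = expectation (\<lambda>\<omega>. Z s \<omega> * Z t \<omega> - exp (- \<theta> * t) * (Z s \<omega> * Z 0 \<omega>) - exp (- \<theta> * s) * (Z 0 \<omega> * Z t \<omega>) + exp (- \<theta> * s) * exp (- \<theta> * t) * (Z 0 \<omega> * Z 0 \<omega>))"
    unfolding r_def
  proof (rule integral_cong_AE)
    show "AE \<omega> in M. X s \<omega> * X t \<omega> = Z s \<omega> * Z t \<omega> - exp (- \<theta> * t) * (Z s \<omega> * Z 0 \<omega>) - exp (- \<theta> * s) * (Z 0 \<omega> * Z t \<omega>) + exp (- \<theta> * s) * exp (- \<theta> * t) * (Z 0 \<omega> * Z 0 \<omega>)"
      using X_eq[OF s] X_eq[OF t]
    proof eventually_elim
      case (elim \<omega>)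
      show ?case unfolding elim by (simp add: algebra_simps)
    qed
  qed measurable
  also have "\<dots> = \<rho> (t - s) - exp (- \<theta> * t) * \<rho> (0 - s) - exp (- \<theta> * s) * \<rho> (t - 0) + exp (- \<theta> * s) * exp (- \<theta> * t) * \<rho> (0 - 0)"
    using s t by (simp add: ZZ_integrable ZZ_cov)
  finally show ?thesis by (simp add: rho_even f0_def)
qed

lemma exp_le_1: "t \<ge> 0 \<Longrightarrow> exp (- \<theta> * t) \<le> 1"
  using \<theta> by simp

lemma abs_r_le:
  assumes s: "s \<ge> 0" and t: "t \<ge> 0"
  shows "\<bar>r s t\<bar> \<le> \<bar>\<rho> (s - t)\<bar> + \<bar>\<rho> s\<bar> + 2 * f0 * exp (- \<theta> * s)"
proof -
  have a: "\<bar>exp (- \<theta> * t) * \<rho> s\<bar> \<le> 1 * \<bar>\<rho> s\<bar>"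
    unfolding abs_mult using exp_le_1[OF t] by (intro mult_right_mono) auto
  have b: "\<bar>exp (- \<theta> * s) * \<rho> t\<bar> \<le> exp (- \<theta> * s) * f0"
    unfolding abs_mult using abs_rho_le[of t] by (simp add: mult_left_mono)
  have "exp (- \<theta> * s) * exp (- \<theta> * t) * f0 \<le> exp (- \<theta> * s) * 1 * f0"
    using exp_le_1[OF t] f0_pos by (intro mult_right_mono mult_left_mono) auto
  then have c: "\<bar>exp (- \<theta> * s) * exp (- \<theta> * t) * f0\<bar> \<le> exp (- \<theta> * s) * f0" using f0_pos by (simp add: abs_mult)
  have d: "\<rho> (t - s) = \<rho> (s - t)" using rho_even[of "s - t"] by simp
  have tri: "\<bar>x - y - z + w\<bar> \<le> \<bar>x\<bar> + Y + (Z + W)" if "\<bar>y\<bar> \<le> Y" "\<bar>z\<bar> \<le> Z" "\<bar>w\<bar> \<le> W" for x y z w Y Z W :: real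
    using that by linarith
  show ?thesis using tri[OF a b c, of "\<rho> (s - t)"] unfolding r_eq[OF s t] d by (simp add: mult_ac)
qed

lemma abs_r_le4:
  assumes "s \<ge> 0" "t \<ge> 0"
  shows "\<bar>r s t\<bar> \<le> 4 * f0"
proof -
  have "2 * f0 * exp (- \<theta> * s) \<le> 2 * f0 * 1" using exp_le_1[OF assms(1)] f0_pos by (intro mult_left_mono) auto
  then show ?thesis using abs_r_le[OF assms] abs_rho_le[of "s - t"] abs_rho_le[of s] by linarith
qed

lemma r_lower:
  assumes s: "s \<ge> 0" and t: "t \<ge> s"
  shows "\<bar>r s t - \<rho> (t - s)\<bar> \<le> 3 * f0 * exp (- \<theta> * s)"
proof -
  have t0: "t \<ge> 0" using s t by simp
  have "exp (- \<theta> * t) \<le> exp (- \<theta> * s)" using t \<theta> by simp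
  then have a: "\<bar>exp (- \<theta> * t) * \<rho> s\<bar> \<le> exp (- \<theta> * s) * f0"
    unfolding abs_mult using abs_rho_le[of s] by (intro mult_mono) auto
  have b: "\<bar>exp (- \<theta> * s) * \<rho> t\<bar> \<le> exp (- \<theta> * s) * f0"
    unfolding abs_mult using abs_rho_le[of t] by (simp add: mult_left_mono)
  have "exp (- \<theta> * s) * exp (- \<theta> * t) * f0 \<le> exp (- \<theta> * s) * 1 * f0"
    using exp_le_1[OF t0] f0_pos by (intro mult_right_mono mult_left_mono) auto
  then have c: "\<bar>exp (- \<theta> * s) * exp (- \<theta> * t) * f0\<bar> \<le> exp (- \<theta> * s) * f0" using f0_pos by (simp add: abs_mult)
  have tri: "\<bar>x - y - z + w - x\<bar> \<le> 3 * Y" if "\<bar>y\<bar> \<le> Y" "\<bar>z\<bar> \<le> Y" "\<bar>w\<bar> \<le> Y" for x y z w Y :: real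
    using that by linarith
  show ?thesis using tri[OF a b c, of "\<rho> (t - s)"] unfolding r_eq[OF s t0] by (simp add: mult_ac)
qed

lemma r_diag:
  assumes "t \<ge> 0"
  shows "f0 * (1 - exp (- \<theta> * t))\<^sup>2 \<le> r t t" "r t t \<le> 4 * f0" "\<bar>r t t - f0\<bar> \<le> 3 * f0 * exp (- \<theta> * t)"
proof -
  have eq: "r t t = f0 - 2 * exp (- \<theta> * t) * \<rho> t + (exp (- \<theta> * t))\<^sup>2 * f0"
    using r_eq[OF assms assms] by (simp add: f0_def power2_eq_square)
  have "exp (- \<theta> * t) * \<rho> t \<le> exp (- \<theta> * t) * f0" using abs_rho_le[of t] by (intro mult_left_mono) auto
  then show "f0 * (1 - exp (- \<theta> * t))\<^sup>2 \<le> r t t" unfolding eq by (simp add: power2_diff algebra_simps)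
  show *: "\<bar>r t t - f0\<bar> \<le> 3 * f0 * exp (- \<theta> * t)" using r_lower[OF assms order_refl] by (simp add: f0_def)
  have "3 * f0 * exp (- \<theta> * t) \<le> 3 * f0 * 1" using exp_le_1[OF assms] f0_pos by (intro mult_left_mono) auto
  then show "r t t \<le> 4 * f0" using * by linarith
qed

lemma f_lim_eq: "f_lim M X = f0"
proof -
  have "((\<lambda>T. exp (- (\<theta> * T))) \<longlongrightarrow> 0) at_top"
    using \<theta> by real_asymp
  then have "((\<lambda>T. 3 * f0 * exp (- \<theta> * T)) \<longlongrightarrow> 0) at_top"
    using tendsto_mult_right_zero by fastforce
  then have "((\<lambda>T. r T T - f0) \<longlongrightarrow> 0) at_top"
    by (rule Lim_null_comparison[rotated], intro eventually_mono[OF eventually_ge_at_top[of 0]]) (use r_diag(3) in simp)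
  then have "((\<lambda>T. r T T) \<longlongrightarrow> f0) at_top" by (simp add: LIM_zero_iff)
  then have "((\<lambda>T. expectation (\<lambda>\<omega>. (X T \<omega>)\<^sup>2)) \<longlongrightarrow> f0) at_top" by (simp add: r_def power2_eq_square)
  then show ?thesis unfolding f_lim_def by (intro tendsto_Lim) auto
qed

lemma gaussian_path: "T > 0 \<Longrightarrow> gaussian_path M T X (4 * f0)"
proof unfold_locales
  assume T: "T > 0"
  show "0 < T" by (rule T)
  show "centered_gaussian_rv M (\<lambda>\<omega>. \<Sum>t\<in>J. a t * X t \<omega>)" if "finite J" "J \<subseteq> {0..T}" for J a
    using that by (intro X_gaussian) auto
  show "continuous_on {0..T} (\<lambda>t. X t \<omega>)" if "\<omega> \<in> space M" for \<omega>
    using X that unfolding gaussian_OU_def by (auto intro: continuous_on_subset[of "{0..}"])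
  show "expectation (\<lambda>\<omega>. (X t \<omega>)\<^sup>2) \<le> 4 * f0" if "t \<in> {0..T}" for t
    using r_diag(2)[of t] that by (simp add: r_def power2_eq_square)
qed

lemma r_path:
  fixes T :: real
  assumes "T > 0"
  shows "gaussian_path.r M X = r"
proof -
  interpret P: gaussian_path M T X "4 * f0" by (rule gaussian_path[OF assms])
  show ?thesis by (intro ext) (simp add: P.r_def r_def)
qed

text \<open>
  Majorants for the covariance \<open>r\<close>: the Riemann sum \<open>row\<close> of \<open>\<kappa>\<close> bounds, uniformly in the row, the average of the
  powers of \<open>\<bar>r\<bar>\<close> over a row of the covariance matrix on the grid.  Every shift and reflection of \<open>\<rho>\<close> that
  occurs in a row has been replaced by \<open>\<rho>\<close> on the positive half-line.
\<close>

definition \<kappa> :: "real \<Rightarrow> real \<Rightarrow> real" where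
  "\<kappa> p u = 3 * \<bar>\<rho> u\<bar> powr p + (2 * f0) powr p * exp (- (p * \<theta>) * u)"

definition row :: "real \<Rightarrow> real \<Rightarrow> nat \<Rightarrow> real" where
  "row p T n = 3 powr p * ((\<Sum>i<n. \<kappa> p (real i * T / real n)) / real n)"

lemma rho_powr_continuous: "p > 0 \<Longrightarrow> continuous_on S (\<lambda>u. \<bar>\<rho> u\<bar> powr p)"
  by (intro continuous_on_powr' continuous_intros continuous_on_subset[OF rho_continuous]) auto

lemma \<kappa>_continuous: "p > 0 \<Longrightarrow> continuous_on S (\<kappa> p)"
  unfolding \<kappa>_def[abs_def] by (intro continuous_intros rho_powr_continuous)

lemma row_nonneg: "row p T n \<ge> 0"
  unfolding row_def \<kappa>_def using f0_pos by (intro mult_nonneg_nonneg divide_nonneg_nonneg sum_nonneg) auto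

lemma row_tendsto: "p > 0 \<Longrightarrow> T > 0 \<Longrightarrow> row p T \<longlonglongrightarrow> 3 powr p * (integral {0..T} (\<kappa> p) / T)"
  unfolding row_def[abs_def] by (intro tendsto_intros riemann_sums_tendsto \<kappa>_continuous) auto

lemma row_bound:
  assumes T: "T > 0" and j: "j < n" and p: "p > 0"
  shows "(\<Sum>i<n. \<bar>r (real i * T / real n) (real j * T / real n)\<bar> powr p) / real n \<le> row p T n"
proof -
  define t where "t i = real i * T / real n" for i
  have n0: "real n > 0" using j by simp
  have t0: "t i \<ge> 0" for i using T by (simp add: t_def)
  have "(\<Sum>i<n. \<bar>r (t i) (t j)\<bar> powr p) \<le> (\<Sum>i<n. 3 powr p * (\<bar>\<rho> (t i - t j)\<bar> powr p + \<bar>\<rho> (t i)\<bar> powr p + (2 * f0) powr p * exp (- (p * \<theta>) * t i)))"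
  proof (rule sum_mono)
    fix i
    have "\<bar>r (t i) (t j)\<bar> powr p \<le> (\<bar>\<rho> (t i - t j)\<bar> + \<bar>\<rho> (t i)\<bar> + 2 * f0 * exp (- \<theta> * t i)) powr p"
      using abs_r_le[OF t0 t0] p by (intro powr_mono2) auto
    also have "\<dots> \<le> 3 powr p * (\<bar>\<rho> (t i - t j)\<bar> powr p + \<bar>\<rho> (t i)\<bar> powr p + (2 * f0 * exp (- \<theta> * t i)) powr p)"
      using f0_pos p by (intro power_sum_three) auto
    also have "(2 * f0 * exp (- \<theta> * t i)) powr p = (2 * f0) powr p * exp (- (p * \<theta>) * t i)"
      using f0_pos by (simp add: powr_mult powr_def[of "exp _"] mult_ac)
    finally show "\<bar>r (t i) (t j)\<bar> powr p \<le> 3 powr p * (\<bar>\<rho> (t i - t j)\<bar> powr p + \<bar>\<rho> (t i)\<bar> powr p + (2 * f0) powr p * exp (- (p * \<theta>) * t i))" .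
  qed
  also have "\<dots> = 3 powr p * ((\<Sum>i<n. \<bar>\<rho> (t i - t j)\<bar> powr p) + (\<Sum>i<n. \<bar>\<rho> (t i)\<bar> powr p) + (\<Sum>i<n. (2 * f0) powr p * exp (- (p * \<theta>) * t i)))"
    by (simp add: sum_distrib_left sum.distrib distrib_left)
  also have "(\<Sum>i<n. \<bar>\<rho> (t i - t j)\<bar> powr p) \<le> 2 * (\<Sum>k<n. \<bar>\<rho> (t k)\<bar> powr p)"
  proof -
    have "(\<Sum>i<n. \<bar>\<rho> (t i - t j)\<bar> powr p) = (\<Sum>i<n. \<bar>\<rho> (t (if i < j then j - i else i - j))\<bar> powr p)"
    proof (intro sum.cong refl)
      fix i
      show "\<bar>\<rho> (t i - t j)\<bar> powr p = \<bar>\<rho> (t (if i < j then j - i else i - j))\<bar> powr p"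
      proof (cases "i < j")
        case True
        then have "t (j - i) = - (t i - t j)" by (simp add: t_def of_nat_diff left_diff_distrib diff_divide_distrib)
        then show ?thesis using True rho_even[of "t i - t j"] by simp
      next
        case False
        then have "t (i - j) = t i - t j" by (simp add: t_def of_nat_diff left_diff_distrib diff_divide_distrib)
        then show ?thesis using False by simp
      qed
    qed
    also have "\<dots> \<le> 2 * (\<Sum>k<n. \<bar>\<rho> (t k)\<bar> powr p)" by (rule sum_abs_diff_le[OF _ j]) simp
    finally show ?thesis .
  qed
  finally have "(\<Sum>i<n. \<bar>r (t i) (t j)\<bar> powr p) \<le> 3 powr p * (\<Sum>i<n. \<kappa> p (t i))"
    by (simp add: \<kappa>_def sum.distrib sum_distrib_left[symmetric] mult_left_mono algebra_simps)
  then show ?thesis using n0 by (simp add: row_def t_def divide_right_mono)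
qed

lemma integral_\<kappa>_le:
  assumes p: "p > 0" and T: "T > 0"
  shows "integral {0..T} (\<kappa> p) \<le> 3 * integral {0..T} (\<lambda>u. \<bar>\<rho> u\<bar> powr p) + (2 * f0) powr p / (p * \<theta>)"
proof -
  define c where "c = p * \<theta>"
  have c: "c > 0" using p \<theta> by (simp add: c_def)
  have "((\<lambda>u. exp (- c * u)) has_integral (- exp (- c * T) / c - (- exp (- c * 0) / c))) {0..T}"
    by (rule fundamental_theorem_of_calculus)
      (use T c in \<open>auto intro!: derivative_eq_intros simp: has_real_derivative_iff_has_vector_derivative[symmetric]\<close>)
  then have I: "integral {0..T} (\<lambda>u. exp (- c * u)) = (1 - exp (- c * T)) / c"
    by (simp add: integral_unique diff_divide_distrib)
  also have "\<dots> \<le> 1 / c" using c by (intro divide_right_mono) auto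
  finally have I: "integral {0..T} (\<lambda>u. exp (- c * u)) \<le> 1 / c" .
  have "integral {0..T} (\<kappa> p) = integral {0..T} (\<lambda>u. 3 * \<bar>\<rho> u\<bar> powr p) + integral {0..T} (\<lambda>u. (2 * f0) powr p * exp (- c * u))"
    unfolding \<kappa>_def[abs_def] c_def
    by (intro Henstock_Kurzweil_Integration.integral_add integrable_continuous_real continuous_intros rho_powr_continuous p)
  also have "\<dots> = 3 * integral {0..T} (\<lambda>u. \<bar>\<rho> u\<bar> powr p) + (2 * f0) powr p * integral {0..T} (\<lambda>u. exp (- c * u))"
    by simp
  also have "\<dots> \<le> 3 * integral {0..T} (\<lambda>u. \<bar>\<rho> u\<bar> powr p) + (2 * f0) powr p * (1 / c)"
    using I by (intro add_left_mono mult_left_mono) auto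
  finally show ?thesis by (simp add: c_def)
qed

definition R2 :: real where "R2 = (\<integral>u. (\<rho> u)\<^sup>2 \<partial>lborel)"

lemma integral_rho2_le: "T > 0 \<Longrightarrow> integral {0..T} (\<lambda>u. \<bar>\<rho> u\<bar> powr 2) \<le> R2"
proof -
  assume T: "T > 0"
  have eq: "\<bar>\<rho> u\<bar> powr 2 = (\<rho> u)\<^sup>2" for u by (simp add: powr_numeral)
  have si: "set_integrable lborel {0..T} (\<lambda>u. (\<rho> u)\<^sup>2)"
    by (intro borel_integrable_atLeastAtMost' continuous_intros continuous_on_subset[OF rho_continuous]) auto
  have "integral {0..T} (\<lambda>u. (\<rho> u)\<^sup>2) = (LINT u:{0..T}|lborel. (\<rho> u)\<^sup>2)"
    by (rule set_borel_integral_eq_integral(2)[OF si, symmetric])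
  also have "\<dots> \<le> R2"
    unfolding set_lebesgue_integral_def R2_def
    by (rule integral_mono) (use si rho2 in \<open>auto simp: set_integrable_def indicator_def\<close>)
  finally show ?thesis by (simp add: eq)
qed

lemma sn_le_row: "T > 0 \<Longrightarrow> gaussian_path.sn M T X n \<le> row 2 T n"
proof -
  assume T: "T > 0"
  interpret P: gaussian_path M T X "4 * f0" by (rule gaussian_path[OF T])
  show ?thesis
  proof (cases "n = 0")
    case True then show ?thesis unfolding P.sn_eq using row_nonneg[of 2 T n] by simp
  next
    case False
    then have n0: "real n > 0" by simp
    define t where "t i = real i * T / real n" for i
    have "P.sn n = (\<Sum>i<n. \<Sum>j<n. (r (t i) (t j))\<^sup>2) / (real n)\<^sup>2"
      unfolding P.sn_eq r_path[OF T] t_def ..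
    also have "\<dots> = (\<Sum>j<n. (\<Sum>i<n. \<bar>r (t i) (t j)\<bar> powr 2) / real n) / real n"
      by (subst sum.swap) (simp add: powr_numeral sum_divide_distrib power2_eq_square)
    also have "\<dots> \<le> (\<Sum>j<n. row 2 T n) / real n"
      unfolding t_def by (intro divide_right_mono sum_mono row_bound[OF T]) auto
    also have "\<dots> = row 2 T n" using n0 by simp
    finally show ?thesis .
  qed
qed

text \<open>
  Here square integrability of \<open>\<rho>\<close> enters: it makes the variance of the time average of order \<open>1 / T\<close>.
\<close>

lemma s2_upper:
  assumes T: "T > 0"
  shows "gaussian_path.s2 M T X \<le> (54 * R2 + 36 * f0\<^sup>2 / \<theta>) / T"
proof -
  interpret P: gaussian_path M T X "4 * f0" by (rule gaussian_path[OF T])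
  have "P.s2 \<le> 2 * (3 powr 2 * (integral {0..T} (\<kappa> 2) / T))"
  proof (rule LIMSEQ_le[OF P.sn_tendsto tendsto_mult[OF tendsto_const row_tendsto]])
    show "\<exists>N. \<forall>n\<ge>N. 2 * P.sn n \<le> 2 * row 2 T n" using sn_le_row[OF T] by auto
  qed (use T in auto)
  also have "\<dots> \<le> 2 * (9 * ((3 * R2 + (2 * f0) powr 2 / (2 * \<theta>)) / T))"
  proof -
    have "integral {0..T} (\<kappa> 2) \<le> 3 * R2 + (2 * f0) powr 2 / (2 * \<theta>)"
      using integral_\<kappa>_le[of 2 T] integral_rho2_le[OF T] T by simp
    then have "integral {0..T} (\<kappa> 2) / T \<le> (3 * R2 + (2 * f0) powr 2 / (2 * \<theta>)) / T"
      using T by (intro divide_right_mono) auto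
    moreover have "(3::real) powr 2 = 9" by (simp add: powr_numeral)
    ultimately show ?thesis by (simp only: mult_left_mono)
  qed
  also have "\<dots> = (54 * R2 + 36 * f0\<^sup>2 / \<theta>) / T"
    using f0_pos \<theta> T by (simp add: powr_numeral power_mult_distrib field_simps)
  finally show ?thesis .
qed

text \<open>
  The previous bound is useless for small \<open>T\<close>; this one holds uniformly.
\<close>

lemma s2_bounded:
  assumes T: "T > 0"
  shows "gaussian_path.s2 M T X \<le> 32 * f0\<^sup>2"
proof -
  interpret P: gaussian_path M T X "4 * f0" by (rule gaussian_path[OF T])
  have "P.sn n \<le> (4 * f0)\<^sup>2" for n
  proof (cases "n = 0")
    case True then show ?thesis unfolding P.sn_eq by simp
  next
    case False
    have "(r (real i * T / real n) (real j * T / real n))\<^sup>2 \<le> (4 * f0)\<^sup>2" for i j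
      using abs_r_le4[of "real i * T / real n" "real j * T / real n"] T f0_pos by (intro abs_le_square_iff[THEN iffD1]) auto
    then have "(\<Sum>i<n. \<Sum>j<n. (r (real i * T / real n) (real j * T / real n))\<^sup>2) \<le> (\<Sum>i<n. \<Sum>j<n. (4 * f0)\<^sup>2)"
      by (intro sum_mono)
    then show ?thesis
      unfolding P.sn_eq r_path[OF T] using False by (simp add: divide_le_eq power2_eq_square mult_ac)
  qed
  then have "2 * P.sn n \<le> 32 * f0\<^sup>2" for n by (simp add: power_mult_distrib)
  then show ?thesis by (intro LIMSEQ_le_const2[OF P.sn_tendsto]) auto
qed

text \<open>
  By \<open>product_three_le\<close> and symmetry, the triple sum is at most the sum over one index of squared row sums.
\<close>

lemma tn_le_row: "T > 0 \<Longrightarrow> gaussian_path.tn M T X n \<le> (row (3/2) T n)\<^sup>2"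
proof -
  assume T: "T > 0"
  interpret P: gaussian_path M T X "4 * f0" by (rule gaussian_path[OF T])
  show ?thesis
  proof (cases "n = 0")
    case True then show ?thesis unfolding P.tn_eq by simp
  next
    case False
    then have n0: "real n > 0" by simp
    define t where "t i = real i * T / real n" for i
    define a where "a i j = \<bar>r (t i) (t j)\<bar> powr (3/2)" for i j
    define R where "R = real n * row (3/2) T n"
    have R0: "R \<ge> 0" using row_nonneg n0 by (simp add: R_def)
    have a0: "a i j \<ge> 0" for i j by (simp add: a_def)
    have asym: "a i j = a j i" for i j by (simp add: a_def r_def mult.commute)
    have col: "(\<Sum>i<n. a i j) \<le> R" if "j < n" for j
      using row_bound[OF T that, of "3/2"] n0 by (simp add: a_def t_def R_def field_simps)
    have rows: "(\<Sum>j<n. a i j) \<le> R" if "i < n" for i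
      using col[OF that] asym by simp
    have sq: "(\<Sum>j<n. \<Sum>k<n. a i j * a i k) \<le> R\<^sup>2" if "i < n" for i
      unfolding sum_product[symmetric] power2_eq_square using rows[OF that] a0 R0 by (intro mult_mono sum_nonneg) auto
    have "(\<Sum>i<n. \<Sum>j<n. \<Sum>k<n. r (t i) (t j) * r (t i) (t k) * r (t j) (t k)) \<le>
      (\<Sum>i<n. \<Sum>j<n. \<Sum>k<n. (a i j * a i k + a i j * a j k + a i k * a j k) / 3)"
    proof (intro sum_mono)
      fix i j k
      have "r (t i) (t j) * r (t i) (t k) * r (t j) (t k) \<le> \<bar>r (t i) (t j)\<bar> * \<bar>r (t i) (t k)\<bar> * \<bar>r (t j) (t k)\<bar>"
        by (metis abs_ge_self abs_mult)
      also have "\<dots> \<le> (a i j * a i k + a i j * a j k + a i k * a j k) / 3"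
        unfolding a_def by (rule product_three_le) auto
      finally show "r (t i) (t j) * r (t i) (t k) * r (t j) (t k) \<le> (a i j * a i k + a i j * a j k + a i k * a j k) / 3" .
    qed
    also have "\<dots> = ((\<Sum>i<n. \<Sum>j<n. \<Sum>k<n. a i j * a i k) + (\<Sum>i<n. \<Sum>j<n. \<Sum>k<n. a i j * a j k) + (\<Sum>i<n. \<Sum>j<n. \<Sum>k<n. a i k * a j k)) / 3"
      by (simp add: sum.distrib sum_divide_distrib add_divide_distrib)
    also have "(\<Sum>i<n. \<Sum>j<n. \<Sum>k<n. a i j * a j k) = (\<Sum>j<n. \<Sum>i<n. \<Sum>k<n. a j i * a j k)"
    proof -
      have "(\<Sum>i<n. \<Sum>j<n. \<Sum>k<n. a i j * a j k) = (\<Sum>j<n. \<Sum>i<n. \<Sum>k<n. a i j * a j k)" by (rule sum.swap)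
      also have "\<dots> = (\<Sum>j<n. \<Sum>i<n. \<Sum>k<n. a j i * a j k)"
        by (intro sum.cong refl arg_cong2[where f="(*)"]) (rule asym)
      finally show ?thesis .
    qed
    also have "(\<Sum>i<n. \<Sum>j<n. \<Sum>k<n. a i k * a j k) = (\<Sum>k<n. \<Sum>i<n. \<Sum>j<n. a k i * a k j)"
    proof -
      have "(\<Sum>i<n. \<Sum>j<n. \<Sum>k<n. a i k * a j k) = (\<Sum>i<n. \<Sum>k<n. \<Sum>j<n. a i k * a j k)"
        by (rule sum.cong[OF refl sum.swap])
      also have "\<dots> = (\<Sum>k<n. \<Sum>i<n. \<Sum>j<n. a i k * a j k)" by (rule sum.swap)
      also have "\<dots> = (\<Sum>k<n. \<Sum>i<n. \<Sum>j<n. a k i * a k j)"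
        by (intro sum.cong refl arg_cong2[where f="(*)"]; rule asym)
      finally show ?thesis .
    qed
    also have "((\<Sum>i<n. \<Sum>j<n. \<Sum>k<n. a i j * a i k) + (\<Sum>j<n. \<Sum>i<n. \<Sum>k<n. a j i * a j k) + (\<Sum>k<n. \<Sum>i<n. \<Sum>j<n. a k i * a k j)) / 3 = (\<Sum>i<n. \<Sum>j<n. \<Sum>k<n. a i j * a i k)"
      by simp
    also have "\<dots> \<le> (\<Sum>i<n. R\<^sup>2)" using sq by (intro sum_mono) auto
    also have "\<dots> = real n ^ 3 * (row (3/2) T n)\<^sup>2" by (simp add: R_def power_mult_distrib power2_eq_square power3_eq_cube)
    finally show ?thesis
      unfolding P.tn_eq r_path[OF T] t_def[symmetric] using n0 by (simp add: divide_le_eq mult.commute)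
  qed
qed

text \<open>
  The integral whose square, divided by \<open>sqrt T\<close>, is the rate of convergence to the normal law.
\<close>

definition J :: "real \<Rightarrow> real" where "J T = integral {-T..T} (\<lambda>t. \<bar>\<rho> t\<bar> powr (3/2))"

lemma J_bound: "T > 0 \<Longrightarrow> 0 \<le> integral {0..T} (\<lambda>t. \<bar>\<rho> t\<bar> powr (3/2)) \<and> integral {0..T} (\<lambda>t. \<bar>\<rho> t\<bar> powr (3/2)) \<le> J T"
  unfolding J_def
  by (intro conjI Henstock_Kurzweil_Integration.integral_nonneg integral_subset_le integrable_continuous_real rho_powr_continuous) auto

lemma clt_time_average:
  fixes h :: "real \<Rightarrow> real"
  assumes T: "T > 0" and lip: "\<And>x y. \<bar>h x - h y\<bar> \<le> \<bar>x - y\<bar>" and pos: "gaussian_path.s2 M T X > 0"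
  shows "\<bar>expectation (\<lambda>\<omega>. h ((gaussian_path.V T X \<omega> - gaussian_path.e M T X) / sqrt (gaussian_path.s2 M T X))) - normal_mean h\<bar>
    \<le> 48 * (3 powr (3/2) * ((3 * J T + (2 * f0) powr (3/2) / (3/2 * \<theta>)) / T))\<^sup>2 / sqrt (gaussian_path.s2 M T X) ^ 3"
proof -
  interpret P: gaussian_path M T X "4 * f0" by (rule gaussian_path[OF T])
  have "\<bar>expectation (\<lambda>\<omega>. h ((P.V \<omega> - P.e) / sqrt P.s2)) - normal_mean h\<bar>
    \<le> 48 * (3 powr (3/2) * (integral {0..T} (\<kappa> (3/2)) / T))\<^sup>2 / sqrt P.s2 ^ 3"
    by (rule P.V_clt[OF lip pos tn_le_row[OF T] tendsto_power[OF row_tendsto[OF _ T]]]) simp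
  also have "\<dots> \<le> 48 * (3 powr (3/2) * ((3 * J T + (2 * f0) powr (3/2) / (3/2 * \<theta>)) / T))\<^sup>2 / sqrt P.s2 ^ 3"
  proof (intro divide_right_mono mult_left_mono power_mono)
    have "integral {0..T} (\<kappa> (3/2)) \<le> 3 * J T + (2 * f0) powr (3/2) / (3/2 * \<theta>)"
      using integral_\<kappa>_le[of "3/2" T] J_bound[OF T] T by simp
    then show "integral {0..T} (\<kappa> (3/2)) \<le> 3 * J T + (2 * f0) powr (3/2) / (3/2 * \<theta>)" .
    have "integral {0..T} (\<kappa> (3/2)) \<ge> 0"
      by (intro Henstock_Kurzweil_Integration.integral_nonneg integrable_continuous_real \<kappa>_continuous) (use f0_pos in \<open>auto simp: \<kappa>_def\<close>)
    then show "0 \<le> 3 powr (3/2) * (integral {0..T} (\<kappa> (3/2)) / T)" using T by simp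
  qed (use T P.s2_nonneg in auto)
  finally show ?thesis .
qed

text \<open>
  The process started at 0 approaches the stationary variance exponentially fast, so the bias of the
  time average is of order \<open>1 / T\<close>, which is smaller than the order of its standard deviation.
\<close>

lemma mean_close:
  assumes T: "T > 0"
  shows "\<bar>gaussian_path.e M T X - f0\<bar> \<le> 3 * f0 / (\<theta> * T)"
proof -
  interpret P: gaussian_path M T X "4 * f0" by (rule gaussian_path[OF T])
  have c: "continuous_on {0..T} (\<lambda>u. exp (- \<theta> * u))" by (intro continuous_intros)
  have I: "integral {0..T} (\<lambda>u. exp (- \<theta> * u)) \<le> 1 / \<theta>"
  proof -
    have "((\<lambda>u. exp (- \<theta> * u)) has_integral (- exp (- \<theta> * T) / \<theta> - (- exp (- \<theta> * 0) / \<theta>))) {0..T}"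
      by (rule fundamental_theorem_of_calculus)
        (use T \<theta> in \<open>auto intro!: derivative_eq_intros simp: has_real_derivative_iff_has_vector_derivative[symmetric]\<close>)
    then have "integral {0..T} (\<lambda>u. exp (- \<theta> * u)) = (1 - exp (- \<theta> * T)) / \<theta>"
      by (simp add: integral_unique diff_divide_distrib)
    also have "\<dots> \<le> 1 / \<theta>" using \<theta> by (intro divide_right_mono) auto
    finally show ?thesis .
  qed
  have "\<bar>P.e - f0\<bar> \<le> 3 * f0 * (integral {0..T} (\<lambda>u. exp (- \<theta> * u)) / T)"
  proof (rule LIMSEQ_le[OF tendsto_rabs[OF tendsto_diff[OF P.en_tendsto[folded P.e_def] tendsto_const]] tendsto_mult[OF tendsto_const riemann_sums_tendsto[OF T c]]])
    show "\<exists>N. \<forall>n\<ge>N. \<bar>P.en n - f0\<bar> \<le> 3 * f0 * ((\<Sum>i<n. exp (- \<theta> * (real i * T / real n))) / real n)"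
    proof (intro exI[of _ 1] allI impI)
      fix n :: nat assume n: "n \<ge> 1"
      then have n0: "real n > 0" by simp
      have "P.en n - f0 = (\<Sum>i<n. r (real i * T / real n) (real i * T / real n) - f0) / real n"
        unfolding P.en_eq r_path[OF T] using n0 by (simp add: sum_subtractf diff_divide_distrib)
      then have "\<bar>P.en n - f0\<bar> \<le> (\<Sum>i<n. \<bar>r (real i * T / real n) (real i * T / real n) - f0\<bar>) / real n"
        by (simp add: abs_divide divide_right_mono)
      also have "\<dots> \<le> (\<Sum>i<n. 3 * f0 * exp (- \<theta> * (real i * T / real n))) / real n"
        using T by (intro divide_right_mono sum_mono r_diag(3)) auto
      finally show "\<bar>P.en n - f0\<bar> \<le> 3 * f0 * ((\<Sum>i<n. exp (- \<theta> * (real i * T / real n))) / real n)"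
        by (simp add: sum_distrib_left[symmetric])
    qed
  qed
  also have "\<dots> \<le> 3 * f0 * (1 / \<theta> / T)"
    using I T f0_pos by (intro mult_left_mono divide_right_mono) auto
  finally show ?thesis by simp
qed

text \<open>
  The variance is twice the mean of \<open>r\<^sup>2\<close> over the square of times.  At times beyond \<open>T / 2\<close> the covariance \<open>r\<close> is within
  \<open>f0 / 4\<close> of the stationary one, which itself is close to \<open>f0\<close> for small lags; hence a strip of fixed width
  along the diagonal contributes at least a multiple of \<open>1 / T\<close>.  \<open>\<eta>\<close> is a continuous minorant of \<open>r\<^sup>2\<close> on
  that strip as a function of the lag.
\<close>

lemma s2_lower:
  "\<exists>c>0. \<exists>T1\<ge>4. \<forall>T\<ge>T1. gaussian_path.s2 M T X \<ge> c / T"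
proof -
  define \<eta> where "\<eta> u = (max (\<rho> u - f0 / 4) 0)\<^sup>2" for u
  have c\<eta>: "continuous_on S \<eta>" for S
    unfolding \<eta>_def[abs_def] by (intro continuous_intros continuous_on_subset[OF rho_continuous]) auto
  have \<eta>0: "\<eta> u \<ge> 0" for u by (simp add: \<eta>_def)
  define c where "c = integral {0..1} \<eta>"
  have c: "c > 0"
  proof -
    have "c \<ge> 0" unfolding c_def by (intro Henstock_Kurzweil_Integration.integral_nonneg integrable_continuous_real c\<eta> \<eta>0)
    moreover have "c \<noteq> 0"
    proof
      assume "c = 0"
      then have "\<forall>x\<in>{0..1}. \<eta> x = 0"
        using integral_eq_0_iff[OF c\<eta>, of 0 1] \<eta>0 by (simp add: c_def)
      then have "\<eta> 0 = 0" by simp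
      then show False using f0_pos by (simp add: \<eta>_def f0_def[symmetric])
    qed
    ultimately show ?thesis by simp
  qed
  have "((\<lambda>T. exp (- (\<theta> / 2 * T))) \<longlongrightarrow> 0) at_top" using \<theta> by real_asymp
  then have "\<forall>\<^sub>F T in at_top. exp (- (\<theta> / 2 * T)) < 1 / 12" by (rule order_tendstoD(2)) simp
  then obtain T0 where T0: "\<And>T. T \<ge> T0 \<Longrightarrow> exp (- (\<theta> / 2 * T)) < 1 / 12" unfolding eventually_at_top_linorder by blast
  have "gaussian_path.s2 M T X \<ge> (c / 2) / T" if T: "T \<ge> max 4 T0" for T
  proof -
    have Tp: "T > 0" using T by simp
    interpret P: gaussian_path M T X "4 * f0" by (rule gaussian_path[OF Tp])
    \<comment> \<open>Grids with \<open>4 * m\<close> points; only rows \<open>i\<close> in the third quarter and columns \<open>i + k\<close> with \<open>k < m\<close> are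
      kept, so that all times lie between \<open>T / 2\<close> and \<open>T\<close>.\<close>
    have low: "(1 / 16) * ((\<Sum>k<m. \<eta> (real k * (T / 4) / real m)) / real m) \<le> P.sn (4 * m)" if m: "m \<ge> 1" for m
    proof -
      have m0: "real m > 0" using m by simp
      define t where "t i = real i * T / real (4 * m)" for i
      have t0: "t i \<ge> 0" for i using Tp by (simp add: t_def)
      have inner: "(\<Sum>k<m. \<eta> (t k)) \<le> (\<Sum>j<4 * m. (r (t i) (t j))\<^sup>2)" if i: "i \<in> {2 * m..<3 * m}" for i
      proof -
        have "(\<Sum>k<m. \<eta> (t k)) \<le> (\<Sum>k<m. (r (t i) (t (i + k)))\<^sup>2)"
        proof (rule sum_mono)
          fix k
          have d: "t (i + k) - t i = t k" by (simp add: t_def distrib_right add_divide_distrib)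
          have ti: "t i \<ge> T / 2"
          proof -
            have "real (2 * m) * T \<le> real i * T" using i Tp by (intro mult_right_mono) auto
            then show ?thesis using m0 by (simp add: t_def field_simps)
          qed
          have "exp (- \<theta> * t i) \<le> exp (- (\<theta> / 2 * T))" using ti \<theta> by simp
          also have "\<dots> < 1 / 12" using T0[of T] T by simp
          finally have "3 * f0 * exp (- \<theta> * t i) \<le> 3 * f0 * (1 / 12)" using f0_pos by (intro mult_left_mono) auto
          moreover have "\<bar>r (t i) (t (i + k)) - \<rho> (t k)\<bar> \<le> 3 * f0 * exp (- \<theta> * t i)"
            using r_lower[of "t i" "t (i + k)"] t0[of i] t0[of k] d by simp
          ultimately have "\<rho> (t k) - f0 / 4 \<le> r (t i) (t (i + k))" by linarith
          then show "\<eta> (t k) \<le> (r (t i) (t (i + k)))\<^sup>2"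
          proof (cases "\<rho> (t k) - f0 / 4 \<ge> 0")
            case True
            then show ?thesis using \<open>\<rho> (t k) - f0 / 4 \<le> r (t i) (t (i + k))\<close> by (simp add: \<eta>_def power_mono)
          next
            case False then show ?thesis by (simp add: \<eta>_def)
          qed
        qed
        also have "\<dots> = (\<Sum>j\<in>(\<lambda>k. i + k) ` {..<m}. (r (t i) (t j))\<^sup>2)"
          by (subst sum.reindex) (auto simp: inj_on_def)
        also have "\<dots> \<le> (\<Sum>j<4 * m. (r (t i) (t j))\<^sup>2)"
          using i by (intro sum_mono2) auto
        finally show ?thesis .
      qed
      have "real m * (\<Sum>k<m. \<eta> (t k)) = (\<Sum>i\<in>{2 * m..<3 * m}. \<Sum>k<m. \<eta> (t k))" by simp
      also have "\<dots> \<le> (\<Sum>i\<in>{2 * m..<3 * m}. \<Sum>j<4 * m. (r (t i) (t j))\<^sup>2)" using inner by (rule sum_mono)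
      also have "\<dots> \<le> (\<Sum>i<4 * m. \<Sum>j<4 * m. (r (t i) (t j))\<^sup>2)" by (intro sum_mono2 sum_nonneg) auto
      finally have "real m * (\<Sum>k<m. \<eta> (t k)) / (real (4 * m))\<^sup>2 \<le> P.sn (4 * m)"
        unfolding P.sn_eq r_path[OF Tp] t_def[symmetric] by (rule divide_right_mono) simp
      moreover have "t k = real k * (T / 4) / real m" for k by (simp add: t_def)
      ultimately show ?thesis using m0 by (simp add: power2_eq_square)
    qed
    have T4: "T / 4 > 0" using Tp by simp
    have L1: "(\<lambda>m. (1 / 16) * ((\<Sum>k<m. \<eta> (real k * (T / 4) / real m)) / real m)) \<longlonglongrightarrow> (1 / 16) * (integral {0..T / 4} \<eta> / (T / 4))"
      by (intro tendsto_mult tendsto_const riemann_sums_tendsto[OF T4] c\<eta>)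
    have fl: "filterlim (\<lambda>m::nat. 4 * m) at_top sequentially"
      by (rule filterlim_subseq) (auto simp: strict_mono_def)
    have L2: "(\<lambda>m. 2 * P.sn (4 * m)) \<longlonglongrightarrow> P.s2"
      using filterlim_compose[OF P.sn_tendsto fl] .
    have "2 * ((1 / 16) * (integral {0..T / 4} \<eta> / (T / 4))) \<le> P.s2"
      by (intro LIMSEQ_le[OF tendsto_mult[OF tendsto_const L1] L2] exI[of _ 1] allI impI mult_left_mono low) auto
    moreover have "c \<le> integral {0..T / 4} \<eta>"
      unfolding c_def using T \<eta>0 by (intro integral_subset_le integrable_continuous_real c\<eta>) auto
    then have "(c / 2) / T \<le> 2 * ((1 / 16) * (integral {0..T / 4} \<eta> / (T / 4)))"
      using Tp by (simp add: field_simps)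
    ultimately show ?thesis by linarith
  qed
  then show ?thesis using c by (intro exI[of _ "c / 2"] conjI exI[of _ "max 4 T0"]) auto
qed

text \<open>
  A continuous nonnegative function with integral 0 vanishes, but \<open>X T\<close> is a nondegenerate Gaussian
  variable and therefore almost surely nonzero.
\<close>

lemma V_positive:
  assumes T: "T > 0"
  shows "AE \<omega> in M. gaussian_path.V T X \<omega> > 0"
proof -
  interpret P: gaussian_path M T X "4 * f0" by (rule gaussian_path[OF T])
  have g: "centered_gaussian_rv M (X T)" using X_gaussian[of "{T}" "\<lambda>_. 1"] T by simp
  have "\<theta> * T > 0" using T \<theta> by simp
  then have "1 - exp (- \<theta> * T) \<noteq> 0" using T \<theta> by simp
  then have "f0 * (1 - exp (- \<theta> * T))\<^sup>2 > 0" by (intro mult_pos_pos f0_pos) (simp only: zero_less_power2 not_False_eq_True)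
  then have "r T T > 0" using r_diag(1)[of T] T by simp
  then have "expectation (\<lambda>\<omega>. (X T \<omega>)\<^sup>2) > 0" by (simp add: r_def power2_eq_square)
  from gaussian_AE_nonzero[OF g this] AE_space show ?thesis
  proof eventually_elim
    case (elim \<omega>)
    have c: "continuous_on {0..T} (\<lambda>t. (X t \<omega>)\<^sup>2)" by (intro continuous_intros P.paths elim)
    have "P.V \<omega> \<noteq> 0"
    proof
      assume "P.V \<omega> = 0"
      then have "integral {0..T} (\<lambda>t. (X t \<omega>)\<^sup>2) = 0" using T by (simp add: P.V_def)
      then have "\<forall>t\<in>{0..T}. (X t \<omega>)\<^sup>2 = 0"
        using integral_eq_0_iff[OF c] T by simp
      then show False using elim T by auto
    qed
    then show ?case using P.V_nonneg[of \<omega>] by simp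
  qed
qed

end

section \<open>Normal approximation of the estimator\<close>

text \<open>
  A measurable choice of a point between \<open>x\<close> and \<open>f\<close> at which \<open>q\<close> dominates \<open>q x\<close> and, if \<open>x\<close> lies below
  \<open>f\<close>, is maximal on the whole segment.  The largest maximiser depends monotonically on \<open>x\<close>: when the
  segment shrinks from the left, it stays or is overtaken by the left end.  Monotone functions are
  measurable.  For nonpositive \<open>x\<close>, where \<open>q\<close> is not assumed continuous, \<open>x\<close> itself is chosen.
\<close>

lemma monotone_argmax_selection:
  fixes q :: "real \<Rightarrow> real"
  assumes q: "continuous_on {0<..} q" and f: "f > 0"
  obtains s :: "real \<Rightarrow> real" where "s \<in> borel_measurable borel" "\<forall>x. s x \<in> closed_segment x f"
    "\<forall>x u. 0 < x \<longrightarrow> x \<le> u \<longrightarrow> u \<le> f \<longrightarrow> q u \<le> q (s x)" "\<forall>x>0. q x \<le> q (s x)"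
proof -
  define A where "A x = {u \<in> {x..f}. \<forall>v\<in>{x..f}. q v \<le> q u}" for x
  have A: "Sup (A x) \<in> A x \<and> (\<forall>u\<in>A x. u \<le> Sup (A x))" if x: "0 < x" "x \<le> f" for x
  proof -
    have c: "continuous_on {x..f} q" using x by (intro continuous_on_subset[OF q]) auto
    obtain u where u: "u \<in> {x..f}" "\<forall>v\<in>{x..f}. q v \<le> q u"
      using continuous_attains_sup[OF compact_Icc _ c] x by auto
    have "A x = {x..f} \<inter> q -` {q u..}" using u by (auto simp: A_def intro: order_trans)
    then have "closed (A x)" using continuous_closed_preimage[OF c closed_atLeastAtMost closed_atLeast] by simp
    moreover have "A x \<noteq> {}" using u by (auto simp: A_def)
    moreover have bdd: "bdd_above (A x)" by (intro bdd_aboveI[of _ f]) (auto simp: A_def)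
    ultimately show ?thesis using closed_contains_Sup cSup_upper by blast
  qed
  define s where "s x = (if 0 < x \<and> x \<le> f then Sup (A x) else x)" for x
  have sb: "x \<le> s x \<and> s x \<le> f" if "0 < x" "x \<le> f" for x
    using A[OF that] that by (auto simp: s_def A_def)
  have s_in: "s x \<in> A x" if "0 < x" "x \<le> f" for x using A[OF that] that by (simp add: s_def)
  have "mono s"
  proof (rule monoI)
    fix x y :: real assume xy: "x \<le> y"
    consider "x \<le> 0" | "0 < x" "y \<le> f" | "0 < x" "x \<le> f" "f < y" | "f < x" by linarith
    then show "s x \<le> s y"
    proof cases
      case 1
      then have "s x = x" by (simp add: s_def)
      moreover have "y \<le> s y" using sb[of y] by (cases "0 < y \<and> y \<le> f") (auto simp: s_def)
      ultimately show ?thesis using xy by simp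
    next
      case 2
      show ?thesis
      proof (cases "s x \<ge> y")
        case True
        then have "s x \<in> A y" using s_in[of x] 2 xy by (auto simp: A_def)
        then show ?thesis using A[of y] 2 xy by (simp add: s_def)
      next
        case False then show ?thesis using sb[of y] 2 xy by simp
      qed
    next
      case 3 then show ?thesis using sb[of x] f by (simp add: s_def)
    next
      case 4 then show ?thesis using xy by (simp add: s_def)
    qed
  qed
  then have m: "s \<in> borel_measurable borel" by (rule borel_measurable_mono)
  have seg: "s x \<in> closed_segment x f" for x
  proof (cases "0 < x \<and> x \<le> f")
    case True then show ?thesis using sb[of x] by (simp add: closed_segment_eq_real_ivl)
  next
    case False then show ?thesis by (auto simp: s_def)
  qed
  have mx: "q u \<le> q (s x)" if "0 < x" "x \<le> u" "u \<le> f" for x u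
    using s_in[of x] that by (auto simp: A_def)
  have mx': "q x \<le> q (s x)" if "0 < x" for x
    using mx[OF that order_refl] by (cases "x \<le> f") (auto simp: s_def)
  show ?thesis by (rule that) (use m seg mx mx' in blast)+
qed

text \<open>
  Monotonicity of \<open>L\<^sup>p\<close> norms in \<open>p\<close>, including infinite values, from Young's inequality for
  \<open>\<bar>y\<bar> / a\<close> and 1, where \<open>a\<close> is the norm on the right.
\<close>

lemma (in prob_space) nn_integral_abs_le_Lp_norm:
  assumes [measurable]: "Y \<in> borel_measurable M" and p: "p \<ge> 1"
  shows "(\<integral>\<^sup>+\<omega>. ennreal \<bar>Y \<omega>\<bar> \<partial>M) \<le> Lp_norm M p Y"
proof -
  define I where "I = (\<integral>\<^sup>+\<omega>. ennreal (\<bar>Y \<omega>\<bar> powr p) \<partial>M)"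
  consider "I = \<infinity>" | "I = 0" | i where "I = ennreal i" "i > 0"
    by (cases I) (auto simp: less_le)
  then show ?thesis
  proof cases
    case 1 then show ?thesis by (simp add: Lp_norm_def I_def)
  next
    case 2
    then have "AE \<omega> in M. ennreal (\<bar>Y \<omega>\<bar> powr p) = 0"
      unfolding I_def by (subst (asm) nn_integral_0_iff_AE) auto
    then have "AE \<omega> in M. ennreal \<bar>Y \<omega>\<bar> = 0" by eventually_elim auto
    then have "(\<integral>\<^sup>+\<omega>. ennreal \<bar>Y \<omega>\<bar> \<partial>M) = 0" by (subst nn_integral_0_iff_AE) auto
    then show ?thesis by simp
  next
    case (3 i)
    define a where "a = i powr (1 / p)"
    have a: "a > 0" using 3 by (simp add: a_def)
    have ap: "a powr p = i" using 3 p by (simp add: a_def powr_powr)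
    have young: "\<bar>y\<bar> \<le> (a / (p * i)) * (\<bar>y\<bar> powr p) + a * (1 - 1 / p)" for y :: real
    proof (cases "y = 0")
      case True
      have "0 \<le> a * (1 - 1 / p)" using a p by simp
      then show ?thesis using True by simp
    next
      case False
      define t where "t = \<bar>y\<bar> / a"
      have t: "t > 0" using a False by (simp add: t_def)
      have "(t powr p) powr (1 / p) * 1 powr (1 - 1 / p) \<le> 1 / p * t powr p + (1 - 1 / p) * 1"
        using t p by (intro Youngs_inequality_0) auto
      then have "t \<le> t powr p / p + (1 - 1 / p)" using t p by (simp add: powr_powr)
      then have "a * t \<le> a * (t powr p / p + (1 - 1 / p))" using a by (intro mult_left_mono) auto
      moreover have "t powr p = \<bar>y\<bar> powr p / i" using a by (simp add: t_def powr_divide ap)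
      ultimately show ?thesis using a by (simp add: t_def distrib_left mult_ac)
    qed
    have "(\<integral>\<^sup>+\<omega>. ennreal \<bar>Y \<omega>\<bar> \<partial>M) \<le> (\<integral>\<^sup>+\<omega>. ennreal (a / (p * i)) * ennreal (\<bar>Y \<omega>\<bar> powr p) + ennreal (a * (1 - 1 / p)) \<partial>M)"
    proof (rule nn_integral_mono)
      fix \<omega>
      have "ennreal \<bar>Y \<omega>\<bar> \<le> ennreal ((a / (p * i)) * (\<bar>Y \<omega>\<bar> powr p) + a * (1 - 1 / p))"
        by (rule ennreal_leI[OF young])
      also have "\<dots> = ennreal ((a / (p * i)) * (\<bar>Y \<omega>\<bar> powr p)) + ennreal (a * (1 - 1 / p))"
        using a p 3 by (intro ennreal_plus) auto
      also have "ennreal ((a / (p * i)) * (\<bar>Y \<omega>\<bar> powr p)) = ennreal (a / (p * i)) * ennreal (\<bar>Y \<omega>\<bar> powr p)"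
        using a p 3 by (intro ennreal_mult) auto
      finally show "ennreal \<bar>Y \<omega>\<bar> \<le> ennreal (a / (p * i)) * ennreal (\<bar>Y \<omega>\<bar> powr p) + ennreal (a * (1 - 1 / p))" .
    qed
    also have "\<dots> = ennreal (a / (p * i)) * I + ennreal (a * (1 - 1 / p))"
      unfolding I_def by (subst nn_integral_add) (auto simp: nn_integral_cmult emeasure_space_1)
    also have "\<dots> = ennreal (a / (p * i) * i + a * (1 - 1 / p))"
    proof -
      have "ennreal (a / (p * i) * i + a * (1 - 1 / p)) = ennreal (a / (p * i) * i) + ennreal (a * (1 - 1 / p))"
        using a p 3(2) by (intro ennreal_plus) auto
      also have "ennreal (a / (p * i) * i) = ennreal (a / (p * i)) * ennreal i"
        using a p 3(2) by (intro ennreal_mult) auto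
      finally show ?thesis unfolding 3(1) by simp
    qed
    also have "a / (p * i) * i + a * (1 - 1 / p) = a" using 3(2) p by (simp add: field_simps)
    also have "ennreal a = Lp_norm M p Y"
      using 3 unfolding Lp_norm_def I_def[symmetric] by (simp add: a_def)
    finally show ?thesis .
  qed
qed

lemma wasserstein_dist_normal_le:
  assumes P: "prob_space P" and N: "distributed P lborel N (\<lambda>x. ennreal (std_normal_density x))"
    and B: "\<And>h. (\<And>x y. \<bar>h x - h y\<bar> \<le> \<bar>x - y\<bar>) \<Longrightarrow>
      \<bar>prob_space.expectation M (\<lambda>\<omega>. h (U \<omega>)) - normal_mean h\<bar> \<le> (B :: real)"
  shows "wasserstein_dist M U P N \<le> ennreal B"
  unfolding wasserstein_dist_def
proof (rule SUP_least)
  fix h :: "real \<Rightarrow> real" assume "h \<in> {h. 1-lipschitz_on UNIV h}"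
  then have l: "1-lipschitz_on UNIV h" by simp
  have lip: "\<bar>h x - h y\<bar> \<le> \<bar>x - y\<bar>" for x y using lipschitz_onD[OF l, of x y] by (simp add: dist_real_def)
  have [measurable]: "h \<in> borel_measurable borel"
    using lipschitz_on_continuous_on[OF l] by (rule borel_measurable_continuous_onI)
  have "normal_mean h = prob_space.expectation P (\<lambda>\<omega>. h (N \<omega>))"
    by (rule distributed_integral[OF N]) auto
  then show "ennreal \<bar>prob_space.expectation M (\<lambda>\<omega>. h (U \<omega>)) - prob_space.expectation P (\<lambda>\<omega>. h (N \<omega>))\<bar> \<le> ennreal B"
    using B[OF lip] by (intro ennreal_leI) simp
qed

context prob_space
begin

lemma lipschitz_normal_distance_le:
  fixes h :: "real \<Rightarrow> real"
  assumes lip: "\<And>x y. \<bar>h x - h y\<bar> \<le> \<bar>x - y\<bar>" and U: "integrable M U"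
  shows "\<bar>expectation (\<lambda>\<omega>. h (U \<omega>)) - normal_mean h\<bar> \<le> 1 + expectation (\<lambda>\<omega>. \<bar>U \<omega>\<bar>)"
proof -
  define c where "c = normal_mean h"
  note hU = lipschitz_comp_integrable[OF lip U]
  have "\<bar>expectation (\<lambda>\<omega>. h (U \<omega>)) - c\<bar> = \<bar>expectation (\<lambda>\<omega>. h (U \<omega>) - c)\<bar>"
    using hU by (simp add: prob_space)
  also have "\<dots> \<le> expectation (\<lambda>\<omega>. \<bar>h (U \<omega>) - c\<bar>)" by (rule integral_abs_bound)
  also have "\<dots> \<le> expectation (\<lambda>\<omega>. 1 + \<bar>U \<omega>\<bar>)"
    unfolding c_def by (rule integral_mono) (use hU U lipschitz_std_normal_mean[OF hU(2) lip] in auto)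
  also have "\<dots> = 1 + expectation (\<lambda>\<omega>. \<bar>U \<omega>\<bar>)" using U by (simp add: prob_space)
  finally show ?thesis by (simp add: c_def)
qed

lemma lipschitz_perturbation:
  fixes h :: "real \<Rightarrow> real"
  assumes lip: "\<And>x y. \<bar>h x - h y\<bar> \<le> \<bar>x - y\<bar>" and U: "integrable M U" and F: "integrable M F"
  shows "\<bar>expectation (\<lambda>\<omega>. h (U \<omega>)) - expectation (\<lambda>\<omega>. h (F \<omega>))\<bar> \<le> expectation (\<lambda>\<omega>. \<bar>U \<omega> - F \<omega>\<bar>)"
proof -
  note h = lipschitz_comp_integrable(1)[OF lip U] lipschitz_comp_integrable(1)[OF lip F]
  have "\<bar>expectation (\<lambda>\<omega>. h (U \<omega>)) - expectation (\<lambda>\<omega>. h (F \<omega>))\<bar> = \<bar>expectation (\<lambda>\<omega>. h (U \<omega>) - h (F \<omega>))\<bar>"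
    using h by simp
  also have "\<dots> \<le> expectation (\<lambda>\<omega>. \<bar>h (U \<omega>) - h (F \<omega>)\<bar>)" by (rule integral_abs_bound)
  also have "\<dots> \<le> expectation (\<lambda>\<omega>. \<bar>U \<omega> - F \<omega>\<bar>)"
    by (rule integral_mono) (use h U F lip in auto)
  finally show ?thesis .
qed

lemma mean_absolute_deviation_le:
  fixes Y :: "'a \<Rightarrow> real"
  assumes Y: "integrable M Y"
  shows "expectation (\<lambda>\<omega>. \<bar>Y \<omega> - expectation Y\<bar>) \<le> 2 * expectation (\<lambda>\<omega>. \<bar>Y \<omega> - c\<bar>)"
proof -
  have "\<bar>expectation Y - c\<bar> = \<bar>expectation (\<lambda>\<omega>. Y \<omega> - c)\<bar>" using Y by (simp add: prob_space)
  also have "\<dots> \<le> expectation (\<lambda>\<omega>. \<bar>Y \<omega> - c\<bar>)" by (rule integral_abs_bound)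
  finally have m: "\<bar>expectation Y - c\<bar> \<le> expectation (\<lambda>\<omega>. \<bar>Y \<omega> - c\<bar>)" .
  have "expectation (\<lambda>\<omega>. \<bar>Y \<omega> - expectation Y\<bar>) \<le> expectation (\<lambda>\<omega>. \<bar>Y \<omega> - c\<bar> + \<bar>expectation Y - c\<bar>)"
    by (rule integral_mono) (use Y in auto)
  also have "\<dots> = expectation (\<lambda>\<omega>. \<bar>Y \<omega> - c\<bar>) + \<bar>expectation Y - c\<bar>" using Y by (simp add: prob_space)
  finally show ?thesis using m by simp
qed

end

text \<open>
  The estimating function \<open>g\<close> with its first two derivatives, and the nonvanishing of the derivative at the
  limit that permits the normalisation.
\<close>

locale smooth_estimator = gaussian_OU_setting +
  fixes g g' g'' :: "real \<Rightarrow> real"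
  assumes g': "\<And>x. x > 0 \<Longrightarrow> (g has_real_derivative g' x) (at x)"
    and g'': "\<And>x. x > 0 \<Longrightarrow> (g' has_real_derivative g'' x) (at x)"
    and cont_g'': "continuous_on {0<..} g''"
    and g'_f0: "g' f0 \<noteq> 0"
begin

abbreviation "V \<equiv> \<lambda>T. gaussian_path.V T X"
abbreviation "e \<equiv> \<lambda>T. gaussian_path.e M T X"
abbreviation "s2 \<equiv> \<lambda>T. gaussian_path.s2 M T X"

text \<open>
  The variable \<open>W\<close> stands for \<open>\<bar>g''\<bar>\<close> at the random intermediate point.  Above \<open>f0\<close> it only has to dominate
  \<open>\<bar>g''\<bar>\<close> at \<open>V\<close> itself; below \<open>f0\<close> it has to do so on the whole segment, which is needed for short times.
\<close>

definition dominates :: "real \<Rightarrow> ('a \<Rightarrow> real) \<Rightarrow> bool" where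
  "dominates T W \<longleftrightarrow> integrable M W \<and> (\<forall>\<omega>. W \<omega> \<ge> 0) \<and>
    (\<forall>\<omega>\<in>space M. V T \<omega> > 0 \<longrightarrow> \<bar>g'' (V T \<omega>)\<bar> \<le> W \<omega> \<and> (\<forall>u. V T \<omega> \<le> u \<longrightarrow> u \<le> f0 \<longrightarrow> \<bar>g'' u\<bar> \<le> W \<omega>))"

text \<open>
  The normalised estimator.  If the variance is 0, division by 0 gives the value 0.
\<close>

definition U :: "real \<Rightarrow> 'a \<Rightarrow> real" where
  "U T \<omega> = (g (V T \<omega>) - expectation (\<lambda>\<omega>. g (V T \<omega>))) / (g' f0 * sqrt (s2 T))"

lemma poincare_V:
  assumes T: "T > 0" and s: "s2 T > 0"
  shows "poincare_variable M (V T) (e T) (sqrt (s2 T))"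
proof -
  interpret P: gaussian_path M T X "4 * f0" by (rule gaussian_path[OF T])
  show ?thesis
  proof unfold_locales
    show "V T \<in> borel_measurable M" "integrable M (V T)" "integrable M (\<lambda>\<omega>. (V T \<omega>)\<^sup>2)"
      "V T \<omega> \<ge> 0" "AE \<omega> in M. V T \<omega> > 0" "e T = expectation (V T)" "sqrt (s2 T) > 0" "(sqrt (s2 T))\<^sup>2 = variance (V T)" for \<omega>
      using P.V_measurable P.V_integrable P.V2_integrable P.V_nonneg V_positive[OF T] P.e_def s P.s2_def by auto
    fix \<psi> \<psi>' :: "real \<Rightarrow> real" and K
    assume d: "\<And>x. (\<psi> has_real_derivative \<psi>' x) (at x)" "continuous_on UNIV \<psi>'" "\<forall>x\<ge>0. \<bar>\<psi>' x\<bar> \<le> K"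
    note p = P.V_poincare[OF d]
    have "sqrt 2 * sqrt (s2 T) * expectation (\<lambda>\<omega>. V T \<omega> * \<bar>\<psi>' (V T \<omega>)\<bar>) \<le> 2 * sqrt (s2 T) * expectation (\<lambda>\<omega>. V T \<omega> * \<bar>\<psi>' (V T \<omega>)\<bar>)"
    proof (intro mult_right_mono)
      show "sqrt 2 \<le> 2" using real_sqrt_le_mono[of 2 4] by simp
      show "0 \<le> expectation (\<lambda>\<omega>. V T \<omega> * \<bar>\<psi>' (V T \<omega>)\<bar>)"
        by (intro Bochner_Integration.integral_nonneg mult_nonneg_nonneg P.V_nonneg) auto
    qed (use s in auto)
    then show "integrable M (\<lambda>\<omega>. (V T \<omega> - e T) * \<psi> (V T \<omega>)) \<and> integrable M (\<lambda>\<omega>. V T \<omega> * \<bar>\<psi>' (V T \<omega>)\<bar>) \<and>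
      \<bar>expectation (\<lambda>\<omega>. (V T \<omega> - e T) * \<psi> (V T \<omega>))\<bar> \<le> 2 * sqrt (s2 T) * expectation (\<lambda>\<omega>. V T \<omega> * \<bar>\<psi>' (V T \<omega>)\<bar>)"
      using p by linarith
  qed
qed

lemma cont_g: "continuous_on {0<..} g" and cont_g': "continuous_on {0<..} g'"
proof -
  show "continuous_on {0<..} g"
    by (rule DERIV_continuous_on[of _ _ g']) (rule DERIV_subset[OF g'], simp_all)
  show "continuous_on {0<..} g'"
    by (rule DERIV_continuous_on[of _ _ g'']) (rule DERIV_subset[OF g''], simp_all)
qed

lemma gV_measurable: "T > 0 \<Longrightarrow> (\<lambda>\<omega>. g (V T \<omega>)) \<in> borel_measurable M"
proof -
  assume T: "T > 0"
  interpret P: gaussian_path M T X "4 * f0" by (rule gaussian_path[OF T])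
  have "(\<lambda>x. if x \<in> {0<..} then g x else g 0) \<in> borel_measurable borel"
    by (intro borel_measurable_continuous_on_if cont_g continuous_on_const) simp
  from measurable_compose[OF P.V_measurable this]
  have "(\<lambda>\<omega>. if V T \<omega> \<in> {0<..} then g (V T \<omega>) else g 0) \<in> borel_measurable M" .
  moreover have "(if V T \<omega> \<in> {0<..} then g (V T \<omega>) else g 0) = g (V T \<omega>)" for \<omega>
    using P.V_nonneg[of \<omega>] by (cases "V T \<omega> = 0") auto
  ultimately show ?thesis by simp
qed

lemma bounds_near_limit:
  obtains b K K' where "b = 1 + 100 * f0" "\<forall>x. f0 / 2 \<le> x \<longrightarrow> x \<le> b \<longrightarrow> \<bar>g'' x\<bar> \<le> K" "\<forall>x. f0 \<le> x \<longrightarrow> x \<le> b \<longrightarrow> \<bar>g' x\<bar> \<le> K'" "K \<ge> 0" "K' \<ge> 0"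
proof -
  \<comment> \<open>right end of a compact interval that serves for all \<open>T\<close>: as \<open>e T \<le> 4 * f0\<close> and the deviation is at most
    \<open>6 * f0\<close>, it exceeds 1, \<open>2 * e T\<close>, 16 deviations, and \<open>e T\<close> plus two deviations\<close>
  define b where "b = 1 + 100 * f0"
  have bounded: "\<exists>K. \<forall>x\<in>{u..b}. \<bar>k x\<bar> \<le> K" if k: "continuous_on {0<..} k" and u: "u > 0" for k :: "real \<Rightarrow> real" and u
  proof -
    have "compact (k ` {u..b})"
      by (intro compact_continuous_image compact_Icc continuous_on_subset[OF k]) (use u in auto)
    from compact_imp_bounded[OF this] show ?thesis unfolding bounded_iff by simp
  qed
  obtain K where K: "\<forall>x\<in>{f0 / 2..b}. \<bar>g'' x\<bar> \<le> K" using bounded[OF cont_g'', of "f0 / 2"] f0_pos by auto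
  obtain K' where K': "\<forall>x\<in>{f0..b}. \<bar>g' x\<bar> \<le> K'" using bounded[OF cont_g', of f0] f0_pos by auto
  have "f0 \<in> {f0 / 2..b}" "f0 \<in> {f0..b}" using f0_pos by (auto simp: b_def)
  then have "K \<ge> 0" "K' \<ge> 0" using K K' by (meson abs_ge_zero order_trans)+
  with K K' show ?thesis by (intro that[of b K K', OF b_def]) auto
qed

lemma parameter_bounds:
  assumes T: "T > 0"
  shows "0 \<le> e T" "e T \<le> 4 * f0" "0 \<le> sqrt (s2 T)" "sqrt (s2 T) \<le> 6 * f0"
proof -
  interpret P: gaussian_path M T X "4 * f0" by (rule gaussian_path[OF T])
  show "0 \<le> e T" "e T \<le> 4 * f0" by (rule P.e_le)+
  show "0 \<le> sqrt (s2 T)" using P.s2_nonneg by simp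
  have "s2 T \<le> (6 * f0)\<^sup>2" using s2_bounded[OF T] by (simp add: power_mult_distrib) (smt (verit) zero_le_power2)
  then show "sqrt (s2 T) \<le> 6 * f0" using f0_pos by (intro real_le_lsqrt) auto
qed

text \<open>
  The deviation of \<open>g V\<close> from a constant is of the order of the standard deviation of \<open>V\<close>, uniformly in
  \<open>T\<close>.  This gives integrability and the bound for short times.
\<close>

lemma image_deviation:
  obtains A where "A \<ge> 0" "\<forall>T W. T > 0 \<longrightarrow> s2 T > 0 \<longrightarrow> dominates T W \<longrightarrow> integrable M (\<lambda>\<omega>. g (V T \<omega>)) \<and>
    expectation (\<lambda>\<omega>. \<bar>g (V T \<omega>) - g (e T + 2 * sqrt (s2 T))\<bar>) \<le> A * (1 + expectation W) * sqrt (s2 T)"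
proof -
  obtain b K K' where b: "b = 1 + 100 * f0" and K: "\<forall>x. f0 / 2 \<le> x \<longrightarrow> x \<le> b \<longrightarrow> \<bar>g'' x\<bar> \<le> K"
    and K': "\<forall>x. f0 \<le> x \<longrightarrow> x \<le> b \<longrightarrow> \<bar>g' x\<bar> \<le> K'" and K0: "K \<ge> 0" "K' \<ge> 0" by (rule bounds_near_limit)
  define A where "A = 3 * K' + 33 * f0 * K + 1576 * f0"
  have A: "A \<ge> 0" using K0 f0_pos by (simp add: A_def)
  show ?thesis
  proof (rule that[OF A], intro allI impI)
    fix T W assume T: "T > 0" and s: "s2 T > 0" and W: "dominates T W"
    interpret Q: poincare_variable M "V T" "e T" "sqrt (s2 T)" by (rule poincare_V[OF T s])
    define \<sigma> where "\<sigma> = sqrt (s2 T)"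
    define w where "w = expectation W"
    note pb = parameter_bounds[OF T]
    have w: "w \<ge> 0" using W unfolding w_def dominates_def by (intro Bochner_Integration.integral_nonneg) auto
    have *: "integrable M (\<lambda>\<omega>. \<bar>g (V T \<omega>) - g (e T + 2 * sqrt (s2 T))\<bar>)"
      "expectation (\<lambda>\<omega>. \<bar>g (V T \<omega>) - g (e T + 2 * sqrt (s2 T))\<bar>) \<le>
      3 * \<sigma> * (K' + f0 * (K + 2 * w)) + 5 * \<sigma>\<^sup>2 * (K + w) + 4 * \<sigma> * f0 * w + 256 * \<sigma>\<^sup>2 * w"
      unfolding \<sigma>_def w_def
      by (rule Q.lipschitz_image_bound[OF g' g'' cont_g'' gV_measurable[OF T] f0_pos, where b = b and K = K and K' = K' and W = W];
          use W pb b f0_pos K K' in \<open>auto simp: dominates_def\<close>)+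
    have i: "integrable M (\<lambda>\<omega>. g (V T \<omega>))"
    proof -
      have m: "(\<lambda>\<omega>. g (V T \<omega>) - g (e T + 2 * sqrt (s2 T))) \<in> borel_measurable M"
        using gV_measurable[OF T] by measurable
      have "integrable M (\<lambda>\<omega>. g (V T \<omega>) - g (e T + 2 * sqrt (s2 T)))"
        using *(1) integrable_abs_iff[OF m] by simp
      then have "integrable M (\<lambda>\<omega>. (g (V T \<omega>) - g (e T + 2 * sqrt (s2 T))) + g (e T + 2 * sqrt (s2 T)))"
        by (intro Bochner_Integration.integrable_add) auto
      then show ?thesis by simp
    qed
    have \<sigma>: "\<sigma> \<ge> 0" "\<sigma> \<le> 6 * f0" using pb by (auto simp: \<sigma>_def)
    have sq: "\<sigma>\<^sup>2 * x \<le> \<sigma> * (6 * f0) * x" if "x \<ge> 0" for x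
      unfolding power2_eq_square using \<sigma> that by (intro mult_right_mono mult_left_mono) auto
    have "3 * \<sigma> * (K' + f0 * (K + 2 * w)) + 5 * \<sigma>\<^sup>2 * (K + w) + 4 * \<sigma> * f0 * w + 256 * \<sigma>\<^sup>2 * w
      \<le> 3 * \<sigma> * (K' + f0 * (K + 2 * w)) + 5 * (\<sigma> * (6 * f0) * (K + w)) + 4 * \<sigma> * f0 * w + 256 * (\<sigma> * (6 * f0) * w)"
    proof -
      have "5 * (\<sigma>\<^sup>2 * (K + w)) \<le> 5 * (\<sigma> * (6 * f0) * (K + w))" "256 * (\<sigma>\<^sup>2 * w) \<le> 256 * (\<sigma> * (6 * f0) * w)"
        using K0 w by (intro mult_left_mono sq; simp)+
      then show ?thesis unfolding mult.assoc by (intro add_mono order_refl)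
    qed
    also have "\<dots> = \<sigma> * (3 * K' + 33 * f0 * K + 1576 * f0 * w)" by (simp add: algebra_simps)
    also have "\<dots> \<le> \<sigma> * (A * (1 + w))"
    proof (intro mult_left_mono \<sigma>)
      have "0 \<le> 1576 * f0 + (3 * K' + 33 * f0 * K) * w" using K0 w f0_pos by simp
      then show "3 * K' + 33 * f0 * K + 1576 * f0 * w \<le> A * (1 + w)" by (simp add: A_def algebra_simps)
    qed
    finally show "integrable M (\<lambda>\<omega>. g (V T \<omega>)) \<and>
      expectation (\<lambda>\<omega>. \<bar>g (V T \<omega>) - g (e T + 2 * sqrt (s2 T))\<bar>) \<le> A * (1 + expectation W) * sqrt (s2 T)"
      using i *(2) by (simp add: \<sigma>_def w_def mult_ac)
  qed
qed

lemma gV_integrable: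
  assumes "T > 0" "s2 T > 0" "dominates T W"
  shows "integrable M (\<lambda>\<omega>. g (V T \<omega>))"
proof -
  obtain A where "\<forall>T W. T > 0 \<longrightarrow> s2 T > 0 \<longrightarrow> dominates T W \<longrightarrow> integrable M (\<lambda>\<omega>. g (V T \<omega>)) \<and>
    expectation (\<lambda>\<omega>. \<bar>g (V T \<omega>) - g (e T + 2 * sqrt (s2 T))\<bar>) \<le> A * (1 + expectation W) * sqrt (s2 T)"
    by (rule image_deviation)
  then show ?thesis using assms by blast
qed

text \<open>
  The Wasserstein distance to the normal law is at most 1 plus the first absolute moment of \<open>U\<close>, and
  the standard deviation cancels in that moment.
\<close>

lemma short_time_bound:
  obtains A where "A \<ge> 0" "\<forall>T W h. T > 0 \<longrightarrow> dominates T W \<longrightarrow> (\<forall>x y. \<bar>h x - h y\<bar> \<le> \<bar>x - y\<bar>) \<longrightarrow>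
    \<bar>expectation (\<lambda>\<omega>. h (U T \<omega>)) - normal_mean h\<bar> \<le> A * (1 + expectation W)"
proof -
  obtain A where A: "A \<ge> 0" and dev: "\<forall>T W. T > 0 \<longrightarrow> s2 T > 0 \<longrightarrow> dominates T W \<longrightarrow> integrable M (\<lambda>\<omega>. g (V T \<omega>)) \<and>
    expectation (\<lambda>\<omega>. \<bar>g (V T \<omega>) - g (e T + 2 * sqrt (s2 T))\<bar>) \<le> A * (1 + expectation W) * sqrt (s2 T)"
    by (rule image_deviation)
  define a where "a = \<bar>g' f0\<bar>"
  have a: "a > 0" using g'_f0 by (simp add: a_def)
  have A': "1 + 2 * A / a \<ge> 0" using A a by simp
  show ?thesis
  proof (rule that[OF A'], intro allI impI)
    fix T W and h :: "real \<Rightarrow> real" assume T: "T > 0" and W: "dominates T W" and lip: "\<forall>x y. \<bar>h x - h y\<bar> \<le> \<bar>x - y\<bar>"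
    interpret P: gaussian_path M T X "4 * f0" by (rule gaussian_path[OF T])
    have w: "expectation W \<ge> 0" using W unfolding dominates_def by (intro Bochner_Integration.integral_nonneg) auto
    have "integrable M (U T) \<and> expectation (\<lambda>\<omega>. \<bar>U T \<omega>\<bar>) \<le> 2 * A / a * (1 + expectation W)"
    proof (cases "s2 T = 0")
      case True
      then have "U T = (\<lambda>_. 0)" by (simp add: U_def fun_eq_iff)
      then show ?thesis using A a w by simp
    next
      case False
      then have s: "s2 T > 0" using P.s2_nonneg by simp
      define \<sigma> where "\<sigma> = sqrt (s2 T)"
      have \<sigma>: "\<sigma> > 0" using s by (simp add: \<sigma>_def)
      have i: "integrable M (\<lambda>\<omega>. g (V T \<omega>))"
        and d: "expectation (\<lambda>\<omega>. \<bar>g (V T \<omega>) - g (e T + 2 * sqrt (s2 T))\<bar>) \<le> A * (1 + expectation W) * \<sigma>"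
        using dev T s W unfolding \<sigma>_def by blast+
      have "expectation (\<lambda>\<omega>. \<bar>U T \<omega>\<bar>) = expectation (\<lambda>\<omega>. \<bar>g (V T \<omega>) - expectation (\<lambda>\<omega>. g (V T \<omega>))\<bar>) / (a * \<sigma>)"
        using \<sigma> by (simp add: U_def abs_divide abs_mult a_def \<sigma>_def)
      also have "\<dots> \<le> (2 * (A * (1 + expectation W) * \<sigma>)) / (a * \<sigma>)"
        using mean_absolute_deviation_le[OF i, of "g (e T + 2 * sqrt (s2 T))"] d a \<sigma> by (intro divide_right_mono) auto
      also have "\<dots> = 2 * A / a * (1 + expectation W)" using \<sigma> by simp
      finally show ?thesis using i by (simp add: U_def[abs_def])
    qed
    then have "\<bar>expectation (\<lambda>\<omega>. h (U T \<omega>)) - normal_mean h\<bar> \<le> 1 + 2 * A / a * (1 + expectation W)"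
      using lipschitz_normal_distance_le[of h "U T"] lip by fastforce
    also have "\<dots> \<le> (1 + 2 * A / a) * (1 + expectation W)" using w by (simp add: distrib_right)
    finally show "\<bar>expectation (\<lambda>\<omega>. h (U T \<omega>)) - normal_mean h\<bar> \<le> (1 + 2 * A / a) * (1 + expectation W)" .
  qed
qed

lemma taylor_remainder_bound:
  obtains A T2 where "A \<ge> 0" "T2 \<ge> 1" "\<forall>T W. T \<ge> T2 \<longrightarrow> s2 T > 0 \<longrightarrow> dominates T W \<longrightarrow>
    integrable M (\<lambda>\<omega>. g (V T \<omega>) - g f0 - g' f0 * (V T \<omega> - f0)) \<and>
    expectation (\<lambda>\<omega>. \<bar>g (V T \<omega>) - g f0 - g' f0 * (V T \<omega> - f0)\<bar>) \<le> A * (1 + expectation W) / T"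
proof -
  obtain b K K' where b: "b = 1 + 100 * f0" and K: "\<forall>x. f0 / 2 \<le> x \<longrightarrow> x \<le> b \<longrightarrow> \<bar>g'' x\<bar> \<le> K"
    and K': "\<forall>x. f0 \<le> x \<longrightarrow> x \<le> b \<longrightarrow> \<bar>g' x\<bar> \<le> K'" and K0: "K \<ge> 0" "K' \<ge> 0" by (rule bounds_near_limit)
  define S where "S = 54 * R2 + 36 * f0\<^sup>2 / \<theta>"
  define S' where "S' = 9 * f0\<^sup>2 / \<theta>\<^sup>2"
  define A where "A = K / 2 * (S + S') + 272 * S"
  have R2: "R2 \<ge> 0" unfolding R2_def by simp
  have S: "S \<ge> 0" "S' \<ge> 0" using R2 \<theta> f0_pos by (auto simp: S_def S'_def)
  have A: "A \<ge> 0" using S K0 by (simp add: A_def)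
  \<comment> \<open>from \<open>12 / \<theta>\<close> onwards the bias of the mean is at most \<open>f0 / 4\<close>\<close>
  define T2 where "T2 = max 1 (12 / \<theta>)"
  have T2: "T2 \<ge> 1" "T2 \<ge> 12 / \<theta>" by (auto simp: T2_def)
  show ?thesis
  proof (rule that[OF A T2(1)], intro allI impI)
    fix T W assume T2T: "T \<ge> T2" and s: "s2 T > 0" and W: "dominates T W"
    have T: "T > 0" "T \<ge> 1" using T2T T2 by auto
    interpret P: gaussian_path M T X "4 * f0" by (rule gaussian_path[OF T(1)])
    interpret Q: poincare_variable M "V T" "e T" "sqrt (s2 T)" by (rule poincare_V[OF T(1) s])
    note pb = parameter_bounds[OF T(1)]
    define w where "w = expectation W"
    have w: "w \<ge> 0" using W unfolding w_def dominates_def by (intro Bochner_Integration.integral_nonneg) auto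
    have "12 \<le> \<theta> * T" using order_trans[OF T2(2) T2T] \<theta> by (simp add: divide_le_eq mult.commute)
    then have "3 * f0 / (\<theta> * T) \<le> 3 * f0 / 12" using f0_pos by (intro divide_left_mono) auto
    then have "\<bar>e T - f0\<bar> \<le> f0 / 4" using mean_close[OF T(1)] by simp
    then have e34: "e T \<ge> 3 / 4 * f0" by linarith
    define R where "R \<omega> = g (V T \<omega>) - g f0 - g' f0 * (V T \<omega> - f0)" for \<omega>
    have *: "integrable M (\<lambda>\<omega>. \<bar>R \<omega>\<bar>)" "expectation (\<lambda>\<omega>. \<bar>R \<omega>\<bar>) \<le> K / 2 * ((sqrt (s2 T))\<^sup>2 + (e T - f0)\<^sup>2) + 272 * (sqrt (s2 T))\<^sup>2 * w"
      unfolding R_def w_def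
      by (rule Q.delta_remainder_bound[OF g' g'' cont_g'' gV_measurable[OF T(1)] f0_pos e34, where b = b and K = K and W = W];
          use W pb b f0_pos K in \<open>auto simp: dominates_def\<close>)+
    have m: "R \<in> borel_measurable M" unfolding R_def using gV_measurable[OF T(1)] P.V_measurable by measurable
    have R: "integrable M R" using *(1) integrable_abs_iff[OF m] by simp
    have s2: "(sqrt (s2 T))\<^sup>2 \<le> S / T" using s2_upper[OF T(1)] s by (simp add: S_def)
    have "(e T - f0)\<^sup>2 \<le> (3 * f0 / (\<theta> * T))\<^sup>2" using power_mono[OF mean_close[OF T(1)], of 2] by simp
    also have "\<dots> = S' / T / T" by (simp add: S'_def power_mult_distrib power_divide power2_eq_square)
    also have "\<dots> \<le> S' / T" using T S mult_left_mono[of 1 T S'] by (simp add: divide_le_eq)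
    finally have ef: "(e T - f0)\<^sup>2 \<le> S' / T" .
    have "expectation (\<lambda>\<omega>. \<bar>R \<omega>\<bar>) \<le> K / 2 * (S / T + S' / T) + 272 * (S / T) * w"
      using *(2) by (rule order_trans) (intro add_mono mult_left_mono mult_right_mono s2 ef; use K0 w in simp)
    also have "\<dots> = (K / 2 * (S + S') + 272 * S * w) / T" by (simp add: add_divide_distrib algebra_simps)
    also have "\<dots> \<le> A * (1 + w) / T"
    proof (intro divide_right_mono)
      have "0 \<le> 272 * S + K / 2 * (S + S') * w" using S K0 w by simp
      moreover have "A * (1 + w) = K / 2 * (S + S') + 272 * S * w + (272 * S + K / 2 * (S + S') * w)"
        unfolding A_def by (simp add: algebra_simps add_divide_distrib)
      ultimately show "K / 2 * (S + S') + 272 * S * w \<le> A * (1 + w)" by linarith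
    qed (use T in simp)
    finally show "integrable M (\<lambda>\<omega>. g (V T \<omega>) - g f0 - g' f0 * (V T \<omega> - f0)) \<and>
      expectation (\<lambda>\<omega>. \<bar>g (V T \<omega>) - g f0 - g' f0 * (V T \<omega> - f0)\<bar>) \<le> A * (1 + expectation W) / T"
      using R unfolding R_def w_def by simp
  qed
qed

text \<open>
  The delta method: up to a centred remainder, \<open>U\<close> equals the normalised time average \<open>F\<close>.  The remainder is of
  order \<open>1 / T\<close> and the standard deviation at least of order \<open>1 / sqrt T\<close>, so their quotient is of order
  \<open>1 / sqrt T\<close>.
\<close>

lemma long_time_bound:
  obtains A T2 where "A \<ge> 0" "T2 \<ge> 1" "\<forall>T W h. T \<ge> T2 \<longrightarrow> dominates T W \<longrightarrow> (\<forall>x y. \<bar>h x - h y\<bar> \<le> \<bar>x - y\<bar>) \<longrightarrow>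
    \<bar>expectation (\<lambda>\<omega>. h (U T \<omega>)) - normal_mean h\<bar> \<le> A * (1 + expectation W + (J T)\<^sup>2) / sqrt T"
proof -
  obtain A T0 where A: "A \<ge> 0" "T0 \<ge> 1" and rem: "\<forall>T W. T \<ge> T0 \<longrightarrow> s2 T > 0 \<longrightarrow> dominates T W \<longrightarrow>
    integrable M (\<lambda>\<omega>. g (V T \<omega>) - g f0 - g' f0 * (V T \<omega> - f0)) \<and>
    expectation (\<lambda>\<omega>. \<bar>g (V T \<omega>) - g f0 - g' f0 * (V T \<omega> - f0)\<bar>) \<le> A * (1 + expectation W) / T"
    by (rule taylor_remainder_bound)
  obtain c T1 where c: "c > 0" and T1: "T1 \<ge> 4" and low: "\<forall>T\<ge>T1. s2 T \<ge> c / T" using s2_lower by blast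
  define T2 where "T2 = max T0 T1"
  define a where "a = \<bar>g' f0\<bar>"
  have a: "a > 0" using g'_f0 by (simp add: a_def)
  define D where "D = (2 * f0) powr (3/2) / (3/2 * \<theta>)"
  define A3 where "A3 = 2 * A / (a * sqrt c)"
  define A4 where "A4 = 1296 * (18 + 2 * D\<^sup>2) / (sqrt c) ^ 3"
  have A34: "A3 \<ge> 0" "A4 \<ge> 0" using A a c by (auto simp: A3_def A4_def)
  then have A': "A3 + A4 \<ge> 0" by simp
  have T2: "T2 \<ge> 1" using A by (auto simp: T2_def)
  show ?thesis
  proof (rule that[OF A' T2], intro allI impI)
    fix T W and h :: "real \<Rightarrow> real" assume T2T: "T \<ge> T2" and W: "dominates T W" and lip: "\<forall>x y. \<bar>h x - h y\<bar> \<le> \<bar>x - y\<bar>"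
    have T: "T > 0" "T \<ge> T0" "T \<ge> T1" using T2T T2 by (auto simp: T2_def)
    interpret P: gaussian_path M T X "4 * f0" by (rule gaussian_path[OF T(1)])
    have cT: "c / T > 0" using c T by simp
    have sc: "s2 T \<ge> c / T" using low T by blast
    then have s: "s2 T > 0" using cT by linarith
    define \<sigma> where "\<sigma> = sqrt (s2 T)"
    have \<sigma>: "\<sigma> > 0" using s by (simp add: \<sigma>_def)
    have \<sigma>c: "sqrt c / sqrt T \<le> \<sigma>" unfolding \<sigma>_def using real_sqrt_le_mono[OF sc] by (simp add: real_sqrt_divide)
    have sT: "sqrt T > 0" using T by simp
    have sTT: "sqrt T * sqrt T = T" using T by simp
    define w where "w = expectation W"
    have w: "w \<ge> 0" using W unfolding w_def dominates_def by (intro Bochner_Integration.integral_nonneg) auto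
    define R where "R \<omega> = g (V T \<omega>) - g f0 - g' f0 * (V T \<omega> - f0)" for \<omega>
    have R: "integrable M R" "expectation (\<lambda>\<omega>. \<bar>R \<omega>\<bar>) \<le> A * (1 + w) / T"
      using rem T s W unfolding R_def w_def by blast+
    define F where "F \<omega> = (V T \<omega> - e T) / \<sigma>" for \<omega>
    have gV: "g (V T \<omega>) = R \<omega> + (g f0 + g' f0 * (V T \<omega> - f0))" for \<omega> by (simp add: R_def)
    have EgV: "expectation (\<lambda>\<omega>. g (V T \<omega>)) = expectation R + (g f0 + g' f0 * (e T - f0))"
      unfolding gV using R P.V_integrable by (simp add: prob_space P.e_def)
    have UF: "U T \<omega> = F \<omega> + (R \<omega> - expectation R) / (g' f0 * \<sigma>)" for \<omega>
      unfolding U_def EgV unfolding gV using g'_f0 \<sigma> by (simp add: F_def \<sigma>_def[symmetric] field_simps)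
    have iF: "integrable M F" unfolding F_def using P.V_integrable by simp
    have iU: "integrable M (U T)" unfolding UF[abs_def] using iF R by simp
    have "expectation (\<lambda>\<omega>. \<bar>U T \<omega> - F \<omega>\<bar>) = expectation (\<lambda>\<omega>. \<bar>R \<omega> - expectation R\<bar>) / (a * \<sigma>)"
      using \<sigma> by (simp add: UF abs_divide abs_mult a_def)
    also have "\<dots> \<le> 2 * (A * (1 + w) / T) / (a * \<sigma>)"
      using mean_absolute_deviation_le[OF R(1), of 0] R(2) a \<sigma> by (intro divide_right_mono) auto
    also have "\<dots> \<le> 2 * (A * (1 + w) / T) / (a * (sqrt c / sqrt T))"
      using \<sigma>c a c w A T \<sigma> by (intro divide_left_mono mult_left_mono mult_pos_pos) auto
    also have "\<dots> = A3 * (1 + w) * (sqrt T / T)" by (simp add: A3_def mult_ac)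
    also have "sqrt T / T = 1 / sqrt T" using sT sTT by (simp add: field_simps)
    finally have "expectation (\<lambda>\<omega>. \<bar>U T \<omega> - F \<omega>\<bar>) \<le> A3 * (1 + w) / sqrt T" by simp
    then have b1: "\<bar>expectation (\<lambda>\<omega>. h (U T \<omega>)) - expectation (\<lambda>\<omega>. h (F \<omega>))\<bar> \<le> A3 * (1 + w) / sqrt T"
      using lipschitz_perturbation[of h, OF _ iU iF] lip by fastforce
    have J0: "J T \<ge> 0" using J_bound[OF T(1)] by linarith
    have D0: "D \<ge> 0" using \<theta> by (simp add: D_def)
    have "\<bar>expectation (\<lambda>\<omega>. h (F \<omega>)) - normal_mean h\<bar>
      \<le> 48 * (3 powr (3/2) * ((3 * J T + D) / T))\<^sup>2 / \<sigma> ^ 3"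
      using clt_time_average[OF T(1), of h] lip s unfolding F_def \<sigma>_def D_def by blast
    also have "\<dots> \<le> 48 * (3 powr (3/2) * ((3 * J T + D) / T))\<^sup>2 / (sqrt c / sqrt T) ^ 3"
      using \<sigma>c \<sigma> c T by (intro divide_left_mono power_mono mult_pos_pos zero_less_power) auto
    also have "\<dots> = 1296 * (3 * J T + D)\<^sup>2 / (sqrt c) ^ 3 / sqrt T"
    proof -
      have "(3 powr (3/2))\<^sup>2 = (27::real)" by (simp add: powr_power powr_numeral)
      moreover have "T\<^sup>2 = sqrt T ^ 3 * sqrt T" using sTT by (simp add: power2_eq_square power3_eq_cube mult_ac)
      ultimately show ?thesis using sT by (simp add: power_mult_distrib power_divide)
    qed
    also have "\<dots> \<le> 1296 * ((18 + 2 * D\<^sup>2) * (1 + (J T)\<^sup>2)) / (sqrt c) ^ 3 / sqrt T"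
    proof (intro divide_right_mono mult_left_mono)
      have "0 \<le> (3 * J T - D)\<^sup>2" by simp
      then have "(3 * J T + D)\<^sup>2 \<le> 18 * (J T)\<^sup>2 + 2 * D\<^sup>2" by (simp add: power2_eq_square algebra_simps)
      also have "\<dots> \<le> (18 + 2 * D\<^sup>2) * (1 + (J T)\<^sup>2)" by (simp add: algebra_simps)
      finally show "(3 * J T + D)\<^sup>2 \<le> (18 + 2 * D\<^sup>2) * (1 + (J T)\<^sup>2)" .
    qed (use c sT in auto)
    also have "\<dots> = A4 * (1 + (J T)\<^sup>2) / sqrt T" by (simp add: A4_def)
    finally have b2: "\<bar>expectation (\<lambda>\<omega>. h (F \<omega>)) - normal_mean h\<bar> \<le> A4 * (1 + (J T)\<^sup>2) / sqrt T" .
    have "\<bar>expectation (\<lambda>\<omega>. h (U T \<omega>)) - normal_mean h\<bar> \<le> (A3 * (1 + w) + A4 * (1 + (J T)\<^sup>2)) / sqrt T"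
      using b1 b2 by (simp add: add_divide_distrib)
    also have "\<dots> \<le> (A3 + A4) * (1 + w + (J T)\<^sup>2) / sqrt T"
    proof (intro divide_right_mono)
      have "0 \<le> A3 * (J T)\<^sup>2 + A4 * w" using A34 w by simp
      then show "A3 * (1 + w) + A4 * (1 + (J T)\<^sup>2) \<le> (A3 + A4) * (1 + w + (J T)\<^sup>2)" by (simp add: algebra_simps)
    qed (use sT in simp)
    finally show "\<bar>expectation (\<lambda>\<omega>. h (U T \<omega>)) - normal_mean h\<bar> \<le> (A3 + A4) * (1 + expectation W + (J T)\<^sup>2) / sqrt T"
      by (simp add: w_def)
  qed
qed

text \<open>
  For \<open>T\<close> below the threshold, \<open>1 / sqrt T\<close> is bounded below, so a constant bound is of the required form.
\<close>

theorem lipschitz_distance_to_normal: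
  obtains C where "C > 0" "\<forall>T W h. T > 0 \<longrightarrow> dominates T W \<longrightarrow> (\<forall>x y. \<bar>h x - h y\<bar> \<le> \<bar>x - y\<bar>) \<longrightarrow>
    \<bar>expectation (\<lambda>\<omega>. h (U T \<omega>)) - normal_mean h\<bar> \<le> C * (1 + expectation W + (J T)\<^sup>2) / sqrt T"
proof -
  obtain A T2 where A: "A \<ge> 0" "T2 \<ge> 1" and long: "\<forall>T W h. T \<ge> T2 \<longrightarrow> dominates T W \<longrightarrow> (\<forall>x y. \<bar>h x - h y\<bar> \<le> \<bar>x - y\<bar>) \<longrightarrow>
    \<bar>expectation (\<lambda>\<omega>. h (U T \<omega>)) - normal_mean h\<bar> \<le> A * (1 + expectation W + (J T)\<^sup>2) / sqrt T"
    by (rule long_time_bound)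
  obtain A' where A': "A' \<ge> 0" and short: "\<forall>T W h. T > 0 \<longrightarrow> dominates T W \<longrightarrow> (\<forall>x y. \<bar>h x - h y\<bar> \<le> \<bar>x - y\<bar>) \<longrightarrow>
    \<bar>expectation (\<lambda>\<omega>. h (U T \<omega>)) - normal_mean h\<bar> \<le> A' * (1 + expectation W)"
    by (rule short_time_bound)
  define C where "C = 1 + A + A' * sqrt T2"
  have C: "C > 0" "C \<ge> A" "C \<ge> A' * sqrt T2" using A A' by (auto simp: C_def add_pos_nonneg)
  show ?thesis
  proof (rule that[OF C(1)], intro allI impI)
    fix T W and h :: "real \<Rightarrow> real" assume T: "T > 0" and W: "dominates T W" and lip: "\<forall>x y. \<bar>h x - h y\<bar> \<le> \<bar>x - y\<bar>"
    define w where "w = expectation W"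
    have w: "w \<ge> 0" using W unfolding w_def dominates_def by (intro Bochner_Integration.integral_nonneg) auto
    have sT: "sqrt T > 0" using T by simp
    have le: "D * (1 + w + (J T)\<^sup>2) / sqrt T \<le> C * (1 + w + (J T)\<^sup>2) / sqrt T" if "D \<le> C" for D
      using that w sT by (intro divide_right_mono mult_right_mono) auto
    show "\<bar>expectation (\<lambda>\<omega>. h (U T \<omega>)) - normal_mean h\<bar> \<le> C * (1 + expectation W + (J T)\<^sup>2) / sqrt T"
    proof (cases "T \<ge> T2")
      case True
      then have "\<bar>expectation (\<lambda>\<omega>. h (U T \<omega>)) - normal_mean h\<bar> \<le> A * (1 + w + (J T)\<^sup>2) / sqrt T"
        using long W lip unfolding w_def by blast
      from order_trans[OF this le[OF C(2)]] show ?thesis by (simp only: w_def)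
    next
      case False
      have "\<bar>expectation (\<lambda>\<omega>. h (U T \<omega>)) - normal_mean h\<bar> \<le> A' * (1 + w)"
        using short T W lip unfolding w_def by blast
      also have "\<dots> \<le> A' * (1 + w + (J T)\<^sup>2) * (sqrt T2 / sqrt T)"
      proof -
        have "A' * (1 + w) * 1 \<le> A' * (1 + w + (J T)\<^sup>2) * (sqrt T2 / sqrt T)"
          using False A' w sT by (intro mult_mono mult_left_mono) auto
        then show ?thesis by simp
      qed
      also have "\<dots> = A' * sqrt T2 * (1 + w + (J T)\<^sup>2) / sqrt T" by simp
      also have "\<dots> \<le> C * (1 + w + (J T)\<^sup>2) / sqrt T" by (rule le[OF C(3)])
      finally show ?thesis by (simp add: w_def)
    qed
  qed
qed

end

lemma twice_continuously_differentiable_onD: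
  assumes "twice_continuously_differentiable_on g S"
  shows "\<And>x. x \<in> S \<Longrightarrow> (g has_real_derivative deriv g x) (at x)"
    "\<And>x. x \<in> S \<Longrightarrow> (deriv g has_real_derivative deriv (deriv g) x) (at x)"
    "continuous_on S (deriv (deriv g))"
proof -
  have C1: "(\<forall>x\<in>S. (k has_real_derivative deriv k x) (at x)) \<and> continuous_on S (deriv k)"
    if k: "k C1_differentiable_on S" for k :: "real \<Rightarrow> real"
  proof -
    obtain D where D: "\<forall>x\<in>S. (k has_vector_derivative D x) (at x)" "continuous_on S D"
      using k unfolding C1_differentiable_on_def by blast
    then have d: "(k has_real_derivative D x) (at x)" if "x \<in> S" for x
      using that by (simp add: has_real_derivative_iff_has_vector_derivative)
    then have "deriv k x = D x" if "x \<in> S" for x using that by (intro DERIV_imp_deriv) auto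
    then show ?thesis using d D(2) by (auto cong: continuous_on_cong)
  qed
  show "\<And>x. x \<in> S \<Longrightarrow> (g has_real_derivative deriv g x) (at x)"
    "\<And>x. x \<in> S \<Longrightarrow> (deriv g has_real_derivative deriv (deriv g) x) (at x)"
    "continuous_on S (deriv (deriv g))"
    using assms C1 unfolding twice_continuously_differentiable_on_def by blast+
qed

text \<open>
  Chain rule for the inverse function.
\<close>

lemma C1_diffeomorphism_deriv_nonzero:
  assumes g: "C1_diffeomorphism S S' g" and x: "x \<in> S" "open S" and d: "(g has_real_derivative D) (at x)"
  shows "D \<noteq> 0"
proof
  assume D: "D = 0"
  have bij: "bij_betw g S S'" and inv: "inv_into S g C1_differentiable_on S'" using g unfolding C1_diffeomorphism_def by auto
  have gx: "g x \<in> S'" using bij x by (auto simp: bij_betw_def)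
  then obtain E where "(inv_into S g has_real_derivative E) (at (g x))"
    using inv unfolding C1_differentiable_on_def has_real_derivative_iff_has_vector_derivative[symmetric] by blast
  from DERIV_chain2[OF this d] have "((\<lambda>y. inv_into S g (g y)) has_real_derivative E * D) (at x)" .
  then have "((\<lambda>y. y) has_real_derivative E * D) (at x)"
    by (rule has_field_derivative_transform_within_open[OF _ x(2) x(1)]) (use bij in \<open>auto simp: bij_betw_def\<close>)
  then have "E * D = 1" by (rule DERIV_unique) (rule DERIV_ident)
  then show False using D by simp
qed

theorem theorem5p1:
  fixes M :: "'a measure" and P :: "'b measure"
    and G :: "real \<Rightarrow> 'a \<Rightarrow> real"
    and Z :: "real \<Rightarrow> real \<Rightarrow> 'a \<Rightarrow> real"
    and X :: "real \<Rightarrow> 'a \<Rightarrow> real"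
    and g :: "real \<Rightarrow> real"
    and N :: "'b \<Rightarrow> real"
    and \<theta> :: real
  assumes "prob_space M"
    and "centered_gaussian_process M UNIV G"
    and "\<forall>\<eta>>0. stationary_gaussian_OU M G \<eta> (Z \<eta>)"
    and "\<theta> > 0"
    and "gaussian_OU M G \<theta> X"
    and "bij_betw g {0<..} {0<..}"
    and "\<forall>\<eta>>0. inv_into {0<..} g \<eta> = prob_space.expectation M (\<lambda>\<omega>. (Z \<eta> 0 \<omega>)\<^sup>2)"
    and "integrable lborel (\<lambda>r. (autocov M (Z \<theta>) r)\<^sup>2)"
    and "C1_diffeomorphism {0<..} {0<..} g"
    and "twice_continuously_differentiable_on g {0<..}"
    and "prob_space P"
    and "distributed P lborel N (\<lambda>x. ennreal (std_normal_density x))"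
  shows "\<exists>C>0. \<exists>\<zeta> :: real \<Rightarrow> 'a \<Rightarrow> real.
    (\<forall>T>0. \<zeta> T \<in> borel_measurable M \<and>
       (\<forall>\<omega>\<in>space M. \<zeta> T \<omega> \<in> closed_segment (f_hat X T \<omega>) (f_lim M X))) \<and>
    (\<forall>\<gamma>::real. \<gamma> > 1 \<longrightarrow> (\<forall>p::real. p \<ge> 1 \<longrightarrow> (\<forall>T::real. T > 0 \<longrightarrow>
       wasserstein_dist M
         (\<lambda>\<omega>. (theta_hat g X T \<omega> - \<theta> - prob_space.expectation M (\<lambda>\<omega>. theta_hat g X T \<omega> - \<theta>)) /
              (deriv g (f_lim M X) * sqrt (prob_space.variance M (\<lambda>\<omega>. f_hat X T \<omega> - f_lim M X))))
         P N
       \<le> ennreal C * Lp_norm M p (\<lambda>\<omega>. deriv (deriv g) (\<zeta> T \<omega>)) / ennreal (sqrt T)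
         + ennreal (phi_bound C (autocov M (Z \<theta>)) T)
         + ennreal (C * T powr (- 1 / 2)))))"
proof -
  interpret prob_space M by fact
  interpret S: gaussian_OU_setting M G \<theta> "Z \<theta>" X
    using assms(2-5,8) by unfold_locales auto
  have f: "f_lim M X = S.f0" by (rule S.f_lim_eq)
  have gf: "inv_into {0<..} g \<theta> = S.f0"
    using assms(4,7) S.Z_var[of 0] by simp
  have d: "\<And>x. x > 0 \<Longrightarrow> (g has_real_derivative deriv g x) (at x)"
    "\<And>x. x > 0 \<Longrightarrow> (deriv g has_real_derivative deriv (deriv g) x) (at x)"
    "continuous_on {0<..} (deriv (deriv g))"
    using twice_continuously_differentiable_onD[OF assms(10)] by auto
  have "deriv g S.f0 \<noteq> 0"
    by (rule C1_diffeomorphism_deriv_nonzero[OF assms(9) _ open_greaterThan d(1)]) (use S.f0_pos in auto)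
  then interpret E: smooth_estimator M G \<theta> "Z \<theta>" X g "deriv g" "deriv (deriv g)"
    using d by unfold_locales auto
  have V: "f_hat X T = E.V T" if "T > 0" for T
  proof -
    interpret P: gaussian_path M T X "4 * S.f0" by (rule S.gaussian_path[OF that])
    show ?thesis by (simp add: fun_eq_iff f_hat_def P.V_def)
  qed
  have var: "variance (\<lambda>\<omega>. f_hat X T \<omega> - f_lim M X) = E.s2 T" if "T > 0" for T
  proof -
    interpret P: gaussian_path M T X "4 * S.f0" by (rule S.gaussian_path[OF that])
    show ?thesis using P.V_integrable by (simp add: V[OF that] P.s2_def prob_space)
  qed
  obtain C where C: "C > 0" and bound: "\<forall>T W h. T > 0 \<longrightarrow> E.dominates T W \<longrightarrow> (\<forall>x y. \<bar>h x - h y\<bar> \<le> \<bar>x - y\<bar>) \<longrightarrow>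
    \<bar>expectation (\<lambda>\<omega>. h (E.U T \<omega>)) - normal_mean h\<bar> \<le> C * (1 + expectation W + (S.J T)\<^sup>2) / sqrt T"
    by (rule E.lipschitz_distance_to_normal)
  have "continuous_on {0<..} (\<lambda>x. \<bar>deriv (deriv g) x\<bar>)" using d(3) by (intro continuous_intros)
  then obtain s where s: "s \<in> borel_measurable borel" "\<forall>x. s x \<in> closed_segment x S.f0"
    "\<forall>x u. 0 < x \<longrightarrow> x \<le> u \<longrightarrow> u \<le> S.f0 \<longrightarrow> \<bar>deriv (deriv g) u\<bar> \<le> \<bar>deriv (deriv g) (s x)\<bar>"
    "\<forall>x>0. \<bar>deriv (deriv g) x\<bar> \<le> \<bar>deriv (deriv g) (s x)\<bar>"
    by (rule monotone_argmax_selection[OF _ S.f0_pos])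
  \<comment> \<open>the intermediate point, at which \<open>g''\<close> is at least as large in modulus as at the estimate itself\<close>
  define \<zeta> where "\<zeta> T \<omega> = s (f_hat X T \<omega>)" for T \<omega>
  have \<zeta>: "\<zeta> T \<in> borel_measurable M" if "T > 0" for T
  proof -
    interpret P: gaussian_path M T X "4 * S.f0" by (rule S.gaussian_path[OF that])
    show ?thesis unfolding \<zeta>_def V[OF that] by (rule measurable_compose[OF P.V_measurable s(1)])
  qed
  have main: "wasserstein_dist M
         (\<lambda>\<omega>. (theta_hat g X T \<omega> - \<theta> - expectation (\<lambda>\<omega>. theta_hat g X T \<omega> - \<theta>)) /
              (deriv g (f_lim M X) * sqrt (variance (\<lambda>\<omega>. f_hat X T \<omega> - f_lim M X))))
         P N
       \<le> ennreal C * Lp_norm M p (\<lambda>\<omega>. deriv (deriv g) (\<zeta> T \<omega>)) / ennreal (sqrt T)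
         + ennreal (phi_bound C (autocov M (Z \<theta>)) T)
         + ennreal (C * T powr (- 1 / 2))" (is "?dist \<le> ?rhs") if p: "p \<ge> 1" and T: "T > 0" for p T
  proof -
    interpret P: gaussian_path M T X "4 * S.f0" by (rule S.gaussian_path[OF T])
    define W where "W \<omega> = \<bar>deriv (deriv g) (\<zeta> T \<omega>)\<bar>" for \<omega>
    define L where "L = Lp_norm M p (\<lambda>\<omega>. deriv (deriv g) (\<zeta> T \<omega>))"
    have sT: "sqrt T > 0" using T by simp
    have Y: "(\<lambda>\<omega>. deriv (deriv g) (\<zeta> T \<omega>)) \<in> borel_measurable M"
    proof -
      have "(\<lambda>x. if x \<in> {0<..} then deriv (deriv g) x else deriv (deriv g) 0) \<in> borel_measurable borel"
        using d(3) by (intro borel_measurable_continuous_on_if continuous_on_const) auto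
      from measurable_compose[OF \<zeta>[OF T] this]
      have "(\<lambda>\<omega>. if \<zeta> T \<omega> \<in> {0<..} then deriv (deriv g) (\<zeta> T \<omega>) else deriv (deriv g) 0) \<in> borel_measurable M" .
      moreover have "\<zeta> T \<omega> \<ge> 0" for \<omega>
        using s(2)[rule_format, of "f_hat X T \<omega>"] P.V_nonneg[of \<omega>] S.f0_pos
        by (auto simp: \<zeta>_def V[OF T] closed_segment_eq_real_ivl split: if_splits)
      then have "(if \<zeta> T \<omega> \<in> {0<..} then deriv (deriv g) (\<zeta> T \<omega>) else deriv (deriv g) 0) = deriv (deriv g) (\<zeta> T \<omega>)" for \<omega>
        by (cases "\<zeta> T \<omega> = 0") (auto simp: less_le)
      ultimately show ?thesis by simp
    qed
    have WL: "(\<integral>\<^sup>+\<omega>. ennreal (W \<omega>) \<partial>M) \<le> L"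
      unfolding W_def L_def by (rule nn_integral_abs_le_Lp_norm[OF Y p])
    show ?thesis
    proof (cases "L = \<infinity>")
      case True
      \<comment> \<open>an infinite moment makes the bound trivial\<close>
      then have "ennreal C * L / ennreal (sqrt T) = \<infinity>" using C sT by (simp add: ennreal_mult_top ennreal_top_divide)
      then show ?thesis unfolding L_def by simp
    next
      case False
      then have fin: "(\<integral>\<^sup>+\<omega>. ennreal (W \<omega>) \<partial>M) < \<infinity>" using WL by (simp add: top.not_eq_extremum le_less_trans)
      have W0: "W \<omega> \<ge> 0" for \<omega> by (simp add: W_def)
      have Wi: "integrable M W"
        using Y W0 fin unfolding W_def[abs_def] by (intro integrableI_bounded) auto
      define w where "w = expectation W"
      have w0: "w \<ge> 0" unfolding w_def using W0 by simp
      have wL: "ennreal w \<le> L"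
        using WL unfolding w_def by (subst (asm) nn_integral_eq_integral[OF Wi]) (use W0 in auto)
      have dom: "E.dominates T W"
        unfolding E.dominates_def using Wi W0 s(3,4) by (auto simp: W_def \<zeta>_def V[OF T])
      have U: "(\<lambda>\<omega>. (theta_hat g X T \<omega> - \<theta> - expectation (\<lambda>\<omega>. theta_hat g X T \<omega> - \<theta>)) /
              (deriv g (f_lim M X) * sqrt (variance (\<lambda>\<omega>. f_hat X T \<omega> - f_lim M X)))) = E.U T"
      proof (cases "E.s2 T = 0")
        case True then show ?thesis unfolding var[OF T] E.U_def[abs_def] by simp
      next
        case False
        then have "E.s2 T > 0" using P.s2_nonneg by simp
        then have i: "integrable M (\<lambda>\<omega>. g (E.V T \<omega>))" by (rule E.gV_integrable[OF T _ dom])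
        show ?thesis unfolding var[OF T] unfolding f E.U_def[abs_def] theta_hat_def V[OF T] using i by (simp add: prob_space)
      qed
      have "?dist \<le> ennreal (C * (1 + w + (S.J T)\<^sup>2) / sqrt T)"
        unfolding U w_def
        by (rule wasserstein_dist_normal_le[OF assms(11,12)]) (use bound T dom in blast)
      also have "\<dots> \<le> ennreal (C * w / sqrt T + phi_bound C (autocov M (Z \<theta>)) T + C * T powr (- 1 / 2))"
      proof (rule ennreal_leI)
        have "T powr (- 1 / 2) = 1 / sqrt T" using T by (simp add: powr_minus_divide powr_half_sqrt)
        moreover have "C * (S.J T)\<^sup>2 / sqrt T \<le> phi_bound C (autocov M (Z \<theta>)) T"
        proof -
          have "1 * (S.J T)\<^sup>2 / sqrt T \<le> 8 * (S.J T)\<^sup>2 / sqrt T" using sT by (intro divide_right_mono mult_right_mono) auto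
          also have "\<dots> \<le> max (8 / sqrt T * (S.J T)\<^sup>2) (48 / T * (integral {-T..T} (\<lambda>t. \<bar>autocov M (Z \<theta>) t\<bar> powr (4/3))) ^ 3)" by simp
          finally show ?thesis using C mult_left_mono[of "(S.J T)\<^sup>2 / sqrt T" _ C] by (simp add: phi_bound_def S.J_def)
        qed
        ultimately show "C * (1 + w + (S.J T)\<^sup>2) / sqrt T \<le> C * w / sqrt T + phi_bound C (autocov M (Z \<theta>)) T + C * T powr (- 1 / 2)"
          by (simp add: add_divide_distrib distrib_left)
      qed
      also have "\<dots> \<le> ?rhs"
      proof -
        have "0 \<le> phi_bound C (autocov M (Z \<theta>)) T" unfolding phi_bound_def using C sT by (intro mult_nonneg_nonneg max.coboundedI1) auto
        then have "ennreal (C * w / sqrt T + phi_bound C (autocov M (Z \<theta>)) T + C * T powr (- 1 / 2)) =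
          ennreal (C * w / sqrt T) + ennreal (phi_bound C (autocov M (Z \<theta>)) T) + ennreal (C * T powr (- 1 / 2))"
          using C w0 sT by (subst ennreal_plus, simp, simp, subst ennreal_plus) auto
        moreover have "ennreal (C * w / sqrt T) = ennreal C * ennreal w / ennreal (sqrt T)"
          using C w0 sT by (simp add: divide_ennreal[symmetric] ennreal_mult)
        moreover have "ennreal C * ennreal w / ennreal (sqrt T) \<le> ennreal C * L / ennreal (sqrt T)"
          by (intro divide_right_mono_ennreal mult_left_mono wL) auto
        ultimately show ?thesis unfolding L_def by (simp add: add_right_mono)
      qed
      finally show ?thesis .
    qed
  qed
  show ?thesis
  proof (intro exI[of _ C] exI[of _ \<zeta>] conjI C allI impI ballI)
    show "\<zeta> T \<omega> \<in> closed_segment (f_hat X T \<omega>) (f_lim M X)" for T \<omega>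
      unfolding f \<zeta>_def using s(2) by blast
  qed (use \<zeta> main in blast)+
qed

end
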